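(* Let $k$ be a field, let $A/B$ be an extension of $k$-algebras and let $M$ be an $(A,A)$-bimodule. Let $\mathcal E$ be the projective class of all epimorphisms of $(A,A)$-bimodules that split as morphisms of $(B,B)$-bimodules, and let $F:=A\otimes_{A^e}(-)$ be the functor from $(A,A)$-bimodules to $k$-vector spaces. Then the Hochschild homology of $A/B$ with coefficients in $M$ is given by the left $\mathcal E$-derived functors of $F$ at $M$: $$\mathrm{HH}_*(A/B,M)\simeq(\mathrm L^{\mathcal E}_*F)(M).$$
   Context: $A/B$ denotes a $k$-algebra $A$ with subalgebra $B$. $A^e=A\otimes A^{opp}$; $(A,A)$-bimodules are left $A^e$-modules. For a $(B,B)$-bimodule $X$, $[X,B]$ is the subspace spanned by all $xb-bx$ and $X_B:=X/[X,B]$; $M\widehat\otimes_BA^{\otimes_Bn}:=(M\otimes_BA^{\otimes_Bn})_B$. $\mathrm{HH}_*(A/B,M)$ is the homology of the complex with $n$-th term $M\widehat\otimes_BA^{\otimes_Bn}$ and differential $\sum_{i=0}^n(-1)^id_i$, where $d_0(m\widehat\otimes_Ba^1\widehat\otimes_B\cdots\widehat\otimes_Ba^n)=ma^1\widehat\otimes_Ba^2\widehat\otimes_B\cdots\widehat\otimes_Ba^n$, $d_i$ multiplies $a^i$ and $a^{i+1}$ for $0<i<n$, and $d_n(m\widehat\otimes_Ba^1\widehat\otimes_B\cdots\widehat\otimes_Ba^n)=a^nm\widehat\otimes_Ba^1\widehat\otimes_B\cdots\widehat\otimes_Ba^{n-1}$. An object $P$ is $\mathcal E$-projective if $\mathrm{Hom}(P,-)$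 sends every epimorphism in $\mathcal E$ to a surjection. An $\mathcal E$-projective resolution of a bimodule $X$ is an exact complex $\cdots\to P_1\to P_0\to X\to0$ of bimodules with all $P_n$ $\mathcal E$-projective and such that each differential, corestricted to its image, lies in $\mathcal E$. $\mathrm L^{\mathcal E}_nF(X)$ is the $n$-th homology of $F(P_* )$ for such a resolution $P_*$ of $X$. *)

theory Defs
  imports "HOL-Algebra.Free_Abelian_Groups" "HOL-Algebra.AbelCoset" "HOL-Algebra.Module"
    "HOL-Algebra.Subrings"
begin

section \<open>Algebras and bimodules\<close>

text \<open>The locale for algebras in HOL-Algebra is restricted to commutative ones.\<close>

definition k_algebra :: "'k ring \<Rightarrow> ('k, 'a) module \<Rightarrow> bool" where
  "k_algebra K A \<longleftrightarrow> field K \<and> module K A \<and> ring A \<and>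
     (\<forall>c\<in>carrier K. \<forall>x\<in>carrier A. \<forall>y\<in>carrier A.
        (c \<odot>\<^bsub>A\<^esub> x) \<otimes>\<^bsub>A\<^esub> y = c \<odot>\<^bsub>A\<^esub> (x \<otimes>\<^bsub>A\<^esub> y) \<and>
        x \<otimes>\<^bsub>A\<^esub> (c \<odot>\<^bsub>A\<^esub> y) = c \<odot>\<^bsub>A\<^esub> (x \<otimes>\<^bsub>A\<^esub> y))"

definition k_subalgebra :: "'k ring \<Rightarrow> ('k, 'a) module \<Rightarrow> 'a set \<Rightarrow> bool" where
  "k_subalgebra K A B \<longleftrightarrow> subring B A \<and> (\<forall>c\<in>carrier K. \<forall>b\<in>B. c \<odot>\<^bsub>A\<^esub> b \<in> B)"

definition opp :: "('k, 'a) module \<Rightarrow> ('k, 'a) module" where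
  "opp A = A\<lparr>mult := \<lambda>x y. y \<otimes>\<^bsub>A\<^esub> x\<rparr>"

text \<open>As for modules in HOL-Algebra, the fields \<open>mult\<close> and \<open>one\<close> of a bimodule are irrelevant.\<close>

record ('k, 'a, 'm) bimodule = "('k, 'm) module" +
  lact :: "'a \<Rightarrow> 'm \<Rightarrow> 'm"
  ract :: "'m \<Rightarrow> 'a \<Rightarrow> 'm"

text \<open>The linearity of both actions over the ground field makes it act in the same way from both
  sides, so that these are the left modules over the enveloping algebra.\<close>

definition is_bimodule :: "'k ring \<Rightarrow> ('k, 'a) module \<Rightarrow> ('k, 'a, 'm) bimodule \<Rightarrow> bool" where
  "is_bimodule K A X \<longleftrightarrow> module K X \<and>
     (\<forall>a\<in>carrier A. \<forall>x\<in>carrier X. lact X a x \<in> carrier X \<and> ract X x a \<in> carrier X) \<and>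
     (\<forall>a\<in>carrier A. \<forall>x\<in>carrier X. \<forall>y\<in>carrier X.
        lact X a (x \<oplus>\<^bsub>X\<^esub> y) = lact X a x \<oplus>\<^bsub>X\<^esub> lact X a y \<and>
        ract X (x \<oplus>\<^bsub>X\<^esub> y) a = ract X x a \<oplus>\<^bsub>X\<^esub> ract X y a) \<and>
     (\<forall>a\<in>carrier A. \<forall>b\<in>carrier A. \<forall>x\<in>carrier X.
        lact X (a \<oplus>\<^bsub>A\<^esub> b) x = lact X a x \<oplus>\<^bsub>X\<^esub> lact X b x \<and>
        ract X x (a \<oplus>\<^bsub>A\<^esub> b) = ract X x a \<oplus>\<^bsub>X\<^esub> ract X x b \<and>
        lact X (a \<otimes>\<^bsub>A\<^esub> b) x = lact X a (lact X b x) \<and>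
        ract X x (a \<otimes>\<^bsub>A\<^esub> b) = ract X (ract X x a) b \<and>
        ract X (lact X a x) b = lact X a (ract X x b)) \<and>
     (\<forall>x\<in>carrier X. lact X \<one>\<^bsub>A\<^esub> x = x \<and> ract X x \<one>\<^bsub>A\<^esub> = x) \<and>
     (\<forall>c\<in>carrier K. \<forall>a\<in>carrier A. \<forall>x\<in>carrier X.
        lact X (c \<odot>\<^bsub>A\<^esub> a) x = c \<odot>\<^bsub>X\<^esub> lact X a x \<and> lact X a (c \<odot>\<^bsub>X\<^esub> x) = c \<odot>\<^bsub>X\<^esub> lact X a x \<and>
        ract X x (c \<odot>\<^bsub>A\<^esub> a) = c \<odot>\<^bsub>X\<^esub> ract X x a \<and> ract X (c \<odot>\<^bsub>X\<^esub> x) a = c \<odot>\<^bsub>X\<^esub> ract X x a)"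

definition linear_map :: "'k ring \<Rightarrow> ('k, 'x, 'p) module_scheme \<Rightarrow> ('k, 'y, 'q) module_scheme
    \<Rightarrow> ('x \<Rightarrow> 'y) \<Rightarrow> bool" where
  "linear_map K X Y f \<longleftrightarrow> f \<in> carrier X \<rightarrow> carrier Y \<and>
     (\<forall>x\<in>carrier X. \<forall>y\<in>carrier X. f (x \<oplus>\<^bsub>X\<^esub> y) = f x \<oplus>\<^bsub>Y\<^esub> f y) \<and>
     (\<forall>c\<in>carrier K. \<forall>x\<in>carrier X. f (c \<odot>\<^bsub>X\<^esub> x) = c \<odot>\<^bsub>Y\<^esub> f x)"

definition linear_iso :: "'k ring \<Rightarrow> ('k, 'x, 'p) module_scheme \<Rightarrow> ('k, 'y, 'q) module_scheme
    \<Rightarrow> bool" where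
  "linear_iso K X Y \<longleftrightarrow> (\<exists>f. linear_map K X Y f \<and> bij_betw f (carrier X) (carrier Y))"

definition bimodule_hom :: "'k ring \<Rightarrow> ('k, 'a) module \<Rightarrow> ('k, 'a, 'x) bimodule
    \<Rightarrow> ('k, 'a, 'y) bimodule \<Rightarrow> ('x \<Rightarrow> 'y) \<Rightarrow> bool" where
  "bimodule_hom K A X Y f \<longleftrightarrow> linear_map K X Y f \<and>
     (\<forall>a\<in>carrier A. \<forall>x\<in>carrier X. f (lact X a x) = lact Y a (f x) \<and> f (ract X x a) = ract Y (f x) a)"

section \<open>Quotients and homology\<close>

text \<open>For a map \<open>f\<close> that respects the cosets in question, the union below is a single coset of
  \<open>N\<close>; compare the library's \<open>rcoset_mult\<close>.\<close>

definition quot_map :: "('k, 'y, 'q) module_scheme \<Rightarrow> 'y set \<Rightarrow> ('x \<Rightarrow> 'y) \<Rightarrow> 'x set \<Rightarrow> 'y set" where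
  "quot_map Y N f U = (\<Union>u\<in>U. N +>\<^bsub>Y\<^esub> f u)"

definition quot_module :: "('k, 'x, 'p) module_scheme \<Rightarrow> 'x set \<Rightarrow> ('k, 'x set) module" where
  "quot_module X N = \<lparr>carrier = a_rcosets\<^bsub>X\<^esub> N, mult = (\<lambda>_ _. N), one = N, zero = N,
     add = set_add X, smult = (\<lambda>c. quot_map X N (\<lambda>x. c \<odot>\<^bsub>X\<^esub> x))\<rparr>"

definition k_span :: "'k ring \<Rightarrow> ('k, 'x, 'p) module_scheme \<Rightarrow> 'x set \<Rightarrow> 'x set" where
  "k_span K X S = generate (add_monoid X) {c \<odot>\<^bsub>X\<^esub> x | c x. c \<in> carrier K \<and> x \<in> S}"

text \<open>The complexes are \<open>\<dots> \<rightarrow> C 2 \<rightarrow> C 1 \<rightarrow> C 0 \<rightarrow> 0\<close> with \<open>d n\<close> defined on \<open>C n\<close> for \<open>n \<ge> 1\<close>;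
  the value \<open>d 0\<close> is not used.\<close>

definition cycles :: "(nat \<Rightarrow> ('k, 'c, 'p) module_scheme) \<Rightarrow> (nat \<Rightarrow> 'c \<Rightarrow> 'c) \<Rightarrow> nat \<Rightarrow> 'c set" where
  "cycles C d n = {x \<in> carrier (C n). n > 0 \<longrightarrow> d n x = \<zero>\<^bsub>C (n - 1)\<^esub>}"

definition homology :: "(nat \<Rightarrow> ('k, 'c) module) \<Rightarrow> (nat \<Rightarrow> 'c \<Rightarrow> 'c) \<Rightarrow> nat \<Rightarrow> ('k, 'c set) module"
  where "homology C d n =
     quot_module ((C n)\<lparr>carrier := cycles C d n\<rparr>) (d (Suc n) ` carrier (C (Suc n)))"

section \<open>Hochschild homology of an extension\<close>

text \<open>The tensor product of \<open>M\<close> with \<open>n\<close> copies of \<open>A\<close>, all over \<open>B\<close>: the free abelian group on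
  the tuples \<open>(m, [a1, \<dots>, an])\<close> modulo additivity in each variable and balancing over \<open>B\<close> at each
  of the \<open>n\<close> tensor signs. Linearity over the ground field is part of the balancing, and for
  \<open>n = 0\<close> this is \<open>M\<close> itself.\<close>

definition tensor_gens :: "('k, 'a) module \<Rightarrow> ('k, 'a, 'm) bimodule \<Rightarrow> nat \<Rightarrow> ('m \<times> 'a list) set" where
  "tensor_gens A M n = carrier M \<times> {as. set as \<subseteq> carrier A \<and> length as = n}"

definition tensor_rels :: "('k, 'a) module \<Rightarrow> 'a set \<Rightarrow> ('k, 'a, 'm) bimodule \<Rightarrow> nat
    \<Rightarrow> (('m \<times> 'a list) \<Rightarrow>\<^sub>0 int) set" where
  "tensor_rels A B M n =
     {frag_of (m \<oplus>\<^bsub>M\<^esub> m', as) - frag_of (m, as) - frag_of (m', as) | m m' as.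
        (m, as) \<in> tensor_gens A M n \<and> m' \<in> carrier M} \<union>
     {frag_of (m, as[i := a \<oplus>\<^bsub>A\<^esub> a']) - frag_of (m, as[i := a]) - frag_of (m, as[i := a']) | m as i a a'.
        (m, as) \<in> tensor_gens A M n \<and> i < n \<and> a \<in> carrier A \<and> a' \<in> carrier A} \<union>
     {frag_of (ract M m b, as) - frag_of (m, as[0 := b \<otimes>\<^bsub>A\<^esub> as ! 0]) | m as b.
        (m, as) \<in> tensor_gens A M n \<and> 0 < n \<and> b \<in> B} \<union>
     {frag_of (m, as[i := as ! i \<otimes>\<^bsub>A\<^esub> b]) - frag_of (m, as[Suc i := b \<otimes>\<^bsub>A\<^esub> as ! Suc i]) | m as i b.
        (m, as) \<in> tensor_gens A M n \<and> Suc i < n \<and> b \<in> B}"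

definition tensor_null :: "('k, 'a) module \<Rightarrow> 'a set \<Rightarrow> ('k, 'a, 'm) bimodule \<Rightarrow> nat
    \<Rightarrow> (('m \<times> 'a list) \<Rightarrow>\<^sub>0 int) set" where
  "tensor_null A B M n = generate (free_Abelian_group (tensor_gens A M n)) (tensor_rels A B M n)"

text \<open>The formal sums, with the operations prescribed on generators; multiplication by scalars and
  the actions of \<open>B\<close> satisfy the axioms only after passing to the quotient.\<close>

definition tensor_pre :: "('k, 'a) module \<Rightarrow> ('k, 'a, 'm) bimodule \<Rightarrow> nat
    \<Rightarrow> ('k, 'a, ('m \<times> 'a list) \<Rightarrow>\<^sub>0 int) bimodule" where
  "tensor_pre A M n = \<lparr>carrier = carrier (free_Abelian_group (tensor_gens A M n)),
     mult = (\<lambda>_ _. 0), one = 0, zero = 0, add = (+),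
     smult = (\<lambda>c. frag_extend (\<lambda>(m, as). frag_of (c \<odot>\<^bsub>M\<^esub> m, as))),
     lact = (\<lambda>b. frag_extend (\<lambda>(m, as). frag_of (lact M b m, as))),
     ract = (\<lambda>u b. frag_extend (\<lambda>(m, as). frag_of
       (if as = [] then (ract M m b, as) else (m, butlast as @ [last as \<otimes>\<^bsub>A\<^esub> b]))) u)\<rparr>"

definition tensor_bimodule :: "('k, 'a) module \<Rightarrow> 'a set \<Rightarrow> ('k, 'a, 'm) bimodule \<Rightarrow> nat
    \<Rightarrow> ('k, 'a, (('m \<times> 'a list) \<Rightarrow>\<^sub>0 int) set) bimodule" where
  "tensor_bimodule A B M n = (let T = tensor_pre A M n; N = tensor_null A B M n in
     module.extend (quot_module T N)
       \<lparr>lact = (\<lambda>b. quot_map T N (lact T b)), ract = (\<lambda>U b. quot_map T N (\<lambda>u. ract T u b) U)\<rparr>)"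

definition commutators :: "'k ring \<Rightarrow> 'a set \<Rightarrow> ('k, 'a, 'x) bimodule \<Rightarrow> 'x set" where
  "commutators K B X = k_span K X {ract X x b \<ominus>\<^bsub>X\<^esub> lact X b x | x b. x \<in> carrier X \<and> b \<in> B}"

definition coinv :: "'k ring \<Rightarrow> 'a set \<Rightarrow> ('k, 'a, 'x) bimodule \<Rightarrow> ('k, 'x set) module" where
  "coinv K B X = quot_module X (commutators K B X)"

definition hoch_module :: "'k ring \<Rightarrow> ('k, 'a) module \<Rightarrow> 'a set \<Rightarrow> ('k, 'a, 'm) bimodule \<Rightarrow> nat
    \<Rightarrow> ('k, (('m \<times> 'a list) \<Rightarrow>\<^sub>0 int) set set) module" where
  "hoch_module K A B M n = coinv K B (tensor_bimodule A B M n)"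

definition hoch_class :: "'k ring \<Rightarrow> ('k, 'a) module \<Rightarrow> 'a set \<Rightarrow> ('k, 'a, 'm) bimodule \<Rightarrow> nat
    \<Rightarrow> (('m \<times> 'a list) \<Rightarrow>\<^sub>0 int) \<Rightarrow> (('m \<times> 'a list) \<Rightarrow>\<^sub>0 int) set set" where
  "hoch_class K A B M n u = commutators K B (tensor_bimodule A B M n)
     +>\<^bsub>tensor_bimodule A B M n\<^esub> (tensor_null A B M n +>\<^bsub>tensor_pre A M n\<^esub> u)"

text \<open>Used for \<open>n = length as \<ge> 1\<close> and \<open>i \<le> n\<close>; list positions are counted from 0, so \<open>as ! (i - 1)\<close>
  is the \<open>i\<close>-th algebra factor.\<close>

definition hoch_face :: "('k, 'a) module \<Rightarrow> ('k, 'a, 'm) bimodule \<Rightarrow> nat \<Rightarrow> 'm \<times> 'a list \<Rightarrow> 'm \<times> 'a list"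
  where "hoch_face A M i = (\<lambda>(m, as).
     if i = 0 then (ract M m (hd as), tl as)
     else if i < length as then (m, take (i - 1) as @ [as ! (i - 1) \<otimes>\<^bsub>A\<^esub> as ! i] @ drop (i + 1) as)
     else (lact M (last as) m, butlast as))"

text \<open>The last face is only defined modulo commutators, so the differential is induced in one step
  from formal sums to the quotient of the quotient: the union is over all representatives of all
  representatives, and its members all coincide.\<close>

definition hoch_diff :: "'k ring \<Rightarrow> ('k, 'a) module \<Rightarrow> 'a set \<Rightarrow> ('k, 'a, 'm) bimodule \<Rightarrow> nat
    \<Rightarrow> (('m \<times> 'a list) \<Rightarrow>\<^sub>0 int) set set \<Rightarrow> (('m \<times> 'a list) \<Rightarrow>\<^sub>0 int) set set" where
  "hoch_diff K A B M n W = (\<Union>U\<in>W. \<Union>u\<in>U. hoch_class K A B M (n - 1)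
     (frag_extend (\<lambda>g. \<Sum>i\<le>n. frag_cmul ((-1) ^ i) (frag_of (hoch_face A M i g))) u))"

definition HH :: "'k ring \<Rightarrow> ('k, 'a) module \<Rightarrow> 'a set \<Rightarrow> ('k, 'a, 'm) bimodule \<Rightarrow> nat
    \<Rightarrow> ('k, (('m \<times> 'a list) \<Rightarrow>\<^sub>0 int) set set set) module" where
  "HH K A B M = homology (hoch_module K A B M) (hoch_diff K A B M)"

section \<open>Tensoring over the enveloping algebra\<close>

text \<open>The tensor product of \<open>X\<close> and \<open>Y\<close> over operators \<open>S\<close> acting on \<open>X\<close> from the right by \<open>r\<close>
  and on \<open>Y\<close> from the left by \<open>l\<close>. Scalars act through the first factor.\<close>

definition bal_rels :: "('k, 'x, 'p) module_scheme \<Rightarrow> ('k, 'y, 'q) module_scheme \<Rightarrow> 's set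
    \<Rightarrow> ('x \<Rightarrow> 's \<Rightarrow> 'x) \<Rightarrow> ('s \<Rightarrow> 'y \<Rightarrow> 'y) \<Rightarrow> (('x \<times> 'y) \<Rightarrow>\<^sub>0 int) set" where
  "bal_rels X Y S r l =
     {frag_of (x \<oplus>\<^bsub>X\<^esub> x', y) - frag_of (x, y) - frag_of (x', y) | x x' y.
        x \<in> carrier X \<and> x' \<in> carrier X \<and> y \<in> carrier Y} \<union>
     {frag_of (x, y \<oplus>\<^bsub>Y\<^esub> y') - frag_of (x, y) - frag_of (x, y') | x y y'.
        x \<in> carrier X \<and> y \<in> carrier Y \<and> y' \<in> carrier Y} \<union>
     {frag_of (r x s, y) - frag_of (x, l s y) | x s y.
        x \<in> carrier X \<and> s \<in> S \<and> y \<in> carrier Y}"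

definition bal_null :: "('k, 'x, 'p) module_scheme \<Rightarrow> ('k, 'y, 'q) module_scheme \<Rightarrow> 's set
    \<Rightarrow> ('x \<Rightarrow> 's \<Rightarrow> 'x) \<Rightarrow> ('s \<Rightarrow> 'y \<Rightarrow> 'y) \<Rightarrow> (('x \<times> 'y) \<Rightarrow>\<^sub>0 int) set" where
  "bal_null X Y S r l = generate (free_Abelian_group (carrier X \<times> carrier Y)) (bal_rels X Y S r l)"

definition bal_pre :: "('k, 'x, 'p) module_scheme \<Rightarrow> ('k, 'y, 'q) module_scheme
    \<Rightarrow> ('k, ('x \<times> 'y) \<Rightarrow>\<^sub>0 int) module" where
  "bal_pre X Y = \<lparr>carrier = carrier (free_Abelian_group (carrier X \<times> carrier Y)),
     mult = (\<lambda>_ _. 0), one = 0, zero = 0, add = (+),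
     smult = (\<lambda>c. frag_extend (\<lambda>(x, y). frag_of (c \<odot>\<^bsub>X\<^esub> x, y)))\<rparr>"

definition bal_tensor :: "('k, 'x, 'p) module_scheme \<Rightarrow> ('k, 'y, 'q) module_scheme \<Rightarrow> 's set
    \<Rightarrow> ('x \<Rightarrow> 's \<Rightarrow> 'x) \<Rightarrow> ('s \<Rightarrow> 'y \<Rightarrow> 'y) \<Rightarrow> ('k, (('x \<times> 'y) \<Rightarrow>\<^sub>0 int) set) module" where
  "bal_tensor X Y S r l = quot_module (bal_pre X Y) (bal_null X Y S r l)"

text \<open>The elements of the enveloping algebra \<open>A \<otimes> opp A\<close>; its multiplication does not enter into
  the tensor product over it, only its actions do.\<close>

definition env_carrier :: "'k ring \<Rightarrow> ('k, 'a) module \<Rightarrow> (('a \<times> 'a) \<Rightarrow>\<^sub>0 int) set set" where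
  "env_carrier K A = carrier (bal_tensor A (opp A) (carrier K)
     (\<lambda>a c. c \<odot>\<^bsub>A\<^esub> a) (\<lambda>c a. c \<odot>\<^bsub>opp A\<^esub> a))"

definition frag_eval :: "('k, 'x, 'p) module_scheme \<Rightarrow> ('g \<Rightarrow> 'x) \<Rightarrow> ('g \<Rightarrow>\<^sub>0 int) \<Rightarrow> 'x" where
  "frag_eval X f u = (\<Oplus>\<^bsub>X\<^esub>g\<in>Poly_Mapping.keys u. [Poly_Mapping.lookup u g] \<cdot>\<^bsub>X\<^esub> f g)"

text \<open>\<open>(a \<otimes> a') x = a x a'\<close> on a bimodule, and \<open>x (a \<otimes> a') = a' x a\<close> on \<open>A\<close>.\<close>

definition env_lact :: "('k, 'a, 'x) bimodule \<Rightarrow> (('a \<times> 'a) \<Rightarrow>\<^sub>0 int) set \<Rightarrow> 'x \<Rightarrow> 'x" where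
  "env_lact X U x = the_elem (frag_eval X (\<lambda>(a, a'). ract X (lact X a x) a') ` U)"

definition env_ract :: "('k, 'a) module \<Rightarrow> 'a \<Rightarrow> (('a \<times> 'a) \<Rightarrow>\<^sub>0 int) set \<Rightarrow> 'a" where
  "env_ract A x U = the_elem (frag_eval A (\<lambda>(a, a'). a' \<otimes>\<^bsub>A\<^esub> x \<otimes>\<^bsub>A\<^esub> a) ` U)"

text \<open>The functor \<open>A \<otimes> -\<close> over the enveloping algebra, on objects and on morphisms into \<open>Y\<close>.\<close>

definition F_obj :: "'k ring \<Rightarrow> ('k, 'a) module \<Rightarrow> ('k, 'a, 'x) bimodule
    \<Rightarrow> ('k, (('a \<times> 'x) \<Rightarrow>\<^sub>0 int) set) module" where
  "F_obj K A X = bal_tensor A X (env_carrier K A) (env_ract A) (env_lact X)"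

definition F_mor :: "'k ring \<Rightarrow> ('k, 'a) module \<Rightarrow> ('k, 'a, 'y) bimodule \<Rightarrow> ('x \<Rightarrow> 'y)
    \<Rightarrow> (('a \<times> 'x) \<Rightarrow>\<^sub>0 int) set \<Rightarrow> (('a \<times> 'y) \<Rightarrow>\<^sub>0 int) set" where
  "F_mor K A Y f = quot_map (bal_pre A Y) (bal_null A Y (env_carrier K A) (env_ract A) (env_lact Y))
     (frag_extend (\<lambda>(a, x). frag_of (a, f x)))"

section \<open>The projective class and its derived functors\<close>

text \<open>Epimorphisms of bimodules are the surjective homomorphisms.\<close>

definition class_E :: "'k ring \<Rightarrow> ('k, 'a) module \<Rightarrow> 'a set \<Rightarrow> ('k, 'a, 'x) bimodule
    \<Rightarrow> ('k, 'a, 'y) bimodule \<Rightarrow> ('x \<Rightarrow> 'y) \<Rightarrow> bool" where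
  "class_E K A B X Y f \<longleftrightarrow> is_bimodule K A X \<and> is_bimodule K A Y \<and> bimodule_hom K A X Y f \<and>
     f ` carrier X = carrier Y \<and>
     (\<exists>s. bimodule_hom K (A\<lparr>carrier := B\<rparr>) Y X s \<and> (\<forall>y\<in>carrier Y. f (s y) = y))"

definition E_lifts :: "'x itself \<Rightarrow> 'y itself \<Rightarrow> 'k ring \<Rightarrow> ('k, 'a) module \<Rightarrow> 'a set
    \<Rightarrow> ('k, 'a, 'p) bimodule \<Rightarrow> bool" where
  "E_lifts _ _ K A B P \<longleftrightarrow> (\<forall>(X :: ('k, 'a, 'x) bimodule) (Y :: ('k, 'a, 'y) bimodule) f g.
     class_E K A B X Y f \<longrightarrow> bimodule_hom K A P Y g \<longrightarrow>
     (\<exists>h. bimodule_hom K A P X h \<and> (\<forall>p\<in>carrier P. f (h p) = g p)))"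

text \<open>A definition cannot quantify over the types that carry the test epimorphisms. Testing against
  the types chosen here is enough: by \<open>E_projective_lifts\<close> below, it implies the lifting property
  for epimorphisms between bimodules carried by arbitrary types.\<close>

definition E_projective :: "'k ring \<Rightarrow> ('k, 'a) module \<Rightarrow> 'a set \<Rightarrow> ('k, 'a, 'p) bimodule \<Rightarrow> bool" where
  "E_projective K A B P \<longleftrightarrow> is_bimodule K A P \<and>
     E_lifts TYPE(('a \<times> 'p \<times> 'a) list) TYPE('p) K A B P"

text \<open>A resolution \<open>\<dots> \<rightarrow> P 1 \<rightarrow> P 0 \<rightarrow> X \<rightarrow> 0\<close> with differentials \<open>d n\<close> for \<open>n \<ge> 1\<close> and
  augmentation \<open>e\<close>. The map to \<open>0\<close> is trivially in the class.\<close>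

definition E_resolution :: "'k ring \<Rightarrow> ('k, 'a) module \<Rightarrow> 'a set \<Rightarrow> ('k, 'a, 'x) bimodule
    \<Rightarrow> (nat \<Rightarrow> ('k, 'a, 'p) bimodule) \<Rightarrow> (nat \<Rightarrow> 'p \<Rightarrow> 'p) \<Rightarrow> ('p \<Rightarrow> 'x) \<Rightarrow> bool" where
  "E_resolution K A B X P d e \<longleftrightarrow>
     (\<forall>n. E_projective K A B (P n)) \<and>
     (\<forall>n. bimodule_hom K A (P (Suc n)) (P n) (d (Suc n))) \<and>
     bimodule_hom K A (P 0) X e \<and>
     e ` carrier (P 0) = carrier X \<and>
     d 1 ` carrier (P 1) = {p \<in> carrier (P 0). e p = \<zero>\<^bsub>X\<^esub>} \<and>
     (\<forall>n>0. d (Suc n) ` carrier (P (Suc n)) = cycles P d n) \<and>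
     class_E K A B (P 0) X e \<and>
     (\<forall>n. class_E K A B (P (Suc n)) ((P n)\<lparr>carrier := d (Suc n) ` carrier (P (Suc n))\<rparr>) (d (Suc n)))"

text \<open>The \<open>n\<close>-th left derived functor as computed by the resolution with terms \<open>P\<close> and
  differentials \<open>d\<close>.\<close>

definition LF :: "'k ring \<Rightarrow> ('k, 'a) module \<Rightarrow> (nat \<Rightarrow> ('k, 'a, 'p) bimodule) \<Rightarrow> (nat \<Rightarrow> 'p \<Rightarrow> 'p)
    \<Rightarrow> nat \<Rightarrow> ('k, (('a \<times> 'p) \<Rightarrow>\<^sub>0 int) set set) module" where
  "LF K A P d = homology (\<lambda>n. F_obj K A (P n)) (\<lambda>n. F_mor K A (P (n - 1)) (d n))"

section \<open>Independence of the types carrying the test epimorphisms\<close>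

lemma is_bimoduleD:
  assumes "is_bimodule K A X"
  shows "module K X"
    and "\<And>a x. a \<in> carrier A \<Longrightarrow> x \<in> carrier X \<Longrightarrow> lact X a x \<in> carrier X"
    and "\<And>a x. a \<in> carrier A \<Longrightarrow> x \<in> carrier X \<Longrightarrow> ract X x a \<in> carrier X"
    and "\<And>a x y. a \<in> carrier A \<Longrightarrow> x \<in> carrier X \<Longrightarrow> y \<in> carrier X
       \<Longrightarrow> lact X a (x \<oplus>\<^bsub>X\<^esub> y) = lact X a x \<oplus>\<^bsub>X\<^esub> lact X a y"
    and "\<And>a x y. a \<in> carrier A \<Longrightarrow> x \<in> carrier X \<Longrightarrow> y \<in> carrier X
       \<Longrightarrow> ract X (x \<oplus>\<^bsub>X\<^esub> y) a = ract X x a \<oplus>\<^bsub>X\<^esub> ract X y a"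
    and "\<And>a b x. a \<in> carrier A \<Longrightarrow> b \<in> carrier A \<Longrightarrow> x \<in> carrier X
       \<Longrightarrow> lact X (a \<oplus>\<^bsub>A\<^esub> b) x = lact X a x \<oplus>\<^bsub>X\<^esub> lact X b x"
    and "\<And>a b x. a \<in> carrier A \<Longrightarrow> b \<in> carrier A \<Longrightarrow> x \<in> carrier X
       \<Longrightarrow> ract X x (a \<oplus>\<^bsub>A\<^esub> b) = ract X x a \<oplus>\<^bsub>X\<^esub> ract X x b"
    and "\<And>a b x. a \<in> carrier A \<Longrightarrow> b \<in> carrier A \<Longrightarrow> x \<in> carrier X
       \<Longrightarrow> lact X (a \<otimes>\<^bsub>A\<^esub> b) x = lact X a (lact X b x)"
    and "\<And>a b x. a \<in> carrier A \<Longrightarrow> b \<in> carrier A \<Longrightarrow> x \<in> carrier X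
       \<Longrightarrow> ract X x (a \<otimes>\<^bsub>A\<^esub> b) = ract X (ract X x a) b"
    and "\<And>a b x. a \<in> carrier A \<Longrightarrow> b \<in> carrier A \<Longrightarrow> x \<in> carrier X
       \<Longrightarrow> ract X (lact X a x) b = lact X a (ract X x b)"
    and "\<And>x. x \<in> carrier X \<Longrightarrow> lact X \<one>\<^bsub>A\<^esub> x = x"
    and "\<And>x. x \<in> carrier X \<Longrightarrow> ract X x \<one>\<^bsub>A\<^esub> = x"
    and "\<And>c a x. c \<in> carrier K \<Longrightarrow> a \<in> carrier A \<Longrightarrow> x \<in> carrier X
       \<Longrightarrow> lact X (c \<odot>\<^bsub>A\<^esub> a) x = c \<odot>\<^bsub>X\<^esub> lact X a x"
    and "\<And>c a x. c \<in> carrier K \<Longrightarrow> a \<in> carrier A \<Longrightarrow> x \<in> carrier X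
       \<Longrightarrow> lact X a (c \<odot>\<^bsub>X\<^esub> x) = c \<odot>\<^bsub>X\<^esub> lact X a x"
    and "\<And>c a x. c \<in> carrier K \<Longrightarrow> a \<in> carrier A \<Longrightarrow> x \<in> carrier X
       \<Longrightarrow> ract X x (c \<odot>\<^bsub>A\<^esub> a) = c \<odot>\<^bsub>X\<^esub> ract X x a"
    and "\<And>c a x. c \<in> carrier K \<Longrightarrow> a \<in> carrier A \<Longrightarrow> x \<in> carrier X
       \<Longrightarrow> ract X (c \<odot>\<^bsub>X\<^esub> x) a = c \<odot>\<^bsub>X\<^esub> ract X x a"
  using assms unfolding is_bimodule_def by blast+

lemma bimodule_homD:
  assumes "bimodule_hom K A X Y f"
  shows "\<And>x. x \<in> carrier X \<Longrightarrow> f x \<in> carrier Y"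
    and "\<And>x y. x \<in> carrier X \<Longrightarrow> y \<in> carrier X \<Longrightarrow> f (x \<oplus>\<^bsub>X\<^esub> y) = f x \<oplus>\<^bsub>Y\<^esub> f y"
    and "\<And>c x. c \<in> carrier K \<Longrightarrow> x \<in> carrier X \<Longrightarrow> f (c \<odot>\<^bsub>X\<^esub> x) = c \<odot>\<^bsub>Y\<^esub> f x"
    and "\<And>a x. a \<in> carrier A \<Longrightarrow> x \<in> carrier X \<Longrightarrow> f (lact X a x) = lact Y a (f x)"
    and "\<And>a x. a \<in> carrier A \<Longrightarrow> x \<in> carrier X \<Longrightarrow> f (ract X x a) = ract Y (f x) a"
  using assms unfolding bimodule_hom_def linear_map_def by blast+

lemma bimodule_homI:
  assumes "\<And>x. x \<in> carrier X \<Longrightarrow> f x \<in> carrier Y"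
    and "\<And>x y. x \<in> carrier X \<Longrightarrow> y \<in> carrier X \<Longrightarrow> f (x \<oplus>\<^bsub>X\<^esub> y) = f x \<oplus>\<^bsub>Y\<^esub> f y"
    and "\<And>c x. c \<in> carrier K \<Longrightarrow> x \<in> carrier X \<Longrightarrow> f (c \<odot>\<^bsub>X\<^esub> x) = c \<odot>\<^bsub>Y\<^esub> f x"
    and "\<And>a x. a \<in> carrier A \<Longrightarrow> x \<in> carrier X \<Longrightarrow> f (lact X a x) = lact Y a (f x)"
    and "\<And>a x. a \<in> carrier A \<Longrightarrow> x \<in> carrier X \<Longrightarrow> f (ract X x a) = ract Y (f x) a"
  shows "bimodule_hom K A X Y f"
  using assms unfolding bimodule_hom_def linear_map_def by blast

lemma is_bimodule_sub:
  assumes X: "is_bimodule K A X" and Z: "Z \<subseteq> carrier X" "\<zero>\<^bsub>X\<^esub> \<in> Z"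
    and add: "\<And>x y. x \<in> Z \<Longrightarrow> y \<in> Z \<Longrightarrow> x \<oplus>\<^bsub>X\<^esub> y \<in> Z"
    and sm: "\<And>c x. c \<in> carrier K \<Longrightarrow> x \<in> Z \<Longrightarrow> c \<odot>\<^bsub>X\<^esub> x \<in> Z"
    and acts: "\<And>a x. a \<in> carrier A \<Longrightarrow> x \<in> Z \<Longrightarrow> lact X a x \<in> Z \<and> ract X x a \<in> Z"
  shows "is_bimodule K A (X\<lparr>carrier := Z\<rparr>)"
proof -
  interpret m: Module.module K X by (rule is_bimoduleD[OF X])
  have c: "x \<in> carrier X" if "x \<in> Z" for x using Z that by blast
  have neg: "\<exists>y\<in>Z. y \<oplus>\<^bsub>X\<^esub> x = \<zero>\<^bsub>X\<^esub>" if x: "x \<in> Z" for x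
  proof
    have "(\<ominus>\<^bsub>K\<^esub> \<one>\<^bsub>K\<^esub>) \<odot>\<^bsub>X\<^esub> x = \<ominus>\<^bsub>X\<^esub> x"
      using c[OF x] by (simp add: m.smult_l_minus)
    then show "(\<ominus>\<^bsub>K\<^esub> \<one>\<^bsub>K\<^esub>) \<odot>\<^bsub>X\<^esub> x \<oplus>\<^bsub>X\<^esub> x = \<zero>\<^bsub>X\<^esub>" using c[OF x] by (simp add: m.M.l_neg)
    show "(\<ominus>\<^bsub>K\<^esub> \<one>\<^bsub>K\<^esub>) \<odot>\<^bsub>X\<^esub> x \<in> Z" using sm x by simp
  qed
  have ag: "abelian_group (X\<lparr>carrier := Z\<rparr>)"
    by (rule abelian_groupI) (use add Z neg c in \<open>auto simp: m.M.a_ac\<close>)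
  have "module K (X\<lparr>carrier := Z\<rparr>)"
    by (rule Module.moduleI[OF m.R.is_cring ag])
      (use sm c in \<open>auto simp: m.smult_l_distr m.smult_r_distr m.smult_assoc1\<close>)
  then show ?thesis
    unfolding is_bimodule_def using acts c by (auto simp: is_bimoduleD[OF X])
qed

definition bimodule_prod :: "('k, 'a, 'x) bimodule \<Rightarrow> ('k, 'a, 'y) bimodule
    \<Rightarrow> ('k, 'a, 'x \<times> 'y) bimodule" where
  "bimodule_prod X Y = \<lparr>carrier = carrier X \<times> carrier Y,
     mult = (\<lambda>_ _. (\<zero>\<^bsub>X\<^esub>, \<zero>\<^bsub>Y\<^esub>)), one = (\<zero>\<^bsub>X\<^esub>, \<zero>\<^bsub>Y\<^esub>), zero = (\<zero>\<^bsub>X\<^esub>, \<zero>\<^bsub>Y\<^esub>),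
     add = (\<lambda>u v. (fst u \<oplus>\<^bsub>X\<^esub> fst v, snd u \<oplus>\<^bsub>Y\<^esub> snd v)),
     smult = (\<lambda>c u. (c \<odot>\<^bsub>X\<^esub> fst u, c \<odot>\<^bsub>Y\<^esub> snd u)),
     lact = (\<lambda>a u. (lact X a (fst u), lact Y a (snd u))),
     ract = (\<lambda>u a. (ract X (fst u) a, ract Y (snd u) a))\<rparr>"

lemma is_bimodule_prod:
  assumes X: "is_bimodule K A X" and Y: "is_bimodule K A Y"
  shows "is_bimodule K A (bimodule_prod X Y)"
proof -
  interpret m: Module.module K X by (rule is_bimoduleD[OF X])
  interpret n: Module.module K Y by (rule is_bimoduleD[OF Y])
  have ag: "abelian_group (bimodule_prod X Y)"
  proof (rule abelian_groupI)
    fix x assume "x \<in> carrier (bimodule_prod X Y)"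
    then show "\<exists>y\<in>carrier (bimodule_prod X Y). y \<oplus>\<^bsub>bimodule_prod X Y\<^esub> x = \<zero>\<^bsub>bimodule_prod X Y\<^esub>"
      by (intro bexI[of _ "(\<ominus>\<^bsub>X\<^esub> fst x, \<ominus>\<^bsub>Y\<^esub> snd x)"])
        (auto simp: bimodule_prod_def m.M.l_neg n.M.l_neg)
  qed (auto simp: bimodule_prod_def m.M.a_ac n.M.a_ac)
  have "module K (bimodule_prod X Y)"
    by (rule Module.moduleI[OF m.R.is_cring ag])
      (auto simp: bimodule_prod_def m.smult_l_distr m.smult_r_distr m.smult_assoc1
        n.smult_l_distr n.smult_r_distr n.smult_assoc1)
  then show ?thesis
    unfolding is_bimodule_def
    by (auto simp: bimodule_prod_def is_bimoduleD[OF X] is_bimoduleD[OF Y])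
qed

definition bimodule_transport :: "('x \<Rightarrow> 'y) \<Rightarrow> ('k, 'a, 'x) bimodule \<Rightarrow> ('k, 'a, 'y) bimodule" where
  "bimodule_transport j X = (let i = inv_into (carrier X) j in
     \<lparr>carrier = j ` carrier X, mult = (\<lambda>_ _. j \<zero>\<^bsub>X\<^esub>), one = j \<zero>\<^bsub>X\<^esub>, zero = j \<zero>\<^bsub>X\<^esub>,
      add = (\<lambda>u v. j (i u \<oplus>\<^bsub>X\<^esub> i v)), smult = (\<lambda>c u. j (c \<odot>\<^bsub>X\<^esub> i u)),
      lact = (\<lambda>a u. j (lact X a (i u))), ract = (\<lambda>u a. j (ract X (i u) a))\<rparr>)"

lemma is_bimodule_transport:
  assumes X: "is_bimodule K A X" and j: "inj_on j (carrier X)"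
  shows "is_bimodule K A (bimodule_transport j X)"
proof -
  interpret m: Module.module K X by (rule is_bimoduleD[OF X])
  note T = bimodule_transport_def Let_def
  note ij [simp] = inv_into_f_f[OF j]
  have ag: "abelian_group (bimodule_transport j X)"
  proof (rule abelian_groupI)
    fix x assume "x \<in> carrier (bimodule_transport j X)"
    then obtain u where u: "u \<in> carrier X" "x = j u" by (auto simp: T)
    then show "\<exists>y\<in>carrier (bimodule_transport j X).
        y \<oplus>\<^bsub>bimodule_transport j X\<^esub> x = \<zero>\<^bsub>bimodule_transport j X\<^esub>"
      by (intro bexI[of _ "j (\<ominus>\<^bsub>X\<^esub> u)"]) (auto simp: T m.M.l_neg)
  qed (auto simp: T m.M.a_ac)
  have "module K (bimodule_transport j X)"
    by (rule Module.moduleI[OF m.R.is_cring ag])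
      (auto simp: T m.smult_l_distr m.smult_r_distr m.smult_assoc1)
  then show ?thesis
    unfolding is_bimodule_def by (auto simp: T is_bimoduleD[OF X])
qed

lemma bimodule_hom_transport:
  assumes X: "is_bimodule K A X" and j: "inj_on j (carrier X)"
  shows "bimodule_hom K A X (bimodule_transport j X) j"
    and "bimodule_hom K A (bimodule_transport j X) X (inv_into (carrier X) j)"
proof -
  interpret m: Module.module K X by (rule is_bimoduleD[OF X])
  note T = bimodule_transport_def Let_def
  note ij [simp] = inv_into_f_f[OF j]
  show "bimodule_hom K A X (bimodule_transport j X) j"
    by (rule bimodule_homI) (auto simp: T)
  show "bimodule_hom K A (bimodule_transport j X) X (inv_into (carrier X) j)"
    by (rule bimodule_homI) (auto simp: T is_bimoduleD[OF X])
qed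

lemma bimodule_hom_comp:
  assumes "bimodule_hom K A X Y f" "bimodule_hom K A Y Z g"
  shows "bimodule_hom K A X Z (\<lambda>x. g (f x))"
  using assms unfolding bimodule_hom_def linear_map_def by (auto simp: Pi_iff)

lemma bimodule_act_zero:
  assumes X: "is_bimodule K A X" and a: "a \<in> carrier A"
  shows "lact X a \<zero>\<^bsub>X\<^esub> = \<zero>\<^bsub>X\<^esub>" "ract X \<zero>\<^bsub>X\<^esub> a = \<zero>\<^bsub>X\<^esub>"
proof -
  interpret m: Module.module K X by (rule is_bimoduleD[OF X])
  have z: "\<zero>\<^bsub>K\<^esub> \<odot>\<^bsub>X\<^esub> x = \<zero>\<^bsub>X\<^esub>" if "x \<in> carrier X" for x using that by simp
  have "lact X a (\<zero>\<^bsub>K\<^esub> \<odot>\<^bsub>X\<^esub> \<zero>\<^bsub>X\<^esub>) = \<zero>\<^bsub>K\<^esub> \<odot>\<^bsub>X\<^esub> lact X a \<zero>\<^bsub>X\<^esub>"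
    by (rule is_bimoduleD[OF X]) (use a in auto)
  then show "lact X a \<zero>\<^bsub>X\<^esub> = \<zero>\<^bsub>X\<^esub>" using is_bimoduleD(2)[OF X a] by (simp add: z)
  have "ract X (\<zero>\<^bsub>K\<^esub> \<odot>\<^bsub>X\<^esub> \<zero>\<^bsub>X\<^esub>) a = \<zero>\<^bsub>K\<^esub> \<odot>\<^bsub>X\<^esub> ract X \<zero>\<^bsub>X\<^esub> a"
    by (rule is_bimoduleD[OF X]) (use a in auto)
  then show "ract X \<zero>\<^bsub>X\<^esub> a = \<zero>\<^bsub>X\<^esub>" using is_bimoduleD(3)[OF X a] by (simp add: z)
qed

text \<open>An epimorphism of the class onto \<open>Y\<close> with splitting \<open>s\<close>, pulled back along \<open>g\<close> from \<open>P\<close>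
  to \<open>Y\<close>, may be restricted to the bimodule generated by the pairs \<open>(s (g p), p)\<close>, whose elements
  are finite sums of terms \<open>a (s (g p), p) a'\<close>.\<close>

lemma E_projective_lifts:
  fixes P :: "('k, 'a, 'p) bimodule"
  assumes A: "k_algebra K A" and B: "k_subalgebra K A B" and P: "E_projective K A B P"
  shows "E_lifts TYPE('x) TYPE('y) K A B P"
  unfolding E_lifts_def
proof (intro allI impI)
  fix X :: "('k, 'a, 'x) bimodule" and Y :: "('k, 'a, 'y) bimodule" and f g
  assume f: "class_E K A B X Y f" and g: "bimodule_hom K A P Y g"
  have bP: "is_bimodule K A P" and bX: "is_bimodule K A X" and bY: "is_bimodule K A Y"
    and hf: "bimodule_hom K A X Y f"
    using P f by (auto simp: E_projective_def class_E_def)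
  obtain s where s: "bimodule_hom K (A\<lparr>carrier := B\<rparr>) Y X s" and fs: "\<And>y. y \<in> carrier Y \<Longrightarrow> f (s y) = y"
    using f by (auto simp: class_E_def)
  interpret A: ring A using A by (simp add: k_algebra_def)
  interpret Am: Module.module K A using A by (simp add: k_algebra_def)
  have BA: "B \<subseteq> carrier A" using B by (auto simp: k_subalgebra_def dest: subringE(1))
  define Q where "Q = bimodule_prod X P"
  have bQ: "is_bimodule K A Q" unfolding Q_def by (rule is_bimodule_prod[OF bX bP])
  interpret Q: Module.module K Q by (rule is_bimoduleD[OF bQ])
  note homg = bimodule_homD[OF g] note homs = bimodule_homD[OF s, simplified]
  define q where "q p = (s (g p), p)" for p
  have q: "q p \<in> carrier Q" if "p \<in> carrier P" for p
    using that homg homs by (auto simp: q_def Q_def bimodule_prod_def)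
  define t where "t = (\<lambda>(a, p, a'). lact Q a (ract Q (q p) a'))"
  define L where "L = lists (carrier A \<times> carrier P \<times> carrier A)"
  define ev where "ev l = foldr (\<lambda>z u. t z \<oplus>\<^bsub>Q\<^esub> u) l \<zero>\<^bsub>Q\<^esub>" for l
  have ev_simps [simp]: "ev [] = \<zero>\<^bsub>Q\<^esub>" "ev (z # l) = t z \<oplus>\<^bsub>Q\<^esub> ev l" for z l
    by (auto simp: ev_def)
  have t: "t z \<in> carrier Q" if "z \<in> carrier A \<times> carrier P \<times> carrier A" for z
    using that q by (auto simp: t_def is_bimoduleD[OF bQ])
  have evc: "ev l \<in> carrier Q" if "l \<in> L" for l
    using that unfolding L_def by (induction l) (auto intro!: Q.M.a_closed t)
  have ev_app: "ev (l @ l') = ev l \<oplus>\<^bsub>Q\<^esub> ev l'" if "l \<in> L" "l' \<in> L" for l l'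
    using that(1) unfolding L_def
  proof (induction l)
    case Nil then show ?case using evc that(2) by simp
  next
    case (Cons z l)
    then show ?case using evc[OF that(2)] evc[of l] t[of z] by (simp add: L_def Q.M.a_assoc)
  qed
  have ev_smult: "c \<odot>\<^bsub>Q\<^esub> ev l = ev (map (\<lambda>(a, p, a'). (c \<odot>\<^bsub>A\<^esub> a, p, a')) l)"
    if "c \<in> carrier K" "l \<in> L" for c l
    using that(2) unfolding L_def
  proof (induction l)
    case (Cons z l)
    have "c \<odot>\<^bsub>Q\<^esub> t z = t ((\<lambda>(a, p, a'). (c \<odot>\<^bsub>A\<^esub> a, p, a')) z)"
      using Cons that(1) q by (auto simp: t_def is_bimoduleD[OF bQ])
    then show ?case using Cons evc[of l] t[of z] that(1) by (simp add: L_def Q.smult_r_distr)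
  qed (use that in auto)
  have ev_lact: "lact Q a ev_l = ev (map (\<lambda>(b, p, a'). (a \<otimes>\<^bsub>A\<^esub> b, p, a')) l)"
    if "a \<in> carrier A" "l \<in> L" "ev_l = ev l" for a l ev_l
    using that(2) unfolding L_def that(3)
  proof (induction l)
    case (Cons z l)
    have "lact Q a (t z) = t ((\<lambda>(b, p, a'). (a \<otimes>\<^bsub>A\<^esub> b, p, a')) z)"
      using Cons that(1) q by (auto simp: t_def is_bimoduleD[OF bQ])
    then show ?case using Cons evc[of l] t[of z] that(1) by (simp add: L_def is_bimoduleD[OF bQ])
  qed (use that bimodule_act_zero[OF bQ] in auto)
  have ev_ract: "ract Q (ev l) a = ev (map (\<lambda>(b, p, a'). (b, p, a' \<otimes>\<^bsub>A\<^esub> a)) l)"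
    if "a \<in> carrier A" "l \<in> L" for a l
    using that(2) unfolding L_def
  proof (induction l)
    case (Cons z l)
    have "ract Q (t z) a = t ((\<lambda>(b, p, a'). (b, p, a' \<otimes>\<^bsub>A\<^esub> a)) z)"
      using Cons that(1) q by (auto simp: t_def is_bimoduleD[OF bQ])
    then show ?case using Cons evc[of l] t[of z] that(1) by (simp add: L_def is_bimoduleD[OF bQ])
  qed (use that bimodule_act_zero[OF bQ] in auto)
  define Z where "Z = ev ` L"
  define S where "S = Q\<lparr>carrier := Z\<rparr>"
  have bS: "is_bimodule K A S" unfolding S_def
  proof (rule is_bimodule_sub[OF bQ])
    show "Z \<subseteq> carrier Q" using evc by (auto simp: Z_def)
    have "[] \<in> L" by (simp add: L_def)
    then show "\<zero>\<^bsub>Q\<^esub> \<in> Z" unfolding Z_def using ev_simps(1) by (metis imageI)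
  next
    fix x y assume "x \<in> Z" "y \<in> Z"
    then obtain l l' where l: "l \<in> L" "l' \<in> L" "x = ev l" "y = ev l'" by (auto simp: Z_def)
    moreover have "l @ l' \<in> L" using l by (simp add: L_def)
    ultimately show "x \<oplus>\<^bsub>Q\<^esub> y \<in> Z" unfolding Z_def by (metis ev_app imageI)
  next
    fix c x assume c: "c \<in> carrier K" and "x \<in> Z"
    then obtain l where l: "l \<in> L" "x = ev l" by (auto simp: Z_def)
    have "map (\<lambda>(a, p, a'). (c \<odot>\<^bsub>A\<^esub> a, p, a')) l \<in> L" using l(1) c by (fastforce simp: L_def lists_eq_set)
    then show "c \<odot>\<^bsub>Q\<^esub> x \<in> Z" using l ev_smult[OF c l(1)] by (simp add: Z_def)
  next
    fix a x assume c: "a \<in> carrier A" and "x \<in> Z"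
    then obtain l where l: "l \<in> L" "x = ev l" by (auto simp: Z_def)
    have "map (\<lambda>(b, p, a'). (a \<otimes>\<^bsub>A\<^esub> b, p, a')) l \<in> L" using l(1) c by (fastforce simp: L_def lists_eq_set)
    moreover have "map (\<lambda>(b, p, a'). (b, p, a' \<otimes>\<^bsub>A\<^esub> a)) l \<in> L" using l(1) c by (fastforce simp: L_def lists_eq_set)
    ultimately show "lact Q a x \<in> Z \<and> ract Q x a \<in> Z"
      using l ev_lact[OF c l] ev_ract[OF c l(1)] by (simp add: Z_def)
  qed
  have qZ: "q p \<in> Z" if "p \<in> carrier P" for p
  proof -
    have "ev [(\<one>\<^bsub>A\<^esub>, p, \<one>\<^bsub>A\<^esub>)] = q p" using q[OF that] by (simp add: t_def is_bimoduleD[OF bQ])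
    moreover have "[(\<one>\<^bsub>A\<^esub>, p, \<one>\<^bsub>A\<^esub>)] \<in> L" using that by (simp add: L_def)
    ultimately show ?thesis unfolding Z_def by (metis imageI)
  qed
  define j where "j = inv_into L ev"
  have j: "inj_on j (carrier S)" unfolding S_def Z_def j_def by (simp add: inj_on_inv_into)
  define W where "W = bimodule_transport j S"
  have bW: "is_bimodule K A W" unfolding W_def by (rule is_bimodule_transport[OF bS j])
  define i where "i = inv_into (carrier S) j"
  have hj: "bimodule_hom K A S W j" and hi: "bimodule_hom K A W S i"
    unfolding W_def i_def using bimodule_hom_transport[OF bS j] by auto
  have ij: "i (j u) = u" if "u \<in> Z" for u
    using inv_into_f_f[OF j] that by (simp add: i_def S_def)
  have Zc: "u \<in> carrier X \<times> carrier P" if "u \<in> Z" for u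
    using that evc by (auto simp: Z_def Q_def bimodule_prod_def)
  have h1: "bimodule_hom K A S X fst" and h2: "bimodule_hom K A S P snd"
    by (rule bimodule_homI; use Zc in \<open>fastforce simp: S_def Q_def bimodule_prod_def\<close>)+
  have hq: "bimodule_hom K (A\<lparr>carrier := B\<rparr>) P S q"
    by (rule bimodule_homI)
      (use qZ homs homg BA in \<open>auto simp: S_def, auto simp: q_def Q_def bimodule_prod_def\<close>)
  have "class_E K A B W P (\<lambda>w. snd (i w))"
    unfolding class_E_def
  proof (intro conjI bW bP exI[of _ "\<lambda>p. j (q p)"] ballI)
    show h: "bimodule_hom K A W P (\<lambda>w. snd (i w))" by (rule bimodule_hom_comp[OF hi h2])
    have hjB: "bimodule_hom K (A\<lparr>carrier := B\<rparr>) S W j"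
      using hj BA unfolding bimodule_hom_def by auto
    show hs: "bimodule_hom K (A\<lparr>carrier := B\<rparr>) P W (\<lambda>p. j (q p))"
      by (rule bimodule_hom_comp[OF hq hjB])
    show e: "snd (i (j (q p))) = p" if "p \<in> carrier P" for p
      using ij[OF qZ[OF that]] by (simp add: q_def)
    show "(\<lambda>w. snd (i w)) ` carrier W = carrier P"
    proof
      show "(\<lambda>w. snd (i w)) ` carrier W \<subseteq> carrier P" using bimodule_homD(1)[OF h] by auto
      show "carrier P \<subseteq> (\<lambda>w. snd (i w)) ` carrier W"
      proof
        fix p assume "p \<in> carrier P"
        then show "p \<in> (\<lambda>w. snd (i w)) ` carrier W"
          using e bimodule_homD(1)[OF hs] by (metis imageI)
      qed
    qed
  qed
  moreover have "bimodule_hom K A P P (\<lambda>p. p)" by (rule bimodule_homI) auto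
  ultimately obtain k where k: "bimodule_hom K A P W k" "\<And>p. p \<in> carrier P \<Longrightarrow> snd (i (k p)) = p"
    using P unfolding E_projective_def E_lifts_def by blast
  have fg: "f (fst u) = g (snd u)" if u: "u \<in> Z" for u
  proof -
    obtain l where l: "l \<in> L" "u = ev l" using u by (auto simp: Z_def)
    interpret mX: Module.module K X by (rule is_bimoduleD[OF bX])
    interpret mP: Module.module K P by (rule is_bimoduleD[OF bP])
    interpret mY: Module.module K Y by (rule is_bimoduleD[OF bY])
    note homf = bimodule_homD[OF hf]
    have f0: "f \<zero>\<^bsub>X\<^esub> = \<zero>\<^bsub>Y\<^esub>"
      using homf(3)[of "\<zero>\<^bsub>K\<^esub>" "\<zero>\<^bsub>X\<^esub>"] homf(1)[of "\<zero>\<^bsub>X\<^esub>"] by simp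
    have g0: "g \<zero>\<^bsub>P\<^esub> = \<zero>\<^bsub>Y\<^esub>"
      using homg(3)[of "\<zero>\<^bsub>K\<^esub>" "\<zero>\<^bsub>P\<^esub>"] homg(1)[of "\<zero>\<^bsub>P\<^esub>"] by simp
    have ft: "f (fst (t z)) = g (snd (t z))" if "z \<in> carrier A \<times> carrier P \<times> carrier A" for z
      using that homs(1) homg(1)
      by (auto simp: t_def q_def Q_def bimodule_prod_def homf homg fs is_bimoduleD[OF bX] is_bimoduleD[OF bP])
    have "f (fst (ev l)) = g (snd (ev l))" using l(1) unfolding L_def
    proof (induction l)
      case Nil show ?case using f0 g0 by (simp add: Q_def bimodule_prod_def)
    next
      case (Cons z l)
      have "t z \<in> carrier X \<times> carrier P" "ev l \<in> carrier X \<times> carrier P"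
        using t[of z] evc[of l] Cons by (auto simp: L_def Q_def bimodule_prod_def)
      moreover have "fst (ev (z # l)) = fst (t z) \<oplus>\<^bsub>X\<^esub> fst (ev l)"
        "snd (ev (z # l)) = snd (t z) \<oplus>\<^bsub>P\<^esub> snd (ev l)"
        unfolding ev_simps by (simp_all add: Q_def bimodule_prod_def)
      ultimately show ?case using Cons ft[of z] by (simp add: homf homg mem_Times_iff)
    qed
    then show ?thesis using l by simp
  qed
  show "\<exists>h. bimodule_hom K A P X h \<and> (\<forall>p\<in>carrier P. f (h p) = g p)"
  proof (intro exI conjI ballI)
    show "bimodule_hom K A P X (\<lambda>p. fst (i (k p)))"
      by (rule bimodule_hom_comp[OF bimodule_hom_comp[OF k(1) hi] h1])
    fix p assume p: "p \<in> carrier P"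
    then have "i (k p) \<in> Z" using bimodule_homD(1)[OF k(1)] bimodule_homD(1)[OF hi] by (auto simp: S_def)
    then show "f (fst (i (k p))) = g p" using fg k(2)[OF p] by simp
  qed
qed

end

theory Submission
  imports Defs
begin

text \<open>For a relatively projective resolution \<open>P\<close> of \<open>M\<close>, consider the double complex whose \<open>q\<close>-th column is
  the relative Hochschild complex of \<open>P q\<close>. In positive degrees the rows are exact, because the \<open>(B,B)\<close>-splittings give a
  contraction of \<open>P\<close>, and their cokernels form the Hochschild complex of \<open>M\<close>. The columns are exact as well:
  lifting the identity along \<open>A \<otimes> P q \<otimes> A \<rightarrow> P q\<close>, tensored over \<open>B\<close>, makes \<open>P q\<close> a direct summand of
  an induced bimodule, whose bar complex contracts; and the cokernel of a column is
  \<open>P q / [P q, A]\<close>, that is, \<open>A \<otimes> P q\<close> over the enveloping algebra. Zigzags through the double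
  complex then identify both homologies. A resolution exists because the terms of the two-sided bar
  resolution are induced bimodules. All modules are presented as subquotients of groups of formal
  sums, and exactness is stated modulo the relations.\<close>

section \<open>Modules presented by subgroups\<close>

text \<open>Formal sums are forced by the shape of the objects. An element of \<open>HH\<close> is a
  set of sets of sets of formal sums; the last Hochschild face does not respect the tensor relations
  before the commutators are divided out; and the contraction of a projective depends on chosen
  representatives. With one ambient group at each spot of the double complex and a subgroup of
  relations that may grow, every map is an honest additive map and every identity is a membership. A
  zigzag is not unique, so the isomorphism is obtained from an additive relation between cycles and
  not from a map on them.

  One inductive construction, \<open>bar_words\<close>, serves twice: for the Hochschild faces other
  than the last, with letters from \<open>A\<close> multiplied in opposite order, and for the
  two-sided bar complex, with pairs of letters acting from both sides. The latter is the resolution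
  attached to the comonad that sends \<open>X\<close> to \<open>A \<otimes> X \<otimes> A\<close>,
  tensored over \<open>B\<close>. Its word length 0 is the bimodule itself, so that the augmentation
  is just the lowest differential; the same map in the case of \<open>P q\<close> provides the
  section used for the columns.\<close>

definition subgrp :: "'g::ab_group_add set \<Rightarrow> bool" where
  "subgrp N \<longleftrightarrow> 0 \<in> N \<and> (\<forall>u\<in>N. \<forall>v\<in>N. u - v \<in> N)"

lemma subgrpI: "0 \<in> N \<Longrightarrow> (\<And>u v. u \<in> N \<Longrightarrow> v \<in> N \<Longrightarrow> u - v \<in> N) \<Longrightarrow> subgrp N"
  by (auto simp: subgrp_def)

lemma subgrp_0: "subgrp N \<Longrightarrow> 0 \<in> N"
  by (simp add: subgrp_def)

lemma subgrp_diff: "subgrp N \<Longrightarrow> u \<in> N \<Longrightarrow> v \<in> N \<Longrightarrow> u - v \<in> N"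
  by (simp add: subgrp_def)

lemma subgrp_minus: "subgrp N \<Longrightarrow> u \<in> N \<Longrightarrow> - u \<in> N"
  using subgrp_diff[of N 0 u] by (simp add: subgrp_0)

lemma subgrp_add: "subgrp N \<Longrightarrow> u \<in> N \<Longrightarrow> v \<in> N \<Longrightarrow> u + v \<in> N"
  using subgrp_diff[of N u "- v"] by (simp add: subgrp_minus)

lemma subgrp_trans: "subgrp N \<Longrightarrow> u - v \<in> N \<Longrightarrow> v - w \<in> N \<Longrightarrow> u - w \<in> N"
  using subgrp_add[of N "u - v" "v - w"] by simp

lemma subgrp_sym: "subgrp N \<Longrightarrow> u - v \<in> N \<Longrightarrow> v - u \<in> N"
  using subgrp_minus[of N "u - v"] by simp

lemma subgrp_mem_cong: "subgrp N \<Longrightarrow> u - v \<in> N \<Longrightarrow> u \<in> N \<longleftrightarrow> v \<in> N"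
  using subgrp_add[of N "u - v" v] subgrp_diff[of N u "u - v"] by auto

lemma subgrp_preimage:
  assumes "additive f" "subgrp G" "subgrp N"
  shows "subgrp {u \<in> G. f u \<in> N}"
  using assms by (auto intro!: subgrpI subgrp_diff simp: subgrp_0 additive.zero additive.diff)

text \<open>Closure under differences matches \<open>subgrp\<close>, and one induction rule covers
  sums and negatives. The agreement with the library's \<open>generate\<close> is shown in
  \<open>generate_free_Abelian_group\<close> and \<open>generate_eq_zspan\<close>.\<close>

inductive_set zspan :: "'g::ab_group_add set \<Rightarrow> 'g set" for R where
  zero: "0 \<in> zspan R"
| base: "r \<in> R \<Longrightarrow> r \<in> zspan R"
| diff: "u \<in> zspan R \<Longrightarrow> v \<in> zspan R \<Longrightarrow> u - v \<in> zspan R"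

lemma subgrp_zspan: "subgrp (zspan R)"
  by (auto intro: subgrpI zspan.intros)

lemma zspan_map:
  assumes "additive f" "subgrp N" "\<And>r. r \<in> R \<Longrightarrow> f r \<in> N" "u \<in> zspan R"
  shows "f u \<in> N"
  using assms(4)
  by induction (use assms(1-3) in \<open>auto simp: additive.zero additive.diff subgrp_0 intro: subgrp_diff\<close>)

lemma zspan_subset: "subgrp N \<Longrightarrow> R \<subseteq> N \<Longrightarrow> zspan R \<subseteq> N"
  using zspan_map[of "\<lambda>u. u" N R] by (auto simp: additive_def)

lemma zspan_mono: "R \<subseteq> R' \<Longrightarrow> zspan R \<subseteq> zspan R'"
  by (rule zspan_subset[OF subgrp_zspan]) (auto intro: zspan.base)

abbreviation frags :: "'w set \<Rightarrow> ('w \<Rightarrow>\<^sub>0 int) set" where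
  "frags S \<equiv> {u. Poly_Mapping.keys u \<subseteq> S}"

lemma subgrp_frags: "subgrp (frags S)"
  by (rule subgrpI) (use keys_diff in fastforce)+

lemma additive_frag_extend: "additive (frag_extend f)"
  by (simp add: additive_def frag_extend_add)

lemma additive_sub: "additive f \<Longrightarrow> additive g \<Longrightarrow> additive (\<lambda>u. f u - g u)"
  by (simp add: additive_def)

lemma additive_plus: "additive f \<Longrightarrow> additive g \<Longrightarrow> additive (\<lambda>u. f u + g u)"
  by (simp add: additive_def)

lemma additive_comp: "additive f \<Longrightarrow> additive g \<Longrightarrow> additive (\<lambda>u. f (g u))"
  by (simp add: additive_def)

lemma additive_id: "additive (\<lambda>u. u)"
  by (simp add: additive_def)

lemma additive_cmul: "additive (frag_cmul c)"
  by (simp add: additive_def frag_cmul_distrib2)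

lemma additive_cmul_comp: "additive f \<Longrightarrow> additive (\<lambda>u. frag_cmul c (f u))"
  by (simp add: additive_def frag_cmul_distrib2)

lemmas additive_intros = additive_frag_extend additive_sub additive_plus additive_id additive_cmul
  additive_cmul_comp additive_comp[OF additive_frag_extend]

text \<open>Reduces statements about formal sums to single words: the formal sums that
  \<open>f\<close> sends into \<open>N\<close> are closed under differences.\<close>

lemma frags_map:
  assumes "additive f" "subgrp N" "\<And>w. w \<in> S \<Longrightarrow> f (frag_of w) \<in> N" "u \<in> frags S"
  shows "f u \<in> N"
proof -
  have "Poly_Mapping.keys u \<subseteq> S" using assms(4) by simp
  then show ?thesis
    by (induction u rule: frag_induction)
      (use assms(1-3) in \<open>auto simp: additive.zero additive.diff subgrp_0 intro: subgrp_diff\<close>)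
qed

lemma frags_map_eq:
  assumes "additive f" "additive g" "\<And>w. w \<in> S \<Longrightarrow> f (frag_of w) = g (frag_of w)" "u \<in> frags S"
  shows "f u = g u"
  using frags_map[OF additive_sub[OF assms(1,2)], of "{0}" S u] assms by (auto simp: subgrp_def)

lemma frag_extend_mem:
  "subgrp N \<Longrightarrow> (\<And>w. w \<in> S \<Longrightarrow> f w \<in> N) \<Longrightarrow> u \<in> frags S \<Longrightarrow> frag_extend f u \<in> N"
  using frags_map[OF additive_frag_extend, of N S f u] by simp

lemma subgrp_cmul:
  assumes "subgrp N" "u \<in> N"
  shows "frag_cmul c u \<in> N"
  by (rule frag_closure_minus_cmul[where P = "\<lambda>u. u \<in> N"]) (use assms in \<open>auto simp: subgrp_0 subgrp_diff\<close>)

text \<open>The operation \<open>sm\<close> of the scalars need not be an action on \<open>G\<close>.\<close>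

definition presents :: "'c set \<Rightarrow> 'g::ab_group_add set \<Rightarrow> 'g set \<Rightarrow> ('c \<Rightarrow> 'g \<Rightarrow> 'g)
    \<Rightarrow> ('c, 'x, 'p) module_scheme \<Rightarrow> ('g \<Rightarrow> 'x) \<Rightarrow> bool" where
  "presents C G N sm X \<phi> \<longleftrightarrow> subgrp G \<and> subgrp N \<and> N \<subseteq> G \<and> \<phi> ` G = carrier X \<and> \<phi> 0 = \<zero>\<^bsub>X\<^esub> \<and>
     (\<forall>u\<in>G. \<forall>v\<in>G. \<phi> (u + v) = \<phi> u \<oplus>\<^bsub>X\<^esub> \<phi> v) \<and>
     (\<forall>u\<in>G. \<forall>v\<in>G. \<phi> u = \<phi> v \<longleftrightarrow> u - v \<in> N) \<and>
     (\<forall>c\<in>C. additive (sm c) \<and> (\<forall>u\<in>G. sm c u \<in> G \<and> \<phi> (sm c u) = c \<odot>\<^bsub>X\<^esub> \<phi> u))"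

lemma presentsD:
  assumes "presents C G N sm X \<phi>"
  shows "subgrp G" "subgrp N" "N \<subseteq> G" "\<phi> ` G = carrier X" "\<phi> 0 = \<zero>\<^bsub>X\<^esub>"
    and "\<And>u v. u \<in> G \<Longrightarrow> v \<in> G \<Longrightarrow> \<phi> (u + v) = \<phi> u \<oplus>\<^bsub>X\<^esub> \<phi> v"
    and "\<And>u v. u \<in> G \<Longrightarrow> v \<in> G \<Longrightarrow> \<phi> u = \<phi> v \<longleftrightarrow> u - v \<in> N"
    and "\<And>c. c \<in> C \<Longrightarrow> additive (sm c)"
    and "\<And>c u. c \<in> C \<Longrightarrow> u \<in> G \<Longrightarrow> sm c u \<in> G"
    and "\<And>c u. c \<in> C \<Longrightarrow> u \<in> G \<Longrightarrow> \<phi> (sm c u) = c \<odot>\<^bsub>X\<^esub> \<phi> u"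
    and "\<And>u. u \<in> G \<Longrightarrow> \<phi> u \<in> carrier X"
  using assms unfolding presents_def by blast+

lemma presents_zero_iff:
  assumes "presents C G N sm X \<phi>" "u \<in> G"
  shows "\<phi> u = \<zero>\<^bsub>X\<^esub> \<longleftrightarrow> u \<in> N"
  using presentsD(7)[OF assms, of 0] presentsD(1,5)[OF assms(1)] by (simp add: subgrp_0)

text \<open>\<open>u\<close> and 0 have the same image under \<phi>, hence so have their scalings,
  and \<open>sm c 0\<close> is 0 by additivity.\<close>

lemma presents_sm_null:
  assumes p: "presents C G N sm X \<phi>" and "c \<in> C" "u \<in> N"
  shows "sm c u \<in> N"
proof -
  have u: "u \<in> G" and 0: "0 \<in> G" using assms presentsD(1,3)[OF p] by (auto simp: subgrp_0)
  have "\<phi> (sm c u) = \<phi> (sm c 0)"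
    using presentsD(7)[OF p u 0] assms u 0 by (simp add: presentsD(10)[OF p])
  then show ?thesis
    using presentsD(7)[OF p, of "sm c u" "sm c 0"] presentsD(8,9)[OF p] assms u 0
    by (simp add: additive.zero)
qed

lemma presents_cong:
  assumes p: "presents C G N sm X f" and eq: "\<And>u. u \<in> G \<Longrightarrow> g u = f u"
  shows "presents C G N sm X g"
proof -
  have "g ` G = f ` G" using eq by (rule image_cong[OF refl])
  then show ?thesis
    unfolding presents_def using presentsD[OF p]
    by (simp add: eq subgrp_0 subgrp_add)
qed

text \<open>The group laws are transported along the surjection \<phi>, so that they need not be
  verified on nested sets of cosets.\<close>

lemma presents_abelian_group:
  assumes p: "presents C G N sm X \<phi>"
  shows "abelian_group X"
proof (rule abelian_groupI)
  note d = presentsD[OF p]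
  have ex: "\<exists>u\<in>G. \<phi> u = x" if "x \<in> carrier X" for x using that d(4) by (metis imageE)
  note cl = subgrp_add[OF d(1)] subgrp_minus[OF d(1)] subgrp_0[OF d(1)]
  show "x \<oplus>\<^bsub>X\<^esub> y \<in> carrier X" if "x \<in> carrier X" "y \<in> carrier X" for x y
    using ex[OF that(1)] ex[OF that(2)] by (auto simp flip: d(6) intro!: d(11) cl)
  show "\<zero>\<^bsub>X\<^esub> \<in> carrier X" using d(11)[OF cl(3)] d(5) by simp
  show "x \<oplus>\<^bsub>X\<^esub> y \<oplus>\<^bsub>X\<^esub> z = x \<oplus>\<^bsub>X\<^esub> (y \<oplus>\<^bsub>X\<^esub> z)"
    if "x \<in> carrier X" "y \<in> carrier X" "z \<in> carrier X" for x y z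
    using ex[OF that(1)] ex[OF that(2)] ex[OF that(3)] by (auto simp flip: d(6) simp: cl add.assoc)
  show "x \<oplus>\<^bsub>X\<^esub> y = y \<oplus>\<^bsub>X\<^esub> x" if "x \<in> carrier X" "y \<in> carrier X" for x y
    using ex[OF that(1)] ex[OF that(2)] by (auto simp flip: d(6) simp: cl add.commute)
  show "\<zero>\<^bsub>X\<^esub> \<oplus>\<^bsub>X\<^esub> x = x" if "x \<in> carrier X" for x
    using ex[OF that] by (auto simp flip: d(5) simp flip: d(6) simp: cl)
  show "\<exists>y\<in>carrier X. y \<oplus>\<^bsub>X\<^esub> x = \<zero>\<^bsub>X\<^esub>" if x: "x \<in> carrier X" for x
  proof -
    obtain u where u: "u \<in> G" "\<phi> u = x" using ex[OF x] by blast
    then have "\<phi> (- u) \<oplus>\<^bsub>X\<^esub> x = \<zero>\<^bsub>X\<^esub>" using d(6)[of "- u" u] cl d(5) by simp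
    then show ?thesis using d(11) cl u by blast
  qed
qed

lemma presents_sub:
  assumes p: "presents C G N sm X \<phi>" and G': "subgrp G'" "N \<subseteq> G'" "G' \<subseteq> G"
    and sm: "\<And>c u. c \<in> C \<Longrightarrow> u \<in> G' \<Longrightarrow> sm c u \<in> G'"
  shows "presents C G' N sm (X\<lparr>carrier := \<phi> ` G'\<rparr>) \<phi>"
proof -
  have "u \<in> G' \<Longrightarrow> u \<in> G" for u using G' by blast
  then show ?thesis
    unfolding presents_def using G' sm presentsD[OF p] by auto
qed

text \<open>Pulls a coset back to \<open>G\<close>, where it is one congruence class; the unions
  over representatives in the definitions can then be computed on formal sums.\<close>

lemma presents_coset:
  assumes p: "presents C G N sm X \<phi>" and N': "subgrp N'" "N \<subseteq> N'" "N' \<subseteq> G" and u: "u \<in> G"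
  shows "\<phi> ` N' +>\<^bsub>X\<^esub> \<phi> u = \<phi> ` {v \<in> G. v - u \<in> N'}"
proof -
  note d = presentsD[OF p]
  have "\<phi> h \<oplus>\<^bsub>X\<^esub> \<phi> u \<in> \<phi> ` {v \<in> G. v - u \<in> N'}" if "h \<in> N'" for h
  proof (rule image_eqI)
    show "\<phi> h \<oplus>\<^bsub>X\<^esub> \<phi> u = \<phi> (h + u)" using that N' u by (subst d(6)) auto
    show "h + u \<in> {v \<in> G. v - u \<in> N'}" using that N' u subgrp_add[OF d(1)] by auto
  qed
  moreover have "\<phi> v \<in> (\<Union>h\<in>\<phi> ` N'. {h \<oplus>\<^bsub>X\<^esub> \<phi> u})" if "v \<in> G" "v - u \<in> N'" for v
  proof -
    have "\<phi> v = \<phi> (v - u) \<oplus>\<^bsub>X\<^esub> \<phi> u" using that N' u by (subst d(6)[symmetric]) auto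
    then show ?thesis using that by blast
  qed
  ultimately show ?thesis unfolding a_r_coset_def' by auto
qed

text \<open>A quotient keeps the group \<open>G\<close> and only enlarges \<open>N\<close> to
  \<open>N'\<close>. Hence a quotient of a quotient is again presented by single formal sums,
  however deeply its carrier is nested.\<close>

lemma presents_quot:
  assumes p: "presents C G N sm X \<phi>" and N': "subgrp N'" "N \<subseteq> N'" "N' \<subseteq> G"
    and sm: "\<And>c u. c \<in> C \<Longrightarrow> u \<in> N' \<Longrightarrow> sm c u \<in> N'"
  shows "presents C G N' sm (quot_module X (\<phi> ` N')) (\<lambda>u. \<phi> ` N' +>\<^bsub>X\<^esub> \<phi> u)"
proof -
  note d = presentsD[OF p]
  define cs where "cs u = \<phi> ` {v \<in> G. v - u \<in> N'}" for u
  note coset = presents_coset[OF p N', folded cs_def]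
  have eq: "cs u = cs v \<longleftrightarrow> u - v \<in> N'" if uv: "u \<in> G" "v \<in> G" for u v
  proof
    assume "cs u = cs v"
    moreover have "\<phi> u \<in> cs u" using uv N' by (auto simp: cs_def subgrp_0)
    ultimately obtain w where w: "w \<in> G" "w - v \<in> N'" "\<phi> u = \<phi> w" by (auto simp: cs_def)
    then have "u - w \<in> N'" using d(7)[of u w] uv N' by auto
    then show "u - v \<in> N'" using w subgrp_trans[OF N'(1)] by blast
  next
    assume uv: "u - v \<in> N'"
    have "w - u \<in> N' \<longleftrightarrow> w - v \<in> N'" for w
      using subgrp_trans[OF N'(1), of w u v] subgrp_trans[OF N'(1), of w v u]
        subgrp_sym[OF N'(1)] uv by blast
    then show "cs u = cs v" by (simp add: cs_def)
  qed
  have add: "set_add X (cs u) (cs v) = cs (u + v)" if uv: "u \<in> G" "v \<in> G" for u v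
  proof -
    have 1: "w + w' - (u + v) \<in> N'" if "w - u \<in> N'" "w' - v \<in> N'" for w w'
      using subgrp_add[OF N'(1) that] by (simp add: algebra_simps)
    have 2: "\<exists>x\<in>G. x - u \<in> N' \<and> (\<exists>y\<in>G. y - v \<in> N' \<and> \<phi> w = \<phi> x \<oplus>\<^bsub>X\<^esub> \<phi> y)"
      if w: "w \<in> G" "w - (u + v) \<in> N'" for w
    proof (intro bexI conjI)
      show "w - v - u \<in> N'" using w by (simp add: algebra_simps)
      show "\<phi> w = \<phi> (w - v) \<oplus>\<^bsub>X\<^esub> \<phi> v"
        using w uv subgrp_diff[OF d(1)] by (subst d(6)[symmetric]) auto
    qed (use w uv N' subgrp_diff[OF d(1)] in \<open>auto simp: subgrp_0\<close>)
    have "set_add X (cs u) (cs v) = {\<phi> x \<oplus>\<^bsub>X\<^esub> \<phi> y | x y. x \<in> G \<and> x - u \<in> N' \<and> y \<in> G \<and> y - v \<in> N'}"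
      by (auto simp: set_add_def set_mult_def cs_def)
    also have "\<dots> = cs (u + v)"
    proof
      show "{\<phi> x \<oplus>\<^bsub>X\<^esub> \<phi> y | x y. x \<in> G \<and> x - u \<in> N' \<and> y \<in> G \<and> y - v \<in> N'} \<subseteq> cs (u + v)"
        using 1 by (auto simp: cs_def simp flip: d(6) intro!: imageI subgrp_add[OF d(1)])
      show "cs (u + v) \<subseteq> {\<phi> x \<oplus>\<^bsub>X\<^esub> \<phi> y | x y. x \<in> G \<and> x - u \<in> N' \<and> y \<in> G \<and> y - v \<in> N'}"
        unfolding cs_def using 2 by blast
    qed
    finally show ?thesis .
  qed
  have smult: "quot_map X (\<phi> ` N') (\<lambda>x. c \<odot>\<^bsub>X\<^esub> x) (cs u) = cs (sm c u)" if c: "c \<in> C" "u \<in> G" for c u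
  proof -
    have "\<phi> ` N' +>\<^bsub>X\<^esub> (c \<odot>\<^bsub>X\<^esub> \<phi> v) = cs (sm c u)" if v: "v \<in> G" "v - u \<in> N'" for v
    proof -
      have "sm c v - sm c u \<in> N'" using sm[OF c(1) v(2)] d(8)[OF c(1)] by (simp add: additive.diff)
      then show ?thesis using c v d(9) by (simp flip: d(10)) (simp add: coset eq)
    qed
    moreover have "u \<in> {v \<in> G. v - u \<in> N'}" using c N' by (simp add: subgrp_0)
    ultimately show ?thesis unfolding quot_map_def by (subst cs_def) auto
  qed
  have c0: "cs 0 = \<phi> ` N'" using N' by (auto simp: cs_def)
  have "presents C G N' sm (quot_module X (\<phi> ` N')) cs"
    unfolding presents_def quot_module_def
    using d N' c0 add smult eq by (auto simp: A_RCOSETS_def' coset simp flip: d(4))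
  then show ?thesis by (rule presents_cong) (simp add: coset)
qed


text \<open>Changes the generators along \<theta>, which has to be surjective only modulo
  \<open>N\<close>. It is applied to the augmentation, to present the Hochschild modules of
  \<open>M\<close> by words over \<open>P 0\<close>, and to \<open>unit_word\<close>, to present
  \<open>F_obj\<close> by words of length 0.\<close>

lemma presents_pull:
  assumes p: "presents C G N sm X \<phi>" and t: "additive \<theta>" and G': "subgrp G'"
    and cl: "\<And>u. u \<in> G' \<Longrightarrow> \<theta> u \<in> G" and onto: "\<And>u. u \<in> G \<Longrightarrow> \<exists>v\<in>G'. u - \<theta> v \<in> N"
    and sm: "\<And>c. c \<in> C \<Longrightarrow> additive (sm' c)" "\<And>c u. c \<in> C \<Longrightarrow> u \<in> G' \<Longrightarrow> sm' c u \<in> G'"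
      "\<And>c u. c \<in> C \<Longrightarrow> u \<in> G' \<Longrightarrow> \<theta> (sm' c u) - sm c (\<theta> u) \<in> N"
  shows "presents C G' {u \<in> G'. \<theta> u \<in> N} sm' X (\<lambda>u. \<phi> (\<theta> u))"
proof -
  note d = presentsD[OF p]
  have "(\<lambda>u. \<phi> (\<theta> u)) ` G' = carrier X"
  proof
    show "carrier X \<subseteq> (\<lambda>u. \<phi> (\<theta> u)) ` G'"
    proof
      fix x assume "x \<in> carrier X"
      then obtain u where "u \<in> G" "x = \<phi> u" using d(4) by (metis imageE)
      then show "x \<in> (\<lambda>u. \<phi> (\<theta> u)) ` G'" using onto[of u] cl d(7) by (metis imageI)
    qed
  qed (use cl d(11) in auto)
  moreover have "subgrp {u \<in> G'. \<theta> u \<in> N}" by (rule subgrp_preimage[OF t G' d(2)])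
  moreover have "\<phi> (\<theta> (sm' c u)) = c \<odot>\<^bsub>X\<^esub> \<phi> (\<theta> u)" if "c \<in> C" "u \<in> G'" for c u
    using that d(7)[of "\<theta> (sm' c u)" "sm c (\<theta> u)"] sm cl d(9,10) by simp
  ultimately show ?thesis
    unfolding presents_def using d(5,6,7) cl sm G' t
    by (auto simp: additive.zero additive.diff additive.add subgrp_diff)
qed

text \<open>\<open>D n\<close> lifts \<open>d (Suc n)\<close> and is a differential only modulo
  \<open>N\<close>, so all hypotheses are congruences. Cycles and boundaries are saturated under
  \<open>N\<close>, which makes homology a subquotient of \<open>G n\<close>.\<close>

lemma presents_homology:
  fixes Cx :: "nat \<Rightarrow> ('k, 'c) module"
  assumes p: "\<And>n. presents C (G n) (N n) (sm n) (Cx n) (\<phi> n)"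
    and D: "\<And>n. additive (D n)" "\<And>n u. u \<in> G (Suc n) \<Longrightarrow> D n u \<in> G n"
    and d: "\<And>n u. u \<in> G (Suc n) \<Longrightarrow> d (Suc n) (\<phi> (Suc n) u) = \<phi> n (D n u)"
    and DD: "\<And>n u. u \<in> G (Suc (Suc n)) \<Longrightarrow> D n (D (Suc n) u) \<in> N n"
    and sm: "\<And>n c u. c \<in> C \<Longrightarrow> u \<in> G (Suc n) \<Longrightarrow> D n (sm (Suc n) c u) - sm n c (D n u) \<in> N n"
  shows "\<exists>\<psi>. presents C {u \<in> G n. n > 0 \<longrightarrow> D (n - 1) u \<in> N (n - 1)}
    {u \<in> G n. \<exists>v\<in>G (Suc n). u - D n v \<in> N n} (sm n) (homology Cx d n) \<psi>"
proof -
  note pd = presentsD[OF p]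
  define Z where "Z = {u \<in> G n. n > 0 \<longrightarrow> D (n - 1) u \<in> N (n - 1)}"
  define Bd where "Bd = {u \<in> G n. \<exists>v\<in>G (Suc n). u - D n v \<in> N n}"
  \<comment> \<open>The lift preserves the relations because \<open>d\<close> is a function on
    classes: \<open>u\<close> and 0 have the same class, hence so have their images.\<close>
  have DN: "D m u \<in> N m" if u: "u \<in> N (Suc m)" for m u
  proof -
    have uG: "u \<in> G (Suc m)" and 0: "0 \<in> G (Suc m)" using u pd(3) subgrp_0[OF pd(1)] by blast+
    have "\<phi> (Suc m) u = \<phi> (Suc m) 0" using pd(7)[OF uG 0] u by simp
    then have "\<phi> m (D m u) = \<phi> m (D m 0)" using d[OF uG] d[OF 0] by simp
    then show ?thesis
      using pd(7)[OF D(2)[OF uG] D(2)[OF 0]] additive.zero[OF D(1)] by simp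
  qed
  have Z_cong: "u \<in> Z" if "v \<in> Z" "u - v \<in> N n" "u \<in> G n" for u v
  proof (cases n)
    case (Suc m)
    have "D m (u - v) \<in> N m" using DN that Suc by auto
    then show ?thesis
      using that Suc subgrp_mem_cong[OF pd(2), of "D m u" "D m v" m] by (simp add: Z_def additive.diff[OF D(1)])
  qed (use that in \<open>auto simp: Z_def\<close>)
  have NZ: "N n \<subseteq> Z"
  proof
    fix u assume "u \<in> N n"
    moreover have "0 \<in> Z"
      by (auto simp: Z_def subgrp_0[OF pd(1)] additive.zero[OF D(1)] subgrp_0[OF pd(2)])
    ultimately show "u \<in> Z" using Z_cong[of 0 u] pd(3) by auto
  qed
  have subZ: "subgrp Z"
    unfolding Z_def using subgrp_preimage[OF D(1) pd(1) pd(2)] pd(1) by (cases n) auto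
  have DZ: "D n v \<in> Z" if "v \<in> G (Suc n)" for v
    using D(2) DD that by (cases n) (auto simp: Z_def)
  have BZ: "Bd \<subseteq> Z" using DZ Z_cong by (auto simp: Bd_def)
  have NB: "N n \<subseteq> Bd"
    using pd(3) subgrp_0[OF pd(1), of "Suc n"] additive.zero[OF D(1), of n] by (force simp: Bd_def)
  have subB: "subgrp Bd"
  proof (rule subgrpI)
    show "0 \<in> Bd" using NB subgrp_0[OF pd(2)] by auto
  next
    fix u v assume "u \<in> Bd" "v \<in> Bd"
    then obtain u' v' where "u \<in> G n" "v \<in> G n" "u' \<in> G (Suc n)" "v' \<in> G (Suc n)"
        and N: "u - D n u' \<in> N n" "v - D n v' \<in> N n"
      by (auto simp: Bd_def)
    moreover have "(u - v) - D n (u' - v') \<in> N n"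
      using subgrp_diff[OF pd(2) N] by (simp add: additive.diff[OF D(1)] algebra_simps)
    ultimately show "u - v \<in> Bd" unfolding Bd_def using subgrp_diff[OF pd(1)] by blast
  qed
  have smZ: "sm n c u \<in> Z" if c: "c \<in> C" "u \<in> Z" for c u
  proof (cases n)
    case (Suc m)
    have "sm m c (D m u) \<in> N m"
      using presents_sm_null[OF p c(1)] c Suc by (auto simp: Z_def)
    then show ?thesis
      using sm[OF c(1), of u m] c Suc pd(9)[OF c(1)] subgrp_mem_cong[OF pd(2)] by (auto simp: Z_def)
  qed (use c pd(9) in \<open>auto simp: Z_def\<close>)
  have smB: "sm n c u \<in> Bd" if c: "c \<in> C" "u \<in> Bd" for c u
  proof -
    obtain v where v: "u \<in> G n" "v \<in> G (Suc n)" "u - D n v \<in> N n" using c by (auto simp: Bd_def)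
    have "sm n c u - sm n c (D n v) \<in> N n"
      using presents_sm_null[OF p c(1) v(3)] by (simp add: additive.diff[OF pd(8)[OF c(1)]])
    then have "sm n c u - D n (sm (Suc n) c v) \<in> N n"
      using subgrp_trans[OF pd(2)] subgrp_sym[OF pd(2)] sm[OF c(1) v(2)] by blast
    then show ?thesis unfolding Bd_def using pd(9)[OF c(1)] v by blast
  qed
  have "cycles Cx d n = \<phi> n ` Z"
  proof (cases n)
    case 0
    then show ?thesis using pd(4)[of n] by (simp add: cycles_def Z_def)
  next
    case (Suc m)
    have iff: "d n (\<phi> n u) = \<zero>\<^bsub>Cx m\<^esub> \<longleftrightarrow> u \<in> Z" if "u \<in> G n" for u
      using that Suc d[of u m] presents_zero_iff[OF p D(2)[of u m]] by (auto simp: Z_def)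
    have "Z \<subseteq> G n" by (auto simp: Z_def)
    then show ?thesis using iff Suc unfolding cycles_def pd(4)[symmetric] by auto
  qed
  moreover have "d (Suc n) ` carrier (Cx (Suc n)) = \<phi> n ` Bd"
  proof -
    have "\<phi> n u \<in> (\<lambda>v. \<phi> n (D n v)) ` G (Suc n)" if u: "u \<in> Bd" for u
    proof -
      obtain v where v: "u \<in> G n" "v \<in> G (Suc n)" "u - D n v \<in> N n" using u by (auto simp: Bd_def)
      then have "\<phi> n u = \<phi> n (D n v)" using pd(7)[OF v(1) D(2)[OF v(2)]] by simp
      then show ?thesis using v by blast
    qed
    moreover have "D n v \<in> Bd" if "v \<in> G (Suc n)" for v
      unfolding Bd_def using that D(2) subgrp_0[OF pd(2)] by force
    moreover have "d (Suc n) ` carrier (Cx (Suc n)) = (\<lambda>v. \<phi> n (D n v)) ` G (Suc n)"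
      using d by (force simp flip: pd(4))
    ultimately show ?thesis by blast
  qed
  moreover have "presents C Z (N n) (sm n) ((Cx n)\<lparr>carrier := \<phi> n ` Z\<rparr>) (\<phi> n)"
    by (rule presents_sub[OF p subZ NZ]) (use smZ in \<open>auto simp: Z_def\<close>)
  note presents_quot[OF this subB NB BZ smB]
  ultimately show ?thesis unfolding homology_def Z_def[symmetric] Bd_def[symmetric] by auto
qed

text \<open>An additive relation that is total on both sides and matches boundaries with boundaries
  induces an isomorphism of the quotients. Any two partners of one class differ by the partner of a
  boundary, so the choice made in \<open>f\<close> is immaterial.\<close>

lemma linear_iso_presents:
  assumes p: "presents (carrier K) Z Bd sm X \<phi>" and p': "presents (carrier K) Z' Bd' sm' X' \<phi>'"
    and rel: "\<And>z z'. \<rho> z z' \<Longrightarrow> z \<in> Z \<and> z' \<in> Z'"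
    and tot: "\<And>z. z \<in> Z \<Longrightarrow> \<exists>z'. \<rho> z z'" "\<And>z'. z' \<in> Z' \<Longrightarrow> \<exists>z. \<rho> z z'"
    and diff: "\<And>z z' y y'. \<rho> z z' \<Longrightarrow> \<rho> y y' \<Longrightarrow> \<rho> (z - y) (z' - y')"
    and sm: "\<And>c z z'. c \<in> carrier K \<Longrightarrow> \<rho> z z' \<Longrightarrow> \<rho> (sm c z) (sm' c z')"
    and bd: "\<And>z z'. \<rho> z z' \<Longrightarrow> z \<in> Bd \<longleftrightarrow> z' \<in> Bd'"
  shows "linear_iso K X X'"
proof -
  note d = presentsD[OF p] and d' = presentsD[OF p']
  define f where "f x = \<phi>' (SOME z'. \<exists>z. \<rho> z z' \<and> \<phi> z = x)" for x
  have f: "f (\<phi> z) = \<phi>' z'" if r: "\<rho> z z'" for z z'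
  proof -
    have "\<exists>z'' y. \<rho> y z'' \<and> \<phi> y = \<phi> z" using r by blast
    then have "\<exists>y. \<rho> y (SOME z'. \<exists>y. \<rho> y z' \<and> \<phi> y = \<phi> z) \<and> \<phi> y = \<phi> z" by (rule someI_ex)
    then obtain y y' where y: "\<rho> y y'" "\<phi> y = \<phi> z" and fy: "f (\<phi> z) = \<phi>' y'" by (auto simp: f_def)
    have "y - z \<in> Bd" using d(7)[of y z] y rel[OF y(1)] rel[OF r] by simp
    then have "y' - z' \<in> Bd'" using bd[OF diff[OF y(1) r]] by simp
    then show ?thesis using d'(7)[of y' z'] rel[OF y(1)] rel[OF r] fy by simp
  qed
  \<comment> \<open>Sums are obtained from differences as
    \<open>z + y = z - ((y - y) - y)\<close>.\<close>
  have add: "\<rho> (z + y) (z' + y')" if r: "\<rho> z z'" "\<rho> y y'" for z z' y y'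
    using diff[OF r(1) diff[OF diff[OF r(2,2)] r(2)]] by simp
  have ex: "\<exists>z z'. \<rho> z z' \<and> \<phi> z = x" if "x \<in> carrier X" for x
    using that tot(1) unfolding d(4)[symmetric] by blast
  have "linear_map K X X' f"
    unfolding linear_map_def
  proof (intro conjI ballI funcsetI)
    fix x assume "x \<in> carrier X"
    then obtain z z' where z: "\<rho> z z'" "\<phi> z = x" using ex by blast
    then show "f x \<in> carrier X'" using f rel d'(11) by metis
    show "f (c \<odot>\<^bsub>X\<^esub> x) = c \<odot>\<^bsub>X'\<^esub> f x" if "c \<in> carrier K" for c
      using f[OF z(1)] f[OF sm[OF that z(1)]] rel[OF z(1)] z(2) d(10)[OF that] d'(10)[OF that] by simp
    fix y assume "y \<in> carrier X"
    then obtain y0 y' where y: "\<rho> y0 y'" "\<phi> y0 = y" using ex by blast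
    show "f (x \<oplus>\<^bsub>X\<^esub> y) = f x \<oplus>\<^bsub>X'\<^esub> f y"
      using f[OF z(1)] f[OF y(1)] f[OF add[OF z(1) y(1)]] rel[OF z(1)] rel[OF y(1)] z(2) y(2) d(6) d'(6)
      by simp
  qed
  moreover have "bij_betw f (carrier X) (carrier X')"
  proof (rule bij_betw_imageI)
    show "inj_on f (carrier X)"
    proof (rule inj_onI)
      fix x y assume "x \<in> carrier X" "y \<in> carrier X" and eq: "f x = f y"
      then obtain z z' y0 y' where z: "\<rho> z z'" "\<phi> z = x" and y: "\<rho> y0 y'" "\<phi> y0 = y"
        using ex by metis
      have "z' - y' \<in> Bd'" using d'(7)[of z' y'] f[OF z(1)] f[OF y(1)] eq z y rel by auto
      then have "z - y0 \<in> Bd" using bd[OF diff[OF z(1) y(1)]] by simp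
      then show "x = y" using d(7)[of z y0] rel[OF z(1)] rel[OF y(1)] z y by simp
    qed
    show "f ` carrier X = carrier X'"
    proof
      show "f ` carrier X \<subseteq> carrier X'" using \<open>linear_map K X X' f\<close> by (auto simp: linear_map_def)
      show "carrier X' \<subseteq> f ` carrier X"
      proof
        fix x' assume "x' \<in> carrier X'"
        then obtain z' where "z' \<in> Z'" "x' = \<phi>' z'" using d'(4) by (metis imageE)
        moreover then obtain z where "\<rho> z z'" using tot(2) by blast
        ultimately show "x' \<in> f ` carrier X" using f rel d(11) by (metis imageI)
      qed
    qed
  qed
  ultimately show ?thesis unfolding linear_iso_def by blast
qed

text \<open>Lifts a generated subgroup of \<open>X\<close> to formal sums: lifts of the generators
  together with \<open>N\<close> span its preimage. This turns the commutator subspace into a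
  subgroup of formal sums.\<close>

lemma generate_eq_zspan:
  assumes p: "presents C G N sm X \<phi>" and T: "T \<subseteq> G"
  shows "generate (add_monoid X) (\<phi> ` T) = \<phi> ` zspan (T \<union> N)" and "zspan (T \<union> N) \<subseteq> G"
proof -
  note d = presentsD[OF p]
  interpret abelian_group X by (rule presents_abelian_group[OF p])
  show sub: "zspan (T \<union> N) \<subseteq> G" using zspan_subset[OF d(1)] T d(3) by auto
  have neg: "\<ominus>\<^bsub>X\<^esub> \<phi> u = \<phi> (- u)" if "u \<in> G" for u
  proof (rule minus_equality)
    show "\<phi> (- u) \<oplus>\<^bsub>X\<^esub> \<phi> u = \<zero>\<^bsub>X\<^esub>"
      using d(6)[of "- u" u] that subgrp_minus[OF d(1)] d(5) by simp
  qed (use that subgrp_minus[OF d(1)] d(11) in auto)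
  show "generate (add_monoid X) (\<phi> ` T) = \<phi> ` zspan (T \<union> N)"
  proof
    have TZ: "u \<in> zspan (T \<union> N)" if "u \<in> T" for u using that by (simp add: zspan.base)
    show "generate (add_monoid X) (\<phi> ` T) \<subseteq> \<phi> ` zspan (T \<union> N)"
    proof
      fix x assume "x \<in> generate (add_monoid X) (\<phi> ` T)"
      then show "x \<in> \<phi> ` zspan (T \<union> N)"
      proof induction
        case one
        have "0 \<in> zspan (T \<union> N)" by (rule zspan.zero)
        then show ?case using d(5) by (metis imageI monoid.select_convs(2))
      next
        case (incl h) then show ?case using TZ by auto
      next
        case (inv h)
        then obtain u where u: "u \<in> T" "h = \<phi> u" by auto
        then have "inv\<^bsub>add_monoid X\<^esub> h = \<phi> (- u)" using neg[of u] T by (auto simp: a_inv_def)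
        then show ?case using subgrp_minus[OF subgrp_zspan TZ[OF u(1)]] by auto
      next
        case (eng h1 h2)
        then obtain u v where u: "u \<in> zspan (T \<union> N)" "v \<in> zspan (T \<union> N)" "h1 = \<phi> u" "h2 = \<phi> v" by auto
        then have "h1 \<oplus>\<^bsub>X\<^esub> h2 = \<phi> (u + v)" using sub by (subst d(6)) auto
        then show ?case using subgrp_add[OF subgrp_zspan u(1,2)] by auto
      qed
    qed
    have "\<phi> u \<in> generate (add_monoid X) (\<phi> ` T)" if "u \<in> zspan (T \<union> N)" for u
      using that
    proof induction
      case zero
      show ?case using generate.one[of "add_monoid X"] d(5) by simp
    next
      case (base r)
      then show ?case
        using generate.incl[of "\<phi> r" "\<phi> ` T" "add_monoid X"] generate.one[of "add_monoid X"]
          presents_zero_iff[OF p, of r] d(3) by auto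
    next
      case (diff u v)
      have "u \<in> G" "v \<in> G" using diff sub by auto
      then have "\<phi> (u - v) = \<phi> u \<oplus>\<^bsub>X\<^esub> \<ominus>\<^bsub>X\<^esub> \<phi> v"
        using d(6)[of u "- v"] neg subgrp_minus[OF d(1)] by simp
      moreover have "\<ominus>\<^bsub>X\<^esub> \<phi> v \<in> generate (add_monoid X) (\<phi> ` T)"
        using group.generate_m_inv_closed[OF a_group, of "\<phi> ` T"] diff d(11) T by (auto simp: a_inv_def)
      ultimately show ?case
        using generate.eng[of "\<phi> u" "add_monoid X" "\<phi> ` T" "\<ominus>\<^bsub>X\<^esub> \<phi> v"] diff by simp
    qed
    then show "\<phi> ` zspan (T \<union> N) \<subseteq> generate (add_monoid X) (\<phi> ` T)" by auto
  qed
qed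

section \<open>Double complexes with exact rows and columns\<close>

text \<open>\<open>a\<close> lowers the first index, in the application the Hochschild degree, and
  \<open>b\<close> the second. The squares commute and do not anticommute, so zigzags carry no
  signs. Exactness is required at positive indices only; the cokernels at the two edges are what
  gets compared.\<close>

locale double_complex =
  fixes G N :: "nat \<Rightarrow> nat \<Rightarrow> 'g::ab_group_add set" and a b :: "nat \<Rightarrow> nat \<Rightarrow> 'g \<Rightarrow> 'g"
  assumes sub: "subgrp (G p q)" "subgrp (N p q)" "N p q \<subseteq> G p q"
    and a: "additive (a p q)" "u \<in> G (Suc p) q \<Longrightarrow> a p q u \<in> G p q" "u \<in> N (Suc p) q \<Longrightarrow> a p q u \<in> N p q"
    and b: "additive (b p q)" "u \<in> G p (Suc q) \<Longrightarrow> b p q u \<in> G p q" "u \<in> N p (Suc q) \<Longrightarrow> b p q u \<in> N p q"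
    and aa: "u \<in> G (Suc (Suc p)) q \<Longrightarrow> a p q (a (Suc p) q u) \<in> N p q"
    and bb: "u \<in> G p (Suc (Suc q)) \<Longrightarrow> b p q (b p (Suc q) u) \<in> N p q"
    and ab: "u \<in> G (Suc p) (Suc q) \<Longrightarrow> a p q (b (Suc p) q u) - b p q (a p (Suc q) u) \<in> N p q"
    and exact_a: "u \<in> G (Suc p) q \<Longrightarrow> a p q u \<in> N p q \<Longrightarrow> \<exists>v\<in>G (Suc (Suc p)) q. u - a (Suc p) q v \<in> N (Suc p) q"
    and exact_b: "u \<in> G p (Suc q) \<Longrightarrow> b p q u \<in> N p q \<Longrightarrow> \<exists>v\<in>G p (Suc (Suc q)). u - b p (Suc q) v \<in> N p (Suc q)"
begin

text \<open>The entries sit on the antidiagonal of total degree \<open>n\<close>. Its ends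
  \<open>w n\<close> and \<open>w 0\<close> lie on the two edges, and the pairs of ends form the
  relation from which the isomorphism is built.\<close>

definition zigzag :: "nat \<Rightarrow> (nat \<Rightarrow> 'g) \<Rightarrow> bool" where
  "zigzag n w \<longleftrightarrow> (\<forall>p\<le>n. w p \<in> G p (n - p)) \<and>
     (\<forall>p<n. a p (n - Suc p) (w (Suc p)) - b p (n - Suc p) (w p) \<in> N p (n - Suc p))"

lemma zigzag_diff:
  assumes "zigzag n w" "zigzag n w'"
  shows "zigzag n (\<lambda>p. w p - w' p)"
proof -
  have "a p q (u - u') - b p q (v - v') \<in> N p q"
    if "a p q u - b p q v \<in> N p q" "a p q u' - b p q v' \<in> N p q" for p q u u' v v'
    using subgrp_diff[OF sub(2) that] by (simp add: additive.diff[OF a(1)] additive.diff[OF b(1)] algebra_simps)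
  then show ?thesis using assms subgrp_diff[OF sub(1)] by (simp add: zigzag_def)
qed

text \<open>Cycles of the complex obtained from the edge with second index 0 by dividing out the
  image of \<open>b\<close>; membership in that image is spelled out by \<open>v\<close>. The
  following definitions do the same for boundaries and for the other edge.\<close>

definition col_cycles where
  "col_cycles n = {u \<in> G n 0. n > 0 \<longrightarrow> (\<exists>v\<in>G (n - 1) 1. a (n - 1) 0 u - b (n - 1) 0 v \<in> N (n - 1) 0)}"

definition col_boundaries where
  "col_boundaries n = {u \<in> G n 0. \<exists>y\<in>G (Suc n) 0. \<exists>x\<in>G n 1. u - a n 0 y - b n 0 x \<in> N n 0}"

definition row_cycles where
  "row_cycles n = {u \<in> G 0 n. n > 0 \<longrightarrow> (\<exists>v\<in>G 1 (n - 1). b 0 (n - 1) u - a 0 (n - 1) v \<in> N 0 (n - 1))}"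

definition row_boundaries where
  "row_boundaries n = {u \<in> G 0 n. \<exists>y\<in>G 0 (Suc n). \<exists>x\<in>G 1 n. u - b 0 n y - a 0 n x \<in> N 0 n}"

lemma zigzag_ends:
  assumes "zigzag n w"
  shows "w n \<in> col_cycles n" "w 0 \<in> row_cycles n"
proof -
  have g: "w p \<in> G p (n - p)" if "p \<le> n" for p using assms that by (simp add: zigzag_def)
  have N: "a p (n - Suc p) (w (Suc p)) - b p (n - Suc p) (w p) \<in> N p (n - Suc p)" if "p < n" for p
    using assms that by (simp add: zigzag_def)
  show "w n \<in> col_cycles n"
  proof (cases n)
    case (Suc m)
    then show ?thesis using g[of n] g[of m] N[of m] by (auto simp: col_cycles_def)
  qed (use g[of n] in \<open>auto simp: col_cycles_def\<close>)
  show "w 0 \<in> row_cycles n"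
  proof (cases n)
    case (Suc m)
    then show ?thesis
      using g[of 0] g[of 1] subgrp_sym[OF sub(2) N[of 0]] by (auto simp: row_cycles_def)
  qed (use g[of n] in \<open>auto simp: row_cycles_def\<close>)
qed

text \<open>Entries are found from index \<open>n\<close> down to 0. An entry is a good choice only
  if the next equation can still be solved, so \<open>P\<close> carries that solvability as the
  invariant for dependent choice.\<close>

lemma zigzag_from_col:
  assumes z: "z \<in> col_cycles n"
  shows "\<exists>w. zigzag n w \<and> w n = z"
proof -
  define P where "P k u \<longleftrightarrow> k \<le> n \<longrightarrow> u \<in> G (n - k) k \<and> (k = 0 \<longrightarrow> u = z) \<and> (k < n \<longrightarrow>
    (\<exists>v\<in>G (n - Suc k) (Suc k). a (n - Suc k) k u - b (n - Suc k) k v \<in> N (n - Suc k) k))" for k u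
  define Q where "Q k u v \<longleftrightarrow> (k < n \<longrightarrow> a (n - Suc k) k u - b (n - Suc k) k v \<in> N (n - Suc k) k)" for k u v
  have "P 0 z" using z by (auto simp: P_def col_cycles_def)
  moreover have "\<exists>v. P (Suc k) v \<and> Q k u v" if P: "P k u" for k u
  proof (cases "k < n")
    case True
    define m where "m = n - Suc k"
    have m: "n - k = Suc m" using True by (simp add: m_def)
    have u: "u \<in> G (Suc m) k" using P True m by (auto simp: P_def)
    obtain v where v: "v \<in> G m (Suc k)" "a m k u - b m k v \<in> N m k"
      using P True by (auto simp: P_def m_def)
    \<comment> \<open>Modulo \<open>N\<close>, \<open>b (a v) = a (b v) = a (a u) = 0\<close>, so
      that \<open>exact_b\<close> applies to \<open>a v\<close>.\<close>
    have "\<exists>v'\<in>G j (Suc (Suc k)). a j (Suc k) v - b j (Suc k) v' \<in> N j (Suc k)" if j: "m = Suc j" for j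
    proof (rule exact_b)
      show "a j (Suc k) v \<in> G j (Suc k)" using a(2) v(1) j by simp
      have "a j k (a m k u - b m k v) \<in> N j k" using a(3)[of _ j k] v(2) j by simp
      then have "a j k (a (Suc j) k u) - a j k (b m k v) \<in> N j k" using j by (simp add: additive.diff[OF a(1)])
      then have "a j k (b m k v) \<in> N j k"
        using subgrp_mem_cong[OF sub(2)] aa[of u j k] u j by blast
      then show "b j k (a j (Suc k) v) \<in> N j k"
        using ab[of v j k] v(1) j subgrp_mem_cong[OF sub(2)] by blast
    qed
    then have "P (Suc k) v" using v(1) True by (auto simp: P_def m_def Suc_diff_Suc)
    then show ?thesis using v(2) by (auto simp: Q_def m_def)
  qed (auto simp: P_def Q_def)
  ultimately obtain x where x: "\<And>k. P k (x k)" "\<And>k. Q k (x k) (x (Suc k))"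
    using dependent_nat_choice[of P Q] by blast
  have "zigzag n (\<lambda>p. x (n - p))"
    unfolding zigzag_def
  proof (intro conjI allI impI)
    show "x (n - p) \<in> G p (n - p)" if "p \<le> n" for p using x(1)[of "n - p"] that by (auto simp: P_def)
    show "a p (n - Suc p) (x (n - Suc p)) - b p (n - Suc p) (x (n - p)) \<in> N p (n - Suc p)" if "p < n" for p
      using x(2)[of "n - Suc p"] that by (auto simp: Q_def Suc_diff_Suc)
  qed
  moreover have "x 0 = z" using x(1)[of 0] by (simp add: P_def)
  ultimately show ?thesis by (intro exI[of _ "\<lambda>p. x (n - p)"]) simp
qed

text \<open>A witness travels along the antidiagonal: if \<open>w (Suc m)\<close> is congruent to
  \<open>a y + b x\<close>, then \<open>b\<close> kills \<open>w m - a x\<close> modulo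
  \<open>N\<close>, and exactness gives a witness for \<open>w m\<close> in which \<open>x\<close>
  takes over the role of \<open>y\<close>.\<close>

lemma zigzag_boundary:
  assumes w: "zigzag n w" and z: "w n \<in> col_boundaries n"
  shows "w 0 \<in> row_boundaries n"
proof -
  have "\<exists>y\<in>G (Suc (n - k)) k. \<exists>x\<in>G (n - k) (Suc k).
      w (n - k) - a (n - k) k y - b (n - k) k x \<in> N (n - k) k" if "k \<le> n" for k
    using that
  proof (induction k)
    case 0
    then show ?case using z by (auto simp: col_boundaries_def)
  next
    case (Suc k)
    define m where "m = n - Suc k"
    have m: "n - k = Suc m" and mk: "n - m = Suc k" "n - Suc m = k" "m < n" using Suc by (auto simp: m_def)
    have wg: "\<And>p. p \<le> n \<Longrightarrow> w p \<in> G p (n - p)"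
      "\<And>p. p < n \<Longrightarrow> a p (n - Suc p) (w (Suc p)) - b p (n - Suc p) (w p) \<in> N p (n - Suc p)"
      using w by (auto simp: zigzag_def)
    have uv: "w (Suc m) \<in> G (Suc m) k" "w m \<in> G m (Suc k)" "a m k (w (Suc m)) - b m k (w m) \<in> N m k"
      using wg(1)[of "Suc m"] wg(1)[of m] wg(2)[of m] mk by auto
    obtain y x where y: "y \<in> G (Suc (Suc m)) k" and x: "x \<in> G (Suc m) (Suc k)"
      and 1: "w (Suc m) - a (Suc m) k y - b (Suc m) k x \<in> N (Suc m) k"
      using Suc m by auto
    have "a m k (w (Suc m)) - a m k (a (Suc m) k y) - a m k (b (Suc m) k x) \<in> N m k"
      using a(3)[OF 1] by (simp add: additive.diff[OF a(1)])
    \<comment> \<open>The term \<open>a (a y)\<close> drops out by \<open>aa\<close>, and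
      \<open>a (b x)\<close> is exchanged for \<open>b (a x)\<close> by \<open>ab\<close>.\<close>
    from subgrp_add[OF sub(2) this subgrp_add[OF sub(2) aa[OF y] ab[OF x]]]
    have "a m k (w (Suc m)) - b m k (a m (Suc k) x) \<in> N m k" by simp
    from subgrp_diff[OF sub(2) this uv(3)]
    have "b m k (w m - a m (Suc k) x) \<in> N m k" by (simp add: additive.diff[OF b(1)])
    then have "\<exists>v\<in>G m (Suc (Suc k)). (w m - a m (Suc k) x) - b m (Suc k) v \<in> N m (Suc k)"
      by (intro exact_b subgrp_diff[OF sub(1)] uv a(2) x)
    then show ?case using x m by (auto simp: m_def)
  qed
  from this[of n] obtain y x where "y \<in> G 1 n" "x \<in> G 0 (Suc n)" "w 0 - a 0 n y - b 0 n x \<in> N 0 n"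
    by auto
  moreover from this have "w 0 - b 0 n x - a 0 n y \<in> N 0 n" by (simp add: algebra_simps)
  moreover have "w 0 \<in> G 0 (n - 0)" using w unfolding zigzag_def by blast
  then have "w 0 \<in> G 0 n" by simp
  ultimately show ?thesis unfolding row_boundaries_def by blast
qed

lemma transpose: "double_complex (\<lambda>p q. G q p) (\<lambda>p q. N q p) (\<lambda>p q. b q p) (\<lambda>p q. a q p)"
  by unfold_locales
    (rule sub additive.add[OF a(1)] additive.add[OF b(1)] a(2,3) b(2,3) aa bb subgrp_sym[OF sub(2) ab] exact_a exact_b; assumption)+

end

section \<open>Symmetry of the two edges and comparison of their homologies\<close>

context double_complex
begin

interpretation T: double_complex "\<lambda>p q. G q p" "\<lambda>p q. N q p" "\<lambda>p q. b q p" "\<lambda>p q. a q p"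
  by (rule transpose)

lemma zigzag_transpose:
  assumes "zigzag n w" shows "T.zigzag n (\<lambda>p. w (n - p))"
  unfolding T.zigzag_def
proof (intro conjI allI impI)
  show "w (n - p) \<in> G (n - p) p" if "p \<le> n" for p
    using assms that unfolding zigzag_def by (metis diff_diff_cancel diff_le_self)
  fix p assume p: "p < n"
  then have "a (n - Suc p) p (w (n - p)) - b (n - Suc p) p (w (n - Suc p)) \<in> N (n - Suc p) p"
    using assms[unfolded zigzag_def, THEN conjunct2, rule_format, of "n - Suc p"]
    by (simp add: Suc_diff_Suc)
  then show "b (n - Suc p) p (w (n - Suc p)) - a (n - Suc p) p (w (n - p)) \<in> N (n - Suc p) p"
    by (rule subgrp_sym[OF sub(2)])
qed

lemma T_defs: "T.col_cycles = row_cycles" "T.col_boundaries = row_boundaries"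
  "T.row_boundaries = col_boundaries"
  unfolding T.col_cycles_def T.col_boundaries_def T.row_boundaries_def
    row_cycles_def row_boundaries_def col_boundaries_def by auto

lemma zigzag_from_row:
  assumes "z \<in> row_cycles n"
  shows "\<exists>w. zigzag n w \<and> w 0 = z"
proof -
  obtain w where w: "T.zigzag n w" "w n = z" using T.zigzag_from_col assms by (auto simp: T_defs)
  have "zigzag n (\<lambda>p. w (n - p))" by (rule double_complex.zigzag_transpose[OF transpose w(1)])
  then show ?thesis using w(2) by (intro exI[of _ "\<lambda>p. w (n - p)"]) simp
qed

lemma zigzag_boundary_iff:
  assumes "zigzag n w"
  shows "w n \<in> col_boundaries n \<longleftrightarrow> w 0 \<in> row_boundaries n"
  using zigzag_boundary[OF assms] T.zigzag_boundary[OF zigzag_transpose[OF assms]]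
  by (auto simp: T_defs)

end

text \<open>Sharing a zigzag is a relation that is total on both sides by exactness, additive by
  \<open>zigzag_diff\<close>, and compatible with boundaries by \<open>zigzag_boundary_iff\<close>.
  Scalars commute strictly with \<open>a\<close> and \<open>b\<close>, so they act on zigzags
  entrywise.\<close>

lemma (in double_complex) linear_iso_rows_cols:
  assumes "presents (carrier K) (col_cycles n) (col_boundaries n) (\<lambda>c. sm c n 0) X \<phi>"
    and "presents (carrier K) (row_cycles n) (row_boundaries n) (\<lambda>c. sm c 0 n) X' \<phi>'"
    and sm: "\<And>c p q. c \<in> carrier K \<Longrightarrow> additive (sm c p q)"
      "\<And>c p q u. c \<in> carrier K \<Longrightarrow> u \<in> G p q \<Longrightarrow> sm c p q u \<in> G p q"
      "\<And>c p q u. c \<in> carrier K \<Longrightarrow> u \<in> N p q \<Longrightarrow> sm c p q u \<in> N p q"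
      "\<And>c p q u. c \<in> carrier K \<Longrightarrow> u \<in> G (Suc p) q \<Longrightarrow> a p q (sm c (Suc p) q u) = sm c p q (a p q u)"
      "\<And>c p q u. c \<in> carrier K \<Longrightarrow> u \<in> G p (Suc q) \<Longrightarrow> b p q (sm c p (Suc q) u) = sm c p q (b p q u)"
  shows "linear_iso K X X'"
proof (rule linear_iso_presents[OF assms(1,2), where \<rho> = "\<lambda>z z'. \<exists>w. zigzag n w \<and> w n = z \<and> w 0 = z'"])
  fix c z z' assume c: "c \<in> carrier K" and "\<exists>w. zigzag n w \<and> w n = z \<and> w 0 = z'"
  then obtain w where w: "zigzag n w" "w n = z" "w 0 = z'" by blast
  have wg: "\<And>p. p \<le> n \<Longrightarrow> w p \<in> G p (n - p)"
    "\<And>p. p < n \<Longrightarrow> a p (n - Suc p) (w (Suc p)) - b p (n - Suc p) (w p) \<in> N p (n - Suc p)"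
    using w(1) by (auto simp: zigzag_def)
  have "zigzag n (\<lambda>p. sm c p (n - p) (w p))"
    unfolding zigzag_def
  proof (intro conjI allI impI)
    show "sm c p (n - p) (w p) \<in> G p (n - p)" if "p \<le> n" for p
      using w(1) that c sm(2) by (simp add: zigzag_def)
    fix p assume p: "p < n"
    define q where "q = n - Suc p"
    have q: "n - p = Suc q" using p by (simp add: q_def)
    have "w (Suc p) \<in> G (Suc p) q" "w p \<in> G p (Suc q)" "a p q (w (Suc p)) - b p q (w p) \<in> N p q"
      using wg(1)[of "Suc p"] wg(1)[of p] wg(2)[of p] p q by (auto simp: q_def)
    then show "a p (n - Suc p) (sm c (Suc p) (n - Suc p) (w (Suc p))) -
        b p (n - Suc p) (sm c p (n - p) (w p)) \<in> N p (n - Suc p)"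
      using sm(3)[OF c, of "a p q (w (Suc p)) - b p q (w p)"] c
      by (simp add: q sm(4,5) additive.diff[OF sm(1)[OF c]] flip: q_def)
  qed
  then show "\<exists>w. zigzag n w \<and> w n = sm c n 0 z \<and> w 0 = sm c 0 n z'"
    using w by (intro exI[of _ "\<lambda>p. sm c p (n - p) (w p)"]) simp
next
  fix z z' y y' assume "\<exists>w. zigzag n w \<and> w n = z \<and> w 0 = z'" "\<exists>w. zigzag n w \<and> w n = y \<and> w 0 = y'"
  then show "\<exists>w. zigzag n w \<and> w n = z - y \<and> w 0 = z' - y'" using zigzag_diff by fastforce
qed (use zigzag_ends zigzag_from_col zigzag_from_row zigzag_boundary_iff in blast)+


section \<open>Bar complexes\<close>

definition fmap :: "('v \<Rightarrow> 'w) \<Rightarrow> ('v \<Rightarrow>\<^sub>0 int) \<Rightarrow> ('w \<Rightarrow>\<^sub>0 int)" where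
  "fmap f = frag_extend (\<lambda>w. frag_of (f w))"

lemma fmap_of [simp]: "fmap f (frag_of w) = frag_of (f w)"
  by (simp add: fmap_def)

lemma additive_fmap: "additive (fmap f)" "additive g \<Longrightarrow> additive (\<lambda>u. fmap f (g u))"
  by (auto simp: fmap_def intro: additive_intros)

lemmas fmap_diff = additive.diff[OF additive_fmap(1)]
lemmas fmap_add = additive.add[OF additive_fmap(1)]

lemma fmap_0 [simp]: "fmap f 0 = 0"
  by (simp add: fmap_def)

lemma fmap_cmul: "fmap f (frag_cmul c u) = frag_cmul c (fmap f u)"
  by (simp add: fmap_def frag_extend_cmul)

lemma fmap_frags: "u \<in> frags S \<Longrightarrow> (\<And>w. w \<in> S \<Longrightarrow> f w \<in> S') \<Longrightarrow> fmap f u \<in> frags S'"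
  unfolding fmap_def by (rule frag_extend_mem[OF subgrp_frags, of S]) auto

lemma fmap_cong: "(\<And>w. w \<in> S \<Longrightarrow> f w = g w) \<Longrightarrow> u \<in> frags S \<Longrightarrow> fmap f u = fmap g u"
  by (rule frags_map_eq[of _ _ S]) (auto intro: additive_fmap)

lemma fmap_fmap: "fmap f (fmap g u) = fmap (\<lambda>w. f (g w)) u"
  by (rule frags_map_eq[of _ _ UNIV]) (auto intro: additive_fmap)

lemma fmap_id: "u \<in> frags S \<Longrightarrow> (\<And>w. w \<in> S \<Longrightarrow> f w = w) \<Longrightarrow> fmap f u = u"
  by (rule frags_map_eq[of _ _ S]) (auto intro: additive_fmap additive_id)

lemma frag_extend_fmap: "frag_extend g (fmap f u) = frag_extend (\<lambda>w. g (f w)) u"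
  by (rule frags_map_eq[of _ _ UNIV]) (auto intro: additive_intros additive_fmap)

text \<open>The bar construction over a monoid \<open>I\<close> with submonoid \<open>J\<close>: the words of length \<open>n + 1\<close> are
  the \<open>t i w\<close>, on which \<open>I\<close> acts by \<open>\<rho>\<close> through the outermost letter, and \<open>t\<close> is balanced over
  \<open>J\<close>. The set \<open>add\<close> consists of the \<open>(i, j, k)\<close> for which \<open>i\<close> is to be the sum of \<open>j\<close> and \<open>k\<close>.\<close>

locale bar_words =
  fixes W :: "nat \<Rightarrow> 'w set" and R :: "nat \<Rightarrow> ('w \<Rightarrow>\<^sub>0 int) set"
    and I :: "'i set" and J :: "'i set" and mul :: "'i \<Rightarrow> 'i \<Rightarrow> 'i" and add :: "('i \<times> 'i \<times> 'i) set"
    and t :: "'i \<Rightarrow> 'w \<Rightarrow> 'w" and \<rho> :: "'i \<Rightarrow> 'w \<Rightarrow> 'w" and D :: "'w \<Rightarrow> ('w \<Rightarrow>\<^sub>0 int)"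
  assumes W_Suc: "W (Suc n) = {t i w | i w. i \<in> I \<and> w \<in> W n}"
    and R_Suc: "R (Suc n) = {fmap (t i) r | i r. i \<in> I \<and> r \<in> R n} \<union>
      {frag_of (t i w) - frag_of (t j w) - frag_of (t k w) | i j k w. (i, j, k) \<in> add \<and> w \<in> W n} \<union>
      {frag_of (t i (\<rho> j w)) - frag_of (t (mul i j) w) | i j w. i \<in> I \<and> j \<in> J \<and> w \<in> W n}"
    and J: "J \<subseteq> I" and mul: "i \<in> I \<Longrightarrow> j \<in> I \<Longrightarrow> mul i j \<in> I"
    and assoc: "i \<in> I \<Longrightarrow> j \<in> I \<Longrightarrow> k \<in> I \<Longrightarrow> mul (mul i j) k = mul i (mul j k)"
    and add: "add \<subseteq> I \<times> I \<times> I"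
      "(i, j, k) \<in> add \<Longrightarrow> l \<in> I \<Longrightarrow> (mul l i, mul l j, mul l k) \<in> add"
      "(i, j, k) \<in> add \<Longrightarrow> l \<in> I \<Longrightarrow> (mul i l, mul j l, mul k l) \<in> add"
    and \<rho>_t: "i \<in> I \<Longrightarrow> j \<in> I \<Longrightarrow> w \<in> W n \<Longrightarrow> \<rho> i (t j w) = t (mul i j) w"
    and \<rho>_W_0: "i \<in> I \<Longrightarrow> w \<in> W 0 \<Longrightarrow> \<rho> i w \<in> W 0"
    and \<rho>_mul_0: "i \<in> I \<Longrightarrow> j \<in> I \<Longrightarrow> w \<in> W 0 \<Longrightarrow> \<rho> i (\<rho> j w) = \<rho> (mul i j) w"
    and R_0: "R 0 \<subseteq> frags (W 0)"
    and \<rho>_R_0: "i \<in> I \<Longrightarrow> r \<in> R 0 \<Longrightarrow> fmap (\<rho> i) r \<in> zspan (R 0)"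
    and \<rho>_add_0: "(i, j, k) \<in> add \<Longrightarrow> w \<in> W 0 \<Longrightarrow> frag_of (\<rho> i w) - frag_of (\<rho> j w) - frag_of (\<rho> k w) \<in> zspan (R 0)"
    and D_0: "w \<in> W 0 \<Longrightarrow> D w = 0"
    and D_t: "i \<in> I \<Longrightarrow> w \<in> W n \<Longrightarrow> D (t i w) = fmap (t i) (D w) + frag_cmul ((-1) ^ n) (frag_of (\<rho> i w))"
begin

lemma t_W: "i \<in> I \<Longrightarrow> w \<in> W n \<Longrightarrow> t i w \<in> W (Suc n)"
  by (auto simp: W_Suc)

lemma W_cases:
  assumes "w \<in> W n" obtains "n = 0" "w \<in> W 0" | m i v where "n = Suc m" "i \<in> I" "v \<in> W m" "w = t i v"
  using assms by (cases n) (auto simp: W_Suc)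

lemma \<rho>_W: "i \<in> I \<Longrightarrow> w \<in> W n \<Longrightarrow> \<rho> i w \<in> W n"
  by (erule W_cases) (auto simp: \<rho>_W_0 \<rho>_t mul t_W)

lemma \<rho>_mul: "i \<in> I \<Longrightarrow> j \<in> I \<Longrightarrow> w \<in> W n \<Longrightarrow> \<rho> i (\<rho> j w) = \<rho> (mul i j) w"
  by (erule W_cases) (auto simp: \<rho>_mul_0 \<rho>_t mul assoc)

lemma R_cases [consumes 1, case_names zero t add bal]:
  assumes "r \<in> R n"
  obtains "n = 0" "r \<in> R 0"
  | m i s where "n = Suc m" "i \<in> I" "s \<in> R m" "r = fmap (t i) s"
  | m i j k w where "n = Suc m" "(i, j, k) \<in> add" "w \<in> W m"
      "r = frag_of (t i w) - frag_of (t j w) - frag_of (t k w)"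
  | m i j w where "n = Suc m" "i \<in> I" "j \<in> J" "w \<in> W m"
      "r = frag_of (t i (\<rho> j w)) - frag_of (t (mul i j) w)"
proof (cases n)
  case 0 then show ?thesis using assms that(1) by simp
next
  case (Suc m)
  then have "r \<in> R (Suc m)" using assms by simp
  then show ?thesis unfolding R_Suc using Suc that(2-4) by blast
qed

lemma t_R: "i \<in> I \<Longrightarrow> r \<in> zspan (R n) \<Longrightarrow> fmap (t i) r \<in> zspan (R (Suc n))"
  by (rule zspan_map[OF additive_fmap(1) subgrp_zspan, of "R n"]) (auto simp: R_Suc intro!: zspan.base)

lemma t_add: "(i, j, k) \<in> add \<Longrightarrow> w \<in> W n \<Longrightarrow>
    frag_of (t i w) - frag_of (t j w) - frag_of (t k w) \<in> zspan (R (Suc n))"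
  by (rule zspan.base) (auto simp: R_Suc)

lemma t_bal: "i \<in> I \<Longrightarrow> j \<in> J \<Longrightarrow> w \<in> W n \<Longrightarrow>
    frag_of (t i (\<rho> j w)) - frag_of (t (mul i j) w) \<in> zspan (R (Suc n))"
  by (rule zspan.base) (auto simp: R_Suc)

lemma R_frags: "R n \<subseteq> frags (W n)"
proof (induction n)
  case (Suc n)
  show ?case
  proof
    fix r assume "r \<in> R (Suc n)"
    then show "r \<in> frags (W (Suc n))"
    proof (cases rule: R_cases)
      case (t m i s)
      then have "fmap (t i) s \<in> frags (W (Suc n))" using Suc by (intro fmap_frags[of _ "W n"]) (auto intro: t_W)
      then show ?thesis using t by simp
    next
      case (add m i j k w)
      then have "i \<in> I" "j \<in> I" "k \<in> I" using bar_words.add(1)[OF bar_words_axioms] by auto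
      then have "frag_of (t i w) - frag_of (t j w) - frag_of (t k w) \<in> frags (W (Suc n))"
        by (intro subgrp_diff[OF subgrp_frags]) (use add in \<open>auto intro!: t_W\<close>)
      then show ?thesis using add by simp
    next
      case (bal m i j w)
      then have "frag_of (t i (\<rho> j w)) - frag_of (t (mul i j) w) \<in> frags (W (Suc n))"
        by (intro subgrp_diff[OF subgrp_frags]) (use bal J in \<open>auto intro!: t_W mul \<rho>_W\<close>)
      then show ?thesis using bal by simp
    qed auto
  qed
qed (rule R_0)

lemma zspan_R_frags: "zspan (R n) \<subseteq> frags (W n)"
  by (rule zspan_subset[OF subgrp_frags R_frags])

text \<open>The action touches only the outermost letter, where \<open>mul\<close> absorbs it, so
  each kind of relation goes to one of the same kind.\<close>

lemma \<rho>_R: assumes "i \<in> I" "r \<in> zspan (R n)" shows "fmap (\<rho> i) r \<in> zspan (R n)"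
proof (rule zspan_map[OF additive_fmap(1) subgrp_zspan _ assms(2)])
  fix r assume "r \<in> R n"
  then show "fmap (\<rho> i) r \<in> zspan (R n)"
  proof (cases rule: R_cases)
    case zero then show ?thesis using \<rho>_R_0 assms by simp
  next
    case (t m j s)
    then have "fmap (\<rho> i) r = fmap (t (mul i j)) s"
      using R_frags[of m] assms(1) by (auto simp: fmap_fmap \<rho>_t intro!: fmap_cong[of "W m"])
    then show ?thesis using t assms(1) t_R[of "mul i j" s m] by (simp add: mul zspan.base)
  next
    case (add m j k l w)
    then show ?thesis
      using t_add[of "mul i j" "mul i k" "mul i l" w m] assms(1) bar_words.add[OF bar_words_axioms]
      by (auto simp: fmap_diff \<rho>_t dest: subsetD)
  next
    case (bal m k j w)
    then have "j \<in> I" "\<rho> j w \<in> W m" using J by (auto intro!: \<rho>_W)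
    then show ?thesis
      using t_bal[of "mul i k" j w m] \<rho>_t[of i k "\<rho> j w" m] \<rho>_t[of i "mul k j" w m] assms(1) bal
      by (simp add: fmap_diff mul assoc)
  qed
qed

lemma \<rho>_add:
  assumes "(i, j, k) \<in> add" "w \<in> W n"
  shows "frag_of (\<rho> i w) - frag_of (\<rho> j w) - frag_of (\<rho> k w) \<in> zspan (R n)"
  using assms(2)
proof (cases rule: W_cases)
  case 1 then show ?thesis using \<rho>_add_0 assms by simp
next
  case (2 m l v)
  then show ?thesis
    using t_add[of "mul i l" "mul j l" "mul k l" v m] assms(1) add by (auto simp: \<rho>_t dest: subsetD)
qed

lemma D_W: "w \<in> W (Suc n) \<Longrightarrow> D w \<in> frags (W n)"
proof (induction n arbitrary: w)
  case 0
  then obtain i v where "i \<in> I" "v \<in> W 0" "w = t i v" by (auto simp: W_Suc)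
  then show ?case by (auto simp: D_t D_0 \<rho>_W)
next
  case (Suc n)
  then obtain i v where v: "i \<in> I" "v \<in> W (Suc n)" "w = t i v" by (auto simp: W_Suc[of "Suc n"])
  have "fmap (t i) (D v) \<in> frags (W (Suc n))" using Suc.IH v by (intro fmap_frags[of _ "W n"]) (auto intro: t_W)
  then show ?case
    unfolding v(3) D_t[OF v(1,2)]
    by (rule subgrp_add[OF subgrp_frags]) (use v in \<open>auto intro!: subgrp_cmul[OF subgrp_frags] \<rho>_W\<close>)
qed

text \<open>On \<open>t j v\<close> both sides become the same expression in \<open>mul i j\<close>.
  As only the outermost letter is involved, a case distinction takes the place of an
  induction.\<close>

lemma D_\<rho>: "i \<in> I \<Longrightarrow> w \<in> W n \<Longrightarrow> D (\<rho> i w) = fmap (\<rho> i) (D w)"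
proof (erule W_cases)
  fix m j v assume i: "i \<in> I" and v: "n = Suc m" "j \<in> I" "v \<in> W m" "w = t j v"
  have "fmap (\<rho> i) (fmap (t j) (D v)) = fmap (t (mul i j)) (D v)"
  proof (cases m)
    case (Suc l)
    then show ?thesis
      using D_W[of v l] v i by (auto simp: fmap_fmap intro!: fmap_cong[of "W l"] \<rho>_t)
  qed (use v in \<open>simp add: D_0\<close>)
  then show ?thesis using i v by (simp add: \<rho>_t D_t mul fmap_add fmap_cmul \<rho>_mul)
qed (simp add: D_0 \<rho>_W_0)

text \<open>The induction step leaves two copies of the action of \<open>i\<close> on
  \<open>D v\<close>: one from \<open>D\<close> applied to \<open>t i\<close> of \<open>D v\<close>,
  the other from \<open>D_\<rho>\<close>. Their signs are opposite because \<open>D v\<close> is one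
  letter shorter than \<open>v\<close>.\<close>

lemma D_D: "w \<in> W (Suc n) \<Longrightarrow> frag_extend D (D w) = 0"
proof (induction n arbitrary: w)
  case 0
  then have "D w \<in> frags (W 0)" by (rule D_W)
  then show ?case by (intro frag_extend_eq_0) (auto simp: D_0)
next
  case (Suc n)
  then obtain i v where v: "i \<in> I" "v \<in> W (Suc n)" "w = t i v" by (auto simp: W_Suc[of "Suc n"])
  have "frag_extend D (fmap (t i) (D v)) = fmap (t i) (frag_extend D (D v)) + frag_cmul ((-1) ^ n) (fmap (\<rho> i) (D v))"
  proof -
    have "frag_extend D (fmap (t i) u) = fmap (t i) (frag_extend D u) + frag_cmul ((-1) ^ n) (fmap (\<rho> i) u)"
      if "u \<in> frags (W n)" for u
      by (rule frags_map_eq[OF _ _ _ that]) (use v in \<open>auto intro!: additive_intros additive_fmap simp: D_t\<close>)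
    then show ?thesis using D_W[OF v(2)] by blast
  qed
  then show ?case
    using v Suc.IH[OF v(2)] D_\<rho>[OF v(1,2)]
    by (simp add: D_t frag_extend_add frag_extend_cmul flip: frag_cmul_distrib)
qed

text \<open>Length one is separate since \<open>D\<close> vanishes on \<open>W 0\<close> and only
  the outermost face survives there. Otherwise a relation below the outermost letter is handled by
  induction, and one at that letter by equivariance of \<open>D\<close> and additivity of the
  action.\<close>

lemma D_R:
  assumes "r \<in> zspan (R (Suc n))"
  shows "frag_extend D r \<in> zspan (R n)"
proof -
  have "frag_extend D r \<in> zspan (R n)" if "r \<in> R (Suc n)" for r
    using that
  proof (induction n arbitrary: r rule: nat.induct)
    case zero
    from zero show ?case
    proof (cases rule: R_cases)
      case (t m i s)
      have "frag_extend D r = frag_extend (\<lambda>w. D (t i w)) s" using t by (simp add: frag_extend_fmap)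
      also have "\<dots> = fmap (\<rho> i) s"
        unfolding fmap_def using t R_0 by (intro frag_extend_eq) (auto simp: D_t D_0 dest!: subsetD)
      finally show ?thesis using \<rho>_R[of i s 0] t by (simp add: zspan.base)
    next
      case (add m i j k w)
      then have "i \<in> I" "j \<in> I" "k \<in> I" using bar_words.add(1)[OF bar_words_axioms] by auto
      then show ?thesis using \<rho>_add[of i j k w 0] add by (simp add: frag_extend_diff D_t D_0)
    next
      case (bal m i j w)
      then have "j \<in> I" "\<rho> j w \<in> W 0" using J by (auto intro!: \<rho>_W)
      then show ?thesis using bal D_t[of i "\<rho> j w" 0]
        by (simp add: frag_extend_diff D_t[of _ _ 0] D_0 \<rho>_mul[of _ _ _ 0] mul zspan.zero)
    qed auto
  next
    case (Suc n)
    from Suc.prems show ?case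
    proof (cases rule: R_cases)
      case (t m i s)
      then have s: "s \<in> frags (W (Suc n))" "s \<in> zspan (R (Suc n))" using R_frags by (auto intro: zspan.base)
      have "frag_extend D r = fmap (t i) (frag_extend D s) + frag_cmul ((-1) ^ Suc n) (fmap (\<rho> i) s)"
        unfolding t(4)
        by (rule frags_map_eq[OF _ _ _ s(1)]) (use t in \<open>auto intro!: additive_intros additive_fmap simp: D_t\<close>)
      then show ?thesis
        using Suc.IH t s by (auto intro!: subgrp_add[OF subgrp_zspan] subgrp_cmul[OF subgrp_zspan] t_R \<rho>_R)
    next
      case (add m i j k w)
      then have ijk: "i \<in> I" "j \<in> I" "k \<in> I" using bar_words.add(1)[OF bar_words_axioms] by auto
      have "fmap (t i) (D w) - fmap (t j) (D w) - fmap (t k) (D w) \<in> zspan (R (Suc n))"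
        by (rule frags_map[of "\<lambda>u. fmap (t i) u - fmap (t j) u - fmap (t k) u" _ "W n"])
          (use add D_W in \<open>auto intro!: additive_intros additive_fmap subgrp_zspan t_add\<close>)
      moreover have "frag_cmul ((-1) ^ Suc n) (frag_of (\<rho> i w) - frag_of (\<rho> j w) - frag_of (\<rho> k w)) \<in> zspan (R (Suc n))"
        using add by (auto intro!: subgrp_cmul[OF subgrp_zspan] \<rho>_add)
      ultimately have "fmap (t i) (D w) - fmap (t j) (D w) - fmap (t k) (D w) +
          frag_cmul ((-1) ^ Suc n) (frag_of (\<rho> i w) - frag_of (\<rho> j w) - frag_of (\<rho> k w)) \<in> zspan (R (Suc n))"
        by (rule subgrp_add[OF subgrp_zspan])
      moreover have "frag_extend D r = fmap (t i) (D w) - fmap (t j) (D w) - fmap (t k) (D w) +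
          frag_cmul ((-1) ^ Suc n) (frag_of (\<rho> i w) - frag_of (\<rho> j w) - frag_of (\<rho> k w))"
        unfolding add(4) using add(1,3) ijk
        by (simp add: frag_extend_diff D_t[of _ _ "Suc n"] additive.diff[OF additive_cmul] del: power_Suc)
      ultimately show ?thesis by simp
    next
      case (bal m i j w)
      then have j: "j \<in> I" and ij: "mul i j \<in> I" using J mul by auto
      have "fmap (t i) (fmap (\<rho> j) (D w)) - fmap (t (mul i j)) (D w) \<in> zspan (R (Suc n))"
        by (rule frags_map[of "\<lambda>u. fmap (t i) (fmap (\<rho> j) u) - fmap (t (mul i j)) u" _ "W n"])
          (use bal D_W in \<open>auto intro!: additive_intros additive_fmap subgrp_zspan t_bal\<close>)
      moreover have "frag_extend D r = fmap (t i) (fmap (\<rho> j) (D w)) - fmap (t (mul i j)) (D w)"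
        unfolding bal(5) using bal(1,2,4) j ij
        by (simp add: frag_extend_diff D_t[of _ _ "Suc n"] D_\<rho>[of _ _ "Suc n"] \<rho>_mul[of _ _ _ "Suc n"] \<rho>_W)
      ultimately show ?thesis by simp
    qed auto
  qed
  then show ?thesis using zspan_map[OF additive_frag_extend subgrp_zspan _ assms] by blast
qed

text \<open>Meant for operations on the innermost entry, such as scalars: commuting with
  \<open>t\<close> reduces everything to words of length 0. Relations involve the action of
  \<open>J\<close> only, whereas the faces in \<open>operator_D\<close> multiply by arbitrary
  letters of \<open>I\<close>.\<close>

lemma operator_R:
  assumes f: "\<And>i w n. i \<in> I \<Longrightarrow> w \<in> W n \<Longrightarrow> f (t i w) = t i (f w)" "\<And>w. w \<in> W 0 \<Longrightarrow> f w \<in> W 0"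
    "\<And>j w. j \<in> J \<Longrightarrow> w \<in> W 0 \<Longrightarrow> f (\<rho> j w) = \<rho> j (f w)" "\<And>r. r \<in> R 0 \<Longrightarrow> fmap f r \<in> zspan (R 0)"
  shows "w \<in> W n \<Longrightarrow> f w \<in> W n" "j \<in> J \<Longrightarrow> w \<in> W n \<Longrightarrow> f (\<rho> j w) = \<rho> j (f w)"
    "r \<in> zspan (R n) \<Longrightarrow> fmap f r \<in> zspan (R n)"
proof -
  show W: "w \<in> W n \<Longrightarrow> f w \<in> W n" for w n
  proof (induction n arbitrary: w)
    case (Suc n)
    then obtain i v where "i \<in> I" "v \<in> W n" "w = t i v" by (auto simp: W_Suc[of n])
    then show ?case using Suc.IH f(1) by (auto intro: t_W)
  qed (rule f(2))
  show \<rho>f: "j \<in> J \<Longrightarrow> w \<in> W n \<Longrightarrow> f (\<rho> j w) = \<rho> j (f w)" for j w n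
  proof (erule W_cases)
    fix m i v assume "j \<in> J" "i \<in> I" "v \<in> W m" "w = t i v"
    then show "f (\<rho> j w) = \<rho> j (f w)"
      using J \<rho>_t[of j i "f v" m] W by (auto simp: \<rho>_t f(1) mul dest!: subsetD)
  qed (rule f(3))
  have "fmap f r \<in> zspan (R n)" if "r \<in> R n" for r n
    using that
  proof (induction n arbitrary: r)
    case (Suc n)
    from Suc.prems show ?case
    proof (cases rule: R_cases)
      case (t m i s)
      then have "s \<in> frags (W n)" using R_frags by auto
      then have "fmap f r = fmap (t i) (fmap f s)"
        unfolding t(4) fmap_fmap using t f(1) by (intro fmap_cong) auto
      then show ?thesis using t Suc.IH by (auto intro: t_R)
    next
      case (add m i j k w)
      then have "i \<in> I" "j \<in> I" "k \<in> I" using bar_words.add(1)[OF bar_words_axioms] by auto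
      then show ?thesis using add f(1) W by (auto simp: fmap_diff intro!: t_add)
    next
      case (bal m i j w)
      then have "j \<in> I" "\<rho> j w \<in> W m" using J by (auto intro!: \<rho>_W)
      then show ?thesis using bal mul W \<rho>f t_bal[of i j "f w" n] f(1)[of i "\<rho> j w" m] f(1)[of "mul i j" w m]
        by (simp add: fmap_diff)
    qed auto
  qed (use f in auto)
  then show "r \<in> zspan (R n) \<Longrightarrow> fmap f r \<in> zspan (R n)"
    by (rule zspan_map[OF additive_fmap(1) subgrp_zspan])
qed

lemma operator_D:
  assumes f: "\<And>i w n. i \<in> I \<Longrightarrow> w \<in> W n \<Longrightarrow> f (t i w) = t i (f w)" "\<And>w. w \<in> W 0 \<Longrightarrow> f w \<in> W 0"
    "\<And>i w. i \<in> I \<Longrightarrow> w \<in> W 0 \<Longrightarrow> f (\<rho> i w) = \<rho> i (f w)"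
    and w: "w \<in> W n"
  shows "D (f w) = fmap f (D w)"
proof -
  have W: "w \<in> W n \<Longrightarrow> f w \<in> W n" for w n
  proof (induction n arbitrary: w)
    case (Suc n)
    then obtain i v where "i \<in> I" "v \<in> W n" "w = t i v" by (auto simp: W_Suc[of n])
    then show ?case using Suc.IH f(1) by (auto intro: t_W)
  qed (rule f(2))
  have \<rho>f: "i \<in> I \<Longrightarrow> w \<in> W n \<Longrightarrow> f (\<rho> i w) = \<rho> i (f w)" for i w n
  proof (erule W_cases)
    fix m j v assume "i \<in> I" "j \<in> I" "v \<in> W m" "w = t j v"
    then show "f (\<rho> i w) = \<rho> i (f w)" using \<rho>_t[of i j "f v" m] W by (simp add: \<rho>_t f(1) mul)
  qed (rule f(3))
  show ?thesis using w
  proof (induction n arbitrary: w)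
    case (Suc n)
    then obtain i v where v: "i \<in> I" "v \<in> W n" "w = t i v" by (auto simp: W_Suc[of n])
    have "fmap (t i) (fmap f (D v)) = fmap f (fmap (t i) (D v))"
    proof (cases n)
      case (Suc m)
      then show ?thesis
        unfolding fmap_fmap using D_W[of v m] v f(1) by (intro fmap_cong[of "W m"]) auto
    qed (use v in \<open>simp add: D_0\<close>)
    then show ?case
      using v Suc.IH[OF v(2)] W[OF v(2)]
      by (simp add: f(1)[of _ _ n] D_t[of _ _ n] fmap_add fmap_cmul \<rho>f[of _ _ n])
  qed (simp add: D_0 f)
qed

end


text \<open>The union in \<open>quot_map\<close> runs over all representatives of a coset; as
  \<open>f\<close> maps \<open>N'\<close> into \<open>M'\<close>, all of them yield the same coset
  in the target.\<close>

lemma presents_quot_map: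
  assumes p: "presents C G N sm X \<phi>" and N': "subgrp N'" "N \<subseteq> N'" "N' \<subseteq> G"
    and q: "presents C' H M sm' Y \<psi>" and M': "subgrp M'" "M \<subseteq> M'" "M' \<subseteq> H"
    and sm': "\<And>c u. c \<in> C' \<Longrightarrow> u \<in> M' \<Longrightarrow> sm' c u \<in> M'"
    and f: "additive f" "\<And>u. u \<in> G \<Longrightarrow> f u \<in> H" "\<And>u. u \<in> N' \<Longrightarrow> f u \<in> M'"
    and F: "\<And>u. u \<in> G \<Longrightarrow> F (\<phi> u) = \<psi> (f u)" and u: "u \<in> G"
  shows "quot_map Y (\<psi> ` M') F (\<phi> ` N' +>\<^bsub>X\<^esub> \<phi> u) = \<psi> ` M' +>\<^bsub>Y\<^esub> \<psi> (f u)"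
proof -
  have "\<psi> ` M' +>\<^bsub>Y\<^esub> \<psi> (f v) = \<psi> ` M' +>\<^bsub>Y\<^esub> \<psi> (f u)" if "v \<in> G" "v - u \<in> N'" for v
    using presentsD(7)[OF presents_quot[OF q M' sm'] f(2)[OF that(1)] f(2)[OF u]] f(3)[OF that(2)]
    by (simp add: additive.diff[OF f(1)])
  then have "\<psi> ` M' +>\<^bsub>Y\<^esub> F x = \<psi> ` M' +>\<^bsub>Y\<^esub> \<psi> (f u)" if "x \<in> \<phi> ` {v \<in> G. v - u \<in> N'}" for x
    using that F by force
  moreover have "\<phi> u \<in> \<phi> ` {v \<in> G. v - u \<in> N'}" using u N' by (simp add: subgrp_0)
  ultimately show ?thesis
    unfolding quot_map_def presents_coset[OF p N' u] by blast
qed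

lemma presents_free:
  assumes X: "carrier X = carrier (free_Abelian_group S)" "zero X = 0" "add X = (+)"
    and sm: "\<And>c. c \<in> C \<Longrightarrow> smult X c = fmap (s c)" "\<And>c w. c \<in> C \<Longrightarrow> w \<in> S \<Longrightarrow> s c w \<in> S"
  shows "presents C (frags S) {0} (\<lambda>c. fmap (s c)) X (\<lambda>u. u)"
proof -
  have "fmap (s c) u \<in> frags S" if "c \<in> C" "u \<in> frags S" for c u
    using that sm(2) by (intro fmap_frags[of _ S]) auto
  then show ?thesis
    unfolding presents_def using X sm subgrp_frags[of S]
    by (auto simp: subgrp_def additive_fmap free_Abelian_group_def)
qed

lemma presents_extend: "presents C G N sm (module.extend X r) \<phi> \<longleftrightarrow> presents C G N sm X \<phi>"
  unfolding presents_def by (simp add: module.defs)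

lemma zspan_Un_zspan: "zspan (T \<union> zspan R) = zspan (T \<union> R)"
proof
  have "zspan R \<subseteq> zspan (T \<union> R)" by (rule zspan_mono) auto
  then show "zspan (T \<union> zspan R) \<subseteq> zspan (T \<union> R)"
    by (intro zspan_subset[OF subgrp_zspan]) (auto intro: zspan.base)
  show "zspan (T \<union> R) \<subseteq> zspan (T \<union> zspan R)" by (rule zspan_mono) (auto intro: zspan.base)
qed

section \<open>The Hochschild complex on formal sums\<close>

definition hoch_ract :: "('k, 'a) module \<Rightarrow> ('k, 'a, 'm) bimodule \<Rightarrow> 'a \<Rightarrow> 'm \<times> 'a list \<Rightarrow> 'm \<times> 'a list" where
  "hoch_ract A X b = (\<lambda>(x, as). if as = [] then (ract X x b, as) else (x, butlast as @ [last as \<otimes>\<^bsub>A\<^esub> b]))"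

text \<open>The boundary without its last face. Its faces only multiply neighbours, so this part is
  the differential of a bar construction; the last face rotates the word and is treated
  apart.\<close>

definition hoch_inner :: "('k, 'a) module \<Rightarrow> ('k, 'a, 'm) bimodule \<Rightarrow> 'm \<times> 'a list \<Rightarrow> (('m \<times> 'a list) \<Rightarrow>\<^sub>0 int)" where
  "hoch_inner A X g = (\<Sum>i<length (snd g). frag_cmul ((-1) ^ i) (frag_of (hoch_face A X i g)))"

definition hoch_bd :: "('k, 'a) module \<Rightarrow> ('k, 'a, 'm) bimodule \<Rightarrow> nat
    \<Rightarrow> (('m \<times> 'a list) \<Rightarrow>\<^sub>0 int) \<Rightarrow> (('m \<times> 'a list) \<Rightarrow>\<^sub>0 int)" where
  "hoch_bd A X n = frag_extend (\<lambda>g. \<Sum>i\<le>n. frag_cmul ((-1) ^ i) (frag_of (hoch_face A X i g)))"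

text \<open>Tensor relations and commutators together, which presents the two successive quotients
  of \<open>hoch_module\<close> in one step. That additive combinations already give the linear span
  of the commutators is part of \<open>commutators_eq\<close>.\<close>

definition hoch_null :: "('k, 'a) module \<Rightarrow> 'a set \<Rightarrow> ('k, 'a, 'm) bimodule \<Rightarrow> nat
    \<Rightarrow> (('m \<times> 'a list) \<Rightarrow>\<^sub>0 int) set" where
  "hoch_null A B X n = zspan (tensor_rels A B X n \<union>
     {frag_of (hoch_ract A X b w) - frag_of (apfst (lact X b) w) | b w. b \<in> B \<and> w \<in> tensor_gens A X n})"

abbreviation snoc :: "'a \<Rightarrow> 'm \<times> 'a list \<Rightarrow> 'm \<times> 'a list" where
  "snoc a \<equiv> apsnd (\<lambda>as. as @ [a])"

abbreviation tfrags :: "('k, 'a) module \<Rightarrow> ('k, 'a, 'm) bimodule \<Rightarrow> nat \<Rightarrow> (('m \<times> 'a list) \<Rightarrow>\<^sub>0 int) set" where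
  "tfrags A X n \<equiv> frags (tensor_gens A X n)"

lemma tensor_gens_iff: "(x, as) \<in> tensor_gens A X n \<longleftrightarrow> x \<in> carrier X \<and> set as \<subseteq> carrier A \<and> length as = n"
  by (auto simp: tensor_gens_def)

lemma tensor_gens_Suc: "tensor_gens A X (Suc n) = {snoc a w | a w. a \<in> carrier A \<and> w \<in> tensor_gens A X n}"
proof (intro equalityI subsetI)
  fix w assume "w \<in> tensor_gens A X (Suc n)"
  then obtain x as a where "w = (x, as @ [a])" "(x, as) \<in> tensor_gens A X n" "a \<in> carrier A"
    by (auto simp: tensor_gens_def length_Suc_conv_rev)
  then show "w \<in> {snoc a w | a w. a \<in> carrier A \<and> w \<in> tensor_gens A X n}" by force
qed (auto simp: tensor_gens_def)

lemma tensor_relsI: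
  assumes "(x, as) \<in> tensor_gens A X n"
  shows "x' \<in> carrier X \<Longrightarrow> frag_of (x \<oplus>\<^bsub>X\<^esub> x', as) - frag_of (x, as) - frag_of (x', as) \<in> tensor_rels A B X n"
    and "i < n \<Longrightarrow> a \<in> carrier A \<Longrightarrow> a' \<in> carrier A \<Longrightarrow>
      frag_of (x, as[i := a \<oplus>\<^bsub>A\<^esub> a']) - frag_of (x, as[i := a]) - frag_of (x, as[i := a']) \<in> tensor_rels A B X n"
    and "0 < n \<Longrightarrow> b \<in> B \<Longrightarrow> frag_of (ract X x b, as) - frag_of (x, as[0 := b \<otimes>\<^bsub>A\<^esub> as ! 0]) \<in> tensor_rels A B X n"
    and "Suc i < n \<Longrightarrow> b \<in> B \<Longrightarrow>
      frag_of (x, as[i := as ! i \<otimes>\<^bsub>A\<^esub> b]) - frag_of (x, as[Suc i := b \<otimes>\<^bsub>A\<^esub> as ! Suc i]) \<in> tensor_rels A B X n"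
  unfolding tensor_rels_def using assms by blast+

lemma tensor_rels_cases [consumes 1, case_names addx adda head bal]:
  assumes "r \<in> tensor_rels A B X n"
  obtains x x' as where "(x, as) \<in> tensor_gens A X n" "x' \<in> carrier X"
      "r = frag_of (x \<oplus>\<^bsub>X\<^esub> x', as) - frag_of (x, as) - frag_of (x', as)"
  | x as i a a' where "(x, as) \<in> tensor_gens A X n" "i < n" "a \<in> carrier A" "a' \<in> carrier A"
      "r = frag_of (x, as[i := a \<oplus>\<^bsub>A\<^esub> a']) - frag_of (x, as[i := a]) - frag_of (x, as[i := a'])"
  | x as b where "(x, as) \<in> tensor_gens A X n" "0 < n" "b \<in> B"
      "r = frag_of (ract X x b, as) - frag_of (x, as[0 := b \<otimes>\<^bsub>A\<^esub> as ! 0])"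
  | x as i b where "(x, as) \<in> tensor_gens A X n" "Suc i < n" "b \<in> B"
      "r = frag_of (x, as[i := as ! i \<otimes>\<^bsub>A\<^esub> b]) - frag_of (x, as[Suc i := b \<otimes>\<^bsub>A\<^esub> as ! Suc i])"
  using assms unfolding tensor_rels_def by blast

lemma tensor_rels_snoc:
  assumes "r \<in> tensor_rels A B X n" "c \<in> carrier A"
  shows "fmap (snoc c) r \<in> tensor_rels A B X (Suc n)"
  using assms(1)
proof (cases rule: tensor_rels_cases)
  case (addx x x' as)
  then show ?thesis
    using tensor_relsI(1)[of x "as @ [c]" A X "Suc n" x' B] assms(2) by (simp add: fmap_diff tensor_gens_iff)
next
  case (adda x as i a a')
  then show ?thesis
    using tensor_relsI(2)[of x "as @ [c]" A X "Suc n" i a a' B] assms(2)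
    by (simp add: fmap_diff tensor_gens_iff list_update_append)
next
  case (head x as b)
  then show ?thesis
    using tensor_relsI(3)[of x "as @ [c]" A X "Suc n" b B] assms(2)
    by (simp add: fmap_diff tensor_gens_iff list_update_append nth_append)
next
  case (bal x as i b)
  then show ?thesis
    using tensor_relsI(4)[of x "as @ [c]" A X "Suc n" i b B] assms(2)
    by (simp add: fmap_diff tensor_gens_iff list_update_append nth_append)
qed

lemma frags_diff2:
  assumes "v \<in> S" "w \<in> S" "w' \<in> S"
  shows "frag_of v - frag_of w - frag_of w' \<in> frags S"
proof -
  have "frag_of x \<in> frags S" if "x \<in> S" for x using that by simp
  then show ?thesis using assms by (intro subgrp_diff[OF subgrp_frags])
qed

lemma bimodule_add_closed:
  assumes "is_bimodule K A X" "x \<in> carrier X" "y \<in> carrier X"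
  shows "x \<oplus>\<^bsub>X\<^esub> y \<in> carrier X"
proof -
  interpret m: Module.module K X by (rule is_bimoduleD[OF assms(1)])
  show ?thesis by (rule m.M.a_closed[OF assms(2,3)])
qed

section \<open>Hochschild words as a bar construction\<close>

locale algebra_ext =
  fixes K :: "'k ring" and A :: "('k, 'a) module" and B :: "'a set"
  assumes alg: "k_algebra K A" and sub: "k_subalgebra K A B"
begin

sublocale A: ring A using alg by (simp add: k_algebra_def)
sublocale Am: Module.module K A using alg by (simp add: k_algebra_def)

lemma BA: "B \<subseteq> carrier A"
  using sub by (auto simp: k_subalgebra_def dest: subringE(1))

lemma B_mem: "b \<in> B \<Longrightarrow> b \<in> carrier A"
  using BA by blast

lemma hom_B: "bimodule_hom K A X Y f \<Longrightarrow> bimodule_hom K (A\<lparr>carrier := B\<rparr>) X Y f"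
  using BA unfolding bimodule_hom_def by auto

text \<open>Sorts the relations by whether the last letter takes part. Those without it come from
  length \<open>n\<close>; balancing at the last tensor sign acts by \<open>hoch_ract\<close> on the
  factor before it, which is the module element if \<open>n = 0\<close>.\<close>

lemma tensor_rels_Suc:
  "tensor_rels A B X (Suc n) = {fmap (snoc a) r | a r. a \<in> carrier A \<and> r \<in> tensor_rels A B X n} \<union>
      {frag_of (snoc i w) - frag_of (snoc j w) - frag_of (snoc k w) | i j k w.
        (i, j, k) \<in> {(a \<oplus>\<^bsub>A\<^esub> a', a, a') | a a'. a \<in> carrier A \<and> a' \<in> carrier A} \<and> w \<in> tensor_gens A X n} \<union>
      {frag_of (snoc a (hoch_ract A X b w)) - frag_of (snoc (b \<otimes>\<^bsub>A\<^esub> a) w) | a b w.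
        a \<in> carrier A \<and> b \<in> B \<and> w \<in> tensor_gens A X n}"
  (is "_ = ?T \<union> ?Add \<union> ?Bal")
proof
  show "tensor_rels A B X (Suc n) \<subseteq> ?T \<union> ?Add \<union> ?Bal"
  proof
    fix r assume "r \<in> tensor_rels A B X (Suc n)"
    then show "r \<in> ?T \<union> ?Add \<union> ?Bal"
    proof (cases rule: tensor_rels_cases)
      case (addx x x' as)
      then obtain as' c where as: "as = as' @ [c]" "length as' = n" by (auto simp: tensor_gens_iff length_Suc_conv_rev)
      have "r = fmap (snoc c) (frag_of (x \<oplus>\<^bsub>X\<^esub> x', as') - frag_of (x, as') - frag_of (x', as'))"
        by (simp add: addx(3) as fmap_diff)
      moreover have "frag_of (x \<oplus>\<^bsub>X\<^esub> x', as') - frag_of (x, as') - frag_of (x', as') \<in> tensor_rels A B X n"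
        by (rule tensor_relsI(1)) (use addx as in \<open>auto simp: tensor_gens_iff\<close>)
      moreover have "c \<in> carrier A" using addx as by (simp add: tensor_gens_iff)
      ultimately show ?thesis by blast
    next
      case (adda x as i a a')
      then obtain as' c where as: "as = as' @ [c]" "length as' = n" by (auto simp: tensor_gens_iff length_Suc_conv_rev)
      have c: "c \<in> carrier A" and x: "(x, as') \<in> tensor_gens A X n" using adda as by (simp_all add: tensor_gens_iff)
      show ?thesis
      proof (cases "i = n")
        case True
        then have "r = frag_of (snoc (a \<oplus>\<^bsub>A\<^esub> a') (x, as')) - frag_of (snoc a (x, as')) - frag_of (snoc a' (x, as'))"
          by (simp add: adda(5) as list_update_append)
        then show ?thesis using adda x by blast
      next
        case False
        then have i: "i < n" using adda by simp
        have "r = fmap (snoc c) (frag_of (x, as'[i := a \<oplus>\<^bsub>A\<^esub> a']) - frag_of (x, as'[i := a]) - frag_of (x, as'[i := a']))"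
          using i as by (simp add: adda(5) fmap_diff list_update_append)
        then show ?thesis using tensor_relsI(2)[OF x i adda(3,4)] c by blast
      qed
    next
      case (head x as b)
      then obtain as' c where as: "as = as' @ [c]" "length as' = n" by (auto simp: tensor_gens_iff length_Suc_conv_rev)
      have c: "c \<in> carrier A" and x: "(x, as') \<in> tensor_gens A X n" using head as by (simp_all add: tensor_gens_iff)
      show ?thesis
      proof (cases "n = 0")
        case True
        then have "r = frag_of (snoc c (hoch_ract A X b (x, as'))) - frag_of (snoc (b \<otimes>\<^bsub>A\<^esub> c) (x, as'))"
          using as by (simp add: head(4) hoch_ract_def)
        then show ?thesis using head x c by blast
      next
        case False
        then have n: "0 < n" by simp
        have "r = fmap (snoc c) (frag_of (ract X x b, as') - frag_of (x, as'[0 := b \<otimes>\<^bsub>A\<^esub> as' ! 0]))"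
          using n as by (simp add: head(4) fmap_diff list_update_append nth_append)
        then show ?thesis using tensor_relsI(3)[OF x n head(3)] c by blast
      qed
    next
      case (bal x as i b)
      then obtain as' c where as: "as = as' @ [c]" "length as' = n" by (auto simp: tensor_gens_iff length_Suc_conv_rev)
      have c: "c \<in> carrier A" and x: "(x, as') \<in> tensor_gens A X n" using bal as by (simp_all add: tensor_gens_iff)
      show ?thesis
      proof (cases "Suc i = n")
        case True
        then obtain as'' d where as': "as' = as'' @ [d]" "length as'' = i" using as by (metis length_Suc_conv_rev)
        have "r = frag_of (snoc c (hoch_ract A X b (x, as'))) - frag_of (snoc (b \<otimes>\<^bsub>A\<^esub> c) (x, as'))"
          using as as' True by (auto simp add: bal(4) hoch_ract_def list_update_append nth_append)
        then show ?thesis using bal x c by blast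
      next
        case False
        then have i: "Suc i < n" using bal by simp
        have "r = fmap (snoc c) (frag_of (x, as'[i := as' ! i \<otimes>\<^bsub>A\<^esub> b]) - frag_of (x, as'[Suc i := b \<otimes>\<^bsub>A\<^esub> as' ! Suc i]))"
          using i as by (simp add: bal(4) fmap_diff list_update_append nth_append)
        then show ?thesis using tensor_relsI(4)[OF x i bal(3)] c by blast
      qed
    qed
  qed
  have "frag_of (snoc (a \<oplus>\<^bsub>A\<^esub> a') (x, as)) - frag_of (snoc a (x, as)) - frag_of (snoc a' (x, as)) \<in> tensor_rels A B X (Suc n)"
    if "a \<in> carrier A" "a' \<in> carrier A" "(x, as) \<in> tensor_gens A X n" for a a' x as
    using that tensor_relsI(2)[of x "as @ [a]" A X "Suc n" n a a' B]
    by (auto simp: tensor_gens_iff list_update_append)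
  moreover have "frag_of (snoc a (hoch_ract A X b (x, as))) - frag_of (snoc (b \<otimes>\<^bsub>A\<^esub> a) (x, as)) \<in> tensor_rels A B X (Suc n)"
    if a: "a \<in> carrier A" "b \<in> B" "(x, as) \<in> tensor_gens A X n" for a b x as
  proof (cases "as = []")
    case True
    then show ?thesis
      using a tensor_relsI(3)[of x "[a]" A X "Suc n" b B] by (auto simp: tensor_gens_iff hoch_ract_def)
  next
    case False
    then obtain as' d where as: "as = as' @ [d]" by (metis append_butlast_last_id)
    then show ?thesis
      using a tensor_relsI(4)[of x "as' @ [d, a]" A X "Suc n" "length as'" b B]
      by (auto simp: tensor_gens_iff hoch_ract_def list_update_append nth_append)
  qed
  ultimately show "?T \<union> ?Add \<union> ?Bal \<subseteq> tensor_rels A B X (Suc n)"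
    using tensor_rels_snoc by fast
qed

lemma hoch_face_snoc:
  assumes "i < length as"
  shows "hoch_face A X i (x, as @ [a]) = snoc a (hoch_face A X i (x, as))"
proof (cases i)
  case 0 then show ?thesis using assms by (cases as) (auto simp: hoch_face_def)
next
  case (Suc j) then show ?thesis using assms by (simp add: hoch_face_def nth_append)
qed

text \<open>The index of the rotating face of the shorter word becomes, once \<open>a\<close> is
  appended, the face that merges \<open>a\<close> into the factor before it.\<close>

lemma hoch_face_length: "hoch_face A X (length as) (x, as @ [a]) = hoch_ract A X a (x, as)"
proof (cases as rule: rev_cases)
  case (snoc as' d) then show ?thesis by (simp add: hoch_face_def hoch_ract_def nth_append)
qed (simp add: hoch_face_def hoch_ract_def)

lemma hoch_inner_snoc:
  assumes "w \<in> tensor_gens A X n"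
  shows "hoch_inner A X (snoc a w) = fmap (snoc a) (hoch_inner A X w) + frag_cmul ((-1) ^ n) (frag_of (hoch_ract A X a w))"
proof -
  obtain x as where w: "w = (x, as)" "length as = n" using assms by (cases w) (auto simp: tensor_gens_iff)
  have "fmap (snoc a) (\<Sum>i<n. frag_cmul ((-1) ^ i) (frag_of (hoch_face A X i (x, as)))) =
      (\<Sum>i<n. frag_cmul ((-1) ^ i) (frag_of (hoch_face A X i (x, as @ [a]))))"
    using w by (simp add: additive.sum[OF additive_fmap(1)] fmap_cmul hoch_face_snoc)
  then show ?thesis using w hoch_face_length[of X as x a] by (simp add: hoch_inner_def)
qed

text \<open>Letters are appended on the right, so the last one is outermost and acts from the right.
  This is why the multiplication of the bar construction is that of \<open>A\<close>
  reversed.\<close>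

lemma hoch_words:
  assumes X: "is_bimodule K A X"
  shows "bar_words (tensor_gens A X) (tensor_rels A B X) (carrier A) B (\<lambda>i j. j \<otimes>\<^bsub>A\<^esub> i)
    {(a \<oplus>\<^bsub>A\<^esub> a', a, a') | a a'. a \<in> carrier A \<and> a' \<in> carrier A} snoc (hoch_ract A X) (hoch_inner A X)"
proof
  note x = is_bimoduleD[OF X]
  show "fmap (hoch_ract A X i) r \<in> zspan (tensor_rels A B X 0)"
    if "i \<in> carrier A" "r \<in> tensor_rels A B X 0" for i r
    using that(2)
  proof (cases rule: tensor_rels_cases)
    case (addx y y' as)
    then have y: "y \<in> carrier X" "y' \<in> carrier X" "as = []" by (auto simp: tensor_gens_iff)
    have "fmap (hoch_ract A X i) r = frag_of (ract X y i \<oplus>\<^bsub>X\<^esub> ract X y' i, []) - frag_of (ract X y i, []) - frag_of (ract X y' i, [])"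
      using y that(1) by (simp add: addx(3) fmap_diff hoch_ract_def x(5))
    moreover have "\<dots> \<in> tensor_rels A B X 0"
      by (rule tensor_relsI(1)) (use y that(1) x(3) in \<open>simp_all add: tensor_gens_iff\<close>)
    ultimately show ?thesis by (simp add: zspan.base)
  qed auto
  show "frag_of (hoch_ract A X i w) - frag_of (hoch_ract A X j w) - frag_of (hoch_ract A X k w)
      \<in> zspan (tensor_rels A B X 0)"
    if "(i, j, k) \<in> {(a \<oplus>\<^bsub>A\<^esub> a', a, a') | a a'. a \<in> carrier A \<and> a' \<in> carrier A}" and w: "w \<in> tensor_gens A X 0" for i j k w
  proof -
    obtain y where y: "y \<in> carrier X" "w = (y, [])" using w by (cases w) (simp add: tensor_gens_iff)
    have j: "j \<in> carrier A" "k \<in> carrier A" "i = j \<oplus>\<^bsub>A\<^esub> k" using that(1) by auto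
    have "frag_of (ract X y j \<oplus>\<^bsub>X\<^esub> ract X y k, []) - frag_of (ract X y j, []) - frag_of (ract X y k, []) \<in> tensor_rels A B X 0"
      by (rule tensor_relsI(1)) (use y j x(3) in \<open>simp_all add: tensor_gens_iff\<close>)
    then show ?thesis using y j by (simp add: hoch_ract_def x(7) zspan.base)
  qed
  show "tensor_rels A B X 0 \<subseteq> tfrags A X 0"
  proof
    fix r assume "r \<in> tensor_rels A B X 0"
    then show "r \<in> tfrags A X 0"
    proof (cases rule: tensor_rels_cases)
      case (addx y y' as)
      have "frag_of (y \<oplus>\<^bsub>X\<^esub> y', as) - frag_of (y, as) - frag_of (y', as) \<in> tfrags A X 0"
      proof (rule frags_diff2)
        show "(y \<oplus>\<^bsub>X\<^esub> y', as) \<in> tensor_gens A X 0"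
          using addx bimodule_add_closed[OF X] by (simp add: tensor_gens_iff)
      qed (use addx(1,2) in \<open>simp_all add: tensor_gens_iff\<close>)
      then show ?thesis unfolding addx(3) .
    qed simp_all
  qed
  show "tensor_rels A B X (Suc n) = {fmap (snoc a) r | a r. a \<in> carrier A \<and> r \<in> tensor_rels A B X n} \<union>
      {frag_of (snoc i w) - frag_of (snoc j w) - frag_of (snoc k w) | i j k w.
        (i, j, k) \<in> {(a \<oplus>\<^bsub>A\<^esub> a', a, a') | a a'. a \<in> carrier A \<and> a' \<in> carrier A} \<and> w \<in> tensor_gens A X n} \<union>
      {frag_of (snoc a (hoch_ract A X b w)) - frag_of (snoc (b \<otimes>\<^bsub>A\<^esub> a) w) | a b w.
        a \<in> carrier A \<and> b \<in> B \<and> w \<in> tensor_gens A X n}" for n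
    by (rule tensor_rels_Suc)
  show "hoch_inner A X (snoc i w) = fmap (snoc i) (hoch_inner A X w) + frag_cmul ((-1) ^ n) (frag_of (hoch_ract A X i w))"
    if "w \<in> tensor_gens A X n" for i w n by (rule hoch_inner_snoc[OF that])
  show "tensor_gens A X (Suc n) = {snoc a w | a w. a \<in> carrier A \<and> w \<in> tensor_gens A X n}" for n
    by (rule tensor_gens_Suc)
  show "hoch_ract A X i (snoc j w) = snoc (j \<otimes>\<^bsub>A\<^esub> i) w" for i j w
    by (cases w) (simp add: hoch_ract_def)
  show "hoch_inner A X w = 0" if "w \<in> tensor_gens A X 0" for w
    using that by (cases w) (simp add: hoch_inner_def tensor_gens_iff)
  show "B \<subseteq> carrier A" by (rule BA)
  show "(l, j, k) \<in> {(a \<oplus>\<^bsub>A\<^esub> a', a, a') | a a'. a \<in> carrier A \<and> a' \<in> carrier A} \<Longrightarrow> i \<in> carrier A \<Longrightarrow>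
      (l \<otimes>\<^bsub>A\<^esub> i, j \<otimes>\<^bsub>A\<^esub> i, k \<otimes>\<^bsub>A\<^esub> i) \<in> {(a \<oplus>\<^bsub>A\<^esub> a', a, a') | a a'. a \<in> carrier A \<and> a' \<in> carrier A}" for i j k l
    by (auto simp: A.l_distr)
  show "(l, j, k) \<in> {(a \<oplus>\<^bsub>A\<^esub> a', a, a') | a a'. a \<in> carrier A \<and> a' \<in> carrier A} \<Longrightarrow> i \<in> carrier A \<Longrightarrow>
      (i \<otimes>\<^bsub>A\<^esub> l, i \<otimes>\<^bsub>A\<^esub> j, i \<otimes>\<^bsub>A\<^esub> k) \<in> {(a \<oplus>\<^bsub>A\<^esub> a', a, a') | a a'. a \<in> carrier A \<and> a' \<in> carrier A}" for i j k l
    by (auto simp: A.r_distr)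
  show "i \<in> carrier A \<Longrightarrow> w \<in> tensor_gens A X 0 \<Longrightarrow> hoch_ract A X i w \<in> tensor_gens A X 0" for i w
    by (cases w) (simp add: tensor_gens_iff hoch_ract_def x(3))
  show "i \<in> carrier A \<Longrightarrow> j \<in> carrier A \<Longrightarrow> w \<in> tensor_gens A X 0 \<Longrightarrow>
      hoch_ract A X i (hoch_ract A X j w) = hoch_ract A X (j \<otimes>\<^bsub>A\<^esub> i) w" for i j w
    by (cases w) (simp add: tensor_gens_iff hoch_ract_def x(9))
  show "{(a \<oplus>\<^bsub>A\<^esub> a', a, a') | a a'. a \<in> carrier A \<and> a' \<in> carrier A} \<subseteq> carrier A \<times> carrier A \<times> carrier A"
    by auto
  show "i \<in> carrier A \<Longrightarrow> j \<in> carrier A \<Longrightarrow> j \<otimes>\<^bsub>A\<^esub> i \<in> carrier A" for i j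
    by (rule A.m_closed)
  show "i \<in> carrier A \<Longrightarrow> j \<in> carrier A \<Longrightarrow> k \<in> carrier A \<Longrightarrow> k \<otimes>\<^bsub>A\<^esub> (j \<otimes>\<^bsub>A\<^esub> i) = k \<otimes>\<^bsub>A\<^esub> j \<otimes>\<^bsub>A\<^esub> i" for i j k
    by (simp add: A.m_assoc)
qed

end


section \<open>The Hochschild boundary on formal sums\<close>

context algebra_ext
begin

lemma hoch_bd_snoc:
  assumes "w \<in> tensor_gens A X n"
  shows "hoch_bd A X (Suc n) (frag_of (snoc a w)) =
    hoch_inner A X (snoc a w) + frag_cmul ((-1) ^ Suc n) (frag_of (apfst (lact X a) w))"
proof -
  obtain x as where w: "w = (x, as)" "length as = n" using assms by (cases w) (auto simp: tensor_gens_iff)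
  have "hoch_face A X (Suc n) (x, as @ [a]) = (lact X a x, as)" using w by (simp add: hoch_face_def)
  then show ?thesis using w by (simp add: hoch_bd_def hoch_inner_def lessThan_Suc_atMost[symmetric])
qed

lemma additive_hoch_bd: "additive (hoch_bd A X n)"
  unfolding hoch_bd_def by (rule additive_frag_extend)

definition hoch_last :: "('k, 'a, 'm) bimodule \<Rightarrow> 'm \<times> 'a list \<Rightarrow> 'm \<times> 'a list" where
  "hoch_last X = (\<lambda>(x, as). (lact X (last as) x, butlast as))"

lemma hoch_last_snoc: "hoch_last X (snoc a w) = apfst (lact X a) w"
  by (cases w) (simp add: hoch_last_def)

lemma hoch_bd_eq:
  assumes "u \<in> tfrags A X (Suc n)"
  shows "hoch_bd A X (Suc n) u = frag_extend (hoch_inner A X) u + frag_cmul ((-1) ^ Suc n) (fmap (hoch_last X) u)"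
proof (rule frags_map_eq[OF additive_hoch_bd _ _ assms])
  fix g assume "g \<in> tensor_gens A X (Suc n)"
  then obtain a w where w: "g = snoc a w" "w \<in> tensor_gens A X n" unfolding tensor_gens_Suc by blast
  then show "hoch_bd A X (Suc n) (frag_of g) =
      frag_extend (hoch_inner A X) (frag_of g) + frag_cmul ((-1) ^ Suc n) (fmap (hoch_last X) (frag_of g))"
    using hoch_bd_snoc[OF w(2), of a] by (simp add: hoch_last_snoc)
qed (intro additive_intros additive_fmap)

lemma hoch_null_R: "zspan (tensor_rels A B X n) \<subseteq> hoch_null A B X n"
  unfolding hoch_null_def by (rule zspan_mono) auto

lemma subgrp_hoch_null: "subgrp (hoch_null A B X n)"
  unfolding hoch_null_def by (rule subgrp_zspan)

lemma hoch_null_comm: "b \<in> B \<Longrightarrow> w \<in> tensor_gens A X n \<Longrightarrow>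
    frag_of (hoch_ract A X b w) - frag_of (apfst (lact X b) w) \<in> hoch_null A B X n"
  unfolding hoch_null_def by (rule zspan.base) blast

lemma hoch_null_addx: "(x, as) \<in> tensor_gens A X n \<Longrightarrow> x' \<in> carrier X \<Longrightarrow>
    frag_of (x \<oplus>\<^bsub>X\<^esub> x', as) - frag_of (x, as) - frag_of (x', as) \<in> hoch_null A B X n"
  unfolding hoch_null_def by (rule zspan.base) (simp add: tensor_relsI(1))

lemma tensor_gens_map: "(\<And>x. x \<in> carrier X \<Longrightarrow> f x \<in> carrier Y) \<Longrightarrow> w \<in> tensor_gens A X n \<Longrightarrow>
    apfst f w \<in> tensor_gens A Y n"
  by (cases w) (simp add: tensor_gens_iff)

lemma tfrags_map: "(\<And>x. x \<in> carrier X \<Longrightarrow> f x \<in> carrier Y) \<Longrightarrow> u \<in> tfrags A X n \<Longrightarrow>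
    fmap (apfst f) u \<in> tfrags A Y n"
  by (erule fmap_frags) (rule tensor_gens_map)

lemma tensor_rels_map:
  assumes f: "\<And>x. x \<in> carrier X \<Longrightarrow> f x \<in> carrier Y"
      "\<And>x y. x \<in> carrier X \<Longrightarrow> y \<in> carrier X \<Longrightarrow> f (x \<oplus>\<^bsub>X\<^esub> y) = f x \<oplus>\<^bsub>Y\<^esub> f y"
      "\<And>b x. b \<in> B \<Longrightarrow> x \<in> carrier X \<Longrightarrow> f (ract X x b) = ract Y (f x) b"
    and r: "r \<in> zspan (tensor_rels A B X n)"
  shows "fmap (apfst f) r \<in> zspan (tensor_rels A B Y n)"
proof (rule zspan_map[OF additive_fmap(1) subgrp_zspan _ r])
  fix r assume "r \<in> tensor_rels A B X n"
  then have "fmap (apfst f) r \<in> tensor_rels A B Y n"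
  proof (cases rule: tensor_rels_cases)
    case (addx x x' as)
    then show ?thesis
      using tensor_relsI(1)[of "f x" as A Y n "f x'" B] f by (simp add: fmap_diff tensor_gens_iff)
  next
    case (adda x as i a a')
    then show ?thesis
      using tensor_relsI(2)[of "f x" as A Y n i a a' B] f by (simp add: fmap_diff tensor_gens_iff)
  next
    case (head x as b)
    then show ?thesis
      using tensor_relsI(3)[of "f x" as A Y n b B] f by (simp add: fmap_diff tensor_gens_iff)
  next
    case (bal x as i b)
    then show ?thesis
      using tensor_relsI(4)[of "f x" as A Y n i b B] f by (simp add: fmap_diff tensor_gens_iff)
  qed
  then show "fmap (apfst f) r \<in> zspan (tensor_rels A B Y n)" by (rule zspan.base)
qed

text \<open>Linearity over \<open>B\<close> suffices because in the relations only elements of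
  \<open>B\<close> act on the module. This lets the \<open>B\<close>-linear splittings of a
  resolution operate on Hochschild words.\<close>

lemma hoch_null_map:
  assumes f: "bimodule_hom K (A\<lparr>carrier := B\<rparr>) X Y f" and u: "u \<in> hoch_null A B X n"
  shows "fmap (apfst f) u \<in> hoch_null A B Y n"
proof (rule zspan_map[OF additive_fmap(1) subgrp_hoch_null _ u[unfolded hoch_null_def]])
  note h = bimodule_homD[OF f, simplified]
  fix r assume "r \<in> tensor_rels A B X n \<union>
    {frag_of (hoch_ract A X b w) - frag_of (apfst (lact X b) w) | b w. b \<in> B \<and> w \<in> tensor_gens A X n}"
  then consider "r \<in> tensor_rels A B X n" | b w where "b \<in> B" "w \<in> tensor_gens A X n"
      "r = frag_of (hoch_ract A X b w) - frag_of (apfst (lact X b) w)" by blast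
  then show "fmap (apfst f) r \<in> hoch_null A B Y n"
  proof cases
    case 1
    then show ?thesis
      using tensor_rels_map[of X f Y r n] h hoch_null_R by (blast intro: zspan.base)
  next
    case 2
    have "apfst f (hoch_ract A X b w) = hoch_ract A Y b (apfst f w)"
      "apfst f (apfst (lact X b) w) = apfst (lact Y b) (apfst f w)"
      using 2 by (cases w; simp add: tensor_gens_iff hoch_ract_def h)+
    then show ?thesis
      using hoch_null_comm[OF 2(1) tensor_gens_map[OF h(1) 2(2)]] by (simp add: 2(3) fmap_diff)
  qed
qed

lemma hoch_null_subset:
  assumes X: "is_bimodule K A X"
  shows "hoch_null A B X n \<subseteq> tfrags A X n"
proof -
  interpret bar_words "tensor_gens A X" "tensor_rels A B X" "carrier A" B "\<lambda>i j. j \<otimes>\<^bsub>A\<^esub> i"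
    "{(a \<oplus>\<^bsub>A\<^esub> a', a, a') | a a'. a \<in> carrier A \<and> a' \<in> carrier A}" snoc "hoch_ract A X" "hoch_inner A X"
    by (rule hoch_words[OF X])
  have "frag_of (hoch_ract A X b w) - frag_of (apfst (lact X b) w) \<in> tfrags A X n"
    if "b \<in> B" "w \<in> tensor_gens A X n" for b w
  proof (rule subgrp_diff[OF subgrp_frags])
    show "frag_of (hoch_ract A X b w) \<in> tfrags A X n" using \<rho>_W[OF B_mem[OF that(1)] that(2)] by simp
    have "apfst (lact X b) w \<in> tensor_gens A X n"
      using that by (intro tensor_gens_map[of X]) (auto intro: is_bimoduleD[OF X] B_mem)
    then show "frag_of (apfst (lact X b) w) \<in> tfrags A X n" by simp
  qed
  then show ?thesis
    unfolding hoch_null_def using R_frags[of n] by (intro zspan_subset[OF subgrp_frags]) blast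
qed

lemma hoch_bd_tfrags:
  assumes X: "is_bimodule K A X" and u: "u \<in> tfrags A X (Suc n)"
  shows "hoch_bd A X (Suc n) u \<in> tfrags A X n"
proof (rule frags_map[OF additive_hoch_bd subgrp_frags _ u])
  interpret bar_words "tensor_gens A X" "tensor_rels A B X" "carrier A" B "\<lambda>i j. j \<otimes>\<^bsub>A\<^esub> i"
    "{(a \<oplus>\<^bsub>A\<^esub> a', a, a') | a a'. a \<in> carrier A \<and> a' \<in> carrier A}" snoc "hoch_ract A X" "hoch_inner A X"
    by (rule hoch_words[OF X])
  fix g assume g: "g \<in> tensor_gens A X (Suc n)"
  then obtain a w where w: "g = snoc a w" "a \<in> carrier A" "w \<in> tensor_gens A X n"
    unfolding tensor_gens_Suc by blast
  have "apfst (lact X a) w \<in> tensor_gens A X n"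
    using w by (intro tensor_gens_map[of X]) (auto intro: is_bimoduleD[OF X])
  then have "frag_of (apfst (lact X a) w) \<in> tfrags A X n" by simp
  then show "hoch_bd A X (Suc n) (frag_of g) \<in> tfrags A X n"
    unfolding w(1) hoch_bd_snoc[OF w(3)]
    using D_W[OF g[unfolded w(1)]] by (intro subgrp_add[OF subgrp_frags] subgrp_cmul[OF subgrp_frags])
qed

text \<open>The inner part squares to zero by the bar construction. What remains is that the last
  face of the inner boundary equals the full boundary of the last face; these two contributions have
  opposite signs.\<close>

lemma hoch_bd_bd:
  assumes X: "is_bimodule K A X" and u: "u \<in> tfrags A X (Suc (Suc n))"
  shows "hoch_bd A X (Suc n) (hoch_bd A X (Suc (Suc n)) u) = 0"
proof (rule frags_map_eq[where g = "\<lambda>_. 0", OF _ _ _ u])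
  note x = is_bimoduleD[OF X]
  interpret bar_words "tensor_gens A X" "tensor_rels A B X" "carrier A" B "\<lambda>i j. j \<otimes>\<^bsub>A\<^esub> i"
    "{(a \<oplus>\<^bsub>A\<^esub> a', a, a') | a a'. a \<in> carrier A \<and> a' \<in> carrier A}" snoc "hoch_ract A X" "hoch_inner A X"
    by (rule hoch_words[OF X])
  note L_t = hoch_last_snoc[of X]
  fix g assume g: "g \<in> tensor_gens A X (Suc (Suc n))"
  then obtain a b w where w: "g = snoc a (snoc b w)" "a \<in> carrier A" "b \<in> carrier A" "w \<in> tensor_gens A X n"
    unfolding tensor_gens_Suc[of A X "Suc n"] tensor_gens_Suc[of A X n] by blast
  define v where "v = snoc b w"
  have v: "v \<in> tensor_gens A X (Suc n)" using w t_W by (simp add: v_def)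
  have D: "hoch_inner A X g \<in> tfrags A X (Suc n)" "hoch_inner A X v \<in> tfrags A X n"
    using D_W g v by blast+
  have lv: "apfst (lact X a) v \<in> tensor_gens A X (Suc n)"
    using w v by (intro tensor_gens_map[of X]) (auto intro: x)
  \<comment> \<open>The left action on the module element commutes with appending letters and with
    the right action, so \<open>operator_D\<close> applies.\<close>
  have inner_l: "hoch_inner A X (apfst (lact X a) v) = fmap (apfst (lact X a)) (hoch_inner A X v)"
  proof (rule operator_D[where n = "Suc n", OF _ _ _ v])
    show "apfst (lact X a) (snoc i w) = snoc i (apfst (lact X a) w)" for i w by (cases w) simp
    show "apfst (lact X a) w \<in> tensor_gens A X 0" if "w \<in> tensor_gens A X 0" for w
      using w(2) that by (intro tensor_gens_map[of X]) (auto intro: x)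
    show "apfst (lact X a) (hoch_ract A X i z) = hoch_ract A X i (apfst (lact X a) z)"
      if "i \<in> carrier A" "z \<in> tensor_gens A X 0" for i z
      using that w(2) by (cases z) (simp add: hoch_ract_def tensor_gens_iff x(10))
  qed
  have "fmap (hoch_last X) (hoch_inner A X g) = fmap (hoch_last X) (fmap (snoc a) (hoch_inner A X v)) +
      frag_cmul ((-1) ^ Suc n) (frag_of (hoch_last X (snoc (b \<otimes>\<^bsub>A\<^esub> a) w)))"
    using D_t[OF w(2) v] \<rho>_t[OF w(2,3,4)] unfolding w(1) v_def[symmetric]
    by (simp add: fmap_add fmap_cmul v_def del: power_Suc)
  also have "fmap (hoch_last X) (fmap (snoc a) (hoch_inner A X v)) = fmap (apfst (lact X a)) (hoch_inner A X v)"
    by (simp add: fmap_fmap L_t)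
  finally have Lg: "fmap (hoch_last X) (hoch_inner A X g) = hoch_inner A X (apfst (lact X a) v) +
      frag_cmul ((-1) ^ Suc n) (frag_of (apfst (lact X (b \<otimes>\<^bsub>A\<^esub> a)) w))"
    by (simp add: inner_l L_t)
  \<comment> \<open>Rotating \<open>a\<close> and then \<open>b\<close> multiplies by the product of
    \<open>b\<close> and \<open>a\<close>, which is also what the last inner face followed by one
    rotation gives.\<close>
  have LL: "hoch_last X (apfst (lact X a) v) = apfst (lact X (b \<otimes>\<^bsub>A\<^esub> a)) w"
    using w by (cases w) (simp add: v_def hoch_last_def tensor_gens_iff x(8))
  have "hoch_bd A X (Suc (Suc n)) (frag_of g) =
      hoch_inner A X g + frag_cmul ((-1) ^ Suc (Suc n)) (frag_of (apfst (lact X a) v))"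
    using hoch_bd_snoc[OF v, of a] by (simp add: w(1) v_def)
  moreover have "hoch_bd A X (Suc n) (hoch_inner A X g) = frag_cmul ((-1) ^ Suc n) (fmap (hoch_last X) (hoch_inner A X g))"
    using hoch_bd_eq[OF D(1)] D_D[OF g] by simp
  moreover have "hoch_bd A X (Suc n) (frag_of (apfst (lact X a) v)) =
      hoch_inner A X (apfst (lact X a) v) + frag_cmul ((-1) ^ Suc n) (frag_of (apfst (lact X (b \<otimes>\<^bsub>A\<^esub> a)) w))"
    using hoch_bd_eq[of "frag_of (apfst (lact X a) v)" X n] lv by (simp add: LL)
  ultimately have "hoch_bd A X (Suc n) (hoch_bd A X (Suc (Suc n)) (frag_of g)) =
      frag_cmul ((-1) ^ Suc n) (fmap (hoch_last X) (hoch_inner A X g)) +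
      frag_cmul ((-1) ^ Suc (Suc n)) (fmap (hoch_last X) (hoch_inner A X g))"
    unfolding Lg hoch_bd_def by (simp add: frag_extend_add frag_extend_cmul del: power_Suc)
  then show "hoch_bd A X (Suc n) (hoch_bd A X (Suc (Suc n)) (frag_of g)) = 0"
    by (simp flip: frag_cmul_distrib)
qed (rule additive_comp[OF additive_hoch_bd additive_hoch_bd], simp add: additive_def)

text \<open>The last face turns a balancing at the last tensor sign into a commutator, so the two
  kinds of relations must be treated together. On a commutator it vanishes outright, while the inner
  faces produce commutators again.\<close>

lemma hoch_bd_null:
  assumes X: "is_bimodule K A X" and u: "u \<in> hoch_null A B X (Suc n)"
  shows "hoch_bd A X (Suc n) u \<in> hoch_null A B X n"
proof (rule zspan_map[OF additive_hoch_bd subgrp_hoch_null _ u[unfolded hoch_null_def]])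
  note x = is_bimoduleD[OF X]
  interpret bar_words "tensor_gens A X" "tensor_rels A B X" "carrier A" B "\<lambda>i j. j \<otimes>\<^bsub>A\<^esub> i"
    "{(a \<oplus>\<^bsub>A\<^esub> a', a, a') | a a'. a \<in> carrier A \<and> a' \<in> carrier A}" snoc "hoch_ract A X" "hoch_inner A X"
    by (rule hoch_words[OF X])
  note L_t = hoch_last_snoc[of X]
  have l: "apfst (lact X a) w \<in> tensor_gens A X m" if "a \<in> carrier A" "w \<in> tensor_gens A X m" for a w m
    using that by (intro tensor_gens_map[of X]) (auto intro: x)
  have l_r: "apfst (lact X a) (hoch_ract A X b w) = hoch_ract A X b (apfst (lact X a) w)"
    if "a \<in> carrier A" "b \<in> carrier A" "w \<in> tensor_gens A X m" for a b w m
    using that by (cases w) (simp add: hoch_ract_def tensor_gens_iff x(10))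
  have l_l: "apfst (lact X a) (apfst (lact X b) w) = apfst (lact X (a \<otimes>\<^bsub>A\<^esub> b)) w"
    if "a \<in> carrier A" "b \<in> carrier A" "w \<in> tensor_gens A X m" for a b w m
    using that by (cases w) (simp add: tensor_gens_iff x(8))
  fix r assume r: "r \<in> tensor_rels A B X (Suc n) \<union>
    {frag_of (hoch_ract A X b w) - frag_of (apfst (lact X b) w) | b w. b \<in> B \<and> w \<in> tensor_gens A X (Suc n)}"
  then have rf: "r \<in> tfrags A X (Suc n)"
    using hoch_null_subset[OF X, of "Suc n"] unfolding hoch_null_def by (blast intro: zspan.base)
  have "frag_extend (hoch_inner A X) r \<in> hoch_null A B X n \<and> fmap (hoch_last X) r \<in> hoch_null A B X n"
    using r
  proof
    assume "r \<in> tensor_rels A B X (Suc n)"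
    then have "frag_extend (hoch_inner A X) r \<in> hoch_null A B X n"
      using D_R[of r n] hoch_null_R by (blast intro: zspan.base)
    moreover have "fmap (hoch_last X) r \<in> hoch_null A B X n"
      using \<open>r \<in> tensor_rels A B X (Suc n)\<close>
    proof (cases rule: R_cases)
      case (t m a s)
      then have "fmap (apfst (lact X a)) s \<in> zspan (tensor_rels A B X n)"
        by (intro tensor_rels_map[of X]) (auto simp: x(2,4,10) B_mem intro: zspan.base)
      then show ?thesis using t hoch_null_R by (auto simp: fmap_fmap L_t)
    next
      case (add m i j k w)
      then obtain y cs where w: "w = (y, cs)" "(y, cs) \<in> tensor_gens A X n" by (cases w) auto
      have jk: "j \<in> carrier A" "k \<in> carrier A" "i = j \<oplus>\<^bsub>A\<^esub> k" using add by auto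
      then have "fmap (hoch_last X) r = frag_of (lact X j y \<oplus>\<^bsub>X\<^esub> lact X k y, cs) - frag_of (lact X j y, cs) - frag_of (lact X k y, cs)"
        using w by (simp add: add(4) fmap_diff hoch_last_def x(6) tensor_gens_iff)
      moreover have "\<dots> \<in> hoch_null A B X n"
        by (rule hoch_null_addx) (use w jk x(2) in \<open>auto simp: tensor_gens_iff\<close>)
      ultimately show ?thesis by simp
    next
      case (bal m a b w)
      then have b: "b \<in> carrier A" and w: "w \<in> tensor_gens A X n" by (auto simp: B_mem)
      have "fmap (hoch_last X) r = frag_of (hoch_ract A X b (apfst (lact X a) w)) - frag_of (apfst (lact X b) (apfst (lact X a) w))"
        using bal l_r[OF bal(2) b w] l_l[OF b bal(2) w] by (simp add: fmap_diff L_t)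
      then show ?thesis using hoch_null_comm[OF bal(3) l[OF bal(2) w]] by simp
    qed auto
    ultimately show ?thesis by blast
  next
    assume "r \<in> {frag_of (hoch_ract A X b w) - frag_of (apfst (lact X b) w) | b w. b \<in> B \<and> w \<in> tensor_gens A X (Suc n)}"
    then obtain b w where bw: "b \<in> B" "w \<in> tensor_gens A X (Suc n)"
        "r = frag_of (hoch_ract A X b w) - frag_of (apfst (lact X b) w)" by blast
    then have b: "b \<in> carrier A" by (simp add: B_mem)
    obtain a v where v: "a \<in> carrier A" "v \<in> tensor_gens A X n" "w = snoc a v"
      using bw(2) unfolding tensor_gens_Suc by blast
    have lb: "hoch_inner A X (apfst (lact X b) w) = fmap (apfst (lact X b)) (hoch_inner A X w)"
    proof (rule operator_D[where n = "Suc n", OF _ _ _ bw(2)])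
      show "apfst (lact X b) (snoc i w) = snoc i (apfst (lact X b) w)" for i w by (cases w) simp
    qed (use l[OF b] l_r[OF b] in auto)
    have "frag_extend (hoch_inner A X) r = fmap (hoch_ract A X b) (hoch_inner A X w) - fmap (apfst (lact X b)) (hoch_inner A X w)"
      using D_\<rho>[OF b bw(2)] lb by (simp add: bw(3) frag_extend_diff)
    moreover have "\<dots> \<in> hoch_null A B X n"
      by (rule frags_map[OF _ subgrp_hoch_null _ D_W[OF bw(2)]])
        (use hoch_null_comm[OF bw(1)] in \<open>auto intro!: additive_intros additive_fmap\<close>)
    moreover have "fmap (hoch_last X) r = 0"
    proof -
      have "hoch_ract A X b w = snoc (a \<otimes>\<^bsub>A\<^esub> b) v" using \<rho>_t[OF b v(1,2)] v(3) by simp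
      moreover have "hoch_last X (apfst (lact X b) (snoc a v)) = apfst (lact X a) (apfst (lact X b) v)"
        by (cases v) (simp add: hoch_last_def)
      ultimately show ?thesis
        using l_l[OF v(1) b v(2)] by (simp add: bw(3) fmap_diff L_t v(3))
    qed
    ultimately show ?thesis using subgrp_0[OF subgrp_hoch_null] by simp
  qed
  then show "hoch_bd A X (Suc n) r \<in> hoch_null A B X n"
    unfolding hoch_bd_eq[OF rf] by (blast intro: subgrp_add[OF subgrp_hoch_null] subgrp_cmul[OF subgrp_hoch_null])
qed

end


section \<open>Presentation of the Hochschild modules by formal sums\<close>

lemma presents_diff:
  assumes p: "presents C G N sm X \<phi>" and "u \<in> G" "v \<in> G"
  shows "\<phi> (u - v) = \<phi> u \<ominus>\<^bsub>X\<^esub> \<phi> v"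
proof -
  note d = presentsD[OF p]
  interpret x: abelian_group X by (rule presents_abelian_group[OF p])
  have "\<phi> u = \<phi> (u - v) \<oplus>\<^bsub>X\<^esub> \<phi> v"
    using d(6)[of "u - v" v] assms subgrp_diff[OF d(1)] by simp
  then show ?thesis
    using d(11) assms subgrp_diff[OF d(1)] by (simp add: a_minus_def x.a_assoc x.r_neg)
qed

lemma generate_free_Abelian_group:
  assumes R: "R \<subseteq> frags S"
  shows "generate (free_Abelian_group S) R = zspan R"
proof
  show "generate (free_Abelian_group S) R \<subseteq> zspan R"
  proof
    fix u assume "u \<in> generate (free_Abelian_group S) R"
    then show "u \<in> zspan R"
    proof induction
      case (inv h)
      then have "inv\<^bsub>free_Abelian_group S\<^esub> h = - h" using R by (intro inv_free_Abelian_group) auto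
      then show ?case using subgrp_minus[OF subgrp_zspan zspan.base[OF inv]] by simp
    qed (simp_all add: zspan.zero zspan.base subgrp_add[OF subgrp_zspan])
  qed
  have keys: "Poly_Mapping.keys v \<subseteq> S" if "v \<in> zspan R" for v
    using zspan_subset[OF subgrp_frags R] that by auto
  show "zspan R \<subseteq> generate (free_Abelian_group S) R"
  proof
    fix u assume "u \<in> zspan R"
    then show "u \<in> generate (free_Abelian_group S) R"
    proof induction
      case zero
      show ?case using generate.one[of "free_Abelian_group S" R] by simp
    next
      case (base r)
      then show ?case by (rule generate.incl)
    next
      case (diff u v)
      have "R \<subseteq> carrier (free_Abelian_group S)" using R by auto
      from group.generate_m_inv_closed[OF group_free_Abelian_group this diff.IH(2)]
      have "- v \<in> generate (free_Abelian_group S) R" using keys[OF diff.hyps(2)] by simp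
      from generate.eng[OF diff.IH(1) this] show ?case by simp
    qed
  qed
qed

context algebra_ext
begin

lemma bimodule_hom_smult:
  assumes X: "is_bimodule K A X" and c: "c \<in> carrier K"
  shows "bimodule_hom K A X X (smult X c)"
proof -
  note x = is_bimoduleD[OF X]
  interpret m: Module.module K X by (rule x)
  show ?thesis
  proof (rule bimodule_homI)
    show "c \<odot>\<^bsub>X\<^esub> (c' \<odot>\<^bsub>X\<^esub> x) = c' \<odot>\<^bsub>X\<^esub> (c \<odot>\<^bsub>X\<^esub> x)" if "c' \<in> carrier K" "x \<in> carrier X" for c' x
      using that c by (metis Am.R.m_comm m.smult_assoc1)
  qed (use c in \<open>simp_all add: m.smult_r_distr x\<close>)
qed

lemma presents_tensor_pre:
  assumes X: "is_bimodule K A X"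
  shows "presents (carrier K) (tfrags A X n) {0} (\<lambda>c. fmap (apfst (smult X c))) (tensor_pre A X n) (\<lambda>u. u)"
proof (rule presents_free)
  interpret m: Module.module K X by (rule is_bimoduleD[OF X])
  show "smult (tensor_pre A X n) c = fmap (apfst (smult X c))" for c
    unfolding tensor_pre_def fmap_def by (simp add: apfst_def map_prod_def case_prod_beta')
  show "apfst (smult X c) w \<in> tensor_gens A X n" if "c \<in> carrier K" "w \<in> tensor_gens A X n" for c w
    using that by (cases w) (simp add: tensor_gens_iff)
qed (simp_all add: tensor_pre_def)

lemma smult_R:
  assumes X: "is_bimodule K A X" and "c \<in> carrier K" "u \<in> zspan (tensor_rels A B X n)"
  shows "fmap (apfst (smult X c)) u \<in> zspan (tensor_rels A B X n)"
  by (rule tensor_rels_map[OF _ _ _ assms(3)])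
    (use bimodule_homD[OF bimodule_hom_smult[OF X assms(2)]] B_mem in auto)

lemma tensor_rels_subset: "is_bimodule K A X \<Longrightarrow> zspan (tensor_rels A B X n) \<subseteq> tfrags A X n"
  using hoch_null_R hoch_null_subset by blast

lemma tensor_null_eq:
  assumes X: "is_bimodule K A X"
  shows "tensor_null A B X n = zspan (tensor_rels A B X n)"
proof -
  have "tensor_rels A B X n \<subseteq> tfrags A X n"
    using tensor_rels_subset[OF X, of n] by (blast intro: zspan.base)
  then show ?thesis unfolding tensor_null_def by (rule generate_free_Abelian_group)
qed

lemma presents_tensor_bimodule:
  assumes X: "is_bimodule K A X"
  shows "presents (carrier K) (tfrags A X n) (zspan (tensor_rels A B X n)) (\<lambda>c. fmap (apfst (smult X c)))
    (tensor_bimodule A B X n) (\<lambda>u. tensor_null A B X n +>\<^bsub>tensor_pre A X n\<^esub> u)"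
  unfolding tensor_bimodule_def Let_def presents_extend
  using presents_quot[OF presents_tensor_pre[OF X] subgrp_zspan, of "tensor_rels A B X n" n]
    tensor_rels_subset[OF X] smult_R[OF X]
  by (simp add: tensor_null_eq[OF X] zspan.zero)

lemma tensor_bimodule_act:
  assumes X: "is_bimodule K A X" and b: "b \<in> B" and u: "u \<in> tfrags A X n"
  defines "cl \<equiv> \<lambda>u. tensor_null A B X n +>\<^bsub>tensor_pre A X n\<^esub> u"
  shows "ract (tensor_bimodule A B X n) (cl u) b = cl (fmap (hoch_ract A X b) u)"
    and "lact (tensor_bimodule A B X n) b (cl u) = cl (fmap (apfst (lact X b)) u)"
proof -
  note x = is_bimoduleD[OF X]
  interpret bar_words "tensor_gens A X" "tensor_rels A B X" "carrier A" B "\<lambda>i j. j \<otimes>\<^bsub>A\<^esub> i"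
    "{(a \<oplus>\<^bsub>A\<^esub> a', a, a') | a a'. a \<in> carrier A \<and> a' \<in> carrier A}" snoc "hoch_ract A X" "hoch_inner A X"
    by (rule hoch_words[OF X])
  have q: "quot_map (tensor_pre A X n) (tensor_null A B X n) F (cl u) = cl (f u)"
    if "additive f" "\<And>u. u \<in> tfrags A X n \<Longrightarrow> f u \<in> tfrags A X n"
      "\<And>u. u \<in> zspan (tensor_rels A B X n) \<Longrightarrow> f u \<in> zspan (tensor_rels A B X n)"
      "\<And>u. u \<in> tfrags A X n \<Longrightarrow> F u = f u" for F f
    using presents_quot_map[OF presents_tensor_pre[OF X] subgrp_zspan _ _ presents_tensor_pre[OF X] subgrp_zspan _ _ _ that u]
      tensor_rels_subset[OF X] smult_R[OF X]
    by (simp add: tensor_null_eq[OF X] cl_def zspan.zero)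
  show "ract (tensor_bimodule A B X n) (cl u) b = cl (fmap (hoch_ract A X b) u)"
  proof -
    have "ract (tensor_pre A X n) v b = fmap (hoch_ract A X b) v" for v
      unfolding tensor_pre_def fmap_def hoch_ract_def by (simp add: case_prod_beta' if_distrib cong: if_cong)
    moreover have "fmap (hoch_ract A X b) v \<in> tfrags A X n" if "v \<in> tfrags A X n" for v
      using that \<rho>_W[OF B_mem[OF b]] by (rule fmap_frags)
    ultimately show ?thesis
      using q[of "fmap (hoch_ract A X b)" "\<lambda>u. ract (tensor_pre A X n) u b"] \<rho>_R[OF B_mem[OF b], of _ n]
      by (simp add: tensor_bimodule_def Let_def module.defs additive_fmap)
  qed
  show "lact (tensor_bimodule A B X n) b (cl u) = cl (fmap (apfst (lact X b)) u)"
  proof -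
    have "lact (tensor_pre A X n) b = fmap (apfst (lact X b))"
      unfolding tensor_pre_def fmap_def by (simp add: apfst_def map_prod_def case_prod_beta')
    moreover have "fmap (apfst (lact X b)) v \<in> tfrags A X n" if "v \<in> tfrags A X n" for v
      using that by (rule tfrags_map[rotated]) (simp add: x(2) B_mem[OF b])
    moreover have "fmap (apfst (lact X b)) v \<in> zspan (tensor_rels A B X n)" if "v \<in> zspan (tensor_rels A B X n)" for v
      using that by (rule tensor_rels_map[rotated 3]) (simp_all add: x(2,4,10) B_mem b)
    ultimately show ?thesis
      using q[of "fmap (apfst (lact X b))" "lact (tensor_pre A X n) b"]
      by (simp add: tensor_bimodule_def Let_def module.defs additive_fmap)
  qed
qed

lemma smult_null:
  assumes X: "is_bimodule K A X" and "c \<in> carrier K" "u \<in> hoch_null A B X n"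
  shows "fmap (apfst (smult X c)) u \<in> hoch_null A B X n"
  by (rule hoch_null_map[OF hom_B[OF bimodule_hom_smult[OF X assms(2)]] assms(3)])

text \<open>The scaled commutators of classes are represented by \<open>T\<close>. Its members lie
  in \<open>hoch_null\<close> because scaling is a bimodule homomorphism, and conversely the scalar
  1 recovers the generating commutators.\<close>

lemma commutators_eq:
  assumes X: "is_bimodule K A X"
  shows "commutators K B (tensor_bimodule A B X n) =
    (\<lambda>u. tensor_null A B X n +>\<^bsub>tensor_pre A X n\<^esub> u) ` hoch_null A B X n"
proof -
  note p = presents_tensor_bimodule[OF X, of n] and x = is_bimoduleD[OF X]
  note d = presentsD[OF p]
  interpret m: Module.module K X by (rule x)
  interpret bar_words "tensor_gens A X" "tensor_rels A B X" "carrier A" B "\<lambda>i j. j \<otimes>\<^bsub>A\<^esub> i"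
    "{(a \<oplus>\<^bsub>A\<^esub> a', a, a') | a a'. a \<in> carrier A \<and> a' \<in> carrier A}" snoc "hoch_ract A X" "hoch_inner A X"
    by (rule hoch_words[OF X])
  define cl where "cl = (\<lambda>u. tensor_null A B X n +>\<^bsub>tensor_pre A X n\<^esub> u)"
  note act = tensor_bimodule_act[OF X, folded cl_def]
  define E where "E b u = fmap (hoch_ract A X b) u - fmap (apfst (lact X b)) u" for b u
  define T where "T = {fmap (apfst (smult X c)) (E b u) | c b u. c \<in> carrier K \<and> b \<in> B \<and> u \<in> tfrags A X n}"
  have parts: "fmap (hoch_ract A X b) u \<in> tfrags A X n" "fmap (apfst (lact X b)) u \<in> tfrags A X n"
    if "b \<in> B" "u \<in> tfrags A X n" for b u
  proof -
    show "fmap (hoch_ract A X b) u \<in> tfrags A X n" using that(2) \<rho>_W[OF B_mem[OF that(1)]] by (rule fmap_frags)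
    show "fmap (apfst (lact X b)) u \<in> tfrags A X n"
      using that(2) by (rule tfrags_map[rotated]) (simp add: x(2) B_mem[OF that(1)])
  qed
  have E: "E b u \<in> tfrags A X n" "cl (E b u) = ract (tensor_bimodule A B X n) (cl u) b \<ominus>\<^bsub>tensor_bimodule A B X n\<^esub>
      lact (tensor_bimodule A B X n) b (cl u)" if "b \<in> B" "u \<in> tfrags A X n" for b u
    unfolding E_def using subgrp_diff[OF subgrp_frags parts[OF that]] presents_diff[OF p parts[OF that]] act[OF that]
    by (simp_all add: cl_def)
  have "{c \<odot>\<^bsub>tensor_bimodule A B X n\<^esub> y | c y. c \<in> carrier K \<and>
      y \<in> {ract (tensor_bimodule A B X n) z b \<ominus>\<^bsub>tensor_bimodule A B X n\<^esub> lact (tensor_bimodule A B X n) b z | z b.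
        z \<in> carrier (tensor_bimodule A B X n) \<and> b \<in> B}} = cl ` T"
    (is "?S = _")
  proof
    show "?S \<subseteq> cl ` T"
    proof
      fix z assume "z \<in> ?S"
      then obtain c b y where c: "c \<in> carrier K" "b \<in> B" "y \<in> carrier (tensor_bimodule A B X n)"
        "z = c \<odot>\<^bsub>tensor_bimodule A B X n\<^esub> (ract (tensor_bimodule A B X n) y b \<ominus>\<^bsub>tensor_bimodule A B X n\<^esub> lact (tensor_bimodule A B X n) b y)"
        by blast
      obtain u where u: "u \<in> tfrags A X n" "y = cl u"
        using c(3)[folded d(4)] unfolding cl_def by blast
      have "z = cl (fmap (apfst (smult X c)) (E b u))"
        using d(10)[OF c(1) E(1)[OF c(2) u(1)]] E(2)[OF c(2) u(1)] c(4) u(2) by (simp add: cl_def)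
      then show "z \<in> cl ` T" unfolding T_def using c u by blast
    qed
    show "cl ` T \<subseteq> ?S"
    proof
      fix z assume "z \<in> cl ` T"
      then obtain c b u where c: "c \<in> carrier K" "b \<in> B" "u \<in> tfrags A X n"
        "z = cl (fmap (apfst (smult X c)) (E b u))" by (auto simp: T_def)
      have "z = c \<odot>\<^bsub>tensor_bimodule A B X n\<^esub> (ract (tensor_bimodule A B X n) (cl u) b
          \<ominus>\<^bsub>tensor_bimodule A B X n\<^esub> lact (tensor_bimodule A B X n) b (cl u))"
        using d(10)[OF c(1) E(1)[OF c(2,3)]] E(2)[OF c(2,3)] c(4) by (simp add: cl_def)
      moreover have "cl u \<in> carrier (tensor_bimodule A B X n)" unfolding cl_def by (rule d(11)[OF c(3)])
      ultimately show "z \<in> ?S" using c by blast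
    qed
  qed
  moreover have "T \<subseteq> tfrags A X n"
  proof
    fix z assume "z \<in> T"
    then obtain c b u where "c \<in> carrier K" "b \<in> B" "u \<in> tfrags A X n" "z = fmap (apfst (smult X c)) (E b u)"
      unfolding T_def by blast
    then show "z \<in> tfrags A X n" using d(9) E(1) by metis
  qed
  moreover have "zspan (T \<union> zspan (tensor_rels A B X n)) = hoch_null A B X n"
  proof
    have "E b u \<in> hoch_null A B X n" if "b \<in> B" "u \<in> tfrags A X n" for b u
      unfolding E_def
      by (rule frags_map[OF _ subgrp_hoch_null _ that(2)])
        (use hoch_null_comm[OF that(1)] in \<open>auto intro!: additive_intros additive_fmap\<close>)
    then have "T \<subseteq> hoch_null A B X n" unfolding T_def using smult_null[OF X] by blast
    then show "zspan (T \<union> zspan (tensor_rels A B X n)) \<subseteq> hoch_null A B X n"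
      using zspan_subset[OF subgrp_hoch_null, of "T \<union> zspan (tensor_rels A B X n)" X n] hoch_null_R[of X n] by simp
    have "frag_of (hoch_ract A X b w) - frag_of (apfst (lact X b) w) \<in> T" if b: "b \<in> B" "w \<in> tensor_gens A X n" for b w
    proof -
      have w: "frag_of w \<in> tfrags A X n" using b by simp
      have "fmap (apfst (smult X \<one>\<^bsub>K\<^esub>)) (E b (frag_of w)) = E b (frag_of w)"
        by (rule fmap_id[OF E(1)[OF b(1) w]]) (auto simp: tensor_gens_def)
      then have "E b (frag_of w) \<in> T" unfolding T_def using b(1) w by (metis (mono_tags, lifting) Am.R.one_closed mem_Collect_eq)
      then show ?thesis by (simp add: E_def)
    qed
    then show "hoch_null A B X n \<subseteq> zspan (T \<union> zspan (tensor_rels A B X n))"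
      unfolding hoch_null_def zspan_Un_zspan by (intro zspan_mono) blast
  qed
  ultimately show ?thesis
    unfolding commutators_def k_span_def using generate_eq_zspan(1)[OF p, of T] by (simp add: cl_def)
qed

lemma presents_hoch_module:
  assumes X: "is_bimodule K A X"
  shows "presents (carrier K) (tfrags A X n) (hoch_null A B X n) (\<lambda>c. fmap (apfst (smult X c)))
    (hoch_module K A B X n) (hoch_class K A B X n)"
  unfolding hoch_module_def coinv_def hoch_class_def commutators_eq[OF X]
  by (rule presents_quot[OF presents_tensor_bimodule[OF X] subgrp_hoch_null hoch_null_R hoch_null_subset[OF X] smult_null[OF X]])

text \<open>Both unions in \<open>hoch_diff\<close> run over formal sums congruent modulo
  \<open>hoch_null\<close>, which \<open>hoch_bd\<close> respects; so all members of the union are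
  one and the same class.\<close>

lemma hoch_diff_class:
  assumes X: "is_bimodule K A X" and u: "u \<in> tfrags A X (Suc n)"
  shows "hoch_diff K A B X (Suc n) (hoch_class K A B X (Suc n) u) = hoch_class K A B X n (hoch_bd A X (Suc n) u)"
proof -
  define cl where "cl = (\<lambda>u. tensor_null A B X (Suc n) +>\<^bsub>tensor_pre A X (Suc n)\<^esub> u)"
  have cl: "cl v = {w \<in> tfrags A X (Suc n). w - v \<in> zspan (tensor_rels A B X (Suc n))}" if "v \<in> tfrags A X (Suc n)" for v
    using presents_coset[OF presents_tensor_pre[OF X] subgrp_zspan _ tensor_rels_subset[OF X] that]
    by (simp add: cl_def tensor_null_eq[OF X] zspan.zero)
  have W: "hoch_class K A B X (Suc n) u = cl ` {v \<in> tfrags A X (Suc n). v - u \<in> hoch_null A B X (Suc n)}"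
    using presents_coset[OF presents_tensor_bimodule[OF X] subgrp_hoch_null hoch_null_R hoch_null_subset[OF X] u]
    by (simp add: hoch_class_def commutators_eq[OF X] cl_def)
  have "hoch_class K A B X n (hoch_bd A X (Suc n) w) = hoch_class K A B X n (hoch_bd A X (Suc n) u)"
    if w: "w \<in> tfrags A X (Suc n)" "w - u \<in> hoch_null A B X (Suc n)" for w
    using presentsD(7)[OF presents_hoch_module[OF X] hoch_bd_tfrags[OF X w(1)] hoch_bd_tfrags[OF X u]]
      hoch_bd_null[OF X w(2)] by (simp add: additive.diff[OF additive_hoch_bd])
  moreover have "w - u \<in> hoch_null A B X (Suc n)"
    if "v - u \<in> hoch_null A B X (Suc n)" "w - v \<in> zspan (tensor_rels A B X (Suc n))" for v w
    using that subgrp_trans[OF subgrp_hoch_null] hoch_null_R by blast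
  ultimately have const: "hoch_class K A B X n (hoch_bd A X (Suc n) w) = hoch_class K A B X n (hoch_bd A X (Suc n) u)"
    if "U \<in> hoch_class K A B X (Suc n) u" "w \<in> U" for U w
    using that by (auto simp: W cl)
  have "cl u \<in> hoch_class K A B X (Suc n) u" "u \<in> cl u"
    using u by (auto simp: W cl zspan.zero subgrp_0[OF subgrp_hoch_null])
  moreover have "hoch_diff K A B X (Suc n) (hoch_class K A B X (Suc n) u) =
      (\<Union>U\<in>hoch_class K A B X (Suc n) u. \<Union>w\<in>U. hoch_class K A B X n (hoch_bd A X (Suc n) w))"
    by (simp add: hoch_diff_def hoch_bd_def)
  ultimately show ?thesis using const by blast
qed

section \<open>Functoriality of Hochschild words and exactness of the rows\<close>

lemma hoch_bd_map:
  assumes f: "bimodule_hom K A X Y f" and u: "u \<in> tfrags A X (Suc n)"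
  shows "hoch_bd A Y (Suc n) (fmap (apfst f) u) = fmap (apfst f) (hoch_bd A X (Suc n) u)"
proof -
  note h = bimodule_homD[OF f]
  have "hoch_face A Y i (apfst f g) = apfst f (hoch_face A X i g)" if "g \<in> tensor_gens A X (Suc n)" for i g
    using that
    by (cases g) (auto simp: hoch_face_def tensor_gens_iff h hd_in_set last_in_set length_Suc_conv subset_eq)
  then have "hoch_bd A Y (Suc n) (fmap (apfst f) (frag_of g)) = fmap (apfst f) (hoch_bd A X (Suc n) (frag_of g))"
    if "g \<in> tensor_gens A X (Suc n)" for g
    using that by (simp add: hoch_bd_def additive.sum[OF additive_fmap(1)] fmap_cmul fmap_add)
  then show ?thesis
    by (rule frags_map_eq[OF additive_comp[OF additive_hoch_bd additive_fmap(1)] additive_fmap(2)[OF additive_hoch_bd] _ u])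
qed

text \<open>Words depend additively on the module element only modulo the relations. This is how an
  identity between sums of maps is carried over to the induced maps on words.\<close>

lemma hoch_map_add:
  assumes "\<And>x. x \<in> carrier X \<Longrightarrow> f x = g x \<oplus>\<^bsub>Y\<^esub> h x" "\<And>x. x \<in> carrier X \<Longrightarrow> g x \<in> carrier Y"
    "\<And>x. x \<in> carrier X \<Longrightarrow> h x \<in> carrier Y" and u: "u \<in> tfrags A X n"
  shows "fmap (apfst f) u - fmap (apfst g) u - fmap (apfst h) u \<in> hoch_null A B Y n"
proof (rule frags_map[OF _ subgrp_hoch_null _ u])
  fix w assume "w \<in> tensor_gens A X n"
  then show "fmap (apfst f) (frag_of w) - fmap (apfst g) (frag_of w) - fmap (apfst h) (frag_of w) \<in> hoch_null A B Y n"
    using assms hoch_null_addx[of "g (fst w)" "snd w" Y n "h (fst w)"] by (cases w) (simp add: tensor_gens_iff)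
qed (intro additive_intros additive_fmap)

lemma hoch_map_zero:
  assumes Y: "is_bimodule K A Y" and f: "\<And>x. x \<in> carrier X \<Longrightarrow> f x = \<zero>\<^bsub>Y\<^esub>" and u: "u \<in> tfrags A X n"
  shows "fmap (apfst f) u \<in> hoch_null A B Y n"
proof -
  interpret m: Module.module K Y by (rule is_bimoduleD[OF Y])
  have "fmap (apfst f) u - fmap (apfst f) u - fmap (apfst f) u \<in> hoch_null A B Y n"
    by (rule hoch_map_add[OF _ _ _ u]) (simp_all add: f)
  then show ?thesis using subgrp_minus[OF subgrp_hoch_null] by fastforce
qed

text \<open>The decomposition of \<open>y\<close> passes to words, and its second summand is null
  because \<open>h'\<close> preserves the relations. So \<open>h\<close> applied to \<open>u\<close>
  is the preimage.\<close>

lemma hoch_contraction_exact: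
  assumes Y: "is_bimodule K A Y"
    and h: "bimodule_hom K (A\<lparr>carrier := B\<rparr>) Y X h" and h': "bimodule_hom K (A\<lparr>carrier := B\<rparr>) Z Y h'"
    and f: "bimodule_hom K A X Y f" and g: "bimodule_hom K A Y Z g"
    and eq: "\<And>y. y \<in> carrier Y \<Longrightarrow> y = f (h y) \<oplus>\<^bsub>Y\<^esub> h' (g y)"
    and u: "u \<in> tfrags A Y n" "fmap (apfst g) u \<in> hoch_null A B Z n"
  shows "\<exists>v\<in>tfrags A X n. u - fmap (apfst f) v \<in> hoch_null A B Y n"
proof
  note hs = bimodule_homD(1)[OF h] bimodule_homD(1)[OF h'] bimodule_homD(1)[OF f] bimodule_homD(1)[OF g]
  show "fmap (apfst h) u \<in> tfrags A X n" using u(1) by (rule tfrags_map[rotated]) (rule hs)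
  have "fmap (apfst (\<lambda>y. y)) u - fmap (apfst (\<lambda>y. f (h y))) u - fmap (apfst (\<lambda>y. h' (g y))) u \<in> hoch_null A B Y n"
    by (rule hoch_map_add[OF _ _ _ u(1)]) (simp_all add: hs flip: eq)
  moreover have "fmap (apfst (\<lambda>y. y)) u = u" by (rule fmap_id[OF u(1)]) (simp add: apfst_def map_prod_def case_prod_beta')
  moreover have "fmap (apfst (\<lambda>y. f (h y))) u = fmap (apfst f) (fmap (apfst h) u)"
    "fmap (apfst (\<lambda>y. h' (g y))) u = fmap (apfst h') (fmap (apfst g) u)"
    by (simp_all add: fmap_fmap apfst_def map_prod_def case_prod_beta')
  ultimately have "u - fmap (apfst f) (fmap (apfst h) u) - fmap (apfst h') (fmap (apfst g) u) \<in> hoch_null A B Y n"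
    by simp
  from subgrp_add[OF subgrp_hoch_null this hoch_null_map[OF h' u(2)]]
  show "u - fmap (apfst f) (fmap (apfst h) u) \<in> hoch_null A B Y n" by simp
qed

section \<open>Contractions of resolutions\<close>

lemma bimodule_hom_add:
  assumes Y: "is_bimodule K A' Y" and f: "bimodule_hom K A' X Y f" and g: "bimodule_hom K A' X Y g"
  shows "bimodule_hom K A' X Y (\<lambda>x. f x \<oplus>\<^bsub>Y\<^esub> g x)"
proof -
  interpret m: Module.module K Y by (rule is_bimoduleD[OF Y])
  note h = bimodule_homD[OF f] bimodule_homD[OF g]
  show ?thesis
    by (rule bimodule_homI) (simp_all add: h m.M.a_ac m.smult_r_distr is_bimoduleD(4,5)[OF Y])
qed

lemma is_bimodule_B: "is_bimodule K A X \<Longrightarrow> is_bimodule K (A\<lparr>carrier := B\<rparr>) X"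
  using BA unfolding is_bimodule_def by (simp add: subset_eq)

text \<open>Let \<open>t q\<close> be a splitting of \<open>d (Suc q)\<close> on its image. The map
  \<open>k q\<close>, which is \<open>s\<close> after \<open>e\<close> or a splitting after
  \<open>d q\<close>, is a projection whose kernel is the image of \<open>d (Suc q)\<close>; so its
  complement \<open>r q\<close> lands where \<open>t q\<close> can be applied, and
  \<open>h q\<close> is the composite.\<close>

lemma E_resolution_contraction:
  assumes R: "E_resolution K A B M P d e"
  obtains h s where "bimodule_hom K (A\<lparr>carrier := B\<rparr>) M (P 0) s"
    "\<And>m. m \<in> carrier M \<Longrightarrow> e (s m) = m"
    "\<And>q. bimodule_hom K (A\<lparr>carrier := B\<rparr>) (P q) (P (Suc q)) (h q)"
    "\<And>y. y \<in> carrier (P 0) \<Longrightarrow> y = d 1 (h 0 y) \<oplus>\<^bsub>P 0\<^esub> s (e y)"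
    "\<And>q y. y \<in> carrier (P (Suc q)) \<Longrightarrow> y = d (Suc (Suc q)) (h (Suc q) y) \<oplus>\<^bsub>P (Suc q)\<^esub> h q (d (Suc q) y)"
proof -
  let ?B = "A\<lparr>carrier := B\<rparr>"
  let ?Z = "\<lambda>q. d (Suc q) ` carrier (P (Suc q))"
  have bP: "is_bimodule K A (P q)" and bM: "is_bimodule K A M"
    and dh: "bimodule_hom K A (P (Suc q)) (P q) (d (Suc q))" and eh: "bimodule_hom K A (P 0) M e"
    and Z0: "?Z 0 = {p \<in> carrier (P 0). e p = \<zero>\<^bsub>M\<^esub>}"
    and ZS: "?Z (Suc q) = {p \<in> carrier (P (Suc q)). d (Suc q) p = \<zero>\<^bsub>P q\<^esub>}" for q
    using R by (auto simp: E_resolution_def E_projective_def class_E_def cycles_def)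
  obtain s where s: "bimodule_hom K ?B M (P 0) s" "\<And>m. m \<in> carrier M \<Longrightarrow> e (s m) = m"
    using R by (auto simp: E_resolution_def class_E_def)
  have "\<exists>t. bimodule_hom K ?B ((P q)\<lparr>carrier := ?Z q\<rparr>) (P (Suc q)) t \<and> (\<forall>y\<in>?Z q. d (Suc q) (t y) = y)" for q
    using R by (auto simp: E_resolution_def class_E_def)
  then obtain t where t: "\<And>q. bimodule_hom K ?B ((P q)\<lparr>carrier := ?Z q\<rparr>) (P (Suc q)) (t q)"
    "\<And>q y. y \<in> ?Z q \<Longrightarrow> d (Suc q) (t q y) = y" by metis
  \<comment> \<open>Negation is written as a scalar multiplication so that
    \<open>bimodule_hom_smult\<close> makes it a homomorphism.\<close>
  define neg where "neg q = smult (P q) (\<ominus>\<^bsub>K\<^esub> \<one>\<^bsub>K\<^esub>)" for q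
  have kk: "\<ominus>\<^bsub>K\<^esub> \<one>\<^bsub>K\<^esub> \<in> carrier K" by simp
  have negh: "bimodule_hom K ?B (P q) (P q) (neg q)" for q
    unfolding neg_def by (rule hom_B[OF bimodule_hom_smult[OF bP kk]])
  have neg: "neg q x = \<ominus>\<^bsub>P q\<^esub> x" if "x \<in> carrier (P q)" for q x
  proof -
    interpret m: Module.module K "P q" by (rule is_bimoduleD[OF bP])
    show ?thesis using that by (simp add: neg_def m.smult_l_minus)
  qed
  define k where "k q = (case q of 0 \<Rightarrow> \<lambda>y. s (e y) | Suc r \<Rightarrow> \<lambda>y. t r (d (Suc r) y))" for q
  have dB: "bimodule_hom K ?B (P (Suc r)) ((P r)\<lparr>carrier := ?Z r\<rparr>) (d (Suc r))" for r
    using bimodule_homD[OF dh] BA by (auto intro!: bimodule_homI)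
  have kh: "bimodule_hom K ?B (P q) (P q) (k q)" for q
  proof (cases q)
    case 0
    then show ?thesis using bimodule_hom_comp[OF hom_B[OF eh] s(1)] by (simp add: k_def)
  next
    case (Suc r)
    then show ?thesis using bimodule_hom_comp[OF dB t(1)] by (simp add: k_def)
  qed
  define r where "r q y = y \<oplus>\<^bsub>P q\<^esub> neg q (k q y)" for q y
  have rh: "bimodule_hom K ?B (P q) (P q) (r q)" for q
    unfolding r_def
    by (rule bimodule_hom_add[OF is_bimodule_B[OF bP] _ bimodule_hom_comp[OF kh negh]]) (rule bimodule_homI; simp)
  have hom0: "f \<zero>\<^bsub>X\<^esub> = \<zero>\<^bsub>Y\<^esub>" if X: "Module.module K X" and Y: "Module.module K Y" and f: "bimodule_hom K A' X Y f"
    for A' X Y f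
  proof -
    interpret x: Module.module K X by (rule X)
    interpret y: Module.module K Y by (rule Y)
    show ?thesis using bimodule_homD(1)[OF f, of "\<zero>\<^bsub>X\<^esub>"] bimodule_homD(3)[OF f, of "\<zero>\<^bsub>K\<^esub>" "\<zero>\<^bsub>X\<^esub>"] by simp
  qed
  have rZ: "r q y \<in> ?Z q" if y: "y \<in> carrier (P q)" for q y
  proof (cases q)
    case 0
    interpret m: Module.module K M by (rule is_bimoduleD[OF bM])
    interpret p: Module.module K "P 0" by (rule is_bimoduleD[OF bP])
    note hm = bimodule_homD[OF eh] bimodule_homD[OF s(1)]
    have "e (r 0 y) = e y \<oplus>\<^bsub>M\<^esub> (\<ominus>\<^bsub>K\<^esub> \<one>\<^bsub>K\<^esub>) \<odot>\<^bsub>M\<^esub> e y"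
      using y 0 hm s(2) by (simp add: r_def k_def neg_def)
    also have "\<dots> = \<zero>\<^bsub>M\<^esub>" using y 0 hm(1) by (simp add: m.smult_l_minus m.M.r_neg)
    finally show ?thesis using 0 y bimodule_homD(1)[OF rh[of 0]] unfolding 0 Z0 by simp
  next
    case (Suc l)
    interpret m: Module.module K "P l" by (rule is_bimoduleD[OF bP])
    interpret p: Module.module K "P (Suc l)" by (rule is_bimoduleD[OF bP])
    note hm = bimodule_homD[OF dh[of l]] bimodule_homD[OF t(1)[of l]]
    have dy: "d (Suc l) y \<in> ?Z l" using y Suc by blast
    then have "t l (d (Suc l) y) \<in> carrier (P q)" using hm(6) Suc by simp
    then have "d (Suc l) (r q y) = d (Suc l) y \<oplus>\<^bsub>P l\<^esub> (\<ominus>\<^bsub>K\<^esub> \<one>\<^bsub>K\<^esub>) \<odot>\<^bsub>P l\<^esub> d (Suc l) y"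
      using y Suc hm(1-5) t(2)[OF dy] by (simp add: r_def k_def neg_def)
    also have "\<dots> = \<zero>\<^bsub>P l\<^esub>" using y Suc hm(1) by (simp add: m.smult_l_minus m.M.r_neg)
    finally show ?thesis using Suc y bimodule_homD(1)[OF rh[of q]] unfolding Suc ZS by simp
  qed
  have rZh: "bimodule_hom K ?B (P q) ((P q)\<lparr>carrier := ?Z q\<rparr>) (r q)" for q
    using bimodule_homD[OF rh[of q]] rZ by (auto intro!: bimodule_homI)
  define h where "h q y = t q (r q y)" for q y
  have hh: "bimodule_hom K ?B (P q) (P (Suc q)) (h q)" for q
    unfolding h_def by (rule bimodule_hom_comp[OF rZh t(1)])
  have kc: "k q y \<in> carrier (P q)" if "y \<in> carrier (P q)" for q y using bimodule_homD(1)[OF kh that] .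
  have dh_eq: "y = d (Suc q) (h q y) \<oplus>\<^bsub>P q\<^esub> k q y" if y: "y \<in> carrier (P q)" for q y
  proof -
    interpret p: Module.module K "P q" by (rule is_bimoduleD[OF bP])
    have "d (Suc q) (h q y) = y \<oplus>\<^bsub>P q\<^esub> \<ominus>\<^bsub>P q\<^esub> k q y"
      using t(2)[OF rZ[OF y]] neg[OF kc[OF y]] by (simp add: h_def r_def)
    then show ?thesis using y kc[OF y] by (simp add: p.M.a_assoc p.M.l_neg)
  qed
  \<comment> \<open>\<open>k q\<close> kills boundaries, so \<open>r q\<close> fixes them, and
    \<open>h q\<close> after the differential reduces to the splitting after the
    differential.\<close>
  have k_Suc: "k (Suc q) y = h q (d (Suc q) y)" if y: "y \<in> carrier (P (Suc q))" for q y
  proof -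
    interpret p: Module.module K "P q" by (rule is_bimoduleD[OF bP])
    have dy: "d (Suc q) y \<in> ?Z q" "d (Suc q) y \<in> carrier (P q)" using y bimodule_homD(1)[OF dh] by auto
    have "k q (d (Suc q) y) = \<zero>\<^bsub>P q\<^esub>"
    proof (cases q)
      case 0
      then have "e (d (Suc q) y) = \<zero>\<^bsub>M\<^esub>" using dy Z0 by auto
      then show ?thesis
        using 0 hom0[OF is_bimoduleD(1)[OF bM] is_bimoduleD(1)[OF bP] s(1)] by (simp add: k_def)
    next
      case (Suc l)
      then have z: "d q (d (Suc q) y) = \<zero>\<^bsub>P l\<^esub>" using dy ZS[of l] by auto
      have "t l \<zero>\<^bsub>P l\<^esub> = \<zero>\<^bsub>P q\<^esub>"
      proof -
        interpret l: Module.module K "P l" by (rule is_bimoduleD[OF bP])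
        have 0: "\<zero>\<^bsub>P l\<^esub> \<in> ?Z l" using z dy Suc by (metis imageI)
        then have "t l \<zero>\<^bsub>P l\<^esub> \<in> carrier (P (Suc l))" using bimodule_homD(1)[OF t(1)[of l]] by simp
        moreover have "t l \<zero>\<^bsub>P l\<^esub> = \<zero>\<^bsub>K\<^esub> \<odot>\<^bsub>P (Suc l)\<^esub> t l \<zero>\<^bsub>P l\<^esub>"
          using bimodule_homD(3)[OF t(1)[of l], of "\<zero>\<^bsub>K\<^esub>" "\<zero>\<^bsub>P l\<^esub>"] 0 by simp
        ultimately show ?thesis using p.smult_l_null Suc by metis
      qed
      then show ?thesis using Suc z by (simp add: k_def)
    qed
    then have "r q (d (Suc q) y) = d (Suc q) y" using dy(2) neg[of "\<zero>\<^bsub>P q\<^esub>" q] by (simp add: r_def)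
    then show ?thesis by (simp add: h_def k_def)
  qed
  show ?thesis
  proof (rule that[OF s hh])
    show "y = d 1 (h 0 y) \<oplus>\<^bsub>P 0\<^esub> s (e y)" if "y \<in> carrier (P 0)" for y
      using dh_eq[OF that] by (simp add: k_def)
    show "y = d (Suc (Suc q)) (h (Suc q) y) \<oplus>\<^bsub>P (Suc q)\<^esub> h q (d (Suc q) y)" if "y \<in> carrier (P (Suc q))" for q y
      using dh_eq[OF that] k_Suc[OF that] by simp
  qed
qed

end


section \<open>Evaluation of formal sums\<close>

text \<open>Lets formal sums with different keys be added over a common finite set; the extra terms
  are zero multiples.\<close>

lemma frag_eval_superset:
  assumes X: "abelian_group X" and f: "f \<in> S \<rightarrow> carrier X"
    and T: "finite T" "Poly_Mapping.keys u \<subseteq> T" "T \<subseteq> S"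
  shows "frag_eval X f u = (\<Oplus>\<^bsub>X\<^esub>g\<in>T. [Poly_Mapping.lookup u g] \<cdot>\<^bsub>X\<^esub> f g)"
proof -
  interpret x: abelian_group X by (rule X)
  show ?thesis
    unfolding frag_eval_def
  proof (rule x.add.finprod_mono_neutral_cong_left[OF T(1,2)])
    show "[Poly_Mapping.lookup u g] \<cdot>\<^bsub>X\<^esub> f g = \<zero>\<^bsub>X\<^esub>" if "g \<in> T - Poly_Mapping.keys u" for g
      using that by (simp add: in_keys_iff add_pow_def int_pow_def2 nat_pow_def)
    show "(\<lambda>g. [Poly_Mapping.lookup u g] \<cdot>\<^bsub>X\<^esub> f g) \<in> T \<rightarrow> carrier X"
      using f T(3) by auto
  qed simp
qed

lemma frag_eval_closed:
  assumes X: "abelian_group X" and f: "f \<in> S \<rightarrow> carrier X" and u: "u \<in> frags S"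
  shows "frag_eval X f u \<in> carrier X"
proof -
  interpret x: abelian_group X by (rule X)
  show ?thesis unfolding frag_eval_def using f u by (intro x.finsum_closed) auto
qed

lemma frag_eval_add:
  assumes X: "abelian_group X" and f: "f \<in> S \<rightarrow> carrier X" and u: "u \<in> frags S" and v: "v \<in> frags S"
  shows "frag_eval X f (u + v) = frag_eval X f u \<oplus>\<^bsub>X\<^esub> frag_eval X f v"
proof -
  interpret x: abelian_group X by (rule X)
  let ?T = "Poly_Mapping.keys u \<union> Poly_Mapping.keys v"
  have T: "finite ?T" "?T \<subseteq> S" "Poly_Mapping.keys (u + v) \<subseteq> ?T" using u v keys_add[of u v] by auto
  have ev: "frag_eval X f z = (\<Oplus>\<^bsub>X\<^esub>g\<in>?T. [Poly_Mapping.lookup z g] \<cdot>\<^bsub>X\<^esub> f g)" if "Poly_Mapping.keys z \<subseteq> ?T" for z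
    by (rule frag_eval_superset[OF X f T(1) that T(2)])
  have c: "f g \<in> carrier X" if "g \<in> ?T" for g using that f T(2) by blast
  have "frag_eval X f (u + v) = (\<Oplus>\<^bsub>X\<^esub>g\<in>?T. [Poly_Mapping.lookup u g] \<cdot>\<^bsub>X\<^esub> f g \<oplus>\<^bsub>X\<^esub> [Poly_Mapping.lookup v g] \<cdot>\<^bsub>X\<^esub> f g)"
    unfolding ev[OF T(3)]
    by (rule x.finsum_cong') (use c in \<open>auto simp: lookup_add x.add.int_pow_mult\<close>)
  also have "\<dots> = frag_eval X f u \<oplus>\<^bsub>X\<^esub> frag_eval X f v"
    using c by (subst x.finsum_addf) (auto simp: ev)
  finally show ?thesis .
qed

lemma frag_eval_of:
  assumes X: "abelian_group X" and "f w \<in> carrier X"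
  shows "frag_eval X f (frag_of w) = f w"
proof -
  interpret x: abelian_group X by (rule X)
  show ?thesis using assms(2) by (simp add: frag_eval_def x.add.int_pow_1)
qed

lemma frag_eval_0: "abelian_group X \<Longrightarrow> frag_eval X f 0 = \<zero>\<^bsub>X\<^esub>"
proof -
  assume "abelian_group X"
  then interpret x: abelian_group X .
  show ?thesis by (simp add: frag_eval_def)
qed

lemma frag_eval_diff:
  assumes X: "abelian_group X" and f: "f \<in> S \<rightarrow> carrier X" and u: "u \<in> frags S" and v: "v \<in> frags S"
  shows "frag_eval X f (u - v) = frag_eval X f u \<ominus>\<^bsub>X\<^esub> frag_eval X f v"
proof -
  interpret x: abelian_group X by (rule X)
  have uv: "u - v \<in> frags S" using subgrp_diff[OF subgrp_frags u v] .
  have c: "frag_eval X f z \<in> carrier X" if "z \<in> frags S" for z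
    by (rule frag_eval_closed[OF X f that])
  have "frag_eval X f u = frag_eval X f (u - v) \<oplus>\<^bsub>X\<^esub> frag_eval X f v"
    using frag_eval_add[OF X f uv v] by simp
  then show ?thesis using c[OF u] c[OF v] c[OF uv] by (simp add: a_minus_def x.a_assoc x.r_neg)
qed

lemma frag_eval_rel3:
  assumes X: "abelian_group X" and f: "f p = f q \<oplus>\<^bsub>X\<^esub> f q'" "f q \<in> carrier X" "f q' \<in> carrier X"
  shows "frag_eval X f (frag_of p - frag_of q - frag_of q') = \<zero>\<^bsub>X\<^esub>"
proof -
  interpret x: abelian_group X by (rule X)
  let ?S = "{p, q, q'}"
  have c: "f \<in> ?S \<rightarrow> carrier X" using f x.a_closed by auto
  have S: "frag_of p \<in> frags ?S" "frag_of q \<in> frags ?S" "frag_of q' \<in> frags ?S" by simp_all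
  have "frag_eval X f (frag_of p - frag_of q - frag_of q') = (f p \<ominus>\<^bsub>X\<^esub> f q) \<ominus>\<^bsub>X\<^esub> f q'"
    using frag_eval_diff[OF X c subgrp_diff[OF subgrp_frags S(1,2)] S(3)] frag_eval_diff[OF X c S(1,2)] c
    by (simp add: frag_eval_of[OF X] Pi_iff)
  also have "f p \<ominus>\<^bsub>X\<^esub> f q = f q'"
    unfolding f(1) using f(2,3) by (simp add: a_minus_def x.a_comm[of "f q"] x.a_assoc x.r_neg)
  also have "f q' \<ominus>\<^bsub>X\<^esub> f q' = \<zero>\<^bsub>X\<^esub>" using f(3) by (simp add: a_minus_def x.r_neg)
  finally show ?thesis .
qed

lemma frag_eval_rel2:
  assumes X: "abelian_group X" and f: "f p = f q" "f q \<in> carrier X"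
  shows "frag_eval X f (frag_of p - frag_of q) = \<zero>\<^bsub>X\<^esub>"
proof -
  interpret x: abelian_group X by (rule X)
  have c: "f \<in> {p, q} \<rightarrow> carrier X" using f by auto
  have "frag_eval X f (frag_of p - frag_of q) = f p \<ominus>\<^bsub>X\<^esub> f q"
    using frag_eval_diff[OF X c, of "frag_of p" "frag_of q"] c by (simp add: frag_eval_of[OF X] Pi_iff)
  then show ?thesis using f by (simp add: a_minus_def x.r_neg)
qed

lemma frag_eval_zspan:
  assumes X: "abelian_group X" and f: "f \<in> S \<rightarrow> carrier X" and R: "R \<subseteq> frags S"
    and 0: "\<And>r. r \<in> R \<Longrightarrow> frag_eval X f r = \<zero>\<^bsub>X\<^esub>" and u: "u \<in> zspan R"
  shows "frag_eval X f u = \<zero>\<^bsub>X\<^esub>"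
  using u
proof induction
  case zero show ?case by (rule frag_eval_0[OF X])
next
  case (diff u v)
  interpret x: abelian_group X by (rule X)
  have "u \<in> frags S" "v \<in> frags S" using diff zspan_subset[OF subgrp_frags R] by blast+
  then show ?case using frag_eval_diff[OF X f, of u v] diff by (simp add: a_minus_def)
qed (rule 0)

section \<open>Presented bimodules\<close>

text \<open>Scalars and both actions come from the functions \<open>s\<close>, \<open>l\<close>,
  \<open>r\<close> on words, while the bimodule axioms may hold only modulo
  \<open>N\<close>.\<close>

definition bipresents :: "'k ring \<Rightarrow> ('k, 'a) module \<Rightarrow> 'w set \<Rightarrow> ('w \<Rightarrow>\<^sub>0 int) set \<Rightarrow> ('k \<Rightarrow> 'w \<Rightarrow> 'w)
    \<Rightarrow> ('a \<Rightarrow> 'w \<Rightarrow> 'w) \<Rightarrow> ('a \<Rightarrow> 'w \<Rightarrow> 'w) \<Rightarrow> ('k, 'a, 'x) bimodule \<Rightarrow> (('w \<Rightarrow>\<^sub>0 int) \<Rightarrow> 'x) \<Rightarrow> bool" where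
  "bipresents K A S N s l r X \<phi> \<longleftrightarrow> presents (carrier K) (frags S) N (\<lambda>c. fmap (s c)) X \<phi> \<and>
     (\<forall>c\<in>carrier K. \<forall>w\<in>S. s c w \<in> S) \<and> (\<forall>a\<in>carrier A. \<forall>w\<in>S. l a w \<in> S \<and> r a w \<in> S) \<and>
     (\<forall>a\<in>carrier A. \<forall>u\<in>frags S. lact X a (\<phi> u) = \<phi> (fmap (l a) u) \<and> ract X (\<phi> u) a = \<phi> (fmap (r a) u))"

lemma bipresentsD:
  assumes "bipresents K A S N s l r X \<phi>"
  shows "presents (carrier K) (frags S) N (\<lambda>c. fmap (s c)) X \<phi>"
    and "\<And>c w. c \<in> carrier K \<Longrightarrow> w \<in> S \<Longrightarrow> s c w \<in> S"
    and "\<And>a w. a \<in> carrier A \<Longrightarrow> w \<in> S \<Longrightarrow> l a w \<in> S"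
    and "\<And>a w. a \<in> carrier A \<Longrightarrow> w \<in> S \<Longrightarrow> r a w \<in> S"
    and "\<And>a u. a \<in> carrier A \<Longrightarrow> u \<in> frags S \<Longrightarrow> lact X a (\<phi> u) = \<phi> (fmap (l a) u)"
    and "\<And>a u. a \<in> carrier A \<Longrightarrow> u \<in> frags S \<Longrightarrow> ract X (\<phi> u) a = \<phi> (fmap (r a) u)"
  using assms unfolding bipresents_def by blast+

text \<open>On words, multiplicativity, units and commutation hold on the nose; additivity in the
  acting element and the passage of scalars from \<open>A\<close> to the module hold modulo
  \<open>N\<close>. Each axiom then extends to formal sums.\<close>

lemma is_bimodule_bipresents:
  assumes K: "cring K" and p: "bipresents K A S N s l r X \<phi>"
    and s: "\<And>c d w. c \<in> carrier K \<Longrightarrow> d \<in> carrier K \<Longrightarrow> w \<in> S \<Longrightarrow> frag_of (s (c \<oplus>\<^bsub>K\<^esub> d) w) - frag_of (s c w) - frag_of (s d w) \<in> N"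
      "\<And>c d w. c \<in> carrier K \<Longrightarrow> d \<in> carrier K \<Longrightarrow> w \<in> S \<Longrightarrow> s (c \<otimes>\<^bsub>K\<^esub> d) w = s c (s d w)"
      "\<And>w. w \<in> S \<Longrightarrow> s \<one>\<^bsub>K\<^esub> w = w"
    and l: "\<And>a b w. a \<in> carrier A \<Longrightarrow> b \<in> carrier A \<Longrightarrow> w \<in> S \<Longrightarrow> frag_of (l (a \<oplus>\<^bsub>A\<^esub> b) w) - frag_of (l a w) - frag_of (l b w) \<in> N"
      "\<And>a b w. a \<in> carrier A \<Longrightarrow> b \<in> carrier A \<Longrightarrow> w \<in> S \<Longrightarrow> l (a \<otimes>\<^bsub>A\<^esub> b) w = l a (l b w)"
      "\<And>w. w \<in> S \<Longrightarrow> l \<one>\<^bsub>A\<^esub> w = w"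
      "\<And>c a w. c \<in> carrier K \<Longrightarrow> a \<in> carrier A \<Longrightarrow> w \<in> S \<Longrightarrow> frag_of (l (c \<odot>\<^bsub>A\<^esub> a) w) - frag_of (s c (l a w)) \<in> N"
      "\<And>c a w. c \<in> carrier K \<Longrightarrow> a \<in> carrier A \<Longrightarrow> w \<in> S \<Longrightarrow> l a (s c w) = s c (l a w)"
    and r: "\<And>a b w. a \<in> carrier A \<Longrightarrow> b \<in> carrier A \<Longrightarrow> w \<in> S \<Longrightarrow> frag_of (r (a \<oplus>\<^bsub>A\<^esub> b) w) - frag_of (r a w) - frag_of (r b w) \<in> N"
      "\<And>a b w. a \<in> carrier A \<Longrightarrow> b \<in> carrier A \<Longrightarrow> w \<in> S \<Longrightarrow> r (a \<otimes>\<^bsub>A\<^esub> b) w = r b (r a w)"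
      "\<And>w. w \<in> S \<Longrightarrow> r \<one>\<^bsub>A\<^esub> w = w"
      "\<And>c a w. c \<in> carrier K \<Longrightarrow> a \<in> carrier A \<Longrightarrow> w \<in> S \<Longrightarrow> frag_of (r (c \<odot>\<^bsub>A\<^esub> a) w) - frag_of (s c (r a w)) \<in> N"
      "\<And>c a w. c \<in> carrier K \<Longrightarrow> a \<in> carrier A \<Longrightarrow> w \<in> S \<Longrightarrow> r a (s c w) = s c (r a w)"
    and lr: "\<And>a b w. a \<in> carrier A \<Longrightarrow> b \<in> carrier A \<Longrightarrow> w \<in> S \<Longrightarrow> r b (l a w) = l a (r b w)"
    and A: "\<And>a b. a \<in> carrier A \<Longrightarrow> b \<in> carrier A \<Longrightarrow> a \<oplus>\<^bsub>A\<^esub> b \<in> carrier A \<and> a \<otimes>\<^bsub>A\<^esub> b \<in> carrier A"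
      "\<one>\<^bsub>A\<^esub> \<in> carrier A" "\<And>c a. c \<in> carrier K \<Longrightarrow> a \<in> carrier A \<Longrightarrow> c \<odot>\<^bsub>A\<^esub> a \<in> carrier A"
  shows "is_bimodule K A X"
proof -
  interpret K: cring K by (rule K)
  note b = bipresentsD[OF p]
  note d = presentsD[OF b(1)]
  have ag: "abelian_group X" by (rule presents_abelian_group[OF b(1)])
  have Fs: "\<And>c u. c \<in> carrier K \<Longrightarrow> u \<in> frags S \<Longrightarrow> fmap (s c) u \<in> frags S"
    "\<And>a u. a \<in> carrier A \<Longrightarrow> u \<in> frags S \<Longrightarrow> fmap (l a) u \<in> frags S"
    "\<And>a u. a \<in> carrier A \<Longrightarrow> u \<in> frags S \<Longrightarrow> fmap (r a) u \<in> frags S"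
    by - (erule fmap_frags, rule b, assumption+)+
  have ex: "\<exists>u. u \<in> frags S \<and> x = \<phi> u" if "x \<in> carrier X" for x
    using that d(4) by blast
  have add3: "\<phi> (fmap f u) = \<phi> (fmap g u) \<oplus>\<^bsub>X\<^esub> \<phi> (fmap h u)"
    if u: "u \<in> frags S" and N: "\<And>w. w \<in> S \<Longrightarrow> frag_of (f w) - frag_of (g w) - frag_of (h w) \<in> N"
      and fgh: "fmap f u \<in> frags S" "fmap g u \<in> frags S" "fmap h u \<in> frags S" for f g h u
  proof -
    have "fmap f u - (fmap g u + fmap h u) \<in> N"
      by (rule frags_map[OF _ d(2) _ u]) (use N in \<open>auto intro!: additive_intros additive_fmap simp: diff_diff_eq\<close>)
    then show ?thesis using d(7)[OF fgh(1) subgrp_add[OF d(1) fgh(2,3)]] d(6)[OF fgh(2,3)] by simp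
  qed
  have eq2: "\<phi> (fmap f u) = \<phi> (fmap g u)"
    if u: "u \<in> frags S" and N: "\<And>w. w \<in> S \<Longrightarrow> frag_of (f w) - frag_of (g w) \<in> N"
      and fgh: "fmap f u \<in> frags S" "fmap g u \<in> frags S" for f g u
  proof -
    have "fmap f u - fmap g u \<in> N"
      by (rule frags_map[OF _ d(2) _ u]) (use N in \<open>auto intro!: additive_intros additive_fmap\<close>)
    then show ?thesis using d(7)[OF fgh] by simp
  qed
  have eqc: "fmap f (fmap g u) = fmap h u" if "u \<in> frags S" "\<And>w. w \<in> S \<Longrightarrow> h w = f (g w)" for f g h u
    unfolding fmap_fmap by (rule fmap_cong[OF _ that(1), symmetric]) (rule that(2))
  have "Module.module K X"
  proof (rule Module.moduleI[OF K ag])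
    show "\<one>\<^bsub>K\<^esub> \<odot>\<^bsub>X\<^esub> x = x" if x: "x \<in> carrier X" for x
    proof -
      obtain u where u: "u \<in> frags S" "x = \<phi> u" using ex[OF x] by blast
      show ?thesis using d(10)[OF K.one_closed u(1)] fmap_id[OF u(1), of "s \<one>\<^bsub>K\<^esub>"] s(3) u(2) by simp
    qed
  next
    fix c x assume c: "c \<in> carrier K" and x: "x \<in> carrier X"
    obtain u where u: "u \<in> frags S" "x = \<phi> u" using ex[OF x] by blast
    show "c \<odot>\<^bsub>X\<^esub> x \<in> carrier X" using d(10)[OF c u(1)] d(11)[OF Fs(1)[OF c u(1)]] u(2) by simp
    show "c \<odot>\<^bsub>X\<^esub> (x \<oplus>\<^bsub>X\<^esub> y) = c \<odot>\<^bsub>X\<^esub> x \<oplus>\<^bsub>X\<^esub> c \<odot>\<^bsub>X\<^esub> y" if y: "y \<in> carrier X" for y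
    proof -
      obtain v where v: "v \<in> frags S" "y = \<phi> v" using ex[OF y] by blast
      show ?thesis
        using d(6)[OF u(1) v(1)] d(10)[OF c subgrp_add[OF d(1) u(1) v(1)]] d(10)[OF c u(1)] d(10)[OF c v(1)]
          d(6)[OF Fs(1)[OF c u(1)] Fs(1)[OF c v(1)]] u(2) v(2) by (simp add: fmap_add)
    qed
    fix e assume e: "e \<in> carrier K"
    have "\<phi> (fmap (s (c \<oplus>\<^bsub>K\<^esub> e)) u) = \<phi> (fmap (s c) u) \<oplus>\<^bsub>X\<^esub> \<phi> (fmap (s e) u)"
      by (rule add3[OF u(1)]) (use s(1) Fs(1)[OF _ u(1)] c e in blast)+
    then show "(c \<oplus>\<^bsub>K\<^esub> e) \<odot>\<^bsub>X\<^esub> x = c \<odot>\<^bsub>X\<^esub> x \<oplus>\<^bsub>X\<^esub> e \<odot>\<^bsub>X\<^esub> x"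
      using d(10)[OF K.a_closed[OF c e] u(1)] d(10)[OF c u(1)] d(10)[OF e u(1)] u(2) by simp
    have "fmap (s c) (fmap (s e) u) = fmap (s (c \<otimes>\<^bsub>K\<^esub> e)) u"
      by (rule eqc[OF u(1)]) (rule s(2)[OF c e])
    then show "(c \<otimes>\<^bsub>K\<^esub> e) \<odot>\<^bsub>X\<^esub> x = c \<odot>\<^bsub>X\<^esub> (e \<odot>\<^bsub>X\<^esub> x)"
      using d(10)[OF K.m_closed[OF c e] u(1)] d(10)[OF e u(1)] d(10)[OF c Fs(1)[OF e u(1)]] u(2) by simp
  qed
  moreover have "lact X a x \<in> carrier X \<and> ract X x a \<in> carrier X" if a: "a \<in> carrier A" "x \<in> carrier X" for a x
  proof -
    obtain u where u: "u \<in> frags S" "x = \<phi> u" using ex[OF a(2)] by blast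
    show ?thesis using b(5,6)[OF a(1) u(1)] d(11)[OF Fs(2)[OF a(1) u(1)]] d(11)[OF Fs(3)[OF a(1) u(1)]] u(2) by simp
  qed
  moreover have "lact X a (x \<oplus>\<^bsub>X\<^esub> y) = lact X a x \<oplus>\<^bsub>X\<^esub> lact X a y \<and> ract X (x \<oplus>\<^bsub>X\<^esub> y) a = ract X x a \<oplus>\<^bsub>X\<^esub> ract X y a"
    if a: "a \<in> carrier A" and xy: "x \<in> carrier X" "y \<in> carrier X" for a x y
  proof -
    obtain u v where u: "u \<in> frags S" "x = \<phi> u" and v: "v \<in> frags S" "y = \<phi> v" using ex xy by meson
    note uv = subgrp_add[OF d(1) u(1) v(1)]
    show ?thesis
      using d(6)[OF u(1) v(1)] b(5,6)[OF a uv] b(5,6)[OF a u(1)] b(5,6)[OF a v(1)]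
        d(6)[OF Fs(2)[OF a u(1)] Fs(2)[OF a v(1)]] d(6)[OF Fs(3)[OF a u(1)] Fs(3)[OF a v(1)]] u(2) v(2)
      by (simp add: fmap_add)
  qed
  moreover have "lact X (a \<oplus>\<^bsub>A\<^esub> a') x = lact X a x \<oplus>\<^bsub>X\<^esub> lact X a' x \<and>
      ract X x (a \<oplus>\<^bsub>A\<^esub> a') = ract X x a \<oplus>\<^bsub>X\<^esub> ract X x a' \<and>
      lact X (a \<otimes>\<^bsub>A\<^esub> a') x = lact X a (lact X a' x) \<and> ract X x (a \<otimes>\<^bsub>A\<^esub> a') = ract X (ract X x a) a' \<and>
      ract X (lact X a x) a' = lact X a (ract X x a')"
    if a: "a \<in> carrier A" and a': "a' \<in> carrier A" and x: "x \<in> carrier X" for a a' x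
  proof -
    obtain u where u: "u \<in> frags S" "x = \<phi> u" using ex[OF x] by blast
    have p: "a \<oplus>\<^bsub>A\<^esub> a' \<in> carrier A" and m: "a \<otimes>\<^bsub>A\<^esub> a' \<in> carrier A" using A(1) a a' by auto
    have "fmap (r a') (fmap (l a) u) = fmap (l a) (fmap (r a') u)"
      unfolding fmap_fmap by (rule fmap_cong[OF _ u(1)]) (rule lr[OF a a'])
    moreover have "\<phi> (fmap (l (a \<oplus>\<^bsub>A\<^esub> a')) u) = \<phi> (fmap (l a) u) \<oplus>\<^bsub>X\<^esub> \<phi> (fmap (l a') u)"
      by (rule add3[OF u(1)]) (use l(1) Fs(2)[OF _ u(1)] p a a' in blast)+
    moreover have "\<phi> (fmap (r (a \<oplus>\<^bsub>A\<^esub> a')) u) = \<phi> (fmap (r a) u) \<oplus>\<^bsub>X\<^esub> \<phi> (fmap (r a') u)"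
      by (rule add3[OF u(1)]) (use r(1) Fs(3)[OF _ u(1)] p a a' in blast)+
    moreover have "fmap (l a) (fmap (l a') u) = fmap (l (a \<otimes>\<^bsub>A\<^esub> a')) u"
      by (rule eqc[OF u(1)]) (rule l(2)[OF a a'])
    moreover have "fmap (r a') (fmap (r a) u) = fmap (r (a \<otimes>\<^bsub>A\<^esub> a')) u"
      by (rule eqc[OF u(1)]) (rule r(2)[OF a a'])
    ultimately show ?thesis
      using b(5,6)[OF p u(1)] b(5,6)[OF m u(1)] b(5,6)[OF a u(1)] b(5,6)[OF a' u(1)]
        b(5)[OF a Fs(2)[OF a' u(1)]] b(6)[OF a' Fs(3)[OF a u(1)]] b(6)[OF a' Fs(2)[OF a u(1)]] b(5)[OF a Fs(3)[OF a' u(1)]]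
        u(2) by simp
  qed
  moreover have "lact X \<one>\<^bsub>A\<^esub> x = x \<and> ract X x \<one>\<^bsub>A\<^esub> = x" if x: "x \<in> carrier X" for x
  proof -
    obtain u where u: "u \<in> frags S" "x = \<phi> u" using ex[OF x] by blast
    show ?thesis using b(5,6)[OF A(2) u(1)] fmap_id[OF u(1), of "l \<one>\<^bsub>A\<^esub>"] fmap_id[OF u(1), of "r \<one>\<^bsub>A\<^esub>"] l(3) r(3) u(2) by simp
  qed
  moreover have "lact X (c \<odot>\<^bsub>A\<^esub> a) x = c \<odot>\<^bsub>X\<^esub> lact X a x \<and> lact X a (c \<odot>\<^bsub>X\<^esub> x) = c \<odot>\<^bsub>X\<^esub> lact X a x \<and>
        ract X x (c \<odot>\<^bsub>A\<^esub> a) = c \<odot>\<^bsub>X\<^esub> ract X x a \<and> ract X (c \<odot>\<^bsub>X\<^esub> x) a = c \<odot>\<^bsub>X\<^esub> ract X x a"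
    if c: "c \<in> carrier K" and a: "a \<in> carrier A" and x: "x \<in> carrier X" for c a x
  proof -
    obtain u where u: "u \<in> frags S" "x = \<phi> u" using ex[OF x] by blast
    note ca = A(3)[OF c a]
    note la = Fs(2)[OF a u(1)] and ra = Fs(3)[OF a u(1)] and sc = Fs(1)[OF c u(1)]
    have "\<phi> (fmap (l (c \<odot>\<^bsub>A\<^esub> a)) u) = \<phi> (fmap (s c) (fmap (l a) u))"
      unfolding fmap_fmap
      by (rule eq2[OF u(1) _ Fs(2)[OF ca u(1)]]) (use l(4) c a Fs(1)[OF c la] in \<open>simp_all add: fmap_fmap\<close>)
    moreover have "\<phi> (fmap (r (c \<odot>\<^bsub>A\<^esub> a)) u) = \<phi> (fmap (s c) (fmap (r a) u))"
      unfolding fmap_fmap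
      by (rule eq2[OF u(1) _ Fs(3)[OF ca u(1)]]) (use r(4) c a Fs(1)[OF c ra] in \<open>simp_all add: fmap_fmap\<close>)
    moreover have "fmap (l a) (fmap (s c) u) = fmap (s c) (fmap (l a) u)"
      unfolding fmap_fmap by (rule fmap_cong[OF _ u(1)]) (rule l(5)[OF c a])
    moreover have "fmap (r a) (fmap (s c) u) = fmap (s c) (fmap (r a) u)"
      unfolding fmap_fmap by (rule fmap_cong[OF _ u(1)]) (rule r(5)[OF c a])
    ultimately show ?thesis
      using b(5,6)[OF ca u(1)] b(5,6)[OF a u(1)] b(5,6)[OF a sc] d(10)[OF c u(1)] d(10)[OF c la] d(10)[OF c ra] u(2)
      by simp
  qed
  ultimately show ?thesis unfolding is_bimodule_def by blast
qed

text \<open>A choice of representative in place of \<open>quot_map\<close>, because source and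
  target need not consist of cosets: \<open>M\<close> itself is presented through
  \<open>bar_eval\<close>.\<close>

definition pmap :: "'g set \<Rightarrow> ('g \<Rightarrow> 'x) \<Rightarrow> ('h \<Rightarrow> 'y) \<Rightarrow> ('g \<Rightarrow> 'h) \<Rightarrow> 'x \<Rightarrow> 'y" where
  "pmap G \<phi> \<psi> f x = \<psi> (f (SOME u. u \<in> G \<and> \<phi> u = x))"

lemma pmap:
  assumes p: "presents C G N sm X \<phi>" and q: "presents C' G' N' sm' Y \<psi>"
    and f: "additive f" "\<And>u. u \<in> G \<Longrightarrow> f u \<in> G'" "\<And>u. u \<in> N \<Longrightarrow> f u \<in> N'" and u: "u \<in> G"
  shows "pmap G \<phi> \<psi> f (\<phi> u) = \<psi> (f u)"
proof -
  define v where "v = (SOME v. v \<in> G \<and> \<phi> v = \<phi> u)"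
  have "\<exists>v. v \<in> G \<and> \<phi> v = \<phi> u" using u by blast
  then have v: "v \<in> G" "\<phi> v = \<phi> u" unfolding v_def by (metis (mono_tags, lifting) someI_ex)+
  then have "f v - f u \<in> N'" using presentsD(7)[OF p v(1) u] f(3)[of "v - u"] by (simp add: additive.diff[OF f(1)])
  then show ?thesis
    unfolding pmap_def v_def[symmetric] using presentsD(7)[OF q f(2)[OF v(1)] f(2)[OF u]] by simp
qed

text \<open>The acting set \<open>E\<close> is a parameter so that both homomorphisms over
  \<open>A\<close> and maps linear over \<open>B\<close>, such as the sections of the bar
  resolution, are obtained.\<close>

lemma bimodule_hom_pmap:
  assumes p: "bipresents K A S N s l r X \<phi>" and q: "bipresents K A S' N' s' l' r' Y \<psi>"
    and f: "additive f" "\<And>w. w \<in> S \<Longrightarrow> f (frag_of w) \<in> frags S'" "\<And>u. u \<in> N \<Longrightarrow> f u \<in> N'"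
    and sf: "\<And>c w. c \<in> carrier K \<Longrightarrow> w \<in> S \<Longrightarrow> f (frag_of (s c w)) - fmap (s' c) (f (frag_of w)) \<in> N'"
    and lf: "\<And>a w. a \<in> E \<Longrightarrow> w \<in> S \<Longrightarrow> f (frag_of (l a w)) - fmap (l' a) (f (frag_of w)) \<in> N'"
    and rf: "\<And>a w. a \<in> E \<Longrightarrow> w \<in> S \<Longrightarrow> f (frag_of (r a w)) - fmap (r' a) (f (frag_of w)) \<in> N'"
    and E: "E \<subseteq> carrier A"
  shows "bimodule_hom K (A\<lparr>carrier := E\<rparr>) X Y (pmap (frags S) \<phi> \<psi> f)"
    and "u \<in> frags S \<Longrightarrow> pmap (frags S) \<phi> \<psi> f (\<phi> u) = \<psi> (f u)"
proof -
  note b = bipresentsD[OF p] and b' = bipresentsD[OF q]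
  note d = presentsD[OF b(1)] and d' = presentsD[OF b'(1)]
  have fc: "f u \<in> frags S'" if "u \<in> frags S" for u
    by (rule frags_map[OF f(1) subgrp_frags f(2) that])
  have pm: "pmap (frags S) \<phi> \<psi> f (\<phi> u) = \<psi> (f u)" if "u \<in> frags S" for u
    by (rule pmap[OF b(1) b'(1) f(1) _ _ that]) (use fc f(3) in blast)+
  show "u \<in> frags S \<Longrightarrow> pmap (frags S) \<phi> \<psi> f (\<phi> u) = \<psi> (f u)" by (rule pm)
  have ex: "\<exists>u. u \<in> frags S \<and> x = \<phi> u" if "x \<in> carrier X" for x
    using that d(4) by blast
  have Fs: "\<And>c u. c \<in> carrier K \<Longrightarrow> u \<in> frags S \<Longrightarrow> fmap (s c) u \<in> frags S"
    "\<And>a u. a \<in> carrier A \<Longrightarrow> u \<in> frags S \<Longrightarrow> fmap (l a) u \<in> frags S"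
    "\<And>a u. a \<in> carrier A \<Longrightarrow> u \<in> frags S \<Longrightarrow> fmap (r a) u \<in> frags S"
    by - (erule fmap_frags, rule b, assumption+)+
  have comm: "\<psi> (f (fmap g u)) = \<psi> (fmap h (f u))"
    if u: "u \<in> frags S" and gh: "\<And>w. w \<in> S \<Longrightarrow> g w \<in> S" "\<And>w. w \<in> S' \<Longrightarrow> h w \<in> S'"
      and N: "\<And>w. w \<in> S \<Longrightarrow> f (frag_of (g w)) - fmap h (f (frag_of w)) \<in> N'" for g h u
  proof -
    have "f (fmap g u) - fmap h (f u) \<in> N'"
      by (rule frags_map[OF additive_sub[OF additive_comp[OF f(1) additive_fmap(1)] additive_fmap(2)[OF f(1)]] d'(2) _ u])
        (simp add: N)
    moreover have "fmap g u \<in> frags S" by (rule fmap_frags[OF u]) (rule gh(1))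
    moreover have "fmap h (f u) \<in> frags S'" by (rule fmap_frags[OF fc[OF u]]) (rule gh(2))
    ultimately show ?thesis using d'(7)[OF fc] by simp
  qed
  show "bimodule_hom K (A\<lparr>carrier := E\<rparr>) X Y (pmap (frags S) \<phi> \<psi> f)"
  proof (rule bimodule_homI)
    fix x assume x: "x \<in> carrier X"
    obtain u where u: "u \<in> frags S" "x = \<phi> u" using ex[OF x] by blast
    note fu = fc[OF u(1)]
    show "pmap (frags S) \<phi> \<psi> f x \<in> carrier Y" using d'(11)[OF fu] pm[OF u(1)] u(2) by simp
    show "pmap (frags S) \<phi> \<psi> f (c \<odot>\<^bsub>X\<^esub> x) = c \<odot>\<^bsub>Y\<^esub> pmap (frags S) \<phi> \<psi> f x" if c: "c \<in> carrier K" for c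
    proof -
      have cs: "\<psi> (f (fmap (s c) u)) = \<psi> (fmap (s' c) (f u))"
        by (rule comm[OF u(1)]) (use b(2) b'(2) sf c in blast)+
      show ?thesis
      using d(10)[OF c u(1)] d'(10)[OF c fu] cs pm[OF Fs(1)[OF c u(1)]] pm[OF u(1)] u(2)
      by simp
    qed
    show "pmap (frags S) \<phi> \<psi> f (lact X a x) = lact Y a (pmap (frags S) \<phi> \<psi> f x)"
      and "pmap (frags S) \<phi> \<psi> f (ract X x a) = ract Y (pmap (frags S) \<phi> \<psi> f x) a"
      if "a \<in> carrier (A\<lparr>carrier := E\<rparr>)" for a
    proof -
      have a: "a \<in> E" "a \<in> carrier A" using that E by auto
      have cl: "\<psi> (f (fmap (l a) u)) = \<psi> (fmap (l' a) (f u))"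
        by (rule comm[OF u(1)]) (use b(3) b'(3) lf a in blast)+
      have cr: "\<psi> (f (fmap (r a) u)) = \<psi> (fmap (r' a) (f u))"
        by (rule comm[OF u(1)]) (use b(4) b'(4) rf a in blast)+
      show "pmap (frags S) \<phi> \<psi> f (lact X a x) = lact Y a (pmap (frags S) \<phi> \<psi> f x)"
        using b(5)[OF a(2) u(1)] b'(5)[OF a(2) fu] cl
          pm[OF Fs(2)[OF a(2) u(1)]] pm[OF u(1)] u(2) by simp
      show "pmap (frags S) \<phi> \<psi> f (ract X x a) = ract Y (pmap (frags S) \<phi> \<psi> f x) a"
        using b(6)[OF a(2) u(1)] b'(6)[OF a(2) fu] cr
          pm[OF Fs(3)[OF a(2) u(1)]] pm[OF u(1)] u(2) by simp
    qed
    fix y assume y: "y \<in> carrier X"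
    obtain v where v: "v \<in> frags S" "y = \<phi> v" using ex[OF y] by blast
    show "pmap (frags S) \<phi> \<psi> f (x \<oplus>\<^bsub>X\<^esub> y) = pmap (frags S) \<phi> \<psi> f x \<oplus>\<^bsub>Y\<^esub> pmap (frags S) \<phi> \<psi> f y"
      using d(6)[OF u(1) v(1)] pm[OF subgrp_add[OF d(1) u(1) v(1)]] pm[OF u(1)] pm[OF v(1)] d'(6)[OF fu fc[OF v(1)]] u(2) v(2)
      by (simp add: additive.add[OF f(1)])
  qed
qed


section \<open>The bar resolution\<close>

text \<open>The word \<open>([a1, \<dots>, an], m, [b1, \<dots>, bn])\<close> stands for \<open>a1 \<otimes> \<dots> \<otimes> an \<otimes> m \<otimes> bn \<otimes> \<dots> \<otimes> b1\<close>: both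
  lists start with the outermost factor.\<close>

definition bar_gens :: "('k, 'a) module \<Rightarrow> ('k, 'a, 'm) bimodule \<Rightarrow> nat \<Rightarrow> ('a list \<times> 'm \<times> 'a list) set" where
  "bar_gens A M n = {(as, m, bs). set as \<subseteq> carrier A \<and> length as = n \<and> m \<in> carrier M \<and>
     set bs \<subseteq> carrier A \<and> length bs = n}"

definition bar_cons :: "'a \<times> 'a \<Rightarrow> 'a list \<times> 'm \<times> 'a list \<Rightarrow> 'a list \<times> 'm \<times> 'a list" where
  "bar_cons i = (\<lambda>(as, m, bs). (fst i # as, m, snd i # bs))"

definition bar_act :: "('k, 'a) module \<Rightarrow> ('k, 'a, 'm) bimodule \<Rightarrow> 'a \<times> 'a
    \<Rightarrow> 'a list \<times> 'm \<times> 'a list \<Rightarrow> 'a list \<times> 'm \<times> 'a list" where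
  "bar_act A M i = (\<lambda>(as, m, bs). if as = [] then (as, ract M (lact M (fst i) m) (snd i), bs)
     else (fst i \<otimes>\<^bsub>A\<^esub> hd as # tl as, m, hd bs \<otimes>\<^bsub>A\<^esub> snd i # tl bs))"

definition bar_scale :: "('k, 'a, 'm) bimodule \<Rightarrow> 'k \<Rightarrow> 'a list \<times> 'm \<times> 'a list \<Rightarrow> 'a list \<times> 'm \<times> 'a list" where
  "bar_scale M c = (\<lambda>(as, m, bs). (as, c \<odot>\<^bsub>M\<^esub> m, bs))"

definition bar_mul :: "('k, 'a) module \<Rightarrow> 'a \<times> 'a \<Rightarrow> 'a \<times> 'a \<Rightarrow> 'a \<times> 'a" where
  "bar_mul A i j = (fst i \<otimes>\<^bsub>A\<^esub> fst j, snd j \<otimes>\<^bsub>A\<^esub> snd i)"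

text \<open>A pair stands for an elementary tensor of the enveloping algebra, whose product is
  \<open>bar_mul\<close>. The relations add two such tensors when they agree in one factor, hence a
  set of triples and not an operation.\<close>

definition bar_add :: "('k, 'a) module \<Rightarrow> (('a \<times> 'a) \<times> ('a \<times> 'a) \<times> ('a \<times> 'a)) set" where
  "bar_add A = {((a \<oplus>\<^bsub>A\<^esub> a', b), (a, b), (a', b)) | a a' b. a \<in> carrier A \<and> a' \<in> carrier A \<and> b \<in> carrier A} \<union>
     {((a, b \<oplus>\<^bsub>A\<^esub> b'), (a, b), (a, b')) | a b b'. a \<in> carrier A \<and> b \<in> carrier A \<and> b' \<in> carrier A}"

primrec bar_rels :: "('k, 'a) module \<Rightarrow> 'a set \<Rightarrow> ('k, 'a, 'm) bimodule \<Rightarrow> nat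
    \<Rightarrow> (('a list \<times> 'm \<times> 'a list) \<Rightarrow>\<^sub>0 int) set" where
  "bar_rels A B M 0 = {frag_of ([], m \<oplus>\<^bsub>M\<^esub> m', []) - frag_of ([], m, []) - frag_of ([], m', []) | m m'.
     m \<in> carrier M \<and> m' \<in> carrier M}"
| "bar_rels A B M (Suc n) = {fmap (bar_cons i) r | i r. i \<in> carrier A \<times> carrier A \<and> r \<in> bar_rels A B M n} \<union>
      {frag_of (bar_cons i w) - frag_of (bar_cons j w) - frag_of (bar_cons k w) | i j k w.
        (i, j, k) \<in> bar_add A \<and> w \<in> bar_gens A M n} \<union>
      {frag_of (bar_cons i (bar_act A M j w)) - frag_of (bar_cons (bar_mul A i j) w) | i j w.
        i \<in> carrier A \<times> carrier A \<and> j \<in> B \<times> B \<and> w \<in> bar_gens A M n}"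

text \<open>The face that lets the outermost pair act has the sign given by the number of pairs
  below it, so the innermost face is positive. The default equation makes the differential vanish on
  words without letters.\<close>

fun bar_diff_aux :: "('k, 'a) module \<Rightarrow> ('k, 'a, 'm) bimodule \<Rightarrow> 'a list \<Rightarrow> 'm \<Rightarrow> 'a list
    \<Rightarrow> (('a list \<times> 'm \<times> 'a list) \<Rightarrow>\<^sub>0 int)" where
  "bar_diff_aux A M (a # as) m (b # bs) = fmap (bar_cons (a, b)) (bar_diff_aux A M as m bs) +
     frag_cmul ((-1) ^ length as) (frag_of (bar_act A M (a, b) (as, m, bs)))"
| "bar_diff_aux A M _ m _ = 0"

definition bar_diff :: "('k, 'a) module \<Rightarrow> ('k, 'a, 'm) bimodule \<Rightarrow> 'a list \<times> 'm \<times> 'a list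
    \<Rightarrow> (('a list \<times> 'm \<times> 'a list) \<Rightarrow>\<^sub>0 int)" where
  "bar_diff A M = (\<lambda>(as, m, bs). bar_diff_aux A M as m bs)"

abbreviation bar_frags :: "('k, 'a) module \<Rightarrow> ('k, 'a, 'm) bimodule \<Rightarrow> nat
    \<Rightarrow> (('a list \<times> 'm \<times> 'a list) \<Rightarrow>\<^sub>0 int) set" where
  "bar_frags A M n \<equiv> frags (bar_gens A M n)"

abbreviation bar_presents :: "'k ring \<Rightarrow> ('k, 'a) module \<Rightarrow> 'a set \<Rightarrow> ('k, 'a, 'm) bimodule \<Rightarrow> nat
    \<Rightarrow> ('k, 'a, 'x) bimodule \<Rightarrow> ((('a list \<times> 'm \<times> 'a list) \<Rightarrow>\<^sub>0 int) \<Rightarrow> 'x) \<Rightarrow> bool" where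
  "bar_presents K A B M n X \<phi> \<equiv> bipresents K A (bar_gens A M n) (zspan (bar_rels A B M n)) (bar_scale M)
     (\<lambda>a. bar_act A M (a, \<one>\<^bsub>A\<^esub>)) (\<lambda>a. bar_act A M (\<one>\<^bsub>A\<^esub>, a)) X \<phi>"

definition bar_pre :: "('k, 'a) module \<Rightarrow> ('k, 'a, 'm) bimodule \<Rightarrow> nat
    \<Rightarrow> ('k, ('a list \<times> 'm \<times> 'a list) \<Rightarrow>\<^sub>0 int) module" where
  "bar_pre A M n = \<lparr>carrier = carrier (free_Abelian_group (bar_gens A M n)),
     mult = (\<lambda>_ _. 0), one = 0, zero = 0, add = (+), smult = (\<lambda>c. fmap (bar_scale M c))\<rparr>"

definition bar_bimodule :: "('k, 'a) module \<Rightarrow> 'a set \<Rightarrow> ('k, 'a, 'm) bimodule \<Rightarrow> nat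
    \<Rightarrow> ('k, 'a, (('a list \<times> 'm \<times> 'a list) \<Rightarrow>\<^sub>0 int) set) bimodule" where
  "bar_bimodule A B M n = (let T = bar_pre A M n; N = zspan (bar_rels A B M n) in
     module.extend (quot_module T N)
       \<lparr>lact = (\<lambda>a. quot_map T N (fmap (bar_act A M (a, \<one>\<^bsub>A\<^esub>)))),
        ract = (\<lambda>U a. quot_map T N (fmap (bar_act A M (\<one>\<^bsub>A\<^esub>, a))) U)\<rparr>)"

definition bar_class :: "('k, 'a) module \<Rightarrow> 'a set \<Rightarrow> ('k, 'a, 'm) bimodule \<Rightarrow> nat
    \<Rightarrow> (('a list \<times> 'm \<times> 'a list) \<Rightarrow>\<^sub>0 int) \<Rightarrow> (('a list \<times> 'm \<times> 'a list) \<Rightarrow>\<^sub>0 int) set" where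
  "bar_class A B M n u = zspan (bar_rels A B M n) +>\<^bsub>bar_pre A M n\<^esub> u"

definition bar_eval :: "('k, 'a, 'm) bimodule \<Rightarrow> (('a list \<times> 'm \<times> 'a list) \<Rightarrow>\<^sub>0 int) \<Rightarrow> 'm" where
  "bar_eval M = frag_eval M (\<lambda>(as, m, bs). m)"

lemma bar_gens_iff: "(as, m, bs) \<in> bar_gens A M n \<longleftrightarrow> set as \<subseteq> carrier A \<and> length as = n \<and> m \<in> carrier M \<and>
    set bs \<subseteq> carrier A \<and> length bs = n"
  by (simp add: bar_gens_def)

lemma bar_gens_0: "bar_gens A M 0 = {([], m, []) | m. m \<in> carrier M}"
  by (auto simp: bar_gens_def)

lemma bar_gens_Suc: "bar_gens A M (Suc n) = {bar_cons i w | i w. i \<in> carrier A \<times> carrier A \<and> w \<in> bar_gens A M n}"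
proof (intro equalityI subsetI)
  fix w assume "w \<in> bar_gens A M (Suc n)"
  then obtain a as m b bs where "w = bar_cons (a, b) (as, m, bs)" "(as, m, bs) \<in> bar_gens A M n"
      "a \<in> carrier A" "b \<in> carrier A"
    by (auto simp: bar_gens_def bar_cons_def length_Suc_conv)
  then show "w \<in> {bar_cons i w | i w. i \<in> carrier A \<times> carrier A \<and> w \<in> bar_gens A M n}" by blast
qed (auto simp: bar_gens_def bar_cons_def)

section \<open>Two-sided bar words and the bimodules they present\<close>

context algebra_ext
begin

lemma one_B: "\<one>\<^bsub>A\<^esub> \<in> B"
  using sub by (auto simp: k_subalgebra_def dest: subringE(3))

lemma smult_one_B: "c \<in> carrier K \<Longrightarrow> c \<odot>\<^bsub>A\<^esub> \<one>\<^bsub>A\<^esub> \<in> B"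
  using sub one_B by (simp add: k_subalgebra_def)

lemma smult_one_mult: "c \<in> carrier K \<Longrightarrow> a \<in> carrier A \<Longrightarrow>
    (c \<odot>\<^bsub>A\<^esub> \<one>\<^bsub>A\<^esub>) \<otimes>\<^bsub>A\<^esub> a = c \<odot>\<^bsub>A\<^esub> a \<and> a \<otimes>\<^bsub>A\<^esub> (c \<odot>\<^bsub>A\<^esub> \<one>\<^bsub>A\<^esub>) = c \<odot>\<^bsub>A\<^esub> a"
  using alg by (simp add: k_algebra_def)

lemma bar_words:
  assumes M: "is_bimodule K A M"
  shows "bar_words (bar_gens A M) (bar_rels A B M) (carrier A \<times> carrier A) (B \<times> B) (bar_mul A) (bar_add A)
    bar_cons (bar_act A M) (bar_diff A M)"
proof
  note x = is_bimoduleD[OF M]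
  show "bar_gens A M (Suc n) = {bar_cons i w | i w. i \<in> carrier A \<times> carrier A \<and> w \<in> bar_gens A M n}" for n
    by (rule bar_gens_Suc)
  show "bar_rels A B M (Suc n) = {fmap (bar_cons i) r | i r. i \<in> carrier A \<times> carrier A \<and> r \<in> bar_rels A B M n} \<union>
      {frag_of (bar_cons i w) - frag_of (bar_cons j w) - frag_of (bar_cons k w) | i j k w.
        (i, j, k) \<in> bar_add A \<and> w \<in> bar_gens A M n} \<union>
      {frag_of (bar_cons i (bar_act A M j w)) - frag_of (bar_cons (bar_mul A i j) w) | i j w.
        i \<in> carrier A \<times> carrier A \<and> j \<in> B \<times> B \<and> w \<in> bar_gens A M n}" for n
    by simp
  show "B \<times> B \<subseteq> carrier A \<times> carrier A" using BA by blast
  show "bar_mul A i j \<in> carrier A \<times> carrier A" if "i \<in> carrier A \<times> carrier A" "j \<in> carrier A \<times> carrier A" for i j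
    using that by (auto simp: bar_mul_def)
  show "bar_mul A (bar_mul A i j) k = bar_mul A i (bar_mul A j k)"
    if "i \<in> carrier A \<times> carrier A" "j \<in> carrier A \<times> carrier A" "k \<in> carrier A \<times> carrier A" for i j k
    using that by (auto simp: bar_mul_def A.m_assoc)
  show "bar_add A \<subseteq> (carrier A \<times> carrier A) \<times> (carrier A \<times> carrier A) \<times> carrier A \<times> carrier A"
    by (auto simp: bar_add_def)
  show "(bar_mul A l i, bar_mul A l j, bar_mul A l k) \<in> bar_add A"
    if "(i, j, k) \<in> bar_add A" "l \<in> carrier A \<times> carrier A" for i j k l
    using that by (cases l) (auto simp: bar_add_def bar_mul_def A.l_distr A.r_distr)
  show "(bar_mul A i l, bar_mul A j l, bar_mul A k l) \<in> bar_add A"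
    if "(i, j, k) \<in> bar_add A" "l \<in> carrier A \<times> carrier A" for i j k l
    using that by (cases l) (auto simp: bar_add_def bar_mul_def A.l_distr A.r_distr)
  show "bar_act A M i (bar_cons j w) = bar_cons (bar_mul A i j) w" for i j w
    by (cases w) (simp add: bar_act_def bar_cons_def bar_mul_def)
  show "bar_act A M i w \<in> bar_gens A M 0" if "i \<in> carrier A \<times> carrier A" "w \<in> bar_gens A M 0" for i w
    using that x(2,3) by (cases i) (auto simp: bar_gens_0 bar_act_def)
  show "bar_act A M i (bar_act A M j w) = bar_act A M (bar_mul A i j) w"
    if "i \<in> carrier A \<times> carrier A" "j \<in> carrier A \<times> carrier A" "w \<in> bar_gens A M 0" for i j w
    using that by (cases i; cases j) (auto simp: bar_gens_0 bar_act_def bar_mul_def x)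
  show "bar_rels A B M 0 \<subseteq> bar_frags A M 0"
  proof
    fix r assume "r \<in> bar_rels A B M 0"
    then obtain m m' where r: "m \<in> carrier M" "m' \<in> carrier M"
      "r = frag_of ([], m \<oplus>\<^bsub>M\<^esub> m', []) - frag_of ([], m, []) - frag_of ([], m', [])" by auto
    show "r \<in> bar_frags A M 0"
      unfolding r(3) by (rule frags_diff2) (use r bimodule_add_closed[OF M] in \<open>simp_all add: bar_gens_0\<close>)
  qed
  show "fmap (bar_act A M i) r \<in> zspan (bar_rels A B M 0)"
    if i: "i \<in> carrier A \<times> carrier A" and r: "r \<in> bar_rels A B M 0" for i r
  proof -
    obtain m m' where m: "m \<in> carrier M" "m' \<in> carrier M"
      "r = frag_of ([], m \<oplus>\<^bsub>M\<^esub> m', []) - frag_of ([], m, []) - frag_of ([], m', [])" using r by auto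
    have i': "fst i \<in> carrier A" "snd i \<in> carrier A" using i by auto
    define f where "f y = ract M (lact M (fst i) y) (snd i)" for y
    have f: "f (m \<oplus>\<^bsub>M\<^esub> m') = f m \<oplus>\<^bsub>M\<^esub> f m'" "f m \<in> carrier M" "f m' \<in> carrier M"
      using m(1,2) i' by (simp_all add: f_def x)
    have "fmap (bar_act A M i) r = frag_of ([], f m \<oplus>\<^bsub>M\<^esub> f m', []) - frag_of ([], f m, []) - frag_of ([], f m', [])"
      by (simp add: m(3) fmap_diff bar_act_def flip: f(1)) (simp add: f_def)
    then show ?thesis using f(2,3) by (auto intro!: zspan.base)
  qed
  show "frag_of (bar_act A M i w) - frag_of (bar_act A M j w) - frag_of (bar_act A M k w) \<in> zspan (bar_rels A B M 0)"
    if ijk: "(i, j, k) \<in> bar_add A" and w: "w \<in> bar_gens A M 0" for i j k w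
  proof -
    obtain m where m: "m \<in> carrier M" "w = ([], m, [])" using w by (auto simp: bar_gens_0)
    define f where "f i = ract M (lact M (fst i) m) (snd i)" for i
    have "f i = f j \<oplus>\<^bsub>M\<^esub> f k \<and> f j \<in> carrier M \<and> f k \<in> carrier M"
      using ijk m(1) by (auto simp: bar_add_def f_def x)
    then have "frag_of ([], f i, []) - frag_of ([], f j, []) - frag_of ([], f k, []) \<in> bar_rels A B M 0" by auto
    then show ?thesis unfolding m(2) by (auto simp: bar_act_def f_def intro: zspan.base)
  qed
  show "bar_diff A M w = 0" if "w \<in> bar_gens A M 0" for w using that by (auto simp: bar_gens_0 bar_diff_def)
  show "bar_diff A M (bar_cons i w) = fmap (bar_cons i) (bar_diff A M w) + frag_cmul ((-1) ^ n) (frag_of (bar_act A M i w))"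
    if "w \<in> bar_gens A M n" for i w n
    using that by (cases w; cases i) (simp add: bar_diff_def bar_cons_def bar_gens_iff)
qed

lemma bar_scale_cons: "bar_scale M c (bar_cons i w) = bar_cons i (bar_scale M c w)"
  by (cases w) (simp add: bar_scale_def bar_cons_def)

context
  fixes M :: "('k, 'a, 'm) bimodule"
  assumes M: "is_bimodule K A M"
begin

interpretation W: bar_words "bar_gens A M" "bar_rels A B M" "carrier A \<times> carrier A" "B \<times> B" "bar_mul A" "bar_add A"
    bar_cons "bar_act A M" "bar_diff A M"
  by (rule bar_words[OF M])

interpretation m: Module.module K M by (rule is_bimoduleD[OF M])

lemma bar_scale_0:
  assumes c: "c \<in> carrier K"
  shows "\<And>w. w \<in> bar_gens A M 0 \<Longrightarrow> bar_scale M c w \<in> bar_gens A M 0"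
    and "\<And>i w. i \<in> carrier A \<times> carrier A \<Longrightarrow> w \<in> bar_gens A M 0 \<Longrightarrow> bar_scale M c (bar_act A M i w) = bar_act A M i (bar_scale M c w)"
    and "\<And>r. r \<in> bar_rels A B M 0 \<Longrightarrow> fmap (bar_scale M c) r \<in> zspan (bar_rels A B M 0)"
proof -
  note x = is_bimoduleD[OF M]
  show "bar_scale M c w \<in> bar_gens A M 0" if "w \<in> bar_gens A M 0" for w
    using that c by (auto simp: bar_gens_0 bar_scale_def)
  show "bar_scale M c (bar_act A M i w) = bar_act A M i (bar_scale M c w)"
    if "i \<in> carrier A \<times> carrier A" "w \<in> bar_gens A M 0" for i w
    using that c by (cases i) (auto simp: bar_gens_0 bar_scale_def bar_act_def x)
  show "fmap (bar_scale M c) r \<in> zspan (bar_rels A B M 0)" if r: "r \<in> bar_rels A B M 0" for r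
  proof -
    obtain y y' where m: "y \<in> carrier M" "y' \<in> carrier M"
      "r = frag_of ([], y \<oplus>\<^bsub>M\<^esub> y', []) - frag_of ([], y, []) - frag_of ([], y', [])" using r by auto
    then have "fmap (bar_scale M c) r = frag_of ([], c \<odot>\<^bsub>M\<^esub> y \<oplus>\<^bsub>M\<^esub> c \<odot>\<^bsub>M\<^esub> y', []) - frag_of ([], c \<odot>\<^bsub>M\<^esub> y, []) - frag_of ([], c \<odot>\<^bsub>M\<^esub> y', [])"
      using c by (simp add: fmap_diff bar_scale_def m.smult_r_distr)
    moreover have "\<dots> \<in> bar_rels A B M 0" using m c by auto
    ultimately show ?thesis by (simp add: zspan.base)
  qed
qed

lemma bar_scale_gens: "c \<in> carrier K \<Longrightarrow> w \<in> bar_gens A M n \<Longrightarrow> bar_scale M c w \<in> bar_gens A M n"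
  by (cases w) (simp add: bar_scale_def bar_gens_iff)

lemma bar_scale_R:
  assumes "c \<in> carrier K" "r \<in> zspan (bar_rels A B M n)"
  shows "fmap (bar_scale M c) r \<in> zspan (bar_rels A B M n)"
proof (rule W.operator_R(3)[OF _ _ _ _ assms(2)])
  show "bar_scale M c (bar_act A M j w) = bar_act A M j (bar_scale M c w)"
    if "j \<in> B \<times> B" "w \<in> bar_gens A M 0" for j w
    using bar_scale_0(2)[OF assms(1), of j w] that BA by blast
qed (use bar_scale_0(1,3)[OF assms(1)] in \<open>simp_all add: bar_scale_cons\<close>)

lemma bar_scale_act: "c \<in> carrier K \<Longrightarrow> i \<in> carrier A \<times> carrier A \<Longrightarrow> w \<in> bar_gens A M n \<Longrightarrow>
    bar_scale M c (bar_act A M i w) = bar_act A M i (bar_scale M c w)"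
  by (cases n; cases w) (use bar_scale_0(2) in \<open>auto simp: bar_scale_def bar_act_def bar_gens_iff\<close>)

lemma bar_scale_diff: "c \<in> carrier K \<Longrightarrow> w \<in> bar_gens A M n \<Longrightarrow> bar_diff A M (bar_scale M c w) = fmap (bar_scale M c) (bar_diff A M w)"
  by (rule W.operator_D) (use bar_scale_0 in \<open>auto simp: bar_scale_cons\<close>)

lemma bar_act_one: "w \<in> bar_gens A M n \<Longrightarrow> bar_act A M (\<one>\<^bsub>A\<^esub>, \<one>\<^bsub>A\<^esub>) w = w"
  by (cases w; cases n) (auto simp: bar_act_def bar_gens_iff length_Suc_conv is_bimoduleD[OF M])

text \<open>Scalar multiples of 1 lie in \<open>B\<close> and are central, so they slide from the
  outermost pair through all tensor signs to the element of \<open>M\<close>.\<close>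

lemma bar_scalar_act:
  assumes c: "c \<in> carrier K" and j: "j = (c \<odot>\<^bsub>A\<^esub> \<one>\<^bsub>A\<^esub>, \<one>\<^bsub>A\<^esub>) \<or> j = (\<one>\<^bsub>A\<^esub>, c \<odot>\<^bsub>A\<^esub> \<one>\<^bsub>A\<^esub>)"
    and w: "w \<in> bar_gens A M n"
  shows "frag_of (bar_act A M j w) - frag_of (bar_scale M c w) \<in> zspan (bar_rels A B M n)"
  using w
proof (induction n arbitrary: w)
  case 0
  then have "bar_act A M j w = bar_scale M c w"
    using j c is_bimoduleD[OF M] by (auto simp: bar_gens_0 bar_act_def bar_scale_def)
  then show ?case by (simp add: zspan.zero)
next
  case (Suc n)
  then obtain i v where v: "i \<in> carrier A \<times> carrier A" "v \<in> bar_gens A M n" "w = bar_cons i v"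
    unfolding bar_gens_Suc by blast
  have jB: "j \<in> B \<times> B" using j one_B smult_one_B[OF c] by auto
  have "bar_mul A j i = bar_mul A i j"
    using v(1) j smult_one_mult[OF c] by (auto simp: bar_mul_def)
  then have "bar_act A M j w = bar_cons (bar_mul A i j) v"
    using W.\<rho>_t[OF _ v(1,2), of j] jB BA by (auto simp: v(3))
  then have "frag_of (bar_cons i (bar_act A M j v)) - frag_of (bar_act A M j w) \<in> zspan (bar_rels A B M (Suc n))"
    using W.t_bal[OF v(1) jB v(2)] by simp
  moreover have "frag_of (bar_cons i (bar_act A M j v)) - frag_of (bar_scale M c w) \<in> zspan (bar_rels A B M (Suc n))"
    using W.t_R[OF v(1) Suc.IH[OF v(2)]] by (simp add: fmap_diff v(3) bar_scale_cons)
  ultimately show ?case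
    using subgrp_trans[OF subgrp_zspan] subgrp_sym[OF subgrp_zspan] by blast
qed

text \<open>Additivity in the element of \<open>M\<close> is imposed at length 0 only;
  \<open>t_R\<close> carries it outward, one pair at a time.\<close>

lemma bar_add_middle:
  assumes "(as, m, bs) \<in> bar_gens A M n" "m' \<in> carrier M"
  shows "frag_of (as, m \<oplus>\<^bsub>M\<^esub> m', bs) - frag_of (as, m, bs) - frag_of (as, m', bs) \<in> zspan (bar_rels A B M n)"
  using assms(1)
proof (induction n arbitrary: as bs)
  case 0
  then have "frag_of (as, m \<oplus>\<^bsub>M\<^esub> m', bs) - frag_of (as, m, bs) - frag_of (as, m', bs) \<in> bar_rels A B M 0"
    using assms(2) by (auto simp: bar_gens_iff)
  then show ?case by (rule zspan.base)
next
  case (Suc n)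
  then obtain a as' b bs' where c: "as = a # as'" "bs = b # bs'" "(as', m, bs') \<in> bar_gens A M n" "(a, b) \<in> carrier A \<times> carrier A"
    by (auto simp: bar_gens_iff length_Suc_conv)
  show ?case
    using W.t_R[OF c(4) Suc.IH[OF c(3)]] by (simp add: fmap_diff bar_cons_def c(1,2))
qed

lemma bar_is_bimodule:
  assumes p: "bar_presents K A B M n X \<phi>"
  shows "is_bimodule K A X"
proof (rule is_bimodule_bipresents[OF Am.R.is_cring p])
  have one: "\<one>\<^bsub>A\<^esub> \<in> carrier A" by simp
  show "frag_of (bar_scale M (c \<oplus>\<^bsub>K\<^esub> e) w) - frag_of (bar_scale M c w) - frag_of (bar_scale M e w) \<in> zspan (bar_rels A B M n)"
    if "c \<in> carrier K" "e \<in> carrier K" "w \<in> bar_gens A M n" for c e w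
    using that bar_add_middle[of "fst w" "c \<odot>\<^bsub>M\<^esub> fst (snd w)" "snd (snd w)" n "e \<odot>\<^bsub>M\<^esub> fst (snd w)"]
    by (cases w) (simp add: bar_scale_def bar_gens_iff m.smult_l_distr)
  show "bar_scale M (c \<otimes>\<^bsub>K\<^esub> e) w = bar_scale M c (bar_scale M e w)"
    if "c \<in> carrier K" "e \<in> carrier K" "w \<in> bar_gens A M n" for c e w
    using that by (cases w) (simp add: bar_scale_def bar_gens_iff m.smult_assoc1)
  show "bar_scale M \<one>\<^bsub>K\<^esub> w = w" if "w \<in> bar_gens A M n" for w
    using that by (cases w) (simp add: bar_scale_def bar_gens_iff)
  show "frag_of (bar_act A M (a \<oplus>\<^bsub>A\<^esub> b, \<one>\<^bsub>A\<^esub>) w) - frag_of (bar_act A M (a, \<one>\<^bsub>A\<^esub>) w) - frag_of (bar_act A M (b, \<one>\<^bsub>A\<^esub>) w)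
      \<in> zspan (bar_rels A B M n)"
    and "frag_of (bar_act A M (\<one>\<^bsub>A\<^esub>, a \<oplus>\<^bsub>A\<^esub> b) w) - frag_of (bar_act A M (\<one>\<^bsub>A\<^esub>, a) w) - frag_of (bar_act A M (\<one>\<^bsub>A\<^esub>, b) w)
      \<in> zspan (bar_rels A B M n)"
    if "a \<in> carrier A" "b \<in> carrier A" "w \<in> bar_gens A M n" for a b w
    by (rule W.\<rho>_add[OF _ that(3)]; use that one in \<open>force simp: bar_add_def\<close>)+
  show "bar_act A M (a \<otimes>\<^bsub>A\<^esub> b, \<one>\<^bsub>A\<^esub>) w = bar_act A M (a, \<one>\<^bsub>A\<^esub>) (bar_act A M (b, \<one>\<^bsub>A\<^esub>) w)"
    and "bar_act A M (\<one>\<^bsub>A\<^esub>, a \<otimes>\<^bsub>A\<^esub> b) w = bar_act A M (\<one>\<^bsub>A\<^esub>, b) (bar_act A M (\<one>\<^bsub>A\<^esub>, a) w)"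
    and "bar_act A M (\<one>\<^bsub>A\<^esub>, b) (bar_act A M (a, \<one>\<^bsub>A\<^esub>) w) = bar_act A M (a, \<one>\<^bsub>A\<^esub>) (bar_act A M (\<one>\<^bsub>A\<^esub>, b) w)"
    if "a \<in> carrier A" "b \<in> carrier A" "w \<in> bar_gens A M n" for a b w
    using that by (simp_all add: W.\<rho>_mul[OF _ _ that(3)] bar_mul_def)
  show "bar_act A M (\<one>\<^bsub>A\<^esub>, \<one>\<^bsub>A\<^esub>) w = w" "bar_act A M (\<one>\<^bsub>A\<^esub>, \<one>\<^bsub>A\<^esub>) w = w" if "w \<in> bar_gens A M n" for w
    using that by (rule bar_act_one)+
  show "bar_act A M (a, \<one>\<^bsub>A\<^esub>) (bar_scale M c w) = bar_scale M c (bar_act A M (a, \<one>\<^bsub>A\<^esub>) w)"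
    and "bar_act A M (\<one>\<^bsub>A\<^esub>, a) (bar_scale M c w) = bar_scale M c (bar_act A M (\<one>\<^bsub>A\<^esub>, a) w)"
    if "c \<in> carrier K" "a \<in> carrier A" "w \<in> bar_gens A M n" for c a w
    using that bar_scale_act[OF that(1) _ that(3)] by simp_all
  show "frag_of (bar_act A M (c \<odot>\<^bsub>A\<^esub> a, \<one>\<^bsub>A\<^esub>) w) - frag_of (bar_scale M c (bar_act A M (a, \<one>\<^bsub>A\<^esub>) w)) \<in> zspan (bar_rels A B M n)"
    and "frag_of (bar_act A M (\<one>\<^bsub>A\<^esub>, c \<odot>\<^bsub>A\<^esub> a) w) - frag_of (bar_scale M c (bar_act A M (\<one>\<^bsub>A\<^esub>, a) w)) \<in> zspan (bar_rels A B M n)"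
    if c: "c \<in> carrier K" and a: "a \<in> carrier A" and w: "w \<in> bar_gens A M n" for c a w
  proof -
    have l: "bar_act A M (c \<odot>\<^bsub>A\<^esub> a, \<one>\<^bsub>A\<^esub>) w = bar_act A M (c \<odot>\<^bsub>A\<^esub> \<one>\<^bsub>A\<^esub>, \<one>\<^bsub>A\<^esub>) (bar_act A M (a, \<one>\<^bsub>A\<^esub>) w)"
      using c a smult_one_mult[OF c a] by (simp add: W.\<rho>_mul[OF _ _ w] bar_mul_def)
    have r: "bar_act A M (\<one>\<^bsub>A\<^esub>, c \<odot>\<^bsub>A\<^esub> a) w = bar_act A M (\<one>\<^bsub>A\<^esub>, c \<odot>\<^bsub>A\<^esub> \<one>\<^bsub>A\<^esub>) (bar_act A M (\<one>\<^bsub>A\<^esub>, a) w)"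
      using c a smult_one_mult[OF c a] by (simp add: W.\<rho>_mul[OF _ _ w] bar_mul_def)
    show "frag_of (bar_act A M (c \<odot>\<^bsub>A\<^esub> a, \<one>\<^bsub>A\<^esub>) w) - frag_of (bar_scale M c (bar_act A M (a, \<one>\<^bsub>A\<^esub>) w)) \<in> zspan (bar_rels A B M n)"
      unfolding l by (rule bar_scalar_act[OF c]) (use a w in \<open>simp_all add: W.\<rho>_W\<close>)
    show "frag_of (bar_act A M (\<one>\<^bsub>A\<^esub>, c \<odot>\<^bsub>A\<^esub> a) w) - frag_of (bar_scale M c (bar_act A M (\<one>\<^bsub>A\<^esub>, a) w)) \<in> zspan (bar_rels A B M n)"
      unfolding r by (rule bar_scalar_act[OF c]) (use a w in \<open>simp_all add: W.\<rho>_W\<close>)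
  qed
qed simp_all

lemma bar_bimodule_presents: "bar_presents K A B M n (bar_bimodule A B M n) (bar_class A B M n)"
proof -
  let ?N = "zspan (bar_rels A B M n)" and ?T = "bar_pre A M n"
  have T: "presents (carrier K) (bar_frags A M n) {0} (\<lambda>c. fmap (bar_scale M c)) ?T (\<lambda>u. u)"
    by (rule presents_free) (simp_all add: bar_pre_def bar_scale_gens)
  have N: "subgrp ?N" "{0} \<subseteq> ?N" "?N \<subseteq> bar_frags A M n"
    using W.zspan_R_frags[of n] by (simp_all add: subgrp_zspan zspan.zero)
  have Q: "presents (carrier K) (bar_frags A M n) ?N (\<lambda>c. fmap (bar_scale M c)) (bar_bimodule A B M n) (bar_class A B M n)"
    unfolding bar_bimodule_def Let_def presents_extend bar_class_def
    using presents_quot[OF T N bar_scale_R] by simp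
  have q: "quot_map ?T ?N (fmap (bar_act A M i)) (bar_class A B M n u) = bar_class A B M n (fmap (bar_act A M i) u)"
    if i: "i \<in> carrier A \<times> carrier A" and u: "u \<in> bar_frags A M n" for i u
  proof -
    have "fmap (bar_act A M i) v \<in> bar_frags A M n" if "v \<in> bar_frags A M n" for v
      using that by (rule fmap_frags) (rule W.\<rho>_W[OF i])
    then have "quot_map ?T ((\<lambda>u. u) ` ?N) (fmap (bar_act A M i)) ((\<lambda>u. u) ` ?N +>\<^bsub>?T\<^esub> u) =
        (\<lambda>u. u) ` ?N +>\<^bsub>?T\<^esub> fmap (bar_act A M i) u"
      by (intro presents_quot_map[OF T N T N bar_scale_R additive_fmap(1) _ W.\<rho>_R[OF i] _ u]) simp_all
    then show ?thesis by (simp add: bar_class_def)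
  qed
  have "lact (bar_bimodule A B M n) a (bar_class A B M n u) = bar_class A B M n (fmap (bar_act A M (a, \<one>\<^bsub>A\<^esub>)) u)"
    "ract (bar_bimodule A B M n) (bar_class A B M n u) a = bar_class A B M n (fmap (bar_act A M (\<one>\<^bsub>A\<^esub>, a)) u)"
    if "a \<in> carrier A" "u \<in> bar_frags A M n" for a u
    using q[OF _ that(2)] that(1) by (simp_all add: bar_bimodule_def Let_def module.defs)
  then show ?thesis
    unfolding bipresents_def using Q bar_scale_gens W.\<rho>_W by simp
qed

lemma bar_eval_of: "m \<in> carrier M \<Longrightarrow> bar_eval M (frag_of (as, m, bs)) = m"
  unfolding bar_eval_def by (subst frag_eval_of[OF m.M.abelian_group_axioms]) auto

lemma bar_eval_closed: "u \<in> bar_frags A M 0 \<Longrightarrow> bar_eval M u \<in> carrier M"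
  unfolding bar_eval_def by (rule frag_eval_closed[OF m.M.abelian_group_axioms, of _ "bar_gens A M 0"]) (auto simp: bar_gens_0)

lemma bar_eval_diff: "u \<in> bar_frags A M 0 \<Longrightarrow> v \<in> bar_frags A M 0 \<Longrightarrow> bar_eval M (u - v) = bar_eval M u \<ominus>\<^bsub>M\<^esub> bar_eval M v"
  unfolding bar_eval_def by (rule frag_eval_diff[OF m.M.abelian_group_axioms, of _ "bar_gens A M 0"]) (auto simp: bar_gens_0)

lemma bar_eval_add: "u \<in> bar_frags A M 0 \<Longrightarrow> v \<in> bar_frags A M 0 \<Longrightarrow> bar_eval M (u + v) = bar_eval M u \<oplus>\<^bsub>M\<^esub> bar_eval M v"
  unfolding bar_eval_def by (rule frag_eval_add[OF m.M.abelian_group_axioms, of _ "bar_gens A M 0"]) (auto simp: bar_gens_0)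

lemma bar_rel_diff:
  assumes "x \<in> carrier M" "y \<in> carrier M"
  shows "frag_of ([], x \<ominus>\<^bsub>M\<^esub> y, []) - (frag_of ([], x, []) - frag_of ([], y, [])) \<in> zspan (bar_rels A B M 0)"
proof -
  have "(x \<ominus>\<^bsub>M\<^esub> y) \<oplus>\<^bsub>M\<^esub> y = x" using assms by (simp add: a_minus_def m.M.a_assoc m.M.l_neg)
  then have "frag_of ([], x, []) - frag_of ([], x \<ominus>\<^bsub>M\<^esub> y, []) - frag_of ([], y, []) \<in> zspan (bar_rels A B M 0)"
    using bar_add_middle[of "[]" "x \<ominus>\<^bsub>M\<^esub> y" "[]" 0 y] assms by (simp add: bar_gens_iff)
  from subgrp_minus[OF subgrp_zspan this] show ?thesis by (simp add: algebra_simps)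
qed

text \<open>Adding values in \<open>M\<close> and adding them formally agree modulo the relations of
  length 0. It serves for maps \<theta> that respect differences in their values but not as formal
  sums.\<close>

lemma bar_frag_linear:
  assumes \<theta>: "\<And>u. u \<in> frags S \<Longrightarrow> \<theta> u \<in> carrier M" "\<And>u v. u \<in> frags S \<Longrightarrow> v \<in> frags S \<Longrightarrow> \<theta> (u - v) = \<theta> u \<ominus>\<^bsub>M\<^esub> \<theta> v"
    and u: "u \<in> frags S"
  shows "frag_extend (\<lambda>w. frag_of ([], \<theta> (frag_of w), [])) u - frag_of ([], \<theta> u, []) \<in> zspan (bar_rels A B M 0)"
proof -
  have "Poly_Mapping.keys u \<subseteq> S" using u by simp
  then show ?thesis
  proof (rule free_Abelian_group_induct)
    have "\<theta> 0 = \<zero>\<^bsub>M\<^esub>" using \<theta>(2)[of 0 0] \<theta>(1)[of 0] by (simp add: a_minus_def m.M.r_neg)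
    moreover have "frag_of ([], \<zero>\<^bsub>M\<^esub>, []) - frag_of ([], \<zero>\<^bsub>M\<^esub>, []) - frag_of ([], \<zero>\<^bsub>M\<^esub>, []) \<in> zspan (bar_rels A B M 0)"
      using bar_add_middle[of "[]" "\<zero>\<^bsub>M\<^esub>" "[]" 0 "\<zero>\<^bsub>M\<^esub>"] by (simp add: bar_gens_iff)
    ultimately show "frag_extend (\<lambda>w. frag_of ([], \<theta> (frag_of w), [])) 0 - frag_of ([], \<theta> 0, []) \<in> zspan (bar_rels A B M 0)"
      by simp
  next
    fix u v assume 2: "Poly_Mapping.keys u \<subseteq> S" "Poly_Mapping.keys v \<subseteq> S"
      "frag_extend (\<lambda>w. frag_of ([], \<theta> (frag_of w), [])) u - frag_of ([], \<theta> u, []) \<in> zspan (bar_rels A B M 0)"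
      "frag_extend (\<lambda>w. frag_of ([], \<theta> (frag_of w), [])) v - frag_of ([], \<theta> v, []) \<in> zspan (bar_rels A B M 0)"
    have uv: "\<theta> (u - v) = \<theta> u \<ominus>\<^bsub>M\<^esub> \<theta> v" "\<theta> u \<in> carrier M" "\<theta> v \<in> carrier M" using 2 \<theta> by auto
    from subgrp_diff[OF subgrp_zspan subgrp_diff[OF subgrp_zspan 2(3,4)] bar_rel_diff[OF uv(2,3)]]
    show "frag_extend (\<lambda>w. frag_of ([], \<theta> (frag_of w), [])) (u - v) - frag_of ([], \<theta> (u - v), []) \<in> zspan (bar_rels A B M 0)"
      by (simp add: uv(1) frag_extend_diff algebra_simps)
  qed (simp add: zspan.zero)
qed

text \<open>Identifies bar words of length 0 with \<open>M\<close>, so that lemmas on the bar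
  differential cover the augmentation too. The key is \<open>lin\<close>: every formal sum is
  congruent to the single word of its value.\<close>

lemma bar_eval_presents: "bar_presents K A B M 0 M (bar_eval M)"
proof -
  let ?N = "zspan (bar_rels A B M 0)"
  note x = is_bimoduleD[OF M]
  have 0: "bar_eval M 0 = \<zero>\<^bsub>M\<^esub>" unfolding bar_eval_def by (rule frag_eval_0[OF m.M.abelian_group_axioms])
  have N0: "bar_eval M u = \<zero>\<^bsub>M\<^esub>" if "u \<in> ?N" for u
    using that
  proof induction
    case (base r)
    then obtain y y' where r: "y \<in> carrier M" "y' \<in> carrier M"
      "r = frag_of ([], y \<oplus>\<^bsub>M\<^esub> y', []) - frag_of ([], y, []) - frag_of ([], y', [])" by auto
    have f: "frag_of ([], z, []) \<in> bar_frags A M 0" if "z \<in> carrier M" for z using that by (simp add: bar_gens_iff)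
    have yy: "y \<oplus>\<^bsub>M\<^esub> y' \<in> carrier M" using r by simp
    have "bar_eval M r = ((y \<oplus>\<^bsub>M\<^esub> y') \<ominus>\<^bsub>M\<^esub> y) \<ominus>\<^bsub>M\<^esub> y'"
      unfolding r(3) bar_eval_diff[OF subgrp_diff[OF subgrp_frags f[OF yy] f[OF r(1)]] f[OF r(2)]] bar_eval_diff[OF f[OF yy] f[OF r(1)]]
      using r by (simp add: bar_eval_of)
    also have "\<dots> = \<zero>\<^bsub>M\<^esub>" using r(1,2) by (simp add: a_minus_def m.M.a_ac m.M.r_neg m.M.r_neg1 m.M.r_neg2)
    finally show ?case .
  next
    case (diff u v)
    have "u \<in> bar_frags A M 0" "v \<in> bar_frags A M 0" using diff W.zspan_R_frags[of 0] by blast+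
    then show ?case using diff by (simp add: bar_eval_diff a_minus_def)
  qed (rule 0)
  have lin: "u - frag_of ([], bar_eval M u, []) \<in> ?N" if u: "u \<in> bar_frags A M 0" for u
  proof -
    have "frag_extend (\<lambda>w. frag_of ([], bar_eval M (frag_of w), [])) u = fmap (\<lambda>w. w) u"
      unfolding fmap_def using u by (intro frag_extend_eq) (auto simp: bar_gens_0 bar_eval_of dest!: subsetD)
    also have "\<dots> = u" by (rule fmap_id[OF u]) simp
    finally show ?thesis using bar_frag_linear[of "bar_gens A M 0" "bar_eval M" u] bar_eval_closed bar_eval_diff u by simp
  qed
  have eq: "bar_eval M u = bar_eval M v \<longleftrightarrow> u - v \<in> ?N" if uv: "u \<in> bar_frags A M 0" "v \<in> bar_frags A M 0" for u v
  proof
    assume e: "bar_eval M u = bar_eval M v"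
    from subgrp_diff[OF subgrp_zspan lin[OF uv(1)] lin[OF uv(2)]] show "u - v \<in> ?N" by (simp add: e)
  next
    assume "u - v \<in> ?N"
    then have "bar_eval M u \<ominus>\<^bsub>M\<^esub> bar_eval M v = \<zero>\<^bsub>M\<^esub>" using N0[of "u - v"] by (simp add: bar_eval_diff[OF uv])
    moreover have "(bar_eval M u \<ominus>\<^bsub>M\<^esub> bar_eval M v) \<oplus>\<^bsub>M\<^esub> bar_eval M v = bar_eval M u"
      using bar_eval_closed[OF uv(1)] bar_eval_closed[OF uv(2)] by (simp add: a_minus_def m.M.a_assoc m.M.l_neg)
    ultimately show "bar_eval M u = bar_eval M v" using bar_eval_closed[OF uv(2)] by simp
  qed
  have op: "bar_eval M (fmap f u) = g (bar_eval M u)"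
    if u: "u \<in> bar_frags A M 0" and f: "\<And>z. z \<in> carrier M \<Longrightarrow> f ([], z, []) = ([], g z, [])"
      and g: "\<And>z. z \<in> carrier M \<Longrightarrow> g z \<in> carrier M" and fN: "\<And>u. u \<in> ?N \<Longrightarrow> fmap f u \<in> ?N" for u f g
  proof -
    have e: "bar_eval M u \<in> carrier M" by (rule bar_eval_closed[OF u])
    have fu: "fmap f u \<in> bar_frags A M 0"
      by (rule fmap_frags[OF u]) (use f g in \<open>auto simp: bar_gens_0\<close>)
    have "fmap f u - frag_of ([], g (bar_eval M u), []) \<in> ?N"
      using fN[OF lin[OF u]] f[OF e] by (simp add: fmap_diff)
    then have "bar_eval M (fmap f u) = bar_eval M (frag_of ([], g (bar_eval M u), []))"
      using eq[OF fu] g[OF e] by (simp add: bar_gens_iff)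
    then show ?thesis using g[OF e] by (simp add: bar_eval_of)
  qed
  have sc: "bar_eval M (fmap (bar_scale M c) u) = c \<odot>\<^bsub>M\<^esub> bar_eval M u" if "c \<in> carrier K" "u \<in> bar_frags A M 0" for c u
    by (rule op[OF that(2)]) (use that(1) bar_scale_R[OF that(1)] in \<open>auto simp: bar_scale_def simp del: bar_rels.simps\<close>)
  have ac: "bar_eval M (fmap (bar_act A M i) u) = ract M (lact M (fst i) (bar_eval M u)) (snd i)"
    if i: "i \<in> carrier A \<times> carrier A" "u \<in> bar_frags A M 0" for i u
    by (rule op[OF i(2)]) (use i(1) W.\<rho>_R[OF i(1)] x(2,3) in \<open>auto simp: bar_act_def simp del: bar_rels.simps\<close>)
  have "presents (carrier K) (bar_frags A M 0) ?N (\<lambda>c. fmap (bar_scale M c)) M (bar_eval M)"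
    unfolding presents_def
  proof (intro conjI ballI)
    show "bar_eval M ` bar_frags A M 0 = carrier M"
    proof
      show "carrier M \<subseteq> bar_eval M ` bar_frags A M 0"
      proof
        fix z assume "z \<in> carrier M"
        then have "z = bar_eval M (frag_of ([], z, []))" "frag_of ([], z, []) \<in> bar_frags A M 0"
          by (simp_all add: bar_eval_of bar_gens_iff)
        then show "z \<in> bar_eval M ` bar_frags A M 0" by blast
      qed
    qed (use bar_eval_closed in blast)
    show "fmap (bar_scale M c) u \<in> bar_frags A M 0" if "c \<in> carrier K" "u \<in> bar_frags A M 0" for c u
      using that(2) by (rule fmap_frags) (rule bar_scale_gens[OF that(1)])
  qed (simp_all add: subgrp_frags subgrp_zspan W.zspan_R_frags 0 bar_eval_add eq sc additive_fmap del: mem_Collect_eq bar_rels.simps)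
  then show ?thesis
    unfolding bipresents_def using bar_scale_gens W.\<rho>_W[of _ _ 0] ac bar_eval_closed x by (simp del: bar_rels.simps)
qed

end

end


section \<open>Exactness of the bar resolution and projectivity of its terms\<close>

lemma bimodule_hom_zero:
  assumes X: "is_bimodule K A X" and Y: "is_bimodule K A Y" and f: "bimodule_hom K A' X Y f"
  shows "f \<zero>\<^bsub>X\<^esub> = \<zero>\<^bsub>Y\<^esub>"
proof -
  interpret x: Module.module K X by (rule is_bimoduleD[OF X])
  interpret y: Module.module K Y by (rule is_bimoduleD[OF Y])
  show ?thesis using bimodule_homD(1)[OF f, of "\<zero>\<^bsub>X\<^esub>"] bimodule_homD(3)[OF f, of "\<zero>\<^bsub>K\<^esub>" "\<zero>\<^bsub>X\<^esub>"] by simp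
qed

lemma is_bimodule_image:
  assumes X: "is_bimodule K A X" and Y: "is_bimodule K A Y" and f: "bimodule_hom K A X Y f"
  shows "is_bimodule K A (Y\<lparr>carrier := f ` carrier X\<rparr>)"
proof (rule is_bimodule_sub[OF Y])
  note h = bimodule_homD[OF f] and x = is_bimoduleD[OF X]
  interpret x: Module.module K X by (rule x)
  show "f ` carrier X \<subseteq> carrier Y" using h(1) by blast
  show "\<zero>\<^bsub>Y\<^esub> \<in> f ` carrier X" using bimodule_hom_zero[OF X Y f] x.M.zero_closed by (metis imageI)
  show "u \<oplus>\<^bsub>Y\<^esub> v \<in> f ` carrier X" if "u \<in> f ` carrier X" "v \<in> f ` carrier X" for u v
    using that h(2) by (auto simp flip: h(2))
  show "c \<odot>\<^bsub>Y\<^esub> u \<in> f ` carrier X" if "c \<in> carrier K" "u \<in> f ` carrier X" for c u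
    using that by (auto simp flip: h(3))
  show "lact Y a u \<in> f ` carrier X \<and> ract Y u a \<in> f ` carrier X" if "a \<in> carrier A" "u \<in> f ` carrier X" for a u
    using that x(2,3) by (auto simp flip: h(4,5))
qed

lemma bipresents_hom_eq:
  assumes p: "bipresents K A S N s l r X \<phi>" and X: "is_bimodule K A X" and Y: "is_bimodule K A Y"
    and f: "bimodule_hom K A X Y f" and g: "bimodule_hom K A X Y g"
    and eq: "\<And>w. w \<in> S \<Longrightarrow> f (\<phi> (frag_of w)) = g (\<phi> (frag_of w))" and x: "x \<in> carrier X"
  shows "f x = g x"
proof -
  note d = presentsD[OF bipresentsD(1)[OF p]] and hf = bimodule_homD[OF f] and hg = bimodule_homD[OF g]
  interpret y: Module.module K Y by (rule is_bimoduleD[OF Y])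
  interpret x: Module.module K X by (rule is_bimoduleD[OF X])
  have diff: "h (\<phi> (u - v)) = h (\<phi> u) \<ominus>\<^bsub>Y\<^esub> h (\<phi> v)"
    if h: "bimodule_hom K A X Y h" and uv: "u \<in> frags S" "v \<in> frags S" for h u v
  proof -
    note hh = bimodule_homD[OF h]
    note uv' = subgrp_diff[OF d(1) uv]
    have "h (\<phi> u) = h (\<phi> (u - v)) \<oplus>\<^bsub>Y\<^esub> h (\<phi> v)"
      using hh(2)[OF d(11)[OF uv'] d(11)[OF uv(2)]] d(6)[OF uv' uv(2)] by simp
    then show ?thesis
      using hh(1)[OF d(11)[OF uv(1)]] hh(1)[OF d(11)[OF uv(2)]] hh(1)[OF d(11)[OF uv']]
      by (simp add: a_minus_def y.M.a_assoc y.M.r_neg)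
  qed
  obtain u where u: "u \<in> frags S" "x = \<phi> u" using x d(4) by blast
  have "Poly_Mapping.keys u \<subseteq> S" using u by simp
  then have "f (\<phi> u) = g (\<phi> u)"
  proof (rule free_Abelian_group_induct)
    show "f (\<phi> 0) = g (\<phi> 0)"
      using bimodule_hom_zero[OF X Y f] bimodule_hom_zero[OF X Y g] d(5) by simp
    show "f (\<phi> (u - v)) = g (\<phi> (u - v))"
      if "Poly_Mapping.keys u \<subseteq> S" "Poly_Mapping.keys v \<subseteq> S" "f (\<phi> u) = g (\<phi> u)" "f (\<phi> v) = g (\<phi> v)" for u v
      using diff[OF f, of u v] diff[OF g, of u v] that by simp
  qed (rule eq)
  then show ?thesis using u by simp
qed

lemma bar_gens_SucE:
  assumes "w \<in> bar_gens A M (Suc n)"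
  obtains a b v where "a \<in> carrier A" "b \<in> carrier A" "v \<in> bar_gens A M n" "w = bar_cons (a, b) v"
proof -
  obtain i v where "i \<in> carrier A \<times> carrier A" "v \<in> bar_gens A M n" "w = bar_cons i v"
    using assms unfolding bar_gens_Suc by blast
  then show thesis using that[of "fst i" "snd i" v] by auto
qed

context algebra_ext
begin

context
  fixes M :: "('k, 'a, 'm) bimodule"
  assumes M: "is_bimodule K A M"
begin

interpretation W: bar_words "bar_gens A M" "bar_rels A B M" "carrier A \<times> carrier A" "B \<times> B" "bar_mul A" "bar_add A"
    bar_cons "bar_act A M" "bar_diff A M"
  by (rule bar_words[OF M])

interpretation m: Module.module K M by (rule is_bimoduleD[OF M])

lemma bar_diff_frags: "u \<in> bar_frags A M (Suc n) \<Longrightarrow> frag_extend (bar_diff A M) u \<in> bar_frags A M n"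
  by (rule frag_extend_mem[OF subgrp_frags W.D_W])

lemma bar_diff_diff: "u \<in> bar_frags A M (Suc n) \<Longrightarrow> frag_extend (bar_diff A M) (frag_extend (bar_diff A M) u) = 0"
  by (rule frags_map_eq[of _ "\<lambda>_. 0" "bar_gens A M (Suc n)"])
    (auto intro: additive_intros simp: additive_def frag_extend_add W.D_D)

lemma bar_diff_hom:
  assumes p: "bar_presents K A B M (Suc n) X' \<phi>'" and q: "bar_presents K A B M n X \<phi>"
  defines "d \<equiv> pmap (bar_frags A M (Suc n)) \<phi>' \<phi> (frag_extend (bar_diff A M))"
  shows "bimodule_hom K A X' X d"
    and "u \<in> bar_frags A M (Suc n) \<Longrightarrow> d (\<phi>' u) = \<phi> (frag_extend (bar_diff A M) u)"
proof -
  have a: "frag_extend (bar_diff A M) (frag_of (bar_act A M i w)) - fmap (bar_act A M i) (frag_extend (bar_diff A M) (frag_of w))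
      \<in> zspan (bar_rels A B M n)" if "i \<in> carrier A \<times> carrier A" "w \<in> bar_gens A M (Suc n)" for i w
    using W.D_\<rho>[OF that] by (simp add: zspan.zero)
  have s: "frag_extend (bar_diff A M) (frag_of (bar_scale M c w)) - fmap (bar_scale M c) (frag_extend (bar_diff A M) (frag_of w))
      \<in> zspan (bar_rels A B M n)" if "c \<in> carrier K" "w \<in> bar_gens A M (Suc n)" for c w
    using bar_scale_diff[OF M that] by (simp add: zspan.zero)
  have w: "frag_extend (bar_diff A M) (frag_of w) \<in> bar_frags A M n" if "w \<in> bar_gens A M (Suc n)" for w
    using W.D_W[OF that] by simp
  note h = bimodule_hom_pmap[OF p q additive_frag_extend w W.D_R s a a subset_refl]
  show "bimodule_hom K A X' X d" using h(1) unfolding d_def by simp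
  show "u \<in> bar_frags A M (Suc n) \<Longrightarrow> d (\<phi>' u) = \<phi> (frag_extend (bar_diff A M) u)"
    using h(2) unfolding d_def by simp
qed

text \<open>Inserting the pair of units outermost is the usual contraction of a bar complex.
  Balancing makes it linear over \<open>B\<close>, and the sign undoes that of the outermost
  face.\<close>

lemma bar_section:
  assumes p: "bar_presents K A B M (Suc n) X' \<phi>'" and q: "bar_presents K A B M n X \<phi>"
  shows "\<exists>t. bimodule_hom K (A\<lparr>carrier := B\<rparr>) X X' t \<and>
    (\<forall>u\<in>bar_frags A M n. t (\<phi> u) = \<phi>' (frag_cmul ((-1) ^ n) (fmap (bar_cons (\<one>\<^bsub>A\<^esub>, \<one>\<^bsub>A\<^esub>)) u)))"
proof -
  let ?i = "(\<one>\<^bsub>A\<^esub>, \<one>\<^bsub>A\<^esub>)"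
  let ?f = "\<lambda>u. frag_cmul ((-1) ^ n) (fmap (bar_cons ?i) u)"
  have i: "?i \<in> carrier A \<times> carrier A" by simp
  have f: "additive ?f" by (intro additive_intros additive_fmap)
  have fw: "?f (frag_of w) \<in> bar_frags A M (Suc n)" if "w \<in> bar_gens A M n" for w
    by (rule subgrp_cmul[OF subgrp_frags]) (use W.t_W[OF i that] in simp)
  have fR: "?f u \<in> zspan (bar_rels A B M (Suc n))" if "u \<in> zspan (bar_rels A B M n)" for u
    by (rule subgrp_cmul[OF subgrp_zspan W.t_R[OF i that]])
  have s: "?f (frag_of (bar_scale M c w)) - fmap (bar_scale M c) (?f (frag_of w)) \<in> zspan (bar_rels A B M (Suc n))" for c w
    by (simp add: fmap_cmul bar_scale_cons zspan.zero)
  have a: "?f (frag_of (bar_act A M j w)) - fmap (bar_act A M j) (?f (frag_of w)) \<in> zspan (bar_rels A B M (Suc n))"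
    if j: "j \<in> B \<times> B" and w: "w \<in> bar_gens A M n" for j w
  proof -
    have j': "j \<in> carrier A \<times> carrier A" using j BA by blast
    have "bar_act A M j (bar_cons ?i w) = bar_cons (bar_mul A ?i j) w"
      using W.\<rho>_t[OF j' i w] j' by (auto simp: bar_mul_def)
    then show ?thesis
      using subgrp_cmul[OF subgrp_zspan W.t_bal[OF i j w], of "(-1) ^ n"]
      by (simp add: fmap_cmul additive.diff[OF additive_cmul])
  qed
  note h = bimodule_hom_pmap[OF q p f fw fR s a a BA]
  show ?thesis
  proof (intro exI conjI ballI)
    show "bimodule_hom K (A\<lparr>carrier := B\<rparr>) X X' (pmap (bar_frags A M n) \<phi> \<phi>' ?f)" using h(1) one_B by simp
    show "pmap (bar_frags A M n) \<phi> \<phi>' ?f (\<phi> u) = \<phi>' (?f u)" if "u \<in> bar_frags A M n" for u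
      using h(2) one_B that by simp
  qed
qed

text \<open>After the section, the outermost face returns \<open>u\<close> and the other faces see
  only the boundary of \<open>u\<close>. Hence \<open>d\<close> is split over the elements
  represented by sums with null boundary, and these make up its image; for \<open>n = 0\<close> the
  condition is void.\<close>

lemma bar_class_E:
  assumes p: "bar_presents K A B M (Suc n) X' \<phi>'" and q: "bar_presents K A B M n X \<phi>"
  defines "d \<equiv> pmap (bar_frags A M (Suc n)) \<phi>' \<phi> (frag_extend (bar_diff A M))"
  shows "class_E K A B X' (X\<lparr>carrier := d ` carrier X'\<rparr>) d"
    and "d ` carrier X' = {x \<in> carrier X. \<exists>u\<in>bar_frags A M n. x = \<phi> u \<and>
      (n > 0 \<longrightarrow> frag_extend (bar_diff A M) u \<in> zspan (bar_rels A B M (n - 1)))}"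
proof -
  note d = bar_diff_hom[OF p q, folded d_def]
  note P = presentsD[OF bipresentsD(1)[OF p]] and Q = presentsD[OF bipresentsD(1)[OF q]]
  note bX = bar_is_bimodule[OF M q] and bX' = bar_is_bimodule[OF M p]
  obtain t where t: "bimodule_hom K (A\<lparr>carrier := B\<rparr>) X X' t"
    "\<And>u. u \<in> bar_frags A M n \<Longrightarrow> t (\<phi> u) = \<phi>' (frag_cmul ((-1) ^ n) (fmap (bar_cons (\<one>\<^bsub>A\<^esub>, \<one>\<^bsub>A\<^esub>)) u))"
    using bar_section[OF p q] by blast
  let ?Z = "{x \<in> carrier X. \<exists>u\<in>bar_frags A M n. x = \<phi> u \<and>
      (n > 0 \<longrightarrow> frag_extend (bar_diff A M) u \<in> zspan (bar_rels A B M (n - 1)))}"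
  have i: "(\<one>\<^bsub>A\<^esub>, \<one>\<^bsub>A\<^esub>) \<in> carrier A \<times> carrier A" by simp
  have dt: "d (t x) = x" if x: "x \<in> ?Z" for x
  proof -
    obtain u where u: "u \<in> bar_frags A M n" "x = \<phi> u"
        "n > 0 \<longrightarrow> frag_extend (bar_diff A M) u \<in> zspan (bar_rels A B M (n - 1))"
      using x by blast
    let ?t = "fmap (bar_cons (\<one>\<^bsub>A\<^esub>, \<one>\<^bsub>A\<^esub>))"
    have tu: "frag_cmul ((-1) ^ n) (?t u) \<in> bar_frags A M (Suc n)"
      by (rule subgrp_cmul[OF subgrp_frags fmap_frags[OF u(1) W.t_W[OF i]]])
    have eq: "frag_extend (bar_diff A M) (frag_cmul ((-1) ^ n) (?t u)) = frag_cmul ((-1) ^ n) (?t (frag_extend (bar_diff A M) u)) + u"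
    proof (rule frags_map_eq[OF _ _ _ u(1)])
      show "frag_extend (bar_diff A M) (frag_cmul ((-1) ^ n) (?t (frag_of w))) =
          frag_cmul ((-1) ^ n) (?t (frag_extend (bar_diff A M) (frag_of w))) + frag_of w" if "w \<in> bar_gens A M n" for w
        using W.D_t[OF i that] bar_act_one[OF M that]
        by (simp add: frag_extend_cmul frag_cmul_distrib2 flip: power_mult_distrib)
      show "additive (\<lambda>u. frag_extend (bar_diff A M) (frag_cmul ((-1) ^ n) (?t u)))"
        by (intro additive_intros additive_fmap)
      show "additive (\<lambda>u. frag_cmul ((-1) ^ n) (?t (frag_extend (bar_diff A M) u)) + u)"
        by (intro additive_intros additive_fmap)
    qed
    have "?t (frag_extend (bar_diff A M) u) \<in> zspan (bar_rels A B M n)"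
    proof (cases n)
      case 0
      have "frag_extend (bar_diff A M) u = 0" using u(1) 0 by (intro frag_extend_eq_0) (auto intro: W.D_0)
      then show ?thesis by (simp add: zspan.zero)
    next
      case (Suc m)
      then show ?thesis using W.t_R[OF i, of _ m] u(3) by simp
    qed
    from subgrp_cmul[OF subgrp_zspan this, of "(-1) ^ n"]
    have "frag_extend (bar_diff A M) (frag_cmul ((-1) ^ n) (?t u)) - u \<in> zspan (bar_rels A B M n)" by (simp add: eq)
    then show ?thesis
      using d(2)[OF tu] t(2)[OF u(1)] Q(7)[OF bar_diff_frags[OF tu] u(1)] u(2) by simp
  qed
  have Z: "d ` carrier X' = ?Z"
  proof
    show "d ` carrier X' \<subseteq> ?Z"
    proof
      fix x assume "x \<in> d ` carrier X'"
      then obtain v where v: "v \<in> bar_frags A M (Suc n)" "x = d (\<phi>' v)" unfolding P(4)[symmetric] by blast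
      have "frag_extend (bar_diff A M) (frag_extend (bar_diff A M) v) = 0" by (rule bar_diff_diff[OF v(1)])
      then show "x \<in> ?Z"
        using d(2)[OF v(1)] v(2) bar_diff_frags[OF v(1)] Q(11)[OF bar_diff_frags[OF v(1)]] by (auto simp: zspan.zero)
    qed
    show "?Z \<subseteq> d ` carrier X'"
    proof
      fix x assume x: "x \<in> ?Z"
      then have "t x \<in> carrier X'" using bimodule_homD(1)[OF t(1)] by blast
      then show "x \<in> d ` carrier X'" using dt[OF x] by (metis imageI)
    qed
  qed
  then show "d ` carrier X' = ?Z" .
  have "bimodule_hom K A X' (X\<lparr>carrier := d ` carrier X'\<rparr>) d"
    using bimodule_homD[OF d(1)] by (intro bimodule_homI) auto
  moreover have "bimodule_hom K (A\<lparr>carrier := B\<rparr>) (X\<lparr>carrier := d ` carrier X'\<rparr>) X' t"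
    using bimodule_homD[OF t(1)] Z by (intro bimodule_homI) auto
  moreover have "is_bimodule K A (X\<lparr>carrier := d ` carrier X'\<rparr>)" by (rule is_bimodule_image[OF bX' bX d(1)])
  ultimately show "class_E K A B X' (X\<lparr>carrier := d ` carrier X'\<rparr>) d"
    unfolding class_E_def using bX' dt Z by auto
qed

text \<open>A homomorphism from an induced bimodule is determined by its restriction to words with
  the unit pair outermost, where only linearity over \<open>B\<close> is asked. There
  \<open>g\<close> can be lifted by the splitting \<open>s\<close>; the result is \<sigma>.\<close>

lemma bar_lifts:
  fixes P :: "('k, 'a, 'p) bimodule"
  assumes p: "bar_presents K A B M (Suc n) P \<phi>"
  shows "E_lifts TYPE('x) TYPE('y) K A B P"
  unfolding E_lifts_def
proof (intro allI impI)
  fix X :: "('k, 'a, 'x) bimodule" and Y :: "('k, 'a, 'y) bimodule" and f g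
  assume f: "class_E K A B X Y f" and g: "bimodule_hom K A P Y g"
  have bX: "is_bimodule K A X" and bY: "is_bimodule K A Y" and hf: "bimodule_hom K A X Y f"
    using f by (auto simp: class_E_def)
  obtain s where s: "bimodule_hom K (A\<lparr>carrier := B\<rparr>) Y X s" and fs: "\<And>y. y \<in> carrier Y \<Longrightarrow> f (s y) = y"
    using f by (auto simp: class_E_def)
  note x = is_bimoduleD[OF bX] and y = is_bimoduleD[OF bY]
  note hs = bimodule_homD[OF s, simplified] and hg = bimodule_homD[OF g] and hff = bimodule_homD[OF hf]
  note pp = bipresentsD[OF p] note d = presentsD[OF pp(1)]
  note bP = bar_is_bimodule[OF M p]
  note ev = bar_eval_presents[OF bX] bar_eval_of[OF bX]
  let ?i = "(\<one>\<^bsub>A\<^esub>, \<one>\<^bsub>A\<^esub>)" and ?R = "zspan (bar_rels A B X 0)"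
  have i: "?i \<in> carrier A \<times> carrier A" by simp
  interpret x: Module.module K X by (rule x)
  define \<sigma> where "\<sigma> u = s (g (\<phi> (fmap (bar_cons ?i) u)))" for u
  have tc: "fmap (bar_cons ?i) u \<in> bar_frags A M (Suc n)" if "u \<in> bar_frags A M n" for u
    using that by (rule fmap_frags) (rule W.t_W[OF i])
  have \<sigma>c: "\<sigma> u \<in> carrier X" if "u \<in> bar_frags A M n" for u
    unfolding \<sigma>_def by (intro hs hg d(11) tc that)
  have \<sigma>_diff: "\<sigma> (u - v) = \<sigma> u \<ominus>\<^bsub>X\<^esub> \<sigma> v" if uv: "u \<in> bar_frags A M n" "v \<in> bar_frags A M n" for u v
  proof -
    have uv': "u - v \<in> bar_frags A M n" by (rule subgrp_diff[OF subgrp_frags uv])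
    have "fmap (bar_cons ?i) u = fmap (bar_cons ?i) (u - v) + fmap (bar_cons ?i) v" by (simp add: fmap_diff)
    then have "\<sigma> u = \<sigma> (u - v) \<oplus>\<^bsub>X\<^esub> \<sigma> v"
      unfolding \<sigma>_def using d(6)[OF tc[OF uv'] tc[OF uv(2)]] hg(2)[OF d(11)[OF tc[OF uv']] d(11)[OF tc[OF uv(2)]]]
        hs(2)[OF hg(1)[OF d(11)[OF tc[OF uv']]] hg(1)[OF d(11)[OF tc[OF uv(2)]]]] by simp
    then show ?thesis using \<sigma>c[OF uv'] \<sigma>c[OF uv(2)] by (simp add: a_minus_def x.M.a_assoc x.M.r_neg)
  qed
  have \<sigma>_null: "\<sigma> u = \<zero>\<^bsub>X\<^esub>" if "u \<in> zspan (bar_rels A B M n)" for u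
  proof -
    have "\<phi> (fmap (bar_cons ?i) u) = \<zero>\<^bsub>P\<^esub>"
      using presents_zero_iff[OF pp(1)] W.t_R[OF i that] d(3) by blast
    then show ?thesis
      unfolding \<sigma>_def using bimodule_hom_zero[OF bP bY g] bimodule_hom_zero[OF is_bimodule_B[OF bY] is_bimodule_B[OF bX] s] by simp
  qed
  \<comment> \<open>Every word arises from one with the unit pair outermost by the two actions; the
    lift and \<open>g\<close> are compared through this.\<close>
  have gen: "\<phi> (frag_of (bar_cons (c, e) w)) = lact P c (ract P (\<phi> (frag_of (bar_cons ?i w))) e)"
    if c: "c \<in> carrier A" "e \<in> carrier A" and w: "w \<in> bar_gens A M n" for c e w
  proof -
    have t: "frag_of (bar_cons ?i w) \<in> bar_frags A M (Suc n)" "frag_of (bar_cons (\<one>\<^bsub>A\<^esub>, e) w) \<in> bar_frags A M (Suc n)"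
      using W.t_W[OF i w] W.t_W[OF _ w, of "(\<one>\<^bsub>A\<^esub>, e)"] c by simp_all
    show ?thesis
      using pp(6)[OF c(2) t(1)] pp(5)[OF c(1) t(2)] W.\<rho>_t[OF _ i w, of "(\<one>\<^bsub>A\<^esub>, e)"] W.\<rho>_t[OF _ _ w, of "(c, \<one>\<^bsub>A\<^esub>)" "(\<one>\<^bsub>A\<^esub>, e)"] c
      by (simp add: bar_mul_def)
  qed
  \<comment> \<open>Balancing moves a pair from \<open>B\<close> between \<open>w\<close> and the
    letters outside it, and \<open>s\<close> commutes with the actions of \<open>B\<close>; hence
    \<sigma> is linear over \<open>B\<close>.\<close>
  have \<sigma>_act: "\<sigma> (frag_of (bar_act A M (c, e) w)) = lact X c (ract X (\<sigma> (frag_of w)) e)"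
    if c: "c \<in> B" "e \<in> B" and w: "w \<in> bar_gens A M n" for c e w
  proof -
    have cA: "c \<in> carrier A" "e \<in> carrier A" using c by (simp_all add: B_mem)
    have t: "frag_of (bar_cons ?i w) \<in> bar_frags A M (Suc n)" using W.t_W[OF i w] by simp
    note P1 = d(11)[OF t]
    have a: "bar_act A M (c, e) w \<in> bar_gens A M n" using W.\<rho>_W[OF _ w, of "(c, e)"] cA by simp
    have "frag_of (bar_cons ?i (bar_act A M (c, e) w)) - frag_of (bar_cons (c, e) w) \<in> zspan (bar_rels A B M (Suc n))"
      using W.t_bal[OF i _ w, of "(c, e)"] c cA by (simp add: bar_mul_def)
    then have "\<phi> (frag_of (bar_cons ?i (bar_act A M (c, e) w))) = \<phi> (frag_of (bar_cons (c, e) w))"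
      using d(7)[of "frag_of (bar_cons ?i (bar_act A M (c, e) w))" "frag_of (bar_cons (c, e) w)"] W.t_W[OF i a] W.t_W[OF _ w, of "(c, e)"] cA
      by simp
    then show ?thesis
      unfolding \<sigma>_def using gen[OF cA w] cA c P1 is_bimoduleD(2,3)[OF bP] hg y(2,3) by (simp add: hs)
  qed
  \<comment> \<open>Extends \<sigma> to all outermost pairs by acting on its values from both sides.
    The results are written as words of length 0 over \<open>X\<close>, to be evaluated by
    \<open>bar_eval X\<close>, so that \<open>bimodule_hom_pmap\<close> applies.\<close>
  define F where "F = (\<lambda>(as, m, bs). frag_of ([] :: 'a list, lact X (hd as) (ract X (\<sigma> (frag_of (tl as, m, tl bs))) (hd bs)), [] :: 'a list))"
  have F: "F (bar_cons (c, e) w) = frag_of ([], lact X c (ract X (\<sigma> (frag_of w)) e), [])" for c e w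
    by (cases w) (simp add: F_def bar_cons_def)
  have \<sigma>w: "\<sigma> (frag_of w) \<in> carrier X" if "w \<in> bar_gens A M n" for w using \<sigma>c[of "frag_of w"] that by simp
  have F_gens: "frag_extend F (frag_of w) \<in> bar_frags A X 0" if w: "w \<in> bar_gens A M (Suc n)" for w
  proof -
    obtain c e v where "c \<in> carrier A" "e \<in> carrier A" "v \<in> bar_gens A M n" "w = bar_cons (c, e) v"
      using w by (rule bar_gens_SucE)
    then show ?thesis using \<sigma>w[of v] by (simp add: F bar_gens_iff x)
  qed
  have F_rel: "frag_extend F r \<in> ?R" if "r \<in> bar_rels A B M (Suc n)" for r
    using that
  proof (cases rule: W.R_cases)
    \<comment> \<open>\<open>q\<close> is null among the inner words, so \<open>\<sigma> q\<close>
      is zero; \<open>bar_frag_linear\<close> compares the formal sum of the values with the value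
      of the sum.\<close>
    case (t m j q)
    obtain c e where j: "j = (c, e)" "c \<in> carrier A" "e \<in> carrier A" using t(2) by (cases j) auto
    define \<theta> where "\<theta> u = lact X c (ract X (\<sigma> u) e)" for u
    have q: "q \<in> bar_frags A M n" "q \<in> zspan (bar_rels A B M n)" using t(1,3) W.R_frags[of n] by (auto intro: zspan.base)
    have lr0: "lact X c (ract X (z \<ominus>\<^bsub>X\<^esub> z') e) = lact X c (ract X z e) \<ominus>\<^bsub>X\<^esub> lact X c (ract X z' e)"
      if "z \<in> carrier X" "z' \<in> carrier X" for z z'
    proof -
      have "z = (z \<ominus>\<^bsub>X\<^esub> z') \<oplus>\<^bsub>X\<^esub> z'" using that by (simp add: a_minus_def x.M.a_assoc x.M.l_neg)
      then have "lact X c (ract X z e) = lact X c (ract X (z \<ominus>\<^bsub>X\<^esub> z') e) \<oplus>\<^bsub>X\<^esub> lact X c (ract X z' e)"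
        using that j x(2-5) x.M.minus_closed by metis
      then show ?thesis using that j x(2,3) by (simp add: a_minus_def x.M.a_assoc x.M.r_neg)
    qed
    have "frag_extend F r = frag_extend (\<lambda>w. frag_of ([], \<theta> (frag_of w), [])) q"
      unfolding t(4) frag_extend_fmap by (simp add: j F \<theta>_def)
    moreover have "frag_extend (\<lambda>w. frag_of ([], \<theta> (frag_of w), [])) q - frag_of ([], \<theta> q, []) \<in> ?R"
      by (rule bar_frag_linear[OF bX _ _ q(1)]) (simp_all add: \<theta>_def \<sigma>c \<sigma>_diff lr0 x j)
    moreover have "\<theta> q = \<zero>\<^bsub>X\<^esub>"
      using \<sigma>_null[OF q(2)] bimodule_act_zero[OF bX] j by (simp add: \<theta>_def)
    moreover have "frag_of ([], \<zero>\<^bsub>X\<^esub>, []) \<in> ?R"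
    proof -
      have "frag_of ([], \<zero>\<^bsub>X\<^esub>, []) - frag_of ([], \<zero>\<^bsub>X\<^esub>, []) - frag_of ([], \<zero>\<^bsub>X\<^esub>, []) \<in> ?R"
        using bar_add_middle[OF bX, of "[]" "\<zero>\<^bsub>X\<^esub>" "[]" 0 "\<zero>\<^bsub>X\<^esub>"] by (simp add: bar_gens_iff del: bar_rels.simps)
      from subgrp_minus[OF subgrp_zspan this] show ?thesis by (simp del: bar_rels.simps)
    qed
    ultimately show ?thesis using subgrp_mem_cong[OF subgrp_zspan] by metis
  next
    case (add m j k l w)
    then have w: "w \<in> bar_gens A M n" by simp
    let ?z = "\<lambda>j. lact X (fst j) (ract X (\<sigma> (frag_of w)) (snd j))"
    have Fj: "F (bar_cons j w) = frag_of ([], ?z j, [])" for j using F[of "fst j" "snd j" w] by simp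
    have "?z j = ?z k \<oplus>\<^bsub>X\<^esub> ?z l" "?z k \<in> carrier X" "?z l \<in> carrier X"
      using add(2) \<sigma>w[OF w] by (auto simp: bar_add_def x)
    then show ?thesis
      using bar_add_middle[OF bX, of "[]" "?z k" "[]" 0 "?z l"]
      by (simp add: add(4) frag_extend_diff Fj bar_gens_iff del: bar_rels.simps)
  next
    case (bal m j k w)
    then have w: "w \<in> bar_gens A M n" by simp
    obtain a e c f' where jk: "j = (a, e)" "k = (c, f')" "a \<in> carrier A" "e \<in> carrier A" "c \<in> B" "f' \<in> B"
      using bal(2,3) by (cases j; cases k) auto
    have "F (bar_cons j (bar_act A M k w)) = F (bar_cons (bar_mul A j k) w)"
      unfolding jk bar_mul_def fst_conv snd_conv F \<sigma>_act[OF jk(5,6) w]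
      using jk \<sigma>w[OF w] by (simp add: x B_mem)
    then show ?thesis by (simp add: bal(5) frag_extend_diff zspan.zero del: bar_rels.simps)
  qed simp
  have F_N: "frag_extend F u \<in> ?R" if "u \<in> zspan (bar_rels A B M (Suc n))" for u
    using zspan_map[OF additive_frag_extend subgrp_zspan F_rel that] .
  have Fs: "frag_extend F (frag_of (bar_scale M c w)) - fmap (bar_scale X c) (frag_extend F (frag_of w)) \<in> ?R"
    if c: "c \<in> carrier K" and w: "w \<in> bar_gens A M (Suc n)" for c w
  proof -
    obtain a e v where v: "a \<in> carrier A" "e \<in> carrier A" "v \<in> bar_gens A M n" "w = bar_cons (a, e) v"
      using w by (rule bar_gens_SucE)
    have "\<phi> (frag_of (bar_cons ?i (bar_scale M c v))) = c \<odot>\<^bsub>P\<^esub> \<phi> (frag_of (bar_cons ?i v))"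
      using d(10)[OF c, of "frag_of (bar_cons ?i v)"] W.t_W[OF i v(3)] by (simp add: bar_scale_cons)
    then have "\<sigma> (frag_of (bar_scale M c v)) = c \<odot>\<^bsub>X\<^esub> \<sigma> (frag_of v)"
      using c hg hs d(11)[of "frag_of (bar_cons ?i v)"] W.t_W[OF i v(3)] by (simp add: \<sigma>_def)
    then have "frag_extend F (frag_of (bar_scale M c w)) = fmap (bar_scale X c) (frag_extend F (frag_of w))"
      using c v \<sigma>w[OF v(3)] by (simp add: F bar_scale_cons) (simp add: bar_scale_def x)
    then show ?thesis by (simp add: zspan.zero del: bar_rels.simps)
  qed
  have Fa: "frag_extend F (frag_of (bar_act A M j w)) - fmap (bar_act A X j) (frag_extend F (frag_of w)) \<in> ?R"
    if j: "j \<in> carrier A \<times> carrier A" and w: "w \<in> bar_gens A M (Suc n)" for j w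
  proof -
    obtain a e v where v: "a \<in> carrier A" "e \<in> carrier A" "v \<in> bar_gens A M n" "w = bar_cons (a, e) v"
      using w by (rule bar_gens_SucE)
    have "bar_act A M j w = bar_cons (fst j \<otimes>\<^bsub>A\<^esub> a, e \<otimes>\<^bsub>A\<^esub> snd j) v"
      using W.\<rho>_t[OF j _ v(3), of "(a, e)"] v by (simp add: bar_mul_def)
    then have "frag_extend F (frag_of (bar_act A M j w)) = fmap (bar_act A X j) (frag_extend F (frag_of w))"
      using j v \<sigma>w[OF v(3)] by (auto simp add: F bar_act_def x)
    then show ?thesis by (simp add: zspan.zero del: bar_rels.simps)
  qed
  have Fl: "frag_extend F (frag_of (bar_act A M (a, \<one>\<^bsub>A\<^esub>) w)) - fmap (bar_act A X (a, \<one>\<^bsub>A\<^esub>)) (frag_extend F (frag_of w)) \<in> ?R"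
    and Fr: "frag_extend F (frag_of (bar_act A M (\<one>\<^bsub>A\<^esub>, a) w)) - fmap (bar_act A X (\<one>\<^bsub>A\<^esub>, a)) (frag_extend F (frag_of w)) \<in> ?R"
    if "a \<in> carrier A" "w \<in> bar_gens A M (Suc n)" for a w
    using Fa[OF _ that(2)] that(1) by (simp_all del: bar_rels.simps)
  note h = bimodule_hom_pmap[OF p ev(1) additive_frag_extend F_gens F_N Fs Fl Fr subset_refl]
  define H where "H = pmap (bar_frags A M (Suc n)) \<phi> (bar_eval X) (frag_extend F)"
  have hH: "bimodule_hom K A P X H" using h(1) by (simp add: H_def)
  moreover have "f (H z) = g z" if "z \<in> carrier P" for z
  proof (rule bipresents_hom_eq[OF p bP bY bimodule_hom_comp[OF hH hf] g _ that])
    fix w assume w: "w \<in> bar_gens A M (Suc n)"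
    obtain a e v where v: "a \<in> carrier A" "e \<in> carrier A" "v \<in> bar_gens A M n" "w = bar_cons (a, e) v"
      using w by (rule bar_gens_SucE)
    have t: "frag_of (bar_cons ?i v) \<in> bar_frags A M (Suc n)" using W.t_W[OF i v(3)] by simp
    have "H (\<phi> (frag_of w)) = lact X a (ract X (\<sigma> (frag_of v)) e)"
      unfolding H_def using h(2)[of "frag_of w"] w v \<sigma>w[OF v(3)] by (simp add: F ev(2) x)
    then have "f (H (\<phi> (frag_of w))) = lact Y a (ract Y (f (\<sigma> (frag_of v))) e)"
      using v \<sigma>w[OF v(3)] by (simp add: hff x)
    also have "f (\<sigma> (frag_of v)) = g (\<phi> (frag_of (bar_cons ?i v)))"
      unfolding \<sigma>_def using fs hg(1) d(11)[OF t] by simp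
    finally show "f (H (\<phi> (frag_of w))) = g (\<phi> (frag_of w))"
      using gen[OF v(1,2,3)] v d(11)[OF t] is_bimoduleD(2,3)[OF bP] by (simp add: hg)
  qed
  ultimately show "\<exists>h. bimodule_hom K A P X h \<and> (\<forall>p\<in>carrier P. f (h p) = g p)" by blast
qed

text \<open>The index is shifted by one: words of length 1 form \<open>P 0\<close>, and the
  differential from length 1 to length 0, evaluated in \<open>M\<close>, is the
  augmentation.\<close>

theorem bar_resolution:
  "\<exists>d e. E_resolution K A B M (\<lambda>n. bar_bimodule A B M (Suc n)) d e"
proof -
  define P where "P n = bar_bimodule A B M (Suc n)" for n
  define cl where "cl n = bar_class A B M (Suc n)" for n
  define d where "d n = pmap (bar_frags A M (Suc n)) (cl n) (cl (n - 1)) (frag_extend (bar_diff A M))" for n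
  define e where "e = pmap (bar_frags A M 1) (cl 0) (bar_eval M) (frag_extend (bar_diff A M))"
  have p: "bar_presents K A B M (Suc n) (P n) (cl n)" for n
    unfolding P_def cl_def by (rule bar_bimodule_presents[OF M])
  have p0: "bar_presents K A B M (Suc 0) (P 0) (cl 0)" by (rule p)
  note q = bar_eval_presents[OF M]
  have bP: "is_bimodule K A (P n)" for n by (rule bar_is_bimodule[OF M p])
  have eh: "bimodule_hom K A (P 0) M e" and e_cl: "\<And>u. u \<in> bar_frags A M 1 \<Longrightarrow> e (cl 0 u) = bar_eval M (frag_extend (bar_diff A M) u)"
    using bar_diff_hom[OF p0 q] unfolding e_def by simp_all
  have dh: "bimodule_hom K A (P (Suc n)) (P n) (d (Suc n))"
    and d_cl: "\<And>u. u \<in> bar_frags A M (Suc (Suc n)) \<Longrightarrow> d (Suc n) (cl (Suc n) u) = cl n (frag_extend (bar_diff A M) u)" for n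
    using bar_diff_hom[OF p[of "Suc n"] p[of n]] unfolding d_def by simp_all
  have E0: "class_E K A B (P 0) (M\<lparr>carrier := e ` carrier (P 0)\<rparr>) e"
    "e ` carrier (P 0) = {x \<in> carrier M. \<exists>u\<in>bar_frags A M 0. x = bar_eval M u}"
    using bar_class_E[OF p0 q] unfolding e_def by simp_all
  have ES: "class_E K A B (P (Suc n)) ((P n)\<lparr>carrier := d (Suc n) ` carrier (P (Suc n))\<rparr>) (d (Suc n))"
    "d (Suc n) ` carrier (P (Suc n)) = {x \<in> carrier (P n). \<exists>u\<in>bar_frags A M (Suc n). x = cl n u \<and>
      frag_extend (bar_diff A M) u \<in> zspan (bar_rels A B M n)}" for n
    using bar_class_E[OF p[of "Suc n"] p[of n]] unfolding d_def by simp_all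
  have "\<exists>u\<in>bar_frags A M 0. x = bar_eval M u" if "x \<in> carrier M" for x
    using that[folded presentsD(4)[OF bipresentsD(1)[OF q]]] by (elim imageE) blast
  then have e_onto: "e ` carrier (P 0) = carrier M"
    unfolding E0(2) by blast
  note Pc = presentsD(4)[OF bipresentsD(1)[OF p]]
  have ker_e: "d 1 ` carrier (P 1) = {x \<in> carrier (P 0). e x = \<zero>\<^bsub>M\<^esub>}"
  proof -
    have iff: "e (cl 0 u) = \<zero>\<^bsub>M\<^esub> \<longleftrightarrow> frag_extend (bar_diff A M) u \<in> zspan (bar_rels A B M 0)" if "u \<in> bar_frags A M 1" for u
      using e_cl[OF that] presents_zero_iff[OF bipresentsD(1)[OF q] bar_diff_frags] that by simp
    show ?thesis
    proof (intro equalityI subsetI)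
      fix x assume "x \<in> d 1 ` carrier (P 1)"
      then obtain u where "u \<in> bar_frags A M 1" "x = cl 0 u" "x \<in> carrier (P 0)" "frag_extend (bar_diff A M) u \<in> zspan (bar_rels A B M 0)"
        using ES(2)[of 0] unfolding One_nat_def by blast
      then show "x \<in> {x \<in> carrier (P 0). e x = \<zero>\<^bsub>M\<^esub>}" using iff by blast
    next
      fix x assume x: "x \<in> {x \<in> carrier (P 0). e x = \<zero>\<^bsub>M\<^esub>}"
      then obtain u where "u \<in> bar_frags A M 1" "x = cl 0 u" using Pc[of 0] unfolding One_nat_def by blast
      then show "x \<in> d 1 ` carrier (P 1)" using ES(2)[of 0] iff x unfolding One_nat_def by blast
    qed
  qed
  have ker_d: "d (Suc (Suc n)) ` carrier (P (Suc (Suc n))) = cycles P d (Suc n)" for n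
  proof -
    have iff: "d (Suc n) (cl (Suc n) u) = \<zero>\<^bsub>P n\<^esub> \<longleftrightarrow> frag_extend (bar_diff A M) u \<in> zspan (bar_rels A B M (Suc n))"
      if "u \<in> bar_frags A M (Suc (Suc n))" for u
      using d_cl[OF that] presents_zero_iff[OF bipresentsD(1)[OF p[of n]] bar_diff_frags[OF that]] by simp
    have c: "cycles P d (Suc n) = {x \<in> carrier (P (Suc n)). d (Suc n) x = \<zero>\<^bsub>P n\<^esub>}" by (simp add: cycles_def)
    show ?thesis
      unfolding c
    proof (intro equalityI subsetI)
      fix x assume "x \<in> d (Suc (Suc n)) ` carrier (P (Suc (Suc n)))"
      then have "x \<in> carrier (P (Suc n)) \<and> (\<exists>u\<in>bar_frags A M (Suc (Suc n)). x = cl (Suc n) u \<and>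
          frag_extend (bar_diff A M) u \<in> zspan (bar_rels A B M (Suc n)))"
        unfolding ES(2)[of "Suc n"] by simp
      then show "x \<in> {x \<in> carrier (P (Suc n)). d (Suc n) x = \<zero>\<^bsub>P n\<^esub>}"
        using iff by auto
    next
      fix x assume x: "x \<in> {x \<in> carrier (P (Suc n)). d (Suc n) x = \<zero>\<^bsub>P n\<^esub>}"
      then have "x \<in> cl (Suc n) ` bar_frags A M (Suc (Suc n))" using Pc[of "Suc n"] by simp
      then obtain u where u: "u \<in> bar_frags A M (Suc (Suc n))" "x = cl (Suc n) u" by (elim imageE) blast
      then show "x \<in> d (Suc (Suc n)) ` carrier (P (Suc (Suc n)))" unfolding ES(2)[of "Suc n"] using iff[OF u(1)] x by auto
    qed
  qed
  have "E_projective K A B (P n)" for n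
    unfolding E_projective_def using bP bar_lifts[OF p] by blast
  moreover have "d (Suc n) ` carrier (P (Suc n)) = cycles P d n" if "n > 0" for n
    using ker_d[of "n - 1"] that by simp
  moreover have "class_E K A B (P 0) M e" using E0(1) by (simp add: e_onto)
  ultimately have "E_resolution K A B M P d e"
    unfolding E_resolution_def using dh eh e_onto ker_e ES(1) by blast
  then show ?thesis unfolding P_def by blast
qed

end

text \<open>\<open>d\<close> is the multiplication from \<open>A \<otimes> P \<otimes> A\<close> to
  \<open>P\<close>, a member of the class by \<open>bar_class_E\<close>. The carrier type of the bar
  bimodule differs from the test types fixed in \<open>E_projective\<close>, so the identity is
  lifted by \<open>E_projective_lifts\<close>.\<close>

lemma projective_section:
  assumes P: "E_projective K A B P"
  obtains s where "bimodule_hom K A P (bar_bimodule A B P 1) s"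
    "\<And>p u. p \<in> carrier P \<Longrightarrow> u \<in> bar_frags A P 1 \<Longrightarrow> s p = bar_class A B P 1 u \<Longrightarrow>
       bar_eval P (frag_extend (bar_diff A P) u) = p"
proof -
  have bP: "is_bimodule K A P" using P by (simp add: E_projective_def)
  have p: "bar_presents K A B P (Suc 0) (bar_bimodule A B P 1) (bar_class A B P 1)"
    using bar_bimodule_presents[OF bP, of 1] by simp
  note q = bar_eval_presents[OF bP]
  define d where "d = pmap (bar_frags A P (Suc 0)) (bar_class A B P 1) (bar_eval P) (frag_extend (bar_diff A P))"
  have "\<exists>u\<in>bar_frags A P 0. x = bar_eval P u" if "x \<in> carrier P" for x
    using that[folded presentsD(4)[OF bipresentsD(1)[OF q]]] by (elim imageE) blast
  then have "d ` carrier (bar_bimodule A B P 1) = carrier P"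
    unfolding d_def bar_class_E(2)[OF bP p q] by blast
  then have E: "class_E K A B (bar_bimodule A B P 1) P d"
    using bar_class_E(1)[OF bP p q] unfolding d_def by simp
  have "bimodule_hom K A P P (\<lambda>p. p)" by (rule bimodule_homI) auto
  then obtain s where s: "bimodule_hom K A P (bar_bimodule A B P 1) s" "\<And>p. p \<in> carrier P \<Longrightarrow> d (s p) = p"
    using E_projective_lifts[OF alg sub P] E unfolding E_lifts_def by blast
  show ?thesis
  proof (rule that[OF s(1)])
    fix p u assume "p \<in> carrier P" "u \<in> bar_frags A P 1" "s p = bar_class A B P 1 u"
    then show "bar_eval P (frag_extend (bar_diff A P) u) = p"
      using s(2)[of p] bar_diff_hom(2)[OF bP p q, of u] by (simp add: d_def)
  qed
qed

end


section \<open>Vanishing on projectives\<close>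

context algebra_ext
begin

lemma hoch_null_mem_rels: "r \<in> tensor_rels A B X n \<Longrightarrow> r \<in> hoch_null A B X n"
  using hoch_null_R by (blast intro: zspan.base)

lemma bar_gens_1: "bar_gens A P 1 = {([a], x, [b]) | a x b. a \<in> carrier A \<and> x \<in> carrier P \<and> b \<in> carrier A}"
  by (auto simp: bar_gens_def length_Suc_conv)

text \<open>If \<open>s\<close> is a section of \<open>A \<otimes> P \<otimes> A \<rightarrow> P\<close> and \<open>s x\<close> is the sum of the \<open>a \<otimes> y \<otimes> b\<close>, then the
  contraction sends \<open>x \<otimes> a1 \<otimes> \<dots> \<otimes> an\<close> to the sum of the \<open>a y \<otimes> b \<otimes> a1 \<otimes> \<dots> \<otimes> an\<close>.\<close>

definition unfold_word :: "('k, 'a, 'p) bimodule \<Rightarrow> 'a list \<Rightarrow> 'a list \<times> 'p \<times> 'a list \<Rightarrow> 'p \<times> 'a list" where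
  "unfold_word P cs = (\<lambda>(as, x, bs). (lact P (hd as) x, hd bs # cs))"

context
  fixes P :: "('k, 'a, 'p) bimodule"
  assumes bP: "is_bimodule K A P"
begin

interpretation W: bar_words "bar_gens A P" "bar_rels A B P" "carrier A \<times> carrier A" "B \<times> B" "bar_mul A" "bar_add A"
    bar_cons "bar_act A P" "bar_diff A P"
  by (rule bar_words[OF bP])

interpretation p: Module.module K P by (rule is_bimoduleD[OF bP])

text \<open>Transfers \<open>bar_frag_linear\<close> to Hochschild words: \<open>m\<close> turns a
  bar word of length 0 into a word with letters \<open>as\<close>.\<close>

lemma hoch_frag_linear:
  assumes \<theta>: "\<And>u. u \<in> frags S \<Longrightarrow> \<theta> u \<in> carrier P"
      "\<And>u v. u \<in> frags S \<Longrightarrow> v \<in> frags S \<Longrightarrow> \<theta> (u - v) = \<theta> u \<ominus>\<^bsub>P\<^esub> \<theta> v"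
    and u: "u \<in> frags S" and as: "set as \<subseteq> carrier A" "length as = n"
  shows "frag_extend (\<lambda>w. frag_of (\<theta> (frag_of w), as)) u - frag_of (\<theta> u, as) \<in> hoch_null A B P n"
proof -
  define m where "m = (\<lambda>(cs :: 'a list, z :: 'p, ds :: 'a list). (z, as))"
  have "fmap m r \<in> hoch_null A B P n" if "r \<in> zspan (bar_rels A B P 0)" for r
  proof (rule zspan_map[OF additive_fmap(1) subgrp_hoch_null _ that])
    fix r assume "r \<in> bar_rels A B P 0"
    then show "fmap m r \<in> hoch_null A B P n"
      using as by (auto simp: fmap_diff m_def tensor_gens_iff intro!: hoch_null_addx)
  qed
  from this[OF bar_frag_linear[OF bP \<theta> u]]
  have "fmap m (frag_extend (\<lambda>w. frag_of ([], \<theta> (frag_of w), [])) u) - frag_of (\<theta> u, as) \<in> hoch_null A B P n"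
    by (simp add: fmap_diff m_def)
  moreover have "fmap m (fmap (\<lambda>w. ([], \<theta> (frag_of w), [])) u) = fmap (\<lambda>w. (\<theta> (frag_of w), as)) u"
    by (simp add: fmap_fmap m_def)
  ultimately show ?thesis by (simp add: fmap_def)
qed

lemma unfold_word_gens:
  "set cs \<subseteq> carrier A \<Longrightarrow> w \<in> bar_gens A P 1 \<Longrightarrow> unfold_word P cs w \<in> tensor_gens A P (Suc (length cs))"
  unfolding bar_gens_1 by (auto simp: unfold_word_def tensor_gens_iff is_bimoduleD[OF bP])

text \<open>Balancing a pair over \<open>B\<close> has two effects here. Its left half disappears,
  since the left letter is multiplied into the module element; its right half becomes a balancing at
  the first tensor sign.\<close>

lemma unfold_word_null:
  assumes cs: "set cs \<subseteq> carrier A" and u: "u \<in> zspan (bar_rels A B P 1)"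
  shows "fmap (unfold_word P cs) u \<in> hoch_null A B P (Suc (length cs))"
proof (rule zspan_map[OF additive_fmap(1) subgrp_hoch_null _ u])
  note x = is_bimoduleD[OF bP]
  fix r assume "r \<in> bar_rels A B P 1"
  then have "fmap (unfold_word P cs) r \<in> tensor_rels A B P (Suc (length cs))"
  proof (cases rule: W.R_cases)
    case (t m i s)
    then obtain y y' where y: "y \<in> carrier P" "y' \<in> carrier P"
      "s = frag_of ([], y \<oplus>\<^bsub>P\<^esub> y', []) - frag_of ([], y, []) - frag_of ([], y', [])" by auto
    have "fmap (unfold_word P cs) r = frag_of (lact P (fst i) y \<oplus>\<^bsub>P\<^esub> lact P (fst i) y', snd i # cs)
        - frag_of (lact P (fst i) y, snd i # cs) - frag_of (lact P (fst i) y', snd i # cs)"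
      using t(2) y by (auto simp: t(4) y(3) fmap_diff bar_cons_def unfold_word_def x)
    also have "\<dots> \<in> tensor_rels A B P (Suc (length cs))"
      by (rule tensor_relsI(1)) (use t(2) y cs x(2) in \<open>auto simp: tensor_gens_iff\<close>)
    finally show ?thesis .
  next
    case (add m i j k w)
    then obtain y where y: "y \<in> carrier P" "w = ([], y, [])" by (auto simp: bar_gens_0)
    from add(2) consider a a' b where "i = (a \<oplus>\<^bsub>A\<^esub> a', b)" "j = (a, b)" "k = (a', b)" "a \<in> carrier A" "a' \<in> carrier A" "b \<in> carrier A"
      | a b b' where "i = (a, b \<oplus>\<^bsub>A\<^esub> b')" "j = (a, b)" "k = (a, b')" "a \<in> carrier A" "b \<in> carrier A" "b' \<in> carrier A"
      unfolding bar_add_def by blast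
    then show ?thesis
    proof cases
      case 1
      have "fmap (unfold_word P cs) r = frag_of (lact P a y \<oplus>\<^bsub>P\<^esub> lact P a' y, b # cs)
          - frag_of (lact P a y, b # cs) - frag_of (lact P a' y, b # cs)"
        using 1 y by (simp add: add(4) fmap_diff bar_cons_def unfold_word_def x)
      also have "\<dots> \<in> tensor_rels A B P (Suc (length cs))"
        by (rule tensor_relsI(1)) (use 1 y cs x(2) in \<open>auto simp: tensor_gens_iff\<close>)
      finally show ?thesis .
    next
      case 2
      have "fmap (unfold_word P cs) r = frag_of (lact P a y, (b # cs)[0 := b \<oplus>\<^bsub>A\<^esub> b'])
          - frag_of (lact P a y, (b # cs)[0 := b]) - frag_of (lact P a y, (b # cs)[0 := b'])"
        using 2 y by (simp add: add(4) fmap_diff bar_cons_def unfold_word_def)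
      also have "\<dots> \<in> tensor_rels A B P (Suc (length cs))"
        by (rule tensor_relsI(2)) (use 2 y cs x(2) in \<open>auto simp: tensor_gens_iff\<close>)
      finally show ?thesis .
    qed
  next
    case (bal m i j w)
    then obtain y where y: "y \<in> carrier P" "w = ([], y, [])" by (auto simp: bar_gens_0)
    obtain a b c e where ij: "i = (a, b)" "j = (c, e)" "a \<in> carrier A" "b \<in> carrier A" "c \<in> B" "e \<in> B"
      using bal(2,3) by (cases i; cases j) auto
    have "fmap (unfold_word P cs) r = frag_of (ract P (lact P (a \<otimes>\<^bsub>A\<^esub> c) y) e, b # cs)
        - frag_of (lact P (a \<otimes>\<^bsub>A\<^esub> c) y, (b # cs)[0 := e \<otimes>\<^bsub>A\<^esub> (b # cs) ! 0])"
      using ij y by (simp add: bal(5) fmap_diff bar_cons_def unfold_word_def bar_act_def bar_mul_def x B_mem)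
    also have "\<dots> \<in> tensor_rels A B P (Suc (length cs))"
      by (rule tensor_relsI(3)) (use ij y cs x(2) B_mem in \<open>auto simp: tensor_gens_iff\<close>)
    finally show ?thesis .
  qed simp
  then show "fmap (unfold_word P cs) r \<in> hoch_null A B P (Suc (length cs))" by (rule hoch_null_mem_rels)
qed

lemma unfold_word_ract:
  assumes "w \<in> bar_gens A P 1" "b \<in> carrier A"
  shows "unfold_word P cs (bar_act A P (\<one>\<^bsub>A\<^esub>, b) w) = (fst (unfold_word P cs w), (hd (snd (unfold_word P cs w)) \<otimes>\<^bsub>A\<^esub> b) # cs)"
  using assms unfolding bar_gens_1 by (auto simp: unfold_word_def bar_act_def)

lemma unfold_word_lact:
  assumes "w \<in> bar_gens A P 1" "b \<in> carrier A"
  shows "unfold_word P cs (bar_act A P (b, \<one>\<^bsub>A\<^esub>) w) = apfst (lact P b) (unfold_word P cs w)"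
  using assms unfolding bar_gens_1 by (auto simp: unfold_word_def bar_act_def is_bimoduleD[OF bP])

text \<open>The inserted letter shifts the positions of \<open>as\<close> by one, so a balancing at
  the first tensor sign turns into one between the first two letters.\<close>

lemma unfold_word_rel:
  assumes u: "u \<in> bar_frags A P 1" and x: "(x, as) \<in> tensor_gens A P n"
  shows "i < n \<Longrightarrow> a \<in> carrier A \<Longrightarrow> a' \<in> carrier A \<Longrightarrow>
      fmap (unfold_word P (as[i := a \<oplus>\<^bsub>A\<^esub> a'])) u - fmap (unfold_word P (as[i := a])) u -
        fmap (unfold_word P (as[i := a'])) u \<in> hoch_null A B P (Suc n)" (is "_ \<Longrightarrow> _ \<Longrightarrow> _ \<Longrightarrow> ?adda")
    and "0 < n \<Longrightarrow> b \<in> B \<Longrightarrow> fmap (unfold_word P as) (fmap (bar_act A P (\<one>\<^bsub>A\<^esub>, b)) u) -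
      fmap (unfold_word P (as[0 := b \<otimes>\<^bsub>A\<^esub> as ! 0])) u \<in> hoch_null A B P (Suc n)" (is "_ \<Longrightarrow> _ \<Longrightarrow> ?head")
    and "Suc i < n \<Longrightarrow> b \<in> B \<Longrightarrow> fmap (unfold_word P (as[i := as ! i \<otimes>\<^bsub>A\<^esub> b])) u -
      fmap (unfold_word P (as[Suc i := b \<otimes>\<^bsub>A\<^esub> as ! Suc i])) u \<in> hoch_null A B P (Suc n)" (is "_ \<Longrightarrow> _ \<Longrightarrow> ?bal")
proof -
  have g: "(fst (unfold_word P as w), hd (snd (unfold_word P as w)) # as) \<in> tensor_gens A P (Suc n)"
    if "w \<in> bar_gens A P 1" for w
    using unfold_word_gens[of as w] that x by (auto simp: tensor_gens_iff unfold_word_def split: prod.splits)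
  have e: "unfold_word P cs w = (fst (unfold_word P as w), hd (snd (unfold_word P as w)) # cs)" for cs w
    by (simp add: unfold_word_def split: prod.splits)
  show ?adda if i: "i < n" "a \<in> carrier A" "a' \<in> carrier A"
  proof (rule frags_map[OF _ subgrp_hoch_null _ u])
    fix w assume w: "w \<in> bar_gens A P 1"
    show "fmap (unfold_word P (as[i := a \<oplus>\<^bsub>A\<^esub> a'])) (frag_of w) - fmap (unfold_word P (as[i := a])) (frag_of w) -
        fmap (unfold_word P (as[i := a'])) (frag_of w) \<in> hoch_null A B P (Suc n)"
      using tensor_relsI(2)[OF g[OF w], of "Suc i" a a' B] i
      by (simp add: e[of "as[i := _]"] hoch_null_mem_rels)
  qed (intro additive_intros additive_fmap)
  show ?head if b: "0 < n" "b \<in> B"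
  proof (rule frags_map[OF _ subgrp_hoch_null _ u])
    fix w assume w: "w \<in> bar_gens A P 1"
    have "fmap (unfold_word P as) (fmap (bar_act A P (\<one>\<^bsub>A\<^esub>, b)) (frag_of w)) - fmap (unfold_word P (as[0 := b \<otimes>\<^bsub>A\<^esub> as ! 0])) (frag_of w)
        \<in> tensor_rels A B P (Suc n)"
      using tensor_relsI(4)[OF g[OF w], of 0 b B] b
      by (simp add: e[of "as[0 := _]"] unfold_word_ract[OF w B_mem[OF b(2)]])
    then show "fmap (unfold_word P as) (fmap (bar_act A P (\<one>\<^bsub>A\<^esub>, b)) (frag_of w)) - fmap (unfold_word P (as[0 := b \<otimes>\<^bsub>A\<^esub> as ! 0])) (frag_of w)
        \<in> hoch_null A B P (Suc n)" by (rule hoch_null_mem_rels)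
  qed (intro additive_intros additive_fmap)
  show ?bal if b: "Suc i < n" "b \<in> B"
  proof (rule frags_map[OF _ subgrp_hoch_null _ u])
    fix w assume w: "w \<in> bar_gens A P 1"
    show "fmap (unfold_word P (as[i := as ! i \<otimes>\<^bsub>A\<^esub> b])) (frag_of w) - fmap (unfold_word P (as[Suc i := b \<otimes>\<^bsub>A\<^esub> as ! Suc i])) (frag_of w)
        \<in> hoch_null A B P (Suc n)"
      using tensor_relsI(4)[OF g[OF w], of "Suc i" b B] b
      by (simp add: e[of "as[_ := _]"] hoch_null_mem_rels)
  qed (intro additive_intros additive_fmap)
qed

text \<open>The left action of \<open>b\<close> stays on the module element, while the right action
  hits the last letter; if \<open>as\<close> is empty, that letter is the inserted one.\<close>

lemma unfold_word_comm:
  assumes u: "u \<in> bar_frags A P 1" and as: "set as \<subseteq> carrier A" "length as = n" and b: "b \<in> B"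
  shows "(if as = [] then fmap (unfold_word P []) (fmap (bar_act A P (\<one>\<^bsub>A\<^esub>, b)) u)
      else fmap (unfold_word P (butlast as @ [last as \<otimes>\<^bsub>A\<^esub> b])) u) -
    fmap (unfold_word P as) (fmap (bar_act A P (b, \<one>\<^bsub>A\<^esub>)) u) \<in> hoch_null A B P (Suc n)"
proof -
  have bA: "b \<in> carrier A" using b by (rule B_mem)
  have "fmap (\<lambda>w. hoch_ract A P b (unfold_word P as w)) u - fmap (\<lambda>w. apfst (lact P b) (unfold_word P as w)) u \<in> hoch_null A B P (Suc n)"
    by (rule frags_map[OF _ subgrp_hoch_null _ u])
      (use hoch_null_comm[OF b, of _ P "Suc n"] unfold_word_gens[of as] as in \<open>auto intro!: additive_intros additive_fmap\<close>)
  moreover have "fmap (unfold_word P as) (fmap (bar_act A P (b, \<one>\<^bsub>A\<^esub>)) u) = fmap (\<lambda>w. apfst (lact P b) (unfold_word P as w)) u"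
    unfolding fmap_fmap by (rule fmap_cong[OF _ u]) (rule unfold_word_lact[OF _ bA])
  moreover have "(if as = [] then fmap (unfold_word P []) (fmap (bar_act A P (\<one>\<^bsub>A\<^esub>, b)) u)
      else fmap (unfold_word P (butlast as @ [last as \<otimes>\<^bsub>A\<^esub> b])) u) = fmap (\<lambda>w. hoch_ract A P b (unfold_word P as w)) u"
  proof (cases "as = []")
    case True
    have "fmap (unfold_word P []) (fmap (bar_act A P (\<one>\<^bsub>A\<^esub>, b)) u) = fmap (\<lambda>w. hoch_ract A P b (unfold_word P [] w)) u"
      unfolding fmap_fmap
    proof (rule fmap_cong[OF _ u])
      fix w assume w: "w \<in> bar_gens A P 1"
      show "unfold_word P [] (bar_act A P (\<one>\<^bsub>A\<^esub>, b) w) = hoch_ract A P b (unfold_word P [] w)"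
        unfolding unfold_word_ract[OF w bA] by (cases w) (simp add: hoch_ract_def unfold_word_def)
    qed
    then show ?thesis using True by simp
  next
    case False
    have "unfold_word P (butlast as @ [last as \<otimes>\<^bsub>A\<^esub> b]) w = hoch_ract A P b (unfold_word P as w)" for w
      using False by (simp add: hoch_ract_def unfold_word_def split: prod.splits)
    then have "unfold_word P (butlast as @ [last as \<otimes>\<^bsub>A\<^esub> b]) = (\<lambda>w. hoch_ract A P b (unfold_word P as w))" by (rule ext)
    then show ?thesis using False by simp
  qed
  ultimately show ?thesis by simp
qed

end

text \<open>\<open>h\<close> behaves like an extra degeneracy: face 0 after \<open>h\<close> is the
  identity and face \<open>i + 1\<close> after \<open>h\<close> is \<open>h\<close> after face
  \<open>i\<close>, so the alternating sums cancel. This holds modulo \<open>hoch_null\<close> only,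
  because \<open>rep\<close> chooses representatives of \<open>s y\<close> and respects sums and
  actions merely up to relations.\<close>

lemma projective_contraction:
  assumes P: "E_projective K A B P"
  obtains h where "\<And>n u. u \<in> tfrags A P n \<Longrightarrow> frag_extend h u \<in> tfrags A P (Suc n)"
    "\<And>n u. u \<in> hoch_null A B P n \<Longrightarrow> frag_extend h u \<in> hoch_null A B P (Suc n)"
    "\<And>n u. u \<in> tfrags A P (Suc n) \<Longrightarrow>
      hoch_bd A P (Suc (Suc n)) (frag_extend h u) + frag_extend h (hoch_bd A P (Suc n) u) - u \<in> hoch_null A B P (Suc n)"
proof -
  have bP: "is_bimodule K A P" using P by (simp add: E_projective_def)
  interpret W: bar_words "bar_gens A P" "bar_rels A B P" "carrier A \<times> carrier A" "B \<times> B" "bar_mul A" "bar_add A"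
    bar_cons "bar_act A P" "bar_diff A P"
    by (rule bar_words[OF bP])
  interpret p: Module.module K P by (rule is_bimoduleD[OF bP])
  note x = is_bimoduleD[OF bP]
  let ?T = "bar_bimodule A B P 1" and ?cl = "bar_class A B P 1"
  note q = bar_bimodule_presents[OF bP, of 1] note qd = bipresentsD[OF q] note d = presentsD[OF qd(1)]
  obtain s where s: "bimodule_hom K A P ?T s"
    "\<And>p u. p \<in> carrier P \<Longrightarrow> u \<in> bar_frags A P 1 \<Longrightarrow> s p = ?cl u \<Longrightarrow> bar_eval P (frag_extend (bar_diff A P) u) = p"
    using projective_section[OF P] by blast
  note hs = bimodule_homD[OF s(1)]
  have "\<exists>u\<in>bar_frags A P 1. ?cl u = s y" if "y \<in> carrier P" for y
    using hs(1)[OF that, folded d(4)] by (elim imageE) auto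
  then obtain rep where rep: "\<And>y. y \<in> carrier P \<Longrightarrow> rep y \<in> bar_frags A P 1" "\<And>y. y \<in> carrier P \<Longrightarrow> ?cl (rep y) = s y"
    by metis
  let ?\<psi> = "unfold_word P"
  define h where "h = (\<lambda>(y, as). fmap (?\<psi> as) (rep y))"
  have l1: "bar_act A P (b, \<one>\<^bsub>A\<^esub>) w \<in> bar_gens A P 1" "bar_act A P (\<one>\<^bsub>A\<^esub>, b) w \<in> bar_gens A P 1"
    if "b \<in> carrier A" "w \<in> bar_gens A P 1" for b w
    using that W.\<rho>_W[of "(b, \<one>\<^bsub>A\<^esub>)" w 1] W.\<rho>_W[of "(\<one>\<^bsub>A\<^esub>, b)" w 1] by simp_all
  have L1: "fmap (bar_act A P (b, \<one>\<^bsub>A\<^esub>)) u \<in> bar_frags A P 1" "fmap (bar_act A P (\<one>\<^bsub>A\<^esub>, b)) u \<in> bar_frags A P 1"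
    if "b \<in> carrier A" "u \<in> bar_frags A P 1" for b u
    using that(2) l1[OF that(1)] by (auto elim!: fmap_frags simp del: mem_Collect_eq)
  have same: "fmap (?\<psi> as) u - fmap (?\<psi> as) v \<in> hoch_null A B P (Suc n)"
    if as: "set as \<subseteq> carrier A" "length as = n" and uv: "u \<in> bar_frags A P 1" "v \<in> bar_frags A P 1" "?cl u = ?cl v" for as n u v
  proof -
    have "u - v \<in> zspan (bar_rels A B P 1)" using d(7)[OF uv(1,2)] uv(3) by simp
    from unfold_word_null[OF bP as(1) this] show ?thesis by (simp add: fmap_diff as(2))
  qed
  have rep_r: "fmap (?\<psi> as) (rep (ract P y b)) - fmap (?\<psi> as) (fmap (bar_act A P (\<one>\<^bsub>A\<^esub>, b)) (rep y)) \<in> hoch_null A B P (Suc n)"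
    and rep_l: "fmap (?\<psi> as) (rep (lact P b y)) - fmap (?\<psi> as) (fmap (bar_act A P (b, \<one>\<^bsub>A\<^esub>)) (rep y)) \<in> hoch_null A B P (Suc n)"
    if "set as \<subseteq> carrier A" "length as = n" "y \<in> carrier P" "b \<in> carrier A" for as n y b
  proof -
    have "?cl (rep (ract P y b)) = ?cl (fmap (bar_act A P (\<one>\<^bsub>A\<^esub>, b)) (rep y))"
      using rep[OF that(3)] rep(2)[OF x(3)[OF that(4,3)]] hs(5)[OF that(4,3)] qd(6)[OF that(4) rep(1)[OF that(3)]] by simp
    then show "fmap (?\<psi> as) (rep (ract P y b)) - fmap (?\<psi> as) (fmap (bar_act A P (\<one>\<^bsub>A\<^esub>, b)) (rep y)) \<in> hoch_null A B P (Suc n)"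
      by (rule same[OF that(1,2) rep(1)[OF x(3)[OF that(4,3)]] L1(2)[OF that(4) rep(1)[OF that(3)]]])
    have "?cl (rep (lact P b y)) = ?cl (fmap (bar_act A P (b, \<one>\<^bsub>A\<^esub>)) (rep y))"
      using rep[OF that(3)] rep(2)[OF x(2)[OF that(4,3)]] hs(4)[OF that(4,3)] qd(5)[OF that(4) rep(1)[OF that(3)]] by simp
    then show "fmap (?\<psi> as) (rep (lact P b y)) - fmap (?\<psi> as) (fmap (bar_act A P (b, \<one>\<^bsub>A\<^esub>)) (rep y)) \<in> hoch_null A B P (Suc n)"
      by (rule same[OF that(1,2) rep(1)[OF x(2)[OF that(4,3)]] L1(1)[OF that(4) rep(1)[OF that(3)]]])
  qed
  have tr: "a - c \<in> hoch_null A B P n" if "a - b \<in> hoch_null A B P n" "b - c \<in> hoch_null A B P n" for a b c n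
    using subgrp_trans[OF subgrp_hoch_null that] .
  have h_gens: "h g \<in> tfrags A P (Suc n)" if gn: "g \<in> tensor_gens A P n" for g n
  proof -
    obtain y as where g: "g = (y, as)" "y \<in> carrier P" "set as \<subseteq> carrier A" "length as = n"
      using gn by (cases g) (auto simp: tensor_gens_iff)
    show ?thesis
      using fmap_frags[OF rep(1)[OF g(2)] unfold_word_gens[OF bP g(3)]] g by (simp add: h_def)
  qed
  have hN: "frag_extend h u \<in> hoch_null A B P (Suc n)" if u: "u \<in> hoch_null A B P n" for n u
  proof (rule zspan_map[OF additive_frag_extend subgrp_hoch_null _ u[unfolded hoch_null_def]])
    fix r assume "r \<in> tensor_rels A B P n \<union>
      {frag_of (hoch_ract A P b w) - frag_of (apfst (lact P b) w) | b w. b \<in> B \<and> w \<in> tensor_gens A P n}"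
    then show "frag_extend h r \<in> hoch_null A B P (Suc n)"
    proof
      assume "r \<in> tensor_rels A B P n"
      then show ?thesis
      proof (cases rule: tensor_rels_cases)
        case (addx y y' as)
        then have y: "y \<in> carrier P" "y' \<in> carrier P" "set as \<subseteq> carrier A" "length as = n" by (auto simp: tensor_gens_iff)
        have yy: "y \<oplus>\<^bsub>P\<^esub> y' \<in> carrier P" using y by simp
        have "?cl (rep (y \<oplus>\<^bsub>P\<^esub> y')) = ?cl (rep y + rep y')"
          using rep(2)[OF yy] rep(2)[OF y(1)] rep(2)[OF y(2)] hs(2)[OF y(1,2)] d(6)[OF rep(1)[OF y(1)] rep(1)[OF y(2)]] by simp
        from same[OF y(3,4) rep(1)[OF yy] subgrp_add[OF d(1) rep(1)[OF y(1)] rep(1)[OF y(2)]] this]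
        show ?thesis by (simp add: addx(3) h_def frag_extend_diff frag_extend_add fmap_add diff_diff_eq)
      next
        case (adda y as i a a')
        then have "y \<in> carrier P" by (simp add: tensor_gens_iff)
        from unfold_word_rel(1)[OF bP rep(1)[OF this] adda(1-4)]
        show ?thesis by (simp add: adda(5) h_def frag_extend_diff)
      next
        case (head y as b)
        then have y: "y \<in> carrier P" "set as \<subseteq> carrier A" "length as = n" by (auto simp: tensor_gens_iff)
        from tr[OF rep_r[OF y(2,3,1) B_mem[OF head(3)]] unfold_word_rel(2)[OF bP rep(1)[OF y(1)] head(1-3)]]
        show ?thesis by (simp add: head(4) h_def frag_extend_diff)
      next
        case (bal y as i b)
        then have "y \<in> carrier P" by (simp add: tensor_gens_iff)
        from unfold_word_rel(3)[OF bP rep(1)[OF this] bal(1-3)]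
        show ?thesis by (simp add: bal(4) h_def frag_extend_diff)
      qed
    next
      assume "r \<in> {frag_of (hoch_ract A P b w) - frag_of (apfst (lact P b) w) | b w. b \<in> B \<and> w \<in> tensor_gens A P n}"
      then obtain b y as where b: "b \<in> B" "y \<in> carrier P" "set as \<subseteq> carrier A" "length as = n"
          "r = frag_of (hoch_ract A P b (y, as)) - frag_of (lact P b y, as)"
        by (auto simp: tensor_gens_iff)
      let ?M = "if as = [] then fmap (?\<psi> []) (fmap (bar_act A P (\<one>\<^bsub>A\<^esub>, b)) (rep y))
        else fmap (?\<psi> (butlast as @ [last as \<otimes>\<^bsub>A\<^esub> b])) (rep y)"
      have "h (hoch_ract A P b (y, as)) - ?M \<in> hoch_null A B P (Suc n)"
        using rep_r[OF b(3,4,2) B_mem[OF b(1)]] by (auto simp: hoch_ract_def h_def subgrp_0[OF subgrp_hoch_null])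
      moreover have "?M - fmap (?\<psi> as) (fmap (bar_act A P (b, \<one>\<^bsub>A\<^esub>)) (rep y)) \<in> hoch_null A B P (Suc n)"
        by (rule unfold_word_comm[OF bP rep(1)[OF b(2)] b(3,4,1)])
      moreover have "fmap (?\<psi> as) (fmap (bar_act A P (b, \<one>\<^bsub>A\<^esub>)) (rep y)) - h (lact P b y, as) \<in> hoch_null A B P (Suc n)"
        using subgrp_sym[OF subgrp_hoch_null rep_l[OF b(3,4,2) B_mem[OF b(1)]]] by (simp add: h_def)
      ultimately have "h (hoch_ract A P b (y, as)) - h (lact P b y, as) \<in> hoch_null A B P (Suc n)"
        using tr by blast
      then show ?thesis by (simp add: b(5) frag_extend_diff)
    qed
  qed
  \<comment> \<open>Face 0 multiplies the inserted letter into the module element. This evaluates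
    the section, as \<theta> does, and gives back \<open>y\<close>.\<close>
  have face0: "fmap (\<lambda>w. hoch_face A P 0 (?\<psi> as w)) (rep y) - frag_of (y, as) \<in> hoch_null A B P n"
    if y: "y \<in> carrier P" "set as \<subseteq> carrier A" "length as = n" for y as n
  proof -
    define \<theta> where "\<theta> u = bar_eval P (frag_extend (bar_diff A P) u)" for u
    have D: "frag_extend (bar_diff A P) u \<in> bar_frags A P 0" if "u \<in> bar_frags A P 1" for u
      using bar_diff_frags[OF bP, of u 0] that by simp
    have \<theta>: "\<theta> u \<in> carrier P" if "u \<in> bar_frags A P 1" for u
      unfolding \<theta>_def by (rule bar_eval_closed[OF bP D[OF that]])
    have \<theta>d: "\<theta> (u - v) = \<theta> u \<ominus>\<^bsub>P\<^esub> \<theta> v" if "u \<in> bar_frags A P 1" "v \<in> bar_frags A P 1" for u v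
      unfolding \<theta>_def frag_extend_diff by (rule bar_eval_diff[OF bP D[OF that(1)] D[OF that(2)]])
    from hoch_frag_linear[OF bP \<theta> \<theta>d rep(1)[OF y(1)] y(2,3)]
    have "frag_extend (\<lambda>w. frag_of (\<theta> (frag_of w), as)) (rep y) - frag_of (\<theta> (rep y), as) \<in> hoch_null A B P n" .
    moreover have "\<theta> (rep y) = y" unfolding \<theta>_def using s(2)[OF y(1) rep(1)[OF y(1)]] rep(2)[OF y(1)] by simp
    moreover have "frag_extend (\<lambda>w. frag_of (\<theta> (frag_of w), as)) (rep y) = fmap (\<lambda>w. hoch_face A P 0 (?\<psi> as w)) (rep y)"
    proof -
      have "fmap (\<lambda>w. (\<theta> (frag_of w), as)) (rep y) = fmap (\<lambda>w. hoch_face A P 0 (?\<psi> as w)) (rep y)"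
      proof (rule fmap_cong[OF _ rep(1)[OF y(1)]])
        fix w assume "w \<in> bar_gens A P 1"
        then obtain a z b where w: "a \<in> carrier A" "z \<in> carrier P" "b \<in> carrier A" "w = ([a], z, [b])"
          unfolding bar_gens_1 by blast
        have "\<theta> (frag_of w) = ract P (lact P a z) b"
          using w x(2,3) by (simp add: \<theta>_def bar_diff_def bar_act_def bar_eval_of[OF bP])
        then show "(\<theta> (frag_of w), as) = hoch_face A P 0 (?\<psi> as w)"
          using w by (simp add: unfold_word_def hoch_face_def)
      qed
      then show ?thesis by (simp add: fmap_def)
    qed
    ultimately show ?thesis by simp
  qed
  \<comment> \<open>The first case uses that \<open>s\<close> respects the right action and the last
    case that it respects the left action; the faces in between concern letters that
    \<open>h\<close> does not touch.\<close>
  have faceS: "fmap (\<lambda>w. hoch_face A P (Suc i) (?\<psi> as w)) (rep y) - h (hoch_face A P i (y, as)) \<in> hoch_null A B P (Suc n)"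
    if y: "y \<in> carrier P" "set as \<subseteq> carrier A" "length as = Suc n" and i: "i \<le> Suc n" for y as n i
  proof -
    consider "i = 0" | "0 < i" "i < Suc n" | "i = Suc n" using i by linarith
    then show ?thesis
    proof cases
      case 1
      obtain a as' where as: "as = a # as'" "a \<in> carrier A" "set as' \<subseteq> carrier A" "length as' = n"
        using y by (cases as) auto
      have "fmap (\<lambda>w. hoch_face A P (Suc i) (?\<psi> as w)) (rep y) = fmap (?\<psi> as') (fmap (bar_act A P (\<one>\<^bsub>A\<^esub>, a)) (rep y))"
        unfolding fmap_fmap
      proof (rule fmap_cong[OF _ rep(1)[OF y(1)]])
        fix w assume "w \<in> bar_gens A P 1"
        then obtain c z b where w: "c \<in> carrier A" "z \<in> carrier P" "b \<in> carrier A" "w = ([c], z, [b])"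
          unfolding bar_gens_1 by blast
        then show "hoch_face A P (Suc i) (?\<psi> as w) = ?\<psi> as' (bar_act A P (\<one>\<^bsub>A\<^esub>, a) w)"
          using as 1 by (simp add: hoch_face_def unfold_word_def bar_act_def)
      qed
      then show ?thesis
        using subgrp_sym[OF subgrp_hoch_null rep_r[OF as(3,4) y(1) as(2)]] 1 as by (simp add: hoch_face_def h_def)
    next
      case 2
      have "hoch_face A P (Suc i) (?\<psi> as w) = ?\<psi> (take (i - 1) as @ [as ! (i - 1) \<otimes>\<^bsub>A\<^esub> as ! i] @ drop (i + 1) as) w" for w
        using 2 y by (cases w; cases i) (simp_all add: hoch_face_def unfold_word_def)
      then show ?thesis using 2 y by (simp add: hoch_face_def h_def subgrp_0[OF subgrp_hoch_null])
    next
      case 3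
      have as: "as \<noteq> []" "last as \<in> carrier A" "set (butlast as) \<subseteq> carrier A" "length (butlast as) = n"
      proof -
        show ne: "as \<noteq> []" using y(3) by auto
        show "last as \<in> carrier A" using last_in_set[OF ne] y(2) by blast
        show "set (butlast as) \<subseteq> carrier A" using y(2) by (auto dest: in_set_butlastD)
        show "length (butlast as) = n" using y(3) by simp
      qed
      have "fmap (\<lambda>w. hoch_face A P (Suc i) (?\<psi> as w)) (rep y) = fmap (?\<psi> (butlast as)) (fmap (bar_act A P (last as, \<one>\<^bsub>A\<^esub>)) (rep y))"
        unfolding fmap_fmap
      proof (rule fmap_cong[OF _ rep(1)[OF y(1)]])
        fix w assume "w \<in> bar_gens A P 1"
        then obtain c z b where w: "c \<in> carrier A" "z \<in> carrier P" "b \<in> carrier A" "w = ([c], z, [b])"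
          unfolding bar_gens_1 by blast
        then show "hoch_face A P (Suc i) (?\<psi> as w) = ?\<psi> (butlast as) (bar_act A P (last as, \<one>\<^bsub>A\<^esub>) w)"
          using as y 3 by (simp add: hoch_face_def unfold_word_def bar_act_def x)
      qed
      then show ?thesis
        using subgrp_sym[OF subgrp_hoch_null rep_l[OF as(3,4) y(1) as(2)]] 3 y by (simp add: hoch_face_def h_def)
    qed
  qed
  show ?thesis
  proof (rule that)
    show "frag_extend h u \<in> tfrags A P (Suc n)" if "u \<in> tfrags A P n" for n u
      by (rule frag_extend_mem[OF subgrp_frags h_gens that])
    show "frag_extend h u \<in> hoch_null A B P (Suc n)" if "u \<in> hoch_null A B P n" for n u
      by (rule hN[OF that])
    fix n u assume u: "u \<in> tfrags A P (Suc n)"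
    show "hoch_bd A P (Suc (Suc n)) (frag_extend h u) + frag_extend h (hoch_bd A P (Suc n) u) - u \<in> hoch_null A B P (Suc n)"
    proof (rule frags_map[OF _ subgrp_hoch_null _ u])
      show "additive (\<lambda>u. hoch_bd A P (Suc (Suc n)) (frag_extend h u) + frag_extend h (hoch_bd A P (Suc n) u) - u)"
        unfolding hoch_bd_def by (intro additive_intros)
      fix g assume gn: "g \<in> tensor_gens A P (Suc n)"
      then obtain y as where g: "g = (y, as)" "y \<in> carrier P" "set as \<subseteq> carrier A" "length as = Suc n"
        by (cases g) (auto simp: tensor_gens_iff)
      define E where "E i = fmap (\<lambda>w. hoch_face A P i (?\<psi> as w)) (rep y)" for i
      have "hoch_bd A P (Suc (Suc n)) (h g) = (\<Sum>i\<le>Suc (Suc n). frag_cmul ((-1) ^ i) (E i))"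
        unfolding g(1) h_def hoch_bd_def E_def prod.case frag_extend_fmap
        by (rule frags_map_eq[OF additive_frag_extend _ _ rep(1)[OF g(2)]])
          (auto simp: additive_def fmap_add frag_cmul_distrib2 sum.distrib)
      also have "\<dots> = E 0 - (\<Sum>i\<le>Suc n. frag_cmul ((-1) ^ i) (E (Suc i)))"
        by (subst sum.atMost_Suc_shift) (simp add: sum_negf flip: minus_frag_cmul)
      finally have 1: "hoch_bd A P (Suc (Suc n)) (h g) = E 0 - (\<Sum>i\<le>Suc n. frag_cmul ((-1) ^ i) (E (Suc i)))" .
      have 2: "frag_extend h (hoch_bd A P (Suc n) (frag_of g)) = (\<Sum>i\<le>Suc n. frag_cmul ((-1) ^ i) (h (hoch_face A P i g)))"
        by (simp add: hoch_bd_def additive.sum[OF additive_frag_extend] frag_extend_cmul del: sum.atMost_Suc)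
      have "(\<Sum>i\<le>Suc n. frag_cmul ((-1) ^ i) (E (Suc i) - h (hoch_face A P i g))) \<in> hoch_null A B P (Suc n)"
      proof -
        have "(\<Sum>i\<in>I. frag_cmul ((-1) ^ i) (E (Suc i) - h (hoch_face A P i g))) \<in> hoch_null A B P (Suc n)"
          if "finite I" "I \<subseteq> {..Suc n}" for I
          using that
        proof (induction I rule: finite_induct)
          case (insert i I)
          have "E (Suc i) - h (hoch_face A P i g) \<in> hoch_null A B P (Suc n)"
            using faceS[OF g(2-4), of i] insert g(1) by (simp add: E_def)
          then show ?case
            using insert by (simp add: subgrp_add[OF subgrp_hoch_null] subgrp_cmul[OF subgrp_hoch_null])
        qed (simp add: subgrp_0[OF subgrp_hoch_null])
        then show ?thesis by blast
      qed
      then have S: "(\<Sum>i\<le>Suc n. frag_cmul ((-1) ^ i) (E (Suc i))) - (\<Sum>i\<le>Suc n. frag_cmul ((-1) ^ i) (h (hoch_face A P i g))) \<in> hoch_null A B P (Suc n)"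
        by (simp add: additive.diff[OF additive_cmul] sum_subtractf del: sum.atMost_Suc)
      have "E 0 - frag_of g \<in> hoch_null A B P (Suc n)" using face0[OF g(2-4)] g(1) by (simp add: E_def)
      from subgrp_diff[OF subgrp_hoch_null this S]
      have "E 0 - (\<Sum>i\<le>Suc n. frag_cmul ((-1) ^ i) (E (Suc i))) +
          (\<Sum>i\<le>Suc n. frag_cmul ((-1) ^ i) (h (hoch_face A P i g))) - frag_of g \<in> hoch_null A B P (Suc n)"
        by (simp only: algebra_simps)
      then show "hoch_bd A P (Suc (Suc n)) (frag_extend h (frag_of g)) + frag_extend h (hoch_bd A P (Suc n) (frag_of g)) - frag_of g
          \<in> hoch_null A B P (Suc n)" unfolding frag_extend_of 1 2 .
    qed
  qed
qed

lemma hoch_projective_exact: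
  assumes P: "E_projective K A B P" and u: "u \<in> tfrags A P (Suc n)" "hoch_bd A P (Suc n) u \<in> hoch_null A B P n"
  shows "\<exists>v\<in>tfrags A P (Suc (Suc n)). u - hoch_bd A P (Suc (Suc n)) v \<in> hoch_null A B P (Suc n)"
proof -
  obtain h where h: "\<And>n u. u \<in> tfrags A P n \<Longrightarrow> frag_extend h u \<in> tfrags A P (Suc n)"
    "\<And>n u. u \<in> hoch_null A B P n \<Longrightarrow> frag_extend h u \<in> hoch_null A B P (Suc n)"
    "\<And>n u. u \<in> tfrags A P (Suc n) \<Longrightarrow>
      hoch_bd A P (Suc (Suc n)) (frag_extend h u) + frag_extend h (hoch_bd A P (Suc n) u) - u \<in> hoch_null A B P (Suc n)"
    by (rule projective_contraction[OF P]) blast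
  from subgrp_diff[OF subgrp_hoch_null h(2)[OF u(2)] h(3)[OF u(1)]]
  have "u - hoch_bd A P (Suc (Suc n)) (frag_extend h u) \<in> hoch_null A B P (Suc n)" by (simp add: algebra_simps)
  then show ?thesis using h(1)[OF u(1)] by blast
qed

end


section \<open>Tensoring over the enveloping algebra\<close>

definition bal_scale :: "('k, 'x, 'p) module_scheme \<Rightarrow> 'k \<Rightarrow> 'x \<times> 'y \<Rightarrow> 'x \<times> 'y" where
  "bal_scale X c = apfst (\<lambda>x. c \<odot>\<^bsub>X\<^esub> x)"

lemma bal_rels_cases [consumes 1, case_names left right bal]:
  assumes "q \<in> bal_rels X Y S r l"
  obtains x x' y where "x \<in> carrier X" "x' \<in> carrier X" "y \<in> carrier Y"
      "q = frag_of (x \<oplus>\<^bsub>X\<^esub> x', y) - frag_of (x, y) - frag_of (x', y)"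
  | x y y' where "x \<in> carrier X" "y \<in> carrier Y" "y' \<in> carrier Y"
      "q = frag_of (x, y \<oplus>\<^bsub>Y\<^esub> y') - frag_of (x, y) - frag_of (x, y')"
  | x s y where "x \<in> carrier X" "s \<in> S" "y \<in> carrier Y" "q = frag_of (r x s, y) - frag_of (x, l s y)"
  using assms unfolding bal_rels_def by blast

lemma bal_relsI:
  assumes "x \<in> carrier X" "y \<in> carrier Y"
  shows "x' \<in> carrier X \<Longrightarrow> frag_of (x \<oplus>\<^bsub>X\<^esub> x', y) - frag_of (x, y) - frag_of (x', y) \<in> bal_rels X Y S r l"
    and "y' \<in> carrier Y \<Longrightarrow> frag_of (x, y \<oplus>\<^bsub>Y\<^esub> y') - frag_of (x, y) - frag_of (x, y') \<in> bal_rels X Y S r l"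
    and "s \<in> S \<Longrightarrow> frag_of (r x s, y) - frag_of (x, l s y) \<in> bal_rels X Y S r l"
  unfolding bal_rels_def using assms by blast+

lemma presents_bal_pre:
  assumes X: "Module.module K X" and Y: "Module.module K Y"
  shows "presents (carrier K) (frags (carrier X \<times> carrier Y)) {0} (\<lambda>c. fmap (bal_scale X c)) (bal_pre X Y) (\<lambda>u. u)"
proof (rule presents_free)
  interpret x: Module.module K X by (rule X)
  show "smult (bal_pre X Y) c = fmap (bal_scale X c)" for c
    unfolding bal_pre_def fmap_def bal_scale_def by (simp add: apfst_def map_prod_def case_prod_beta')
  show "c \<in> carrier K \<Longrightarrow> w \<in> carrier X \<times> carrier Y \<Longrightarrow> bal_scale X c w \<in> carrier X \<times> carrier Y" for c w
    by (auto simp: bal_scale_def)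
qed (auto simp: bal_pre_def)

context
  fixes K :: "'k ring" and X :: "('k, 'x, 'p) module_scheme" and Y :: "('k, 'y, 'q) module_scheme"
    and S :: "'s set" and r :: "'x \<Rightarrow> 's \<Rightarrow> 'x" and l :: "'s \<Rightarrow> 'y \<Rightarrow> 'y"
  assumes X: "Module.module K X" and Y: "Module.module K Y"
    and r: "\<And>x s. x \<in> carrier X \<Longrightarrow> s \<in> S \<Longrightarrow> r x s \<in> carrier X"
    and l: "\<And>s y. s \<in> S \<Longrightarrow> y \<in> carrier Y \<Longrightarrow> l s y \<in> carrier Y"
begin

interpretation x: Module.module K X by (rule X)
interpretation y: Module.module K Y by (rule Y)

lemma bal_rels_frags: "bal_rels X Y S r l \<subseteq> frags (carrier X \<times> carrier Y)"
proof
  fix q assume "q \<in> bal_rels X Y S r l"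
  then show "q \<in> frags (carrier X \<times> carrier Y)"
  proof (cases rule: bal_rels_cases)
    case (left u u' v)
    show ?thesis unfolding left(4) by (rule frags_diff2) (use left in simp_all)
  next
    case (right u v v')
    show ?thesis unfolding right(4) by (rule frags_diff2) (use right in simp_all)
  next
    case (bal u s v)
    show ?thesis unfolding bal(4) by (rule subgrp_diff[OF subgrp_frags]) (use bal r l in simp_all)
  qed
qed

lemma bal_null_eq: "bal_null X Y S r l = zspan (bal_rels X Y S r l)"
  unfolding bal_null_def by (rule generate_free_Abelian_group[OF bal_rels_frags])

lemma zspan_bal_frags: "zspan (bal_rels X Y S r l) \<subseteq> frags (carrier X \<times> carrier Y)"
  by (rule zspan_subset[OF subgrp_frags bal_rels_frags])

context
  assumes scale: "\<And>c x s. c \<in> carrier K \<Longrightarrow> x \<in> carrier X \<Longrightarrow> s \<in> S \<Longrightarrow> c \<odot>\<^bsub>X\<^esub> r x s = r (c \<odot>\<^bsub>X\<^esub> x) s"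
begin

lemma bal_scale_null:
  assumes "c \<in> carrier K" "u \<in> zspan (bal_rels X Y S r l)"
  shows "fmap (bal_scale X c) u \<in> zspan (bal_rels X Y S r l)"
proof (rule zspan_map[OF additive_fmap(1) subgrp_zspan _ assms(2)])
  fix q assume "q \<in> bal_rels X Y S r l"
  then have "fmap (bal_scale X c) q \<in> bal_rels X Y S r l"
  proof (cases rule: bal_rels_cases)
    case (left u u' v)
    then show ?thesis using bal_relsI(1)[of "c \<odot>\<^bsub>X\<^esub> u" X v Y "c \<odot>\<^bsub>X\<^esub> u'" S r l] assms(1)
      by (simp add: fmap_diff bal_scale_def x.smult_r_distr)
  next
    case (right u v v')
    then show ?thesis using bal_relsI(2)[of "c \<odot>\<^bsub>X\<^esub> u" X v Y v' S r l] assms(1)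
      by (simp add: fmap_diff bal_scale_def)
  next
    case (bal u s v)
    then show ?thesis using bal_relsI(3)[of "c \<odot>\<^bsub>X\<^esub> u" X v Y s S r l] assms(1)
      by (simp add: fmap_diff bal_scale_def scale)
  qed
  then show "fmap (bal_scale X c) q \<in> zspan (bal_rels X Y S r l)" by (rule zspan.base)
qed

lemma presents_bal_tensor:
  "presents (carrier K) (frags (carrier X \<times> carrier Y)) (zspan (bal_rels X Y S r l)) (\<lambda>c. fmap (bal_scale X c))
    (bal_tensor X Y S r l) (\<lambda>u. bal_null X Y S r l +>\<^bsub>bal_pre X Y\<^esub> u)"
  unfolding bal_tensor_def bal_null_eq
  using presents_quot[OF presents_bal_pre[OF X Y] subgrp_zspan _ zspan_bal_frags bal_scale_null]
  by (simp add: zspan.zero)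

end

end

lemma module_hom_diff:
  assumes X: "Module.module K X" and Y: "Module.module K Y" and f: "bimodule_hom K A X Y f"
    and u: "u \<in> carrier X" "v \<in> carrier X"
  shows "f (u \<ominus>\<^bsub>X\<^esub> v) = f u \<ominus>\<^bsub>Y\<^esub> f v"
proof -
  interpret x: Module.module K X by (rule X)
  interpret y: Module.module K Y by (rule Y)
  note h = bimodule_homD[OF f]
  have "u = (u \<ominus>\<^bsub>X\<^esub> v) \<oplus>\<^bsub>X\<^esub> v" using u by (simp add: a_minus_def x.M.a_assoc x.M.l_neg)
  then have "f u = f (u \<ominus>\<^bsub>X\<^esub> v) \<oplus>\<^bsub>Y\<^esub> f v" using h(2) u x.M.minus_closed by metis
  then show ?thesis using h(1) u by (simp add: a_minus_def y.M.a_assoc y.M.r_neg)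
qed

section \<open>The enveloping algebra, and the functor as a module of coinvariants\<close>

context algebra_ext
begin

lemma algebra_bimodule_mult:
  assumes "c \<in> carrier K" "x \<in> carrier A" "y \<in> carrier A"
  shows "(c \<odot>\<^bsub>A\<^esub> x) \<otimes>\<^bsub>A\<^esub> y = c \<odot>\<^bsub>A\<^esub> (x \<otimes>\<^bsub>A\<^esub> y)" "x \<otimes>\<^bsub>A\<^esub> (c \<odot>\<^bsub>A\<^esub> y) = c \<odot>\<^bsub>A\<^esub> (x \<otimes>\<^bsub>A\<^esub> y)"
  using alg assms by (auto simp: k_algebra_def)

abbreviation env_rels :: "(('a \<times> 'a) \<Rightarrow>\<^sub>0 int) set" where
  "env_rels \<equiv> bal_rels A (opp A) (carrier K) (\<lambda>a c. c \<odot>\<^bsub>A\<^esub> a) (\<lambda>c a. c \<odot>\<^bsub>opp A\<^esub> a)"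

definition env_class :: "(('a \<times> 'a) \<Rightarrow>\<^sub>0 int) \<Rightarrow> (('a \<times> 'a) \<Rightarrow>\<^sub>0 int) set" where
  "env_class u = {v \<in> frags (carrier A \<times> carrier A). v - u \<in> zspan env_rels}"

lemma opp_simps: "carrier (opp A) = carrier A" "add (opp A) = add A" "smult (opp A) = smult A"
  by (simp_all add: opp_def)

lemma module_opp: "Module.module K (opp A)"
proof -
  have "abelian_group (opp A)"
    by (rule abelian_groupI) (use A.a_assoc A.a_comm A.add.l_inv_ex in \<open>auto simp: opp_def\<close>)
  then show ?thesis
    by (rule Module.moduleI[OF Am.R.is_cring])
      (simp_all add: opp_simps Am.smult_l_distr Am.smult_r_distr Am.smult_assoc1)
qed

lemma env_rels_frags: "env_rels \<subseteq> frags (carrier A \<times> carrier A)"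
  using bal_rels_frags[OF Am.module_axioms module_opp, of "carrier K"] by (simp add: opp_simps)

lemma env_carrier_eq: "env_carrier K A = env_class ` frags (carrier A \<times> carrier A)"
proof -
  have p0: "presents (carrier K) (frags (carrier A \<times> carrier A)) {0} (\<lambda>c. fmap (bal_scale A c)) (bal_pre A (opp A)) (\<lambda>u. u)"
    using presents_bal_pre[OF Am.module_axioms module_opp] unfolding opp_simps .
  have comm: "c \<odot>\<^bsub>A\<^esub> (c' \<odot>\<^bsub>A\<^esub> x) = c' \<odot>\<^bsub>A\<^esub> (c \<odot>\<^bsub>A\<^esub> x)" if "c \<in> carrier K" "c' \<in> carrier K" "x \<in> carrier A" for c c' x
    using that by (metis Am.R.m_comm Am.smult_assoc1)
  have n: "bal_null A (opp A) (carrier K) (\<lambda>a c. c \<odot>\<^bsub>A\<^esub> a) (\<lambda>c a. c \<odot>\<^bsub>opp A\<^esub> a) = zspan env_rels"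
    by (rule bal_null_eq[OF Am.module_axioms module_opp]) (simp_all add: opp_simps)
  have cl: "bal_null A (opp A) (carrier K) (\<lambda>a c. c \<odot>\<^bsub>A\<^esub> a) (\<lambda>c a. c \<odot>\<^bsub>opp A\<^esub> a) +>\<^bsub>bal_pre A (opp A)\<^esub> u = env_class u"
    if "u \<in> frags (carrier A \<times> carrier A)" for u
    unfolding n
    using presents_coset[OF p0 subgrp_zspan, of env_rels u] that
      zspan_subset[OF subgrp_frags env_rels_frags]
    by (simp add: opp_simps zspan.zero env_class_def)
  have "env_carrier K A = (\<lambda>u. bal_null A (opp A) (carrier K) (\<lambda>a c. c \<odot>\<^bsub>A\<^esub> a) (\<lambda>c a. c \<odot>\<^bsub>opp A\<^esub> a) +>\<^bsub>bal_pre A (opp A)\<^esub> u) `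
      frags (carrier A \<times> carrier A)"
    unfolding env_carrier_def
    by (rule presentsD(4)[OF presents_bal_tensor[OF Am.module_axioms module_opp], unfolded opp_simps(1), symmetric])
      (simp_all add: opp_simps comm)
  also have "\<dots> = env_class ` frags (carrier A \<times> carrier A)"
    by (rule image_cong[OF refl cl])
  finally show ?thesis .
qed

text \<open>\<open>f\<close> is biadditive and balanced over the scalars, so evaluation kills every
  relation and is constant on a class; this makes \<open>the_elem\<close> meaningful.\<close>

lemma env_eval:
  assumes X: "abelian_group X" and f: "\<And>a b. a \<in> carrier A \<Longrightarrow> b \<in> carrier A \<Longrightarrow> f (a, b) \<in> carrier X"
    "\<And>a a' b. a \<in> carrier A \<Longrightarrow> a' \<in> carrier A \<Longrightarrow> b \<in> carrier A \<Longrightarrow> f (a \<oplus>\<^bsub>A\<^esub> a', b) = f (a, b) \<oplus>\<^bsub>X\<^esub> f (a', b)"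
    "\<And>a b b'. a \<in> carrier A \<Longrightarrow> b \<in> carrier A \<Longrightarrow> b' \<in> carrier A \<Longrightarrow> f (a, b \<oplus>\<^bsub>A\<^esub> b') = f (a, b) \<oplus>\<^bsub>X\<^esub> f (a, b')"
    "\<And>c a b. c \<in> carrier K \<Longrightarrow> a \<in> carrier A \<Longrightarrow> b \<in> carrier A \<Longrightarrow> f (c \<odot>\<^bsub>A\<^esub> a, b) = f (a, c \<odot>\<^bsub>A\<^esub> b)"
    and u: "u \<in> frags (carrier A \<times> carrier A)"
  shows "the_elem (frag_eval X f ` env_class u) = frag_eval X f u"
proof -
  interpret x: abelian_group X by (rule X)
  have c: "f \<in> carrier A \<times> carrier A \<rightarrow> carrier X" using f(1) by auto
  have 0: "frag_eval X f r = \<zero>\<^bsub>X\<^esub>" if "r \<in> env_rels" for r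
    using that
  proof (cases rule: bal_rels_cases)
    case (left a a' b)
    show ?thesis unfolding left(4) by (rule frag_eval_rel3[OF X]) (use left f in \<open>simp_all add: opp_simps\<close>)
  next
    case (right a b b')
    show ?thesis unfolding right(4) by (rule frag_eval_rel3[OF X]) (use right f in \<open>simp_all add: opp_simps\<close>)
  next
    case (bal a s b)
    show ?thesis unfolding bal(4) by (rule frag_eval_rel2[OF X]) (use bal f in \<open>simp_all add: opp_simps\<close>)
  qed
  have "frag_eval X f v = frag_eval X f u" if v: "v \<in> env_class u" for v
  proof -
    have v': "v \<in> frags (carrier A \<times> carrier A)" "v - u \<in> zspan env_rels" using v by (auto simp: env_class_def)
    have "frag_eval X f (v - u) = \<zero>\<^bsub>X\<^esub>" by (rule frag_eval_zspan[OF X c env_rels_frags 0 v'(2)])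
    then have e: "frag_eval X f v \<ominus>\<^bsub>X\<^esub> frag_eval X f u = \<zero>\<^bsub>X\<^esub>" using frag_eval_diff[OF X c v'(1) u] by simp
    have cl: "frag_eval X f v \<in> carrier X" "frag_eval X f u \<in> carrier X"
      using frag_eval_closed[OF X c] v'(1) u by blast+
    have "frag_eval X f v = (frag_eval X f v \<ominus>\<^bsub>X\<^esub> frag_eval X f u) \<oplus>\<^bsub>X\<^esub> frag_eval X f u"
      using cl by (simp add: a_minus_def x.a_assoc x.l_neg)
    then show ?thesis using cl by (simp add: e)
  qed
  moreover have "u \<in> env_class u" using u by (simp add: env_class_def zspan.zero)
  ultimately have "frag_eval X f ` env_class u = {frag_eval X f u}" by blast
  then show ?thesis by simp
qed

lemma env_lact_eq:
  assumes X: "is_bimodule K A X" and x: "x \<in> carrier X" and u: "u \<in> frags (carrier A \<times> carrier A)"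
  shows "env_lact X (env_class u) x = frag_eval X (\<lambda>(a, a'). ract X (lact X a x) a') u"
proof -
  note b = is_bimoduleD[OF X]
  interpret m: Module.module K X by (rule b)
  show ?thesis
    unfolding env_lact_def by (rule env_eval[OF m.M.abelian_group_axioms _ _ _ _ u]) (simp_all add: x b)
qed

lemma env_ract_eq:
  assumes y: "y \<in> carrier A" and u: "u \<in> frags (carrier A \<times> carrier A)"
  shows "env_ract A y (env_class u) = frag_eval A (\<lambda>(a, a'). a' \<otimes>\<^bsub>A\<^esub> y \<otimes>\<^bsub>A\<^esub> a) u"
  unfolding env_ract_def
  by (rule env_eval[OF A.abelian_group_axioms _ _ _ _ u])
    (simp_all add: y A.l_distr A.r_distr algebra_bimodule_mult)

definition F_null :: "('k, 'a, 'x) bimodule \<Rightarrow> (('a \<times> 'x) \<Rightarrow>\<^sub>0 int) set" where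
  "F_null X = zspan (bal_rels A X (env_carrier K A) (env_ract A) (env_lact X))"

definition F_class :: "('k, 'a, 'x) bimodule \<Rightarrow> (('a \<times> 'x) \<Rightarrow>\<^sub>0 int) \<Rightarrow> (('a \<times> 'x) \<Rightarrow>\<^sub>0 int) set" where
  "F_class X u = bal_null A X (env_carrier K A) (env_ract A) (env_lact X) +>\<^bsub>bal_pre A X\<^esub> u"

text \<open>The relations among the \<open>1 \<otimes> x\<close> in \<open>A \<otimes> X\<close> over the enveloping algebra: modulo boundaries of the
  Hochschild complex, \<open>x a\<close> equals \<open>a x\<close>.\<close>

definition coinv_null :: "('k, 'a, 'x) bimodule \<Rightarrow> (('x \<times> 'a list) \<Rightarrow>\<^sub>0 int) set" where
  "coinv_null X = {u \<in> tfrags A X 0. \<exists>v\<in>tfrags A X 1. u - hoch_bd A X 1 v \<in> hoch_null A B X 0}"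

definition unit_word :: "'x \<times> 'a list \<Rightarrow> 'a \<times> 'x" where
  "unit_word w = (\<one>\<^bsub>A\<^esub>, fst w)"

lemma coinv_nullI: "u \<in> tfrags A X 0 \<Longrightarrow> v \<in> tfrags A X 1 \<Longrightarrow> u - hoch_bd A X 1 v \<in> hoch_null A B X 0 \<Longrightarrow> u \<in> coinv_null X"
  unfolding coinv_null_def by (rule CollectI, rule conjI, assumption, rule bexI)

lemma coinv_nullE:
  assumes "u \<in> coinv_null X"
  obtains v where "u \<in> tfrags A X 0" "v \<in> tfrags A X 1" "u - hoch_bd A X 1 v \<in> hoch_null A B X 0"
proof -
  from assms have "u \<in> tfrags A X 0 \<and> (\<exists>v\<in>tfrags A X 1. u - hoch_bd A X 1 v \<in> hoch_null A B X 0)"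
    unfolding coinv_null_def by (rule CollectD)
  then show ?thesis using that by (elim conjE bexE)
qed

lemma coinv_null_tfrags: "u \<in> coinv_null X \<Longrightarrow> u \<in> tfrags A X 0"
  by (erule coinv_nullE)

lemma subgrp_coinv_null: "subgrp (coinv_null X)"
proof (rule subgrpI)
  show "0 \<in> coinv_null X"
    by (rule coinv_nullI[of _ _ 0])
      (simp_all add: subgrp_0[OF subgrp_frags] subgrp_0[OF subgrp_hoch_null] additive.zero[OF additive_hoch_bd] del: mem_Collect_eq)
  fix u u' assume "u \<in> coinv_null X" "u' \<in> coinv_null X"
  then obtain v v' where *: "u \<in> tfrags A X 0" "v \<in> tfrags A X 1" "u' \<in> tfrags A X 0" "v' \<in> tfrags A X 1"
    and n: "u - hoch_bd A X 1 v \<in> hoch_null A B X 0" "u' - hoch_bd A X 1 v' \<in> hoch_null A B X 0"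
    by (elim coinv_nullE)
  have "u - u' - hoch_bd A X 1 (v - v') \<in> hoch_null A B X 0"
    using subgrp_diff[OF subgrp_hoch_null n] by (simp add: additive.diff[OF additive_hoch_bd] algebra_simps)
  then show "u - u' \<in> coinv_null X"
    by (rule coinv_nullI[OF subgrp_diff[OF subgrp_frags *(1,3)] subgrp_diff[OF subgrp_frags *(2,4)]])
qed

lemma hoch_null_coinv:
  assumes X: "is_bimodule K A X" and u: "u \<in> hoch_null A B X 0"
  shows "u \<in> coinv_null X"
  by (rule coinv_nullI[OF subsetD[OF hoch_null_subset[OF X] u] subgrp_0[OF subgrp_frags]])
    (simp add: additive.zero[OF additive_hoch_bd] u)

lemma hoch_bd_1: "hoch_bd A X 1 (frag_of (x, [a])) = frag_of (ract X x a, []) - frag_of (lact X a x, [])"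
  by (simp add: hoch_bd_def hoch_face_def)

lemma coinv_null_comm:
  assumes X: "is_bimodule K A X" and "x \<in> carrier X" "a \<in> carrier A"
  shows "frag_of (ract X x a, []) - frag_of (lact X a x, []) \<in> coinv_null X"
proof -
  have v: "frag_of (x, [a]) \<in> tfrags A X 1" using assms by (simp add: tensor_gens_iff)
  then have "hoch_bd A X 1 (frag_of (x, [a])) \<in> tfrags A X 0" using hoch_bd_tfrags[OF X, of _ 0] by simp
  from coinv_nullI[OF this v] show ?thesis unfolding hoch_bd_1 by (simp add: subgrp_0[OF subgrp_hoch_null])
qed

context
  fixes X :: "('k, 'a, 'x) bimodule"
  assumes X: "is_bimodule K A X"
begin

interpretation x: Module.module K X by (rule is_bimoduleD[OF X])

lemma env_mem: "u \<in> frags (carrier A \<times> carrier A) \<Longrightarrow> env_class u \<in> env_carrier K A"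
  unfolding env_carrier_eq by blast

lemma env_closed:
  assumes U: "U \<in> env_carrier K A"
  shows "y \<in> carrier A \<Longrightarrow> env_ract A y U \<in> carrier A" and "z \<in> carrier X \<Longrightarrow> env_lact X U z \<in> carrier X"
    and "c \<in> carrier K \<Longrightarrow> y \<in> carrier A \<Longrightarrow> c \<odot>\<^bsub>A\<^esub> env_ract A y U = env_ract A (c \<odot>\<^bsub>A\<^esub> y) U"
proof -
  obtain u where u: "u \<in> frags (carrier A \<times> carrier A)" "U = env_class u" using U unfolding env_carrier_eq by blast
  note b = is_bimoduleD[OF X]
  have ca: "(\<lambda>(a, a'). a' \<otimes>\<^bsub>A\<^esub> y \<otimes>\<^bsub>A\<^esub> a) \<in> carrier A \<times> carrier A \<rightarrow> carrier A" if "y \<in> carrier A" for y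
    using that by auto
  show "env_ract A y U \<in> carrier A" if y: "y \<in> carrier A" for y
    unfolding u(2) env_ract_eq[OF y u(1)] by (rule frag_eval_closed[OF A.abelian_group_axioms ca[OF y] u(1)])
  show "env_lact X U z \<in> carrier X" if z: "z \<in> carrier X" for z
    unfolding u(2) env_lact_eq[OF X z u(1)]
    by (rule frag_eval_closed[OF x.M.abelian_group_axioms _ u(1)]) (use z b(2,3) in auto)
  show "c \<odot>\<^bsub>A\<^esub> env_ract A y U = env_ract A (c \<odot>\<^bsub>A\<^esub> y) U" if c: "c \<in> carrier K" and y: "y \<in> carrier A" for c y
  proof -
    have cy: "c \<odot>\<^bsub>A\<^esub> y \<in> carrier A" using c y by simp
    let ?e = "\<lambda>y u. frag_eval A (\<lambda>(a, a'). a' \<otimes>\<^bsub>A\<^esub> y \<otimes>\<^bsub>A\<^esub> a) u"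
    have "Poly_Mapping.keys u \<subseteq> carrier A \<times> carrier A" using u by simp
    then have "c \<odot>\<^bsub>A\<^esub> ?e y u = ?e (c \<odot>\<^bsub>A\<^esub> y) u"
    proof (rule free_Abelian_group_induct)
      show "c \<odot>\<^bsub>A\<^esub> ?e y 0 = ?e (c \<odot>\<^bsub>A\<^esub> y) 0" using c by (simp add: frag_eval_0[OF A.abelian_group_axioms])
      show "c \<odot>\<^bsub>A\<^esub> ?e y (frag_of w) = ?e (c \<odot>\<^bsub>A\<^esub> y) (frag_of w)" if "w \<in> carrier A \<times> carrier A" for w
        using that c y cy by (auto simp: frag_eval_of[OF A.abelian_group_axioms] algebra_bimodule_mult)
      fix v v' assume v: "Poly_Mapping.keys v \<subseteq> carrier A \<times> carrier A" "Poly_Mapping.keys v' \<subseteq> carrier A \<times> carrier A"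
        and IH: "c \<odot>\<^bsub>A\<^esub> ?e y v = ?e (c \<odot>\<^bsub>A\<^esub> y) v" "c \<odot>\<^bsub>A\<^esub> ?e y v' = ?e (c \<odot>\<^bsub>A\<^esub> y) v'"
      have v': "v \<in> frags (carrier A \<times> carrier A)" "v' \<in> frags (carrier A \<times> carrier A)" using v by auto
      have cl: "?e y v \<in> carrier A" "?e y v' \<in> carrier A"
        using frag_eval_closed[OF A.abelian_group_axioms ca[OF y]] v' by blast+
      show "c \<odot>\<^bsub>A\<^esub> ?e y (v - v') = ?e (c \<odot>\<^bsub>A\<^esub> y) (v - v')"
        using frag_eval_diff[OF A.abelian_group_axioms ca[OF y] v'] frag_eval_diff[OF A.abelian_group_axioms ca[OF cy] v'] IH cl c
        by (simp add: a_minus_def Am.smult_r_distr Am.smult_r_minus)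
    qed
    then show ?thesis unfolding u(2) env_ract_eq[OF y u(1)] env_ract_eq[OF cy u(1)] .
  qed
qed

lemma presents_F_obj:
  "presents (carrier K) (frags (carrier A \<times> carrier X)) (F_null X) (\<lambda>c. fmap (bal_scale A c)) (F_obj K A X) (F_class X)"
  unfolding F_null_def F_obj_def F_class_def
  by (rule presents_bal_tensor[OF Am.module_axioms is_bimoduleD(1)[OF X]]) (use env_closed in auto)

text \<open>Balancing at 1 with the tensors \<open>a \<otimes> 1\<close> and
  \<open>1 \<otimes> a\<close>: both send 1 to \<open>a\<close>, while on \<open>y\<close> they act
  as left and right multiplication by \<open>a\<close>.\<close>

lemma F_rel_unit:
  assumes a: "a \<in> carrier A" and y: "y \<in> carrier X"
  shows "frag_of (a, y) - frag_of (\<one>\<^bsub>A\<^esub>, lact X a y) \<in> F_null X"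
    and "frag_of (a, y) - frag_of (\<one>\<^bsub>A\<^esub>, ract X y a) \<in> F_null X"
proof -
  note b = is_bimoduleD[OF X]
  have u: "frag_of (a, \<one>\<^bsub>A\<^esub>) \<in> frags (carrier A \<times> carrier A)" "frag_of (\<one>\<^bsub>A\<^esub>, a) \<in> frags (carrier A \<times> carrier A)" using a by simp_all
  have 1: "\<one>\<^bsub>A\<^esub> \<in> carrier A" by simp
  show "frag_of (a, y) - frag_of (\<one>\<^bsub>A\<^esub>, lact X a y) \<in> F_null X"
    using bal_relsI(3)[OF 1 y env_mem[OF u(1)], of "env_ract A" "env_lact X"] a y env_ract_eq[OF 1 u(1)] env_lact_eq[OF X y u(1)]
    by (simp add: F_null_def frag_eval_of[OF A.abelian_group_axioms] frag_eval_of[OF x.M.abelian_group_axioms] b zspan.base)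
  show "frag_of (a, y) - frag_of (\<one>\<^bsub>A\<^esub>, ract X y a) \<in> F_null X"
    using bal_relsI(3)[OF 1 y env_mem[OF u(2)], of "env_ract A" "env_lact X"] a y env_ract_eq[OF 1 u(2)] env_lact_eq[OF X y u(2)]
    by (simp add: F_null_def frag_eval_of[OF A.abelian_group_axioms] frag_eval_of[OF x.M.abelian_group_axioms] b zspan.base)
qed

text \<open>Sending \<open>a \<otimes> y\<close> to \<open>a y\<close> is balanced up to
  commutators: an elementary tensor leads to the comparison of \<open>c' a c y\<close> with
  \<open>a c y c'\<close>, where \<open>c'\<close> is moved around. A general element of the
  enveloping algebra is a formal sum \<open>v\<close> of these, and both sides are linear in
  \<open>v\<close> modulo the relations.\<close>

lemma F_null_coinv:
  assumes u: "u \<in> F_null X"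
  shows "fmap (\<lambda>(a, y). (lact X a y, [])) u \<in> coinv_null X"
proof -
  note b = is_bimoduleD[OF X]
  let ?f = "\<lambda>(a, y). (lact X a y, [])"
  have add: "frag_of (y \<oplus>\<^bsub>X\<^esub> y', []) - frag_of (y, []) - frag_of (y', []) \<in> coinv_null X" if "y \<in> carrier X" "y' \<in> carrier X" for y y'
    by (rule hoch_null_coinv[OF X hoch_null_addx]) (use that in \<open>simp_all add: tensor_gens_iff\<close>)
  have tr: "p - r \<in> coinv_null X" if "p - q \<in> coinv_null X" "q - r \<in> coinv_null X" for p q r
    by (rule subgrp_trans[OF subgrp_coinv_null that])
  have "fmap ?f r \<in> coinv_null X" if "r \<in> bal_rels A X (env_carrier K A) (env_ract A) (env_lact X)" for r
    using that
  proof (cases rule: bal_rels_cases)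
    case (left a a' y)
    then show ?thesis using add[of "lact X a y" "lact X a' y"] by (simp add: fmap_diff b)
  next
    case (right a y y')
    then show ?thesis using add[of "lact X a y" "lact X a y'"] by (simp add: fmap_diff b)
  next
    case (bal a U y)
    then obtain v where v: "v \<in> frags (carrier A \<times> carrier A)" "U = env_class v" unfolding env_carrier_eq by blast
    define \<alpha> where "\<alpha> = frag_eval A (\<lambda>(c, c'). c' \<otimes>\<^bsub>A\<^esub> a \<otimes>\<^bsub>A\<^esub> c)"
    define \<beta> where "\<beta> = frag_eval X (\<lambda>(c, c'). ract X (lact X c y) c')"
    have \<alpha>f: "(\<lambda>(c, c'). c' \<otimes>\<^bsub>A\<^esub> a \<otimes>\<^bsub>A\<^esub> c) \<in> carrier A \<times> carrier A \<rightarrow> carrier A" using bal(1) by auto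
    have \<beta>f: "(\<lambda>(c, c'). ract X (lact X c y) c') \<in> carrier A \<times> carrier A \<rightarrow> carrier X" using bal(3) b(2,3) by auto
    have \<alpha>c: "\<alpha> w \<in> carrier A" if "w \<in> frags (carrier A \<times> carrier A)" for w
      unfolding \<alpha>_def by (rule frag_eval_closed[OF A.abelian_group_axioms \<alpha>f that])
    have \<beta>c: "\<beta> w \<in> carrier X" if "w \<in> frags (carrier A \<times> carrier A)" for w
      unfolding \<beta>_def by (rule frag_eval_closed[OF x.M.abelian_group_axioms \<beta>f that])
    have \<alpha>d: "lact X (\<alpha> (w - w')) y = lact X (\<alpha> w) y \<ominus>\<^bsub>X\<^esub> lact X (\<alpha> w') y"
      if w: "w \<in> frags (carrier A \<times> carrier A)" "w' \<in> frags (carrier A \<times> carrier A)" for w w'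
    proof -
      have ww: "w - w' \<in> frags (carrier A \<times> carrier A)" by (rule subgrp_diff[OF subgrp_frags w])
      have "\<alpha> w = \<alpha> (w - w') \<oplus>\<^bsub>A\<^esub> \<alpha> w'"
        unfolding \<alpha>_def using frag_eval_add[OF A.abelian_group_axioms \<alpha>f ww w(2)] by simp
      then have "lact X (\<alpha> w) y = lact X (\<alpha> (w - w')) y \<oplus>\<^bsub>X\<^esub> lact X (\<alpha> w') y"
        using \<alpha>c[OF ww] \<alpha>c[OF w(2)] bal(3) by (simp add: b)
      then show ?thesis using \<alpha>c[OF ww] \<alpha>c[OF w(2)] bal(3) by (simp add: a_minus_def x.M.a_assoc x.M.r_neg b)
    qed
    have \<beta>d: "lact X a (\<beta> (w - w')) = lact X a (\<beta> w) \<ominus>\<^bsub>X\<^esub> lact X a (\<beta> w')"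
      if w: "w \<in> frags (carrier A \<times> carrier A)" "w' \<in> frags (carrier A \<times> carrier A)" for w w'
    proof -
      have ww: "w - w' \<in> frags (carrier A \<times> carrier A)" by (rule subgrp_diff[OF subgrp_frags w])
      have "\<beta> w = \<beta> (w - w') \<oplus>\<^bsub>X\<^esub> \<beta> w'"
        unfolding \<beta>_def using frag_eval_add[OF x.M.abelian_group_axioms \<beta>f ww w(2)] by simp
      then have "lact X a (\<beta> w) = lact X a (\<beta> (w - w')) \<oplus>\<^bsub>X\<^esub> lact X a (\<beta> w')"
        using \<beta>c[OF ww] \<beta>c[OF w(2)] bal(1) by (simp add: b)
      then show ?thesis using \<beta>c[OF ww] \<beta>c[OF w(2)] bal(1) by (simp add: a_minus_def x.M.a_assoc x.M.r_neg b)
    qed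
    have "frag_extend (\<lambda>w. frag_of (lact X (\<alpha> (frag_of w)) y, [])) v - frag_of (lact X (\<alpha> v) y, []) \<in> coinv_null X"
      by (rule hoch_null_coinv[OF X hoch_frag_linear[OF X _ \<alpha>d v(1)]]) (simp_all add: \<alpha>c bal b)
    moreover have "frag_extend (\<lambda>w. frag_of (lact X a (\<beta> (frag_of w)), [])) v - frag_of (lact X a (\<beta> v), []) \<in> coinv_null X"
      by (rule hoch_null_coinv[OF X hoch_frag_linear[OF X _ \<beta>d v(1)]]) (simp_all add: \<beta>c bal b)
    moreover have "frag_extend (\<lambda>w. frag_of (lact X (\<alpha> (frag_of w)) y, [])) v -
        frag_extend (\<lambda>w. frag_of (lact X a (\<beta> (frag_of w)), [])) v \<in> coinv_null X"
    proof (rule frags_map[OF _ subgrp_coinv_null _ v(1)])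
      fix w assume "w \<in> carrier A \<times> carrier A"
      then obtain c c' where w: "w = (c, c')" "c \<in> carrier A" "c' \<in> carrier A" by auto
      have "\<alpha> (frag_of w) = c' \<otimes>\<^bsub>A\<^esub> a \<otimes>\<^bsub>A\<^esub> c" unfolding \<alpha>_def using w bal(1) by (simp add: frag_eval_of[OF A.abelian_group_axioms])
      then have 1: "lact X (\<alpha> (frag_of w)) y = lact X c' (lact X (a \<otimes>\<^bsub>A\<^esub> c) y)"
        using w bal(1,3) by (simp add: A.m_assoc b)
      have "\<beta> (frag_of w) = ract X (lact X c y) c'" unfolding \<beta>_def using w bal(3) by (simp add: frag_eval_of[OF x.M.abelian_group_axioms] b)
      then have 2: "lact X a (\<beta> (frag_of w)) = ract X (lact X (a \<otimes>\<^bsub>A\<^esub> c) y) c'"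
        using w bal(1,3) by (simp add: b)
      show "frag_extend (\<lambda>w. frag_of (lact X (\<alpha> (frag_of w)) y, [])) (frag_of w) -
          frag_extend (\<lambda>w. frag_of (lact X a (\<beta> (frag_of w)), [])) (frag_of w) \<in> coinv_null X"
        unfolding frag_extend_of 1 2
        by (rule subgrp_sym[OF subgrp_coinv_null coinv_null_comm[OF X]]) (use w bal in \<open>simp_all add: b\<close>)
    qed (intro additive_intros)
    ultimately have "frag_of (lact X (\<alpha> v) y, []) - frag_of (lact X a (\<beta> v), []) \<in> coinv_null X"
      using tr subgrp_sym[OF subgrp_coinv_null] by blast
    then show ?thesis
      using env_ract_eq[OF bal(1) v(1)] env_lact_eq[OF X bal(3) v(1)] by (simp add: bal(4) fmap_diff v(2) \<alpha>_def \<beta>_def)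
  qed
  then show ?thesis by (rule zspan_map[OF additive_fmap(1) subgrp_coinv_null _ u[unfolded F_null_def]])
qed

lemma unit_word_gens: "w \<in> tensor_gens A X 0 \<Longrightarrow> unit_word w \<in> carrier A \<times> carrier X"
  by (cases w) (simp add: unit_word_def tensor_gens_iff)

lemma unit_word_frags: "u \<in> tfrags A X 0 \<Longrightarrow> fmap unit_word u \<in> frags (carrier A \<times> carrier X)"
  by (erule fmap_frags) (rule unit_word_gens)

text \<open>One direction applies the map of \<open>F_null_coinv\<close>, which is a left inverse of
  \<open>unit_word\<close>. The other holds because \<open>1 \<otimes> y a\<close> and
  \<open>1 \<otimes> a y\<close> are both congruent to \<open>a \<otimes> y\<close> by
  \<open>F_rel_unit\<close>.\<close>

lemma F_kernel:
  assumes u: "u \<in> tfrags A X 0"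
  shows "fmap unit_word u \<in> F_null X \<longleftrightarrow> u \<in> coinv_null X"
proof
  note b = is_bimoduleD[OF X]
  assume "fmap unit_word u \<in> F_null X"
  then have "fmap (\<lambda>(a, y). (lact X a y, [])) (fmap unit_word u) \<in> coinv_null X" by (rule F_null_coinv)
  moreover have "fmap (\<lambda>(a, y). (lact X a y, [])) (fmap unit_word u) = u"
    unfolding fmap_fmap by (rule fmap_id[OF u]) (auto simp: tensor_gens_def unit_word_def b)
  ultimately show "u \<in> coinv_null X" by simp
next
  assume "u \<in> coinv_null X"
  then obtain v where v: "v \<in> tfrags A X 1" "u - hoch_bd A X 1 v \<in> hoch_null A B X 0" by (rule coinv_nullE)
  have sF: "subgrp (F_null X)" unfolding F_null_def by (rule subgrp_zspan)
  have comm: "frag_of (\<one>\<^bsub>A\<^esub>, ract X y a) - frag_of (\<one>\<^bsub>A\<^esub>, lact X a y) \<in> F_null X" if "a \<in> carrier A" "y \<in> carrier X" for a y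
    using subgrp_trans[OF sF] subgrp_sym[OF sF] F_rel_unit[OF that] by blast
  have "fmap unit_word (hoch_bd A X 1 v) \<in> F_null X"
  proof (rule frags_map[OF additive_fmap(2)[OF additive_hoch_bd] sF _ v(1)])
    fix g assume "g \<in> tensor_gens A X 1"
    then obtain y a where g: "g = (y, [a])" "y \<in> carrier X" "a \<in> carrier A"
      by (cases g) (auto simp: tensor_gens_iff length_Suc_conv)
    have "fmap unit_word (hoch_bd A X 1 (frag_of g)) = frag_of (\<one>\<^bsub>A\<^esub>, ract X y a) - frag_of (\<one>\<^bsub>A\<^esub>, lact X a y)"
      unfolding g(1) hoch_bd_1 by (simp add: fmap_diff unit_word_def)
    then show "fmap unit_word (hoch_bd A X 1 (frag_of g)) \<in> F_null X" using comm[OF g(3,2)] by (simp only:)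
  qed
  moreover have "fmap unit_word r \<in> F_null X" if r: "r \<in> hoch_null A B X 0" for r
  proof (rule zspan_map[OF additive_fmap(1) sF _ r[unfolded hoch_null_def]])
    fix r assume "r \<in> tensor_rels A B X 0 \<union>
      {frag_of (hoch_ract A X c w) - frag_of (apfst (lact X c) w) | c w. c \<in> B \<and> w \<in> tensor_gens A X 0}"
    then show "fmap unit_word r \<in> F_null X"
    proof
      assume "r \<in> tensor_rels A B X 0"
      then show ?thesis
      proof (cases rule: tensor_rels_cases)
        case (addx y y' as)
        then have "fmap unit_word r \<in> bal_rels A X (env_carrier K A) (env_ract A) (env_lact X)"
          using bal_relsI(2)[of "\<one>\<^bsub>A\<^esub>" A y X y'] by (simp add: fmap_diff unit_word_def tensor_gens_iff)
        then show ?thesis unfolding F_null_def by (rule zspan.base)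
      qed simp_all
    next
      assume "r \<in> {frag_of (hoch_ract A X c w) - frag_of (apfst (lact X c) w) | c w. c \<in> B \<and> w \<in> tensor_gens A X 0}"
      then obtain c y where "c \<in> B" "y \<in> carrier X" "r = frag_of (hoch_ract A X c (y, [])) - frag_of (lact X c y, [])"
        by (auto simp: tensor_gens_iff)
      then show ?thesis using comm B_mem by (simp add: fmap_diff unit_word_def hoch_ract_def)
    qed
  qed
  note this[OF v(2)]
  ultimately show "fmap unit_word u \<in> F_null X" using subgrp_mem_cong[OF sF] by (simp add: fmap_diff)
qed

text \<open>As \<open>a \<otimes> y\<close> is congruent to \<open>1 \<otimes> a y\<close>, the map
  \<open>unit_word\<close> is surjective modulo relations. This expresses the functor through
  Hochschild words of length 0, the bottom of a column of the double complex.\<close>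

lemma presents_F_obj_unit:
  "presents (carrier K) (tfrags A X 0) (coinv_null X) (\<lambda>c. fmap (apfst (smult X c))) (F_obj K A X)
    (\<lambda>u. F_class X (fmap unit_word u))"
proof -
  note b = is_bimoduleD[OF X]
  have sF: "subgrp (F_null X)" unfolding F_null_def by (rule subgrp_zspan)
  have onto: "\<exists>v\<in>tfrags A X 0. u - fmap unit_word v \<in> F_null X" if u: "u \<in> frags (carrier A \<times> carrier X)" for u
  proof
    let ?f = "\<lambda>(a, y). (lact X a y, [])"
    show "fmap ?f u \<in> tfrags A X 0"
      by (rule fmap_frags[OF u]) (auto simp: tensor_gens_iff b)
    show "u - fmap unit_word (fmap ?f u) \<in> F_null X"
      unfolding fmap_fmap
      by (rule frags_map[OF _ sF _ u]) (use F_rel_unit(1) in \<open>auto simp: unit_word_def intro!: additive_intros additive_fmap\<close>)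
  qed
  have sc: "fmap unit_word (fmap (apfst (smult X c)) u) - fmap (bal_scale A c) (fmap unit_word u) \<in> F_null X"
    if c: "c \<in> carrier K" and u: "u \<in> tfrags A X 0" for c u
    unfolding fmap_fmap
  proof (rule frags_map[OF _ sF _ u])
    fix w assume "w \<in> tensor_gens A X 0"
    then have y: "fst w \<in> carrier X" by (cases w) (simp add: tensor_gens_iff)
    have "lact X (c \<odot>\<^bsub>A\<^esub> \<one>\<^bsub>A\<^esub>) (fst w) = c \<odot>\<^bsub>X\<^esub> fst w" using c y by (simp add: b)
    then show "fmap (\<lambda>w. unit_word (apfst (smult X c) w)) (frag_of w) - fmap (\<lambda>w. bal_scale A c (unit_word w)) (frag_of w) \<in> F_null X"
      using subgrp_sym[OF sF F_rel_unit(1)[of "c \<odot>\<^bsub>A\<^esub> \<one>\<^bsub>A\<^esub>" "fst w"]] c y by (simp add: unit_word_def bal_scale_def)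
  qed (intro additive_intros additive_fmap)
  have sm: "fmap (apfst (smult X c)) u \<in> tfrags A X 0" if "c \<in> carrier K" "u \<in> tfrags A X 0" for c u
    using that(2) by (rule tfrags_map[rotated]) (use that(1) in simp)
  have "{u \<in> tfrags A X 0. fmap unit_word u \<in> F_null X} = coinv_null X"
    using F_kernel coinv_null_tfrags by blast
  moreover have "presents (carrier K) (tfrags A X 0) {u \<in> tfrags A X 0. fmap unit_word u \<in> F_null X}
      (\<lambda>c. fmap (apfst (smult X c))) (F_obj K A X) (\<lambda>u. F_class X (fmap unit_word u))"
    by (rule presents_pull[where \<theta> = "fmap unit_word" and sm' = "\<lambda>c. fmap (apfst (smult X c))",
          OF presents_F_obj additive_fmap(1) subgrp_frags unit_word_frags onto additive_fmap(1) sm sc])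
  ultimately show ?thesis by (simp only:)
qed

end

lemma F_mor_class:
  assumes X: "is_bimodule K A X" and Y: "is_bimodule K A Y" and f: "bimodule_hom K A X Y f" and u: "u \<in> tfrags A X 0"
  shows "F_mor K A Y f (F_class X (fmap unit_word u)) = F_class Y (fmap unit_word (fmap (apfst f) u))"
proof -
  note h = bimodule_homD[OF f] and bx = is_bimoduleD[OF X] and bY = is_bimoduleD[OF Y]
  interpret x: Module.module K X by (rule bx)
  interpret y: Module.module K Y by (rule bY)
  let ?f = "apsnd f :: 'a \<times> 'b \<Rightarrow> 'a \<times> 'c"
  have ff: "frag_extend (\<lambda>(a, x). frag_of (a, f x)) = fmap ?f"
    unfolding fmap_def by (simp add: apsnd_def map_prod_def case_prod_beta')
  have env: "f (env_lact X U z) = env_lact Y U (f z)" if U: "U \<in> env_carrier K A" and z: "z \<in> carrier X" for U z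
  proof -
    obtain v where v: "v \<in> frags (carrier A \<times> carrier A)" "U = env_class v" using U unfolding env_carrier_eq by blast
    let ?e = "\<lambda>v. frag_eval X (\<lambda>(a, a'). ract X (lact X a z) a') v" and ?e' = "\<lambda>v. frag_eval Y (\<lambda>(a, a'). ract Y (lact Y a (f z)) a') v"
    have c: "(\<lambda>(a, a'). ract X (lact X a z) a') \<in> carrier A \<times> carrier A \<rightarrow> carrier X" using z bx(2,3) by auto
    have c': "(\<lambda>(a, a'). ract Y (lact Y a (f z)) a') \<in> carrier A \<times> carrier A \<rightarrow> carrier Y" using h(1)[OF z] bY(2,3) by auto
    have "Poly_Mapping.keys v \<subseteq> carrier A \<times> carrier A" using v by simp
    then have "f (?e v) = ?e' v"
    proof (rule free_Abelian_group_induct)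
      show "f (?e 0) = ?e' 0"
        by (simp add: frag_eval_0[OF x.M.abelian_group_axioms] frag_eval_0[OF y.M.abelian_group_axioms] bimodule_hom_zero[OF X Y f])
      show "f (?e (frag_of w)) = ?e' (frag_of w)" if "w \<in> carrier A \<times> carrier A" for w
        using that z h by (auto simp: frag_eval_of[OF x.M.abelian_group_axioms] frag_eval_of[OF y.M.abelian_group_axioms] bx bY)
      fix w w' assume w: "Poly_Mapping.keys w \<subseteq> carrier A \<times> carrier A" "Poly_Mapping.keys w' \<subseteq> carrier A \<times> carrier A"
        and IH: "f (?e w) = ?e' w" "f (?e w') = ?e' w'"
      have ww: "w \<in> frags (carrier A \<times> carrier A)" "w' \<in> frags (carrier A \<times> carrier A)" using w by auto
      have cl: "?e w \<in> carrier X" "?e w' \<in> carrier X" using frag_eval_closed[OF x.M.abelian_group_axioms c] ww by blast+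
      show "f (?e (w - w')) = ?e' (w - w')"
        using frag_eval_diff[OF x.M.abelian_group_axioms c ww] frag_eval_diff[OF y.M.abelian_group_axioms c' ww] IH
          module_hom_diff[OF bx(1) bY(1) f cl] by simp
    qed
    then show ?thesis unfolding v(2) env_lact_eq[OF X z v(1)] env_lact_eq[OF Y h(1)[OF z] v(1)] .
  qed
  have null: "fmap ?f r \<in> F_null Y" if r: "r \<in> F_null X" for r
    unfolding F_null_def
  proof (rule zspan_map[OF additive_fmap(1) subgrp_zspan _ r[unfolded F_null_def]])
    fix q assume "q \<in> bal_rels A X (env_carrier K A) (env_ract A) (env_lact X)"
    then have "fmap ?f q \<in> bal_rels A Y (env_carrier K A) (env_ract A) (env_lact Y)"
    proof (cases rule: bal_rels_cases)
      case (left a a' z)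
      then show ?thesis using bal_relsI(1)[of a A "f z" Y a'] h(1) by (simp add: fmap_diff)
    next
      case (right a z z')
      then show ?thesis using bal_relsI(2)[of a A "f z" Y "f z'"] h(1,2) by (simp add: fmap_diff)
    next
      case (bal a U z)
      then show ?thesis using bal_relsI(3)[of a A "f z" Y U "env_carrier K A" "env_ract A" "env_lact Y"] h(1) env
        by (simp add: fmap_diff)
    qed
    then show "fmap ?f q \<in> zspan (bal_rels A Y (env_carrier K A) (env_ract A) (env_lact Y))" by (rule zspan.base)
  qed
  note pX = presents_bal_pre[OF Am.module_axioms bx(1)] and pY = presents_bal_pre[OF Am.module_axioms bY(1)]
  have nX: "bal_null A X (env_carrier K A) (env_ract A) (env_lact X) = F_null X"
    unfolding F_null_def by (rule bal_null_eq[OF Am.module_axioms bx(1)]) (use env_closed[OF X] in auto)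
  have fX: "F_null X \<subseteq> frags (carrier A \<times> carrier X)"
    unfolding F_null_def by (rule zspan_bal_frags[OF Am.module_axioms bx(1)]) (use env_closed[OF X] in auto)
  have nY: "bal_null A Y (env_carrier K A) (env_ract A) (env_lact Y) = F_null Y"
    unfolding F_null_def by (rule bal_null_eq[OF Am.module_axioms bY(1)]) (use env_closed[OF Y] in auto)
  have fY: "F_null Y \<subseteq> frags (carrier A \<times> carrier Y)"
    unfolding F_null_def by (rule zspan_bal_frags[OF Am.module_axioms bY(1)]) (use env_closed[OF Y] in auto)
  have sF: "subgrp (F_null X)" "subgrp (F_null Y)" unfolding F_null_def by (rule subgrp_zspan)+
  have sc: "fmap (bal_scale A c) w \<in> F_null Y" if "c \<in> carrier K" "w \<in> F_null Y" for c w
    using presents_sm_null[OF presents_F_obj[OF Y] that] .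
  have fc: "fmap ?f w \<in> frags (carrier A \<times> carrier Y)" if "w \<in> frags (carrier A \<times> carrier X)" for w
    using that by (rule fmap_frags) (use h(1) in auto)
  have "quot_map (bal_pre A Y) ((\<lambda>u. u) ` F_null Y) (fmap ?f) ((\<lambda>u. u) ` F_null X +>\<^bsub>bal_pre A X\<^esub> fmap unit_word u) =
      (\<lambda>u. u) ` F_null Y +>\<^bsub>bal_pre A Y\<^esub> fmap ?f (fmap unit_word u)"
    by (rule presents_quot_map[OF pX sF(1) _ fX pY sF(2) _ fY sc additive_fmap(1) fc null _ unit_word_frags[OF X u]])
      (simp_all add: subgrp_0[OF sF(1)] subgrp_0[OF sF(2)])
  moreover have "fmap ?f (fmap unit_word u) = fmap unit_word (fmap (apfst f) u)"
    unfolding fmap_fmap by (rule fmap_cong[OF _ u]) (simp add: unit_word_def)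
  ultimately show ?thesis unfolding F_mor_def F_class_def nX nY ff by simp
qed

end


section \<open>The comparison\<close>

context algebra_ext
begin

lemma smult_map:
  assumes f: "bimodule_hom K A X Y f" and c: "c \<in> carrier K" and u: "u \<in> tfrags A X n"
  shows "fmap (apfst f) (fmap (apfst (smult X c)) u) = fmap (apfst (smult Y c)) (fmap (apfst f) u)"
  unfolding fmap_fmap
proof (rule fmap_cong[OF _ u])
  fix w assume "w \<in> tensor_gens A X n"
  then show "apfst f (apfst (smult X c) w) = apfst (smult Y c) (apfst f w)"
    using bimodule_homD(3)[OF f c] by (cases w) (simp add: tensor_gens_iff)
qed

text \<open>\<open>G p q\<close> consists of the Hochschild words of length \<open>p\<close> over
  \<open>P q\<close>. Dividing out the image of \<open>b\<close>, the edge \<open>q = 0\<close>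
  presents the complex of \<open>HH\<close>; dividing out the image of \<open>a\<close>, the edge
  \<open>p = 0\<close> presents that of \<open>LF\<close>.\<close>

theorem linear_iso_HH_LF:
  fixes M :: "('k, 'a, 'm) bimodule" and P :: "nat \<Rightarrow> ('k, 'a, 'p) bimodule"
  assumes M: "is_bimodule K A M" and R: "E_resolution K A B M P d e"
  shows "linear_iso K (HH K A B M n) (LF K A P d n)"
proof -
  let ?B = "A\<lparr>carrier := B\<rparr>"
  have proj: "E_projective K A B (P q)" and bP: "is_bimodule K A (P q)"
    and dh: "bimodule_hom K A (P (Suc q)) (P q) (d (Suc q))" and eh: "bimodule_hom K A (P 0) M e"
    and ed: "x \<in> carrier (P 1) \<Longrightarrow> e (d 1 x) = \<zero>\<^bsub>M\<^esub>"
    and im: "d (Suc (Suc q)) ` carrier (P (Suc (Suc q))) = cycles P d (Suc q)" for q x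
    using R by (auto simp: E_resolution_def E_projective_def)
  have dd: "d (Suc q) (d (Suc (Suc q)) y) = \<zero>\<^bsub>P q\<^esub>" if "y \<in> carrier (P (Suc (Suc q)))" for q y
    using imageI[OF that, of "d (Suc (Suc q))"] unfolding im cycles_def by simp
  obtain h s where s: "bimodule_hom K ?B M (P 0) s" "\<And>m. m \<in> carrier M \<Longrightarrow> e (s m) = m"
    and h: "\<And>q. bimodule_hom K ?B (P q) (P (Suc q)) (h q)"
    and h0: "\<And>y. y \<in> carrier (P 0) \<Longrightarrow> y = d 1 (h 0 y) \<oplus>\<^bsub>P 0\<^esub> s (e y)"
    and hS: "\<And>q y. y \<in> carrier (P (Suc q)) \<Longrightarrow> y = d (Suc (Suc q)) (h (Suc q) y) \<oplus>\<^bsub>P (Suc q)\<^esub> h q (d (Suc q) y)"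
    by (rule E_resolution_contraction[OF R]) blast
  define G where "G p q = tfrags A (P q) p" for p q
  define N where "N p q = hoch_null A B (P q) p" for p q
  define a where "a p q = hoch_bd A (P q) (Suc p)" for p q
  define b where "b p q = (fmap (apfst (d (Suc q))) :: (('p \<times> 'a list) \<Rightarrow>\<^sub>0 int) \<Rightarrow> _)" for p q :: nat
  define sm where "sm c p q = (fmap (apfst (smult (P q) c)) :: (('p \<times> 'a list) \<Rightarrow>\<^sub>0 int) \<Rightarrow> _)" for c and p q :: nat
  note defs = G_def N_def a_def b_def
  interpret double_complex G N a b
  proof (rule double_complex.intro)
    fix p q u
    show "subgrp (G p q)" "subgrp (N p q)" "N p q \<subseteq> G p q"
      unfolding defs by (rule subgrp_frags subgrp_hoch_null hoch_null_subset[OF bP])+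
    show "additive (a p q)" "additive (b p q)" unfolding defs by (rule additive_hoch_bd additive_fmap)+
    show "a p q u \<in> G p q" if "u \<in> G (Suc p) q" using hoch_bd_tfrags[OF bP] that unfolding defs .
    show "a p q u \<in> N p q" if "u \<in> N (Suc p) q" using hoch_bd_null[OF bP] that unfolding defs .
    show "b p q u \<in> G p q" if "u \<in> G p (Suc q)"
      using that unfolding defs by (rule tfrags_map[rotated]) (rule bimodule_homD(1)[OF dh])
    show "b p q u \<in> N p q" if "u \<in> N p (Suc q)"
      using hoch_null_map[OF hom_B[OF dh]] that unfolding defs .
    show "a p q (a (Suc p) q u) \<in> N p q" if "u \<in> G (Suc (Suc p)) q"
      using hoch_bd_bd[OF bP] that unfolding defs by (simp add: subgrp_0[OF subgrp_hoch_null])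
    show "b p q (b p (Suc q) u) \<in> N p q" if "u \<in> G p (Suc (Suc q))"
    proof -
      have "fmap (apfst (\<lambda>y. d (Suc q) (d (Suc (Suc q)) y))) u \<in> hoch_null A B (P q) p"
        by (rule hoch_map_zero[OF bP dd that[unfolded G_def]])
      then show ?thesis unfolding defs fmap_fmap by (simp add: apfst_def map_prod_def case_prod_beta')
    qed
    show "a p q (b (Suc p) q u) - b p q (a p (Suc q) u) \<in> N p q" if "u \<in> G (Suc p) (Suc q)"
      using hoch_bd_map[OF dh] that unfolding defs by (simp add: subgrp_0[OF subgrp_hoch_null])
    show "\<exists>v\<in>G (Suc (Suc p)) q. u - a (Suc p) q v \<in> N (Suc p) q" if "u \<in> G (Suc p) q" "a p q u \<in> N p q"
      using hoch_projective_exact[OF proj] that unfolding defs .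
    show "\<exists>v\<in>G p (Suc (Suc q)). u - b p (Suc q) v \<in> N p (Suc q)" if "u \<in> G p (Suc q)" "b p q u \<in> N p q"
      unfolding defs by (rule hoch_contraction_exact[OF bP h h dh dh _ that[unfolded defs]]) (rule hS)
  qed
  \<comment> \<open>This is exactness at \<open>P 0\<close>: the words that become null over
    \<open>M\<close> are those coming from \<open>P 1\<close>, so \<open>N'\<close> below amounts to
    the image of \<open>b\<close> together with \<open>N\<close>.\<close>
  have e0: "fmap (apfst e) u \<in> hoch_null A B M k \<longleftrightarrow> (\<exists>v\<in>G k 1. u - b k 0 v \<in> N k 0)" if u: "u \<in> G k 0" for u k
  proof
    show "\<exists>v\<in>G k 1. u - b k 0 v \<in> N k 0" if "fmap (apfst e) u \<in> hoch_null A B M k"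
      unfolding defs One_nat_def
      by (rule hoch_contraction_exact[OF bP h s(1) dh eh _ u[unfolded defs] that]) (rule h0[unfolded One_nat_def])
    assume "\<exists>v\<in>G k 1. u - b k 0 v \<in> N k 0"
    then obtain v where v: "v \<in> tfrags A (P 1) k" "u - fmap (apfst (d 1)) v \<in> hoch_null A B (P 0) k"
      unfolding defs One_nat_def by blast
    have "fmap (apfst (\<lambda>y. e (d 1 y))) v \<in> hoch_null A B M k" by (rule hoch_map_zero[OF M ed v(1)])
    then have "fmap (apfst e) (fmap (apfst (d 1)) v) \<in> hoch_null A B M k"
      unfolding fmap_fmap by (simp add: apfst_def map_prod_def case_prod_beta')
    moreover have "fmap (apfst e) (u - fmap (apfst (d 1)) v) \<in> hoch_null A B M k"
      by (rule hoch_null_map[OF hom_B[OF eh] v(2)])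
    ultimately show "fmap (apfst e) u \<in> hoch_null A B M k"
      using subgrp_mem_cong[OF subgrp_hoch_null] unfolding fmap_diff by blast
  qed
  have eG: "fmap (apfst e) u \<in> tfrags A M k" if "u \<in> tfrags A (P 0) k" for u k
    using that by (rule tfrags_map[rotated]) (rule bimodule_homD(1)[OF eh])
  have smG: "sm c p q u \<in> G p q" if "c \<in> carrier K" "u \<in> G p q" for c p q u
    using that(2) unfolding sm_def defs
    by (rule tfrags_map[rotated]) (rule bimodule_homD(1)[OF bimodule_hom_smult[OF bP that(1)]])
  have sm_add: "additive (sm c p q)" for c p q unfolding sm_def by (rule additive_fmap)
  have sm_a: "a p q (sm c (Suc p) q u) = sm c p q (a p q u)" if "c \<in> carrier K" "u \<in> G (Suc p) q" for c p q u
    using hoch_bd_map[OF bimodule_hom_smult[OF bP that(1)]] that(2) unfolding sm_def defs .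
  have sm_b: "b p q (sm c p (Suc q) u) = sm c p q (b p q u)" if "c \<in> carrier K" "u \<in> G p (Suc q)" for c p q u
    using smult_map[OF dh that(1)] that(2) unfolding sm_def defs .
  define N' where "N' k = {u \<in> G k 0. fmap (apfst e) u \<in> hoch_null A B M k}" for k
  have onto: "\<exists>v\<in>G k 0. u - fmap (apfst e) v \<in> hoch_null A B M k" if u: "u \<in> tfrags A M k" for u k
  proof
    show "fmap (apfst s) u \<in> G k 0"
      using u unfolding G_def by (rule tfrags_map[rotated]) (rule bimodule_homD(1)[OF s(1)])
    have "apfst e (apfst s w) = w" if "w \<in> tensor_gens A M k" for w
      using that s(2) by (cases w) (simp add: tensor_gens_iff)
    then have "fmap (apfst e) (fmap (apfst s) u) = u" unfolding fmap_fmap by (rule fmap_id[OF u])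
    then show "u - fmap (apfst e) (fmap (apfst s) u) \<in> hoch_null A B M k" by (simp add: subgrp_0[OF subgrp_hoch_null])
  qed
  have sme: "fmap (apfst e) (sm c k 0 u) - fmap (apfst (smult M c)) (fmap (apfst e) u) \<in> hoch_null A B M k"
    if "c \<in> carrier K" "u \<in> G k 0" for c k u
    using smult_map[OF eh that(1)] that(2) unfolding sm_def defs by (simp add: subgrp_0[OF subgrp_hoch_null])
  have presM: "presents (carrier K) (G k 0) (N' k) (\<lambda>c. sm c k 0) (hoch_module K A B M k) (\<lambda>u. hoch_class K A B M k (fmap (apfst e) u))" for k
    unfolding N'_def
    by (rule presents_pull[where \<theta> = "fmap (apfst e)" and sm' = "\<lambda>c. sm c k 0",
          OF presents_hoch_module[OF M] additive_fmap(1) sub(1) eG[folded G_def] onto sm_add smG sme])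
  have N'_iff: "u \<in> N' k \<longleftrightarrow> u \<in> G k 0 \<and> (\<exists>v\<in>G k 1. u - b k 0 v \<in> N k 0)" for u k
    unfolding N'_def mem_Collect_eq using e0 by (rule conj_cong[OF refl])
  have N0: "N k 0 \<subseteq> N' k" for k
    unfolding N'_def using hoch_null_map[OF hom_B[OF eh]] sub(3)[of k 0] unfolding defs by blast
  obtain \<phi> where \<phi>: "presents (carrier K) {u \<in> G n 0. n > 0 \<longrightarrow> a (n - 1) 0 u \<in> N' (n - 1)}
      {u \<in> G n 0. \<exists>v\<in>G (Suc n) 0. u - a n 0 v \<in> N' n} (\<lambda>c. sm c n 0) (HH K A B M n) \<phi>"
  proof -
    have "\<exists>\<phi>. presents (carrier K) {u \<in> G n 0. n > 0 \<longrightarrow> a (n - 1) 0 u \<in> N' (n - 1)}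
      {u \<in> G n 0. \<exists>v\<in>G (Suc n) 0. u - a n 0 v \<in> N' n} (\<lambda>c. sm c n 0) (HH K A B M n) \<phi>"
      unfolding HH_def
    proof (rule presents_homology[OF presM])
      show "additive (a k 0)" for k by (rule a)
      show "a k 0 u \<in> G k 0" if "u \<in> G (Suc k) 0" for k u using that by (rule a)
      show "hoch_diff K A B M (Suc k) (hoch_class K A B M (Suc k) (fmap (apfst e) u)) =
          hoch_class K A B M k (fmap (apfst e) (a k 0 u))" if "u \<in> G (Suc k) 0" for k u
        using that hoch_diff_class[OF M eG] hoch_bd_map[OF eh] unfolding defs by simp
      show "a k 0 (a (Suc k) 0 u) \<in> N' k" if "u \<in> G (Suc (Suc k)) 0" for k u
        using aa[OF that] N0 by blast
      show "a k 0 (sm c (Suc k) 0 u) - sm c k 0 (a k 0 u) \<in> N' k" if "c \<in> carrier K" "u \<in> G (Suc k) 0" for k c u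
        using sm_a[OF that] N0 subgrp_0[OF sub(2), of k 0] by auto
    qed
    then show ?thesis using that by blast
  qed
  \<comment> \<open>Unfolding \<open>N'\<close> by \<open>N'_iff\<close> turns membership into the
    existence of \<open>v\<close>, which is the form used in \<open>col_cycles\<close>;
    \<open>C0\<close> does the same for the other edge.\<close>
  have cc: "{u \<in> G n 0. n > 0 \<longrightarrow> a (n - 1) 0 u \<in> N' (n - 1)} = col_cycles n"
    unfolding col_cycles_def N'_iff using a(2)[of _ "n - 1" 0] by (cases n) auto
  have cb: "{u \<in> G n 0. \<exists>v\<in>G (Suc n) 0. u - a n 0 v \<in> N' n} = col_boundaries n"
    unfolding col_boundaries_def N'_iff using a(2)[of _ n 0] subgrp_diff[OF sub(1), of _ n 0] by blast
  have C0: "coinv_null (P q) = {u \<in> G 0 q. \<exists>v\<in>G 1 q. u - a 0 q v \<in> N 0 q}" for q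
    unfolding coinv_null_def defs One_nat_def ..
  have presF: "presents (carrier K) (G 0 q) (coinv_null (P q)) (\<lambda>c. sm c 0 q) (F_obj K A (P q))
      (\<lambda>u. F_class (P q) (fmap unit_word u))" for q
    using presents_F_obj_unit[OF bP] unfolding sm_def G_def .
  have N0': "N 0 q \<subseteq> coinv_null (P q)" for q unfolding N_def using hoch_null_coinv[OF bP] by blast
  obtain \<phi>' where \<phi>': "presents (carrier K) {u \<in> G 0 n. n > 0 \<longrightarrow> b 0 (n - 1) u \<in> coinv_null (P (n - 1))}
      {u \<in> G 0 n. \<exists>v\<in>G 0 (Suc n). u - b 0 n v \<in> coinv_null (P n)} (\<lambda>c. sm c 0 n) (LF K A P d n) \<phi>'"
  proof -
    have "\<exists>\<phi>'. presents (carrier K) {u \<in> G 0 n. n > 0 \<longrightarrow> b 0 (n - 1) u \<in> coinv_null (P (n - 1))}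
      {u \<in> G 0 n. \<exists>v\<in>G 0 (Suc n). u - b 0 n v \<in> coinv_null (P n)} (\<lambda>c. sm c 0 n) (LF K A P d n) \<phi>'"
      unfolding LF_def
    proof (rule presents_homology[OF presF])
      show "additive (b 0 k)" for k by (rule b)
      show "b 0 k u \<in> G 0 k" if "u \<in> G 0 (Suc k)" for k u using that by (rule b)
      show "F_mor K A (P (Suc k - 1)) (d (Suc k)) (F_class (P (Suc k)) (fmap unit_word u)) =
          F_class (P k) (fmap unit_word (b 0 k u))" if "u \<in> G 0 (Suc k)" for k u
        using that F_mor_class[OF bP bP dh] unfolding defs by simp
      show "b 0 k (b 0 (Suc k) u) \<in> coinv_null (P k)" if "u \<in> G 0 (Suc (Suc k))" for k u
        using bb[OF that] N0' by blast
      show "b 0 k (sm c 0 (Suc k) u) - sm c 0 k (b 0 k u) \<in> coinv_null (P k)" if "c \<in> carrier K" "u \<in> G 0 (Suc k)" for k c u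
        using sm_b[OF that] N0' subgrp_0[OF sub(2), of 0 k] by auto
    qed
    then show ?thesis using that by blast
  qed
  have rc: "{u \<in> G 0 n. n > 0 \<longrightarrow> b 0 (n - 1) u \<in> coinv_null (P (n - 1))} = row_cycles n"
    unfolding row_cycles_def C0 using b(2)[of _ 0 "n - 1"] by (cases n) auto
  have rb: "{u \<in> G 0 n. \<exists>v\<in>G 0 (Suc n). u - b 0 n v \<in> coinv_null (P n)} = row_boundaries n"
    unfolding row_boundaries_def C0 using b(2)[of _ 0 n] subgrp_diff[OF sub(1), of _ 0 n] by blast
  show ?thesis
  proof (rule linear_iso_rows_cols[where sm = sm, OF \<phi>[unfolded cc cb] \<phi>'[unfolded rc rb] sm_add smG _ sm_a sm_b])
    show "sm c p q u \<in> N p q" if "c \<in> carrier K" "u \<in> N p q" for c p q u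
      using smult_null[OF bP] that unfolding sm_def defs .
  qed
qed

end

theorem theorem1p11:
  fixes K :: "'k ring" and A :: "('k, 'a) module" and B :: "'a set"
    and M :: "('k, 'a, 'm) bimodule"
  assumes "field K" and "k_algebra K A" and "k_subalgebra K A B" and "is_bimodule K A M"
  shows "(\<exists>(P :: nat \<Rightarrow> ('k, 'a, (('a list \<times> 'm \<times> 'a list) \<Rightarrow>\<^sub>0 int) set) bimodule) d e.
            E_resolution K A B M P d e) \<and>
         (\<forall>(P :: nat \<Rightarrow> ('k, 'a, 'p) bimodule) d e. E_resolution K A B M P d e \<longrightarrow>
            (\<forall>n. linear_iso K (HH K A B M n) (LF K A P d n)))"
proof -
  interpret algebra_ext K A B by unfold_locales (use assms in auto)
  show ?thesis using bar_resolution[OF assms(4)] linear_iso_HH_LF[OF assms(4)] by blast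
qed

end
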